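(* Let $(T_1^{\mathrm{top}},w_1,T_1^{\mathrm{bot}})$ and $(T_2^{\mathrm{top}},w_2,T_2^{\mathrm{bot}})$ be two triples in normal form representing elements $g_1,g_2\in BV$, respectively. Let $n_1$ and $n_2$ be their numbers of strands (i.e. $w_i$ represents a braid in $B_{n_i}$), and let $h_1$ and $h_2$ be the word lengths of $w_1$ and $w_2$, respectively, with respect to the generating sets of non-repeating braids. Then the normal form triple representing the product $g_1g_2$ can be computed in time $$O\big((h_1+h_2)^2\,(n_1+n_2)^2\,\log(n_1+n_2)\big).$$
   Context: **Triples and $BV$.** A triple $(T^{\mathrm{top}},\beta,T^{\mathrm{bot}})$ consists of two finite planar rooted binary trees with the same number $n$ of leaves and a braid $\beta\in B_n$ connecting the leaves of $T^{\mathrm{top}}$ (at the top of the braid) to the leaves of $T^{\mathrm{bot}}$ (drawn upside down, at the bottom). For $1\le i\le n$, let $\iota_i(\beta)\in B_{n+1}$ be obtained by doubling (splitting into two parallel strands all the way down) the strand of $\beta$ that starts at top position $i$. An eye insertion replaces $(T^{\mathrm{top}},\beta,T^{\mathrm{bot}})$ by the triple obtained by attaching a caret (a vertex with two leaf children) to the $i$-th leaf of $T^{\mathrm{top}}$ and to the leaf of $T^{\mathrm{bot}}$ at which the strand starting at $i$ ends, and replacing $\beta$ by $\iota_i(\beta)$. The inverse operation is called eye removal. Elements of $BV$ are equivalence classes of triples under the equivalence relation generated by eye insertions and removals. If $T_1^{\mathrm{bot}}=T_2^{\mathrm{top}}$, the product of the classes of $(T_1^{\mathrm{top}},\beta_1,T_1^{\mathrm{bot}})$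 and $(T_2^{\mathrm{top}},\beta_2,T_2^{\mathrm{bot}})$ is the class of $(T_1^{\mathrm{top}},\beta_1\beta_2,T_2^{\mathrm{bot}})$. In general one first performs eye insertions to make these trees match. A triple is reduced if no eye removal is possible. **Words for braids.** A braid is positive if it can be drawn with only overcrossings (the down-right strand passes over the down-left strand). A positive braid is non-repeating if any pair of strands crosses at most once. Non-repeating braids in $B_n$ are in bijection with permutations of $n$ letters (via the induced permutation), generate $B_n$, and are encoded as permutations. Braids are represented by words $w$ over this generating set (and inverses), and $(T^{\mathrm{top}},w,T^{\mathrm{bot}})$ stands for the triple whose braid is the one represented by $w$. The right-greedy normal form is Thurston's (Epstein et al., *Word Processing in Groups*, Chapter 9), i.e. the (Garside) normal form $s_1\cdots s_k\Delta^p$ with $p\in\mathbb Z$, $\Delta$ the half twist, each $s_i$ a non-repeating braid different from $1,\Delta$, and each $s_i$ the maximal non-repeating right divisor of $s_1\cdots s_i$ in the positive braid monoid. **Normal form in $BV$.** The normal form of an element of $BV$ is a triple $(T^{\mathrm{top}},w,T^{\mathrm{bot}})$ representing it that is reduced and in which $w$ is in right-greedy normal form. **Complexity convention.** Only the cost of operations on braids is counted; the complexity of operations on trees is not taken into account. *)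

theory Defs
  imports
    "HOL-Algebra.Group"
    "HOL-Combinatorics.Permutations"
    "HOL-Library.Tree"
    Complex_Main
begin

section \<open>Braid groups\<close>

text \<open>
  The letter \<open>(True, i)\<close> is the Artin generator \<open>\<sigma>\<^sub>i\<close>, i.e. the overcrossing of the strands in
  positions \<open>i\<close> and \<open>i + 1\<close>; \<open>(False, i)\<close> is its inverse. Positions are counted from 1.
  Words are read from the top of the braid to the bottom.
\<close>

type_synonym artin_word = "(bool \<times> nat) list"
type_synonym braid = "artin_word set"

definition artin_words :: "nat \<Rightarrow> artin_word set" where
  "artin_words n = {w. \<forall>(e, i) \<in> set w. 1 \<le> i \<and> i < n}"

inductive braid_equiv :: "nat \<Rightarrow> artin_word \<Rightarrow> artin_word \<Rightarrow> bool" for n where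
  refl: "w \<in> artin_words n \<Longrightarrow> braid_equiv n w w"
| sym: "braid_equiv n v w \<Longrightarrow> braid_equiv n w v"
| trans: "braid_equiv n u v \<Longrightarrow> braid_equiv n v w \<Longrightarrow> braid_equiv n u w"
| cancel: "u \<in> artin_words n \<Longrightarrow> v \<in> artin_words n \<Longrightarrow> 1 \<le> i \<Longrightarrow> i < n \<Longrightarrow>
    braid_equiv n (u @ [(e, i), (\<not> e, i)] @ v) (u @ v)"
| far: "u \<in> artin_words n \<Longrightarrow> v \<in> artin_words n \<Longrightarrow> 1 \<le> i \<Longrightarrow> i + 2 \<le> j \<Longrightarrow> j < n \<Longrightarrow>
    braid_equiv n (u @ [(True, i), (True, j)] @ v) (u @ [(True, j), (True, i)] @ v)"
| near: "u \<in> artin_words n \<Longrightarrow> v \<in> artin_words n \<Longrightarrow> 1 \<le> i \<Longrightarrow> i + 1 < n \<Longrightarrow>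
    braid_equiv n (u @ [(True, i), (True, i + 1), (True, i)] @ v)
                  (u @ [(True, i + 1), (True, i), (True, i + 1)] @ v)"

definition braid_of :: "nat \<Rightarrow> artin_word \<Rightarrow> braid" where
  "braid_of n w = {v. braid_equiv n w v}"

definition braid_group :: "nat \<Rightarrow> braid monoid" where
  "braid_group n =
     \<lparr>carrier = braid_of n ` artin_words n,
      monoid.mult = (\<lambda>A B. \<Union>a\<in>A. \<Union>b\<in>B. braid_of n (a @ b)),
      one = braid_of n []\<rparr>"

text \<open>The position at the bottom of the strand that starts at position \<open>i\<close> at the top.\<close>

fun strand_end :: "artin_word \<Rightarrow> nat \<Rightarrow> nat" where
  "strand_end [] i = i"
| "strand_end ((e, j) # w) i = strand_end w (transpose j (Suc j) i)"

text \<open>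
  Doubling of the strand that starts at top position \<open>i\<close>. If the doubled strand takes part in a
  crossing, then its two copies cross the other strand one after the other, with the same sign.
\<close>

fun double_strand :: "nat \<Rightarrow> artin_word \<Rightarrow> artin_word" where
  "double_strand i [] = []"
| "double_strand i ((e, j) # w) =
     (if i < j then [(e, Suc j)]
      else if i = j then [(e, Suc j), (e, j)]
      else if i = Suc j then [(e, j), (e, Suc j)]
      else [(e, j)]) @ double_strand (transpose j (Suc j) i) w"


section \<open>Non-repeating braids and the right-greedy normal form\<close>

definition positive_words :: "nat \<Rightarrow> artin_word set" where
  "positive_words n = {w \<in> artin_words n. \<forall>(e, i) \<in> set w. e}"

definition positive_braids :: "nat \<Rightarrow> braid set" where
  "positive_braids n = braid_of n ` positive_words n"

text \<open>
  The list of the pairs of strands that cross, one entry for each crossing. The first argument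
  maps a position to the strand that is currently there; a strand is named by its top position.
\<close>

fun crossings :: "(nat \<Rightarrow> nat) \<Rightarrow> artin_word \<Rightarrow> nat set list" where
  "crossings p [] = []"
| "crossings p ((e, j) # w) = {p j, p (Suc j)} # crossings (p \<circ> transpose j (Suc j)) w"

definition nonrepeating_words :: "nat \<Rightarrow> artin_word set" where
  "nonrepeating_words n = {w \<in> positive_words n. distinct (crossings id w)}"

definition nonrepeating_braids :: "nat \<Rightarrow> braid set" where
  "nonrepeating_braids n = braid_of n ` nonrepeating_words n"

text \<open>The non-repeating braid whose strand from top position \<open>i\<close> ends at bottom position \<open>s i\<close>.\<close>

definition perm_braid :: "nat \<Rightarrow> (nat \<Rightarrow> nat) \<Rightarrow> braid" where
  "perm_braid n s =
     (THE b. \<exists>w \<in> nonrepeating_words n. strand_end w = s \<and> b = braid_of n w)"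

text \<open>
  Words over the non-repeating braids, encoded as permutations of \<open>{1..n}\<close>, and their inverses:
  \<open>(True, s)\<close> stands for the braid of \<open>s\<close> and \<open>(False, s)\<close> for the inverse of this braid.
\<close>

type_synonym perm_word = "(bool \<times> (nat \<Rightarrow> nat)) list"

fun letter_braid :: "nat \<Rightarrow> bool \<times> (nat \<Rightarrow> nat) \<Rightarrow> braid" where
  "letter_braid n (e, s) =
     (if e then perm_braid n s else inv\<^bsub>braid_group n\<^esub> (perm_braid n s))"

definition word_braid :: "nat \<Rightarrow> perm_word \<Rightarrow> braid" where
  "word_braid n w =
     foldr (\<lambda>x b. letter_braid n x \<otimes>\<^bsub>braid_group n\<^esub> b) w \<one>\<^bsub>braid_group n\<^esub>"

definition half_twist :: "nat \<Rightarrow> nat \<Rightarrow> nat" where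
  "half_twist n i = (if i \<in> {1..n} then n + 1 - i else i)"

definition right_divides :: "nat \<Rightarrow> braid \<Rightarrow> braid \<Rightarrow> bool" where
  "right_divides n a b \<longleftrightarrow> (\<exists>c \<in> positive_braids n. b = c \<otimes>\<^bsub>braid_group n\<^esub> a)"

definition max_nonrepeating_right_divisor :: "nat \<Rightarrow> braid \<Rightarrow> braid \<Rightarrow> bool" where
  "max_nonrepeating_right_divisor n a b \<longleftrightarrow>
     a \<in> nonrepeating_braids n \<and> right_divides n a b \<and>
     (\<forall>c \<in> nonrepeating_braids n. right_divides n c b \<longrightarrow> right_divides n c a)"

text \<open>
  The word \<open>s\<^sub>1 \<dots> s\<^sub>k \<Delta>\<^sup>p\<close>. For \<open>n \<le> 1\<close> the half twist \<open>\<Delta>\<close> is trivial, and \<open>p = 0\<close> is required in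
  order that the normal form is unique.
\<close>

definition right_greedy :: "nat \<Rightarrow> perm_word \<Rightarrow> bool" where
  "right_greedy n w \<longleftrightarrow>
     (\<exists>ss (p :: int).
        w = map (Pair True) ss @ replicate (nat \<bar>p\<bar>) (p \<ge> 0, half_twist n) \<and>
        (n \<le> 1 \<longrightarrow> p = 0) \<and>
        (\<forall>s \<in> set ss. s permutes {1..n} \<and> s \<noteq> id \<and> s \<noteq> half_twist n) \<and>
        (\<forall>i < length ss. max_nonrepeating_right_divisor n (perm_braid n (ss ! i))
           (word_braid n (map (Pair True) (take (Suc i) ss)))))"


section \<open>The group \<open>BV\<close>\<close>

text \<open>The number of leaves of a tree \<open>T\<close> is \<open>size1 T\<close>; leaves are counted from 1, left to right.\<close>

type_synonym btree = "unit tree"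
type_synonym triple = "btree \<times> braid \<times> btree"

fun add_caret :: "btree \<Rightarrow> nat \<Rightarrow> btree" where
  "add_caret Leaf i = (if i = 1 then Node Leaf () Leaf else Leaf)"
| "add_caret (Node l u r) i =
     (if i \<le> size1 l then Node (add_caret l i) u r else Node l u (add_caret r (i - size1 l)))"

definition triples :: "triple set" where
  "triples = {(T, b, U). size1 T = size1 U \<and> b \<in> carrier (braid_group (size1 T))}"

inductive eye_insertion :: "triple \<Rightarrow> triple \<Rightarrow> bool" where
  "size1 T = n \<Longrightarrow> size1 U = n \<Longrightarrow> w \<in> artin_words n \<Longrightarrow> i \<in> {1..n} \<Longrightarrow>
   eye_insertion (T, braid_of n w, U)
     (add_caret T i, braid_of (Suc n) (double_strand i w), add_caret U (strand_end w i))"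

definition reduced :: "triple \<Rightarrow> bool" where
  "reduced t \<longleftrightarrow> \<not> (\<exists>t'. eye_insertion t' t)"

definition bv_class :: "triple \<Rightarrow> triple set" where
  "bv_class t = {t'. equivclp eye_insertion t t'}"

definition BV :: "triple set monoid" where
  "BV =
     \<lparr>carrier = bv_class ` triples,
      monoid.mult = (\<lambda>A B. \<Union> {bv_class (T, b \<otimes>\<^bsub>braid_group (size1 T)\<^esub> c, V) |T b U c V.
         (T, b, U) \<in> A \<and> (U, c, V) \<in> B}),
      one = bv_class (Leaf, \<one>\<^bsub>braid_group 1\<^esub>, Leaf)\<rparr>"

type_synonym word_triple = "btree \<times> perm_word \<times> btree"

fun strands :: "word_triple \<Rightarrow> nat" where
  "strands (T, w, U) = size1 T"

fun word_length :: "word_triple \<Rightarrow> nat" where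
  "word_length (T, w, U) = length w"

fun triple_of :: "word_triple \<Rightarrow> triple" where
  "triple_of (T, w, U) = (T, word_braid (size1 T) w, U)"

fun bv_normal_form :: "word_triple \<Rightarrow> bool" where
  "bv_normal_form (T, w, U) \<longleftrightarrow>
     size1 T = size1 U \<and> right_greedy (size1 T) w \<and> reduced (triple_of (T, w, U))"

definition represents :: "word_triple \<Rightarrow> triple set \<Rightarrow> bool" where
  "represents x g \<longleftrightarrow> triple_of x \<in> triples \<and> g = bv_class (triple_of x)"


section \<open>Programs and their running time\<close>

text \<open>
  A first-order call-by-value language on pairs and natural numbers, with the uniform cost
  measure: every evaluation step costs 1. The only arithmetic operations are successor and
  truncated subtraction, so that the numbers in a computation exceed those in the input by at
  most the running time. Trees are atomic data. The operations on trees are primitive and cost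
  nothing, which expresses the convention that their complexity is not taken into account. The
  evaluation of their arguments and all control flow are charged, and each tree operation changes
  at most one caret; hence nothing but a bounded number of such operations per charged step is
  free of charge, and trees cannot be used to do other computations at no cost.
\<close>

datatype val = Num nat | Pr val val | Tr btree

datatype op1 = OFst | OSnd | OIsPair | OSuc

datatype op2 = OPair | OSub | OLess

datatype tree_op = TLeaves | TAddCaret | THasCaret | TRemoveCaret | TOpenLeaf

text \<open>
  In a program, \<open>ECall f e\<close> calls the \<open>f\<close>-th function. Each function has one argument, which is
  its variable 0; \<open>ELet\<close> binds a new variable 0.
\<close>

datatype exp =
    EVar nat
  | EConst nat
  | EOp1 op1 exp
  | EOp2 op2 exp exp
  | ETree tree_op exp exp
  | EIf exp exp exp
  | ELet exp exp
  | ECall nat exp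

type_synonym program = "exp list"

fun apply_op1 :: "op1 \<Rightarrow> val \<Rightarrow> val" where
  "apply_op1 OFst (Pr a b) = a"
| "apply_op1 OSnd (Pr a b) = b"
| "apply_op1 OIsPair (Pr a b) = Num 1"
| "apply_op1 OSuc (Num m) = Num (Suc m)"
| "apply_op1 _ _ = Num 0"

fun apply_op2 :: "op2 \<Rightarrow> val \<Rightarrow> val \<Rightarrow> val" where
  "apply_op2 OPair a b = Pr a b"
| "apply_op2 OSub (Num m) (Num n) = Num (m - n)"
| "apply_op2 OLess (Num m) (Num n) = Num (if m < n then 1 else 0)"
| "apply_op2 _ _ _ = Num 0"

text \<open>Whether the leaves \<open>i\<close> and \<open>i + 1\<close> are the two children of a common vertex.\<close>

fun has_caret :: "btree \<Rightarrow> nat \<Rightarrow> bool" where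
  "has_caret Leaf i = False"
| "has_caret (Node l u r) i =
     (l = Leaf \<and> r = Leaf \<and> i = 1 \<or>
      i < size1 l \<and> has_caret l i \<or> size1 l < i \<and> has_caret r (i - size1 l))"

fun remove_caret :: "btree \<Rightarrow> nat \<Rightarrow> btree" where
  "remove_caret Leaf i = Leaf"
| "remove_caret (Node l u r) i =
     (if l = Leaf \<and> r = Leaf then (if i = 1 then Leaf else Node l u r)
      else if i \<le> size1 l then Node (remove_caret l i) u r
      else Node l u (remove_caret r (i - size1 l)))"

text \<open>The first leaf of the first tree that is not a leaf of the second tree, or 0 if there is none.\<close>

fun open_leaf :: "btree \<Rightarrow> btree \<Rightarrow> nat" where
  "open_leaf Leaf Leaf = 0"
| "open_leaf Leaf (Node l u r) = 1"
| "open_leaf (Node l u r) Leaf = 0"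
| "open_leaf (Node l u r) (Node l' u' r') =
     (if open_leaf l l' \<noteq> 0 then open_leaf l l'
      else if open_leaf r r' \<noteq> 0 then size1 l + open_leaf r r' else 0)"

fun apply_tree_op :: "tree_op \<Rightarrow> val \<Rightarrow> val \<Rightarrow> val" where
  "apply_tree_op TLeaves (Tr T) _ = Num (size1 T)"
| "apply_tree_op TAddCaret (Tr T) (Num i) = Tr (add_caret T i)"
| "apply_tree_op THasCaret (Tr T) (Num i) = Num (if has_caret T i then 1 else 0)"
| "apply_tree_op TRemoveCaret (Tr T) (Num i) = Tr (remove_caret T i)"
| "apply_tree_op TOpenLeaf (Tr T) (Tr U) = Num (open_leaf T U)"
| "apply_tree_op _ _ _ = Num 0"

text \<open>\<open>eval P env e a t\<close>: the expression \<open>e\<close> evaluates to \<open>a\<close> at cost \<open>t\<close>.\<close>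

inductive eval :: "program \<Rightarrow> val list \<Rightarrow> exp \<Rightarrow> val \<Rightarrow> nat \<Rightarrow> bool" for P where
  "i < length env \<Longrightarrow> eval P env (EVar i) (env ! i) 1"
| "eval P env (EConst m) (Num m) 1"
| "eval P env e a t \<Longrightarrow> eval P env (EOp1 f e) (apply_op1 f a) (t + 1)"
| "eval P env e a t \<Longrightarrow> eval P env e' a' t' \<Longrightarrow>
     eval P env (EOp2 f e e') (apply_op2 f a a') (t + t' + 1)"
| "eval P env e a t \<Longrightarrow> eval P env e' a' t' \<Longrightarrow>
     eval P env (ETree f e e') (apply_tree_op f a a') (t + t')"
| "eval P env c a t \<Longrightarrow> eval P env (if a \<noteq> Num 0 then e else e') b t' \<Longrightarrow>
     eval P env (EIf c e e') b (t + t' + 1)"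
| "eval P env e a t \<Longrightarrow> eval P (a # env) e' b t' \<Longrightarrow> eval P env (ELet e e') b (t + t' + 1)"
| "f < length P \<Longrightarrow> eval P env e a t \<Longrightarrow> eval P [a] (P ! f) b t' \<Longrightarrow>
     eval P env (ECall f e) b (t + t' + 1)"

definition computes_in_time :: "program \<Rightarrow> val \<Rightarrow> val \<Rightarrow> nat \<Rightarrow> bool" where
  "computes_in_time P a b t \<longleftrightarrow> eval P [a] (ECall 0 (EVar 0)) b t"

fun enc_list :: "val list \<Rightarrow> val" where
  "enc_list [] = Num 0"
| "enc_list (a # as) = Pr a (enc_list as)"

text \<open>A letter is encoded by its sign and the list \<open>s 1, \<dots>, s n\<close>.\<close>

fun enc_letter :: "nat \<Rightarrow> bool \<times> (nat \<Rightarrow> nat) \<Rightarrow> val" where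
  "enc_letter n (e, s) =
     Pr (Num (if e then 1 else 0)) (enc_list (map (\<lambda>i. Num (s i)) [1..<Suc n]))"

fun enc_triple :: "word_triple \<Rightarrow> val" where
  "enc_triple (T, w, U) =
     Pr (Tr T) (Pr (enc_list (map (enc_letter (size1 T)) w)) (Tr U))"

text \<open>
  A time bound \<open>O((h\<^sub>1 + h\<^sub>2)\<^sup>2 \<dots>)\<close> is 0 if both words are empty, but no program halts in 0 steps.
  In this case, and only in this case, the theorem has 1 in place of \<open>h\<^sub>1 + h\<^sub>2\<close>.
\<close>

end

theory Submission
  imports Defs "HOL-Library.Confluence"
begin

text \<open>
  A product of two classes is computed in four stages: make the two middle trees equal by eye
  insertions, concatenate the two words, bring the resulting word into greedy form, and remove
  eyes as long as there are any. Write \<open>n\<close> for the number of strands and \<open>h\<close> for the number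
  of letters.

  \<^item> Making the trees equal. The union of the bottom tree of the first triple and the top tree of
  the second one is a common expansion. It is reached by at most \<open>n\<close> insertions, and an insertion
  doubles a strand of a word letter by letter (\<open>dblw\<close>): doubling a strand of a non-repeating braid
  gives a non-repeating braid, since the two copies are parallel. For the first triple this is done
  in the inverse triple, where the tree in question is on top. That the result represents the
  product rests on the confluence of eye insertions (\<open>strong_confluentp_eye_insertion\<close>) and on the
  uniqueness of expansions with a given top tree; they make the multiplication of classes well
  defined (\<open>bv_mult\<close>).

  \<^item> Greedy form. Inverse letters are removed by \<open>s\<^sup>-\<^sup>1 = s' \<Delta>\<^sup>-\<^sup>1\<close>, and the powers of \<open>\<Delta>\<close> are
  collected at the end. A positive letter is appended to a greedy word by walking through
  the word from the end to the beginning and replacing each pair of neighbours by the greedy pair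
  with the same product (\<open>insert_letter\<close>). A pair is made greedy by moving crossings one by one from
  the left letter to the right one. On the lists of values this is sorting by exchanges of
  neighbours, with a cursor that goes back one place after each exchange, so that a pair
  costs \<open>O(n\<^sup>2)\<close> steps (\<open>run_slide_aux\<close>). As each of the \<open>h\<close> letters passes at most
  \<open>h\<close> letters, this stage costs \<open>O(h\<^sup>2 n\<^sup>2)\<close>, and it dominates the running time.

  \<^item> Eyes. Whether a braid in greedy form arises from another one by doubling the strand at \<open>i\<close> can
  be read off from its letters: follow the two strands from \<open>i\<close> and \<open>i + 1\<close>; they have to be
  neighbours all the time, and the number of letters in which they cross has to agree with the
  exponent of \<open>\<Delta>\<^sup>-\<^sup>1\<close>. This test is complete because a doubled braid has a greedy word of this
  shape and greedy words are unique (\<open>unribbon_complete\<close>). It costs \<open>O(h n)\<close>; the word without the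
  second strand is greedy again (\<open>greedy_ribs\<close>). No eye arises to the right of a removed one
  (\<open>eye_at_ins\<close>), so \<open>O(n)\<close> tests suffice.

  The theory of greedy words rests on Garside's theorem that the positive braid monoid is
  cancellative with least common multiples and embeds into the braid group (\<open>common_multiple\<close>,
  \<open>braid_equiv_pos_iff\<close>). The program is written in the given language of expressions; its
  evaluation is turned into rewriting by a calculus of postconditions with costs (\<open>wp_simps\<close>).
\<close>

section \<open>The positive braid monoid\<close>

definition far :: "nat \<Rightarrow> nat \<Rightarrow> bool" where
  "far i j \<longleftrightarrow> Suc i < j \<or> Suc j < i"

definition near :: "nat \<Rightarrow> nat \<Rightarrow> bool" where
  "near i j \<longleftrightarrow> j = Suc i \<or> i = Suc j"

lemma far_sym: "far i j \<Longrightarrow> far j i"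
  by (auto simp: far_def)

lemma near_sym: "near i j \<Longrightarrow> near j i"
  by (auto simp: near_def)

lemma index_cases: obtains "i = j" | "far i j" | "near i j"
  by (fastforce simp: far_def near_def)

lemma near_near: "near k i \<Longrightarrow> near k j \<Longrightarrow> i = j \<or> far i j"
  by (auto simp: far_def near_def)

text \<open>The generators \<open>\<sigma>\<^sub>i\<close> are represented by their indices,
  without an upper bound on the index; the number of strands only enters in conditions of the form
  \<open>set w \<subseteq> {1..<n}\<close>, which the relations preserve.\<close>

inductive pstep :: "nat list \<Rightarrow> nat list \<Rightarrow> bool" where
  far: "far i j \<Longrightarrow> pstep (u @ i # j # v) (u @ j # i # v)"
| near: "near i j \<Longrightarrow> pstep (u @ i # j # i # v) (u @ j # i # j # v)"

definition peq :: "nat list \<Rightarrow> nat list \<Rightarrow> bool" (infix "\<approx>" 50) where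
  "u \<approx> v \<longleftrightarrow> pstep\<^sup>*\<^sup>* u v"

lemma pstep_sym: "pstep u v \<Longrightarrow> pstep v u"
  by (induction rule: pstep.induct) (auto intro: pstep.intros far_sym near_sym)

lemma pstep_context: "pstep u v \<Longrightarrow> pstep (x @ u @ y) (x @ v @ y)"
proof (induction rule: pstep.induct)
  case (far i j u v)
  then show ?case using pstep.far[of i j "x @ u" "v @ y"] by simp
next
  case (near i j u v)
  then show ?case using pstep.near[of i j "x @ u" "v @ y"] by simp
qed

lemma peq_refl [simp, intro]: "u \<approx> u"
  by (simp add: peq_def)

lemma peq_trans [trans]: "u \<approx> v \<Longrightarrow> v \<approx> w \<Longrightarrow> u \<approx> w"
  by (auto simp: peq_def)

lemma peq_sym: "u \<approx> v \<Longrightarrow> v \<approx> u"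
  unfolding peq_def
  by (induction rule: rtranclp_induct) (auto intro: converse_rtranclp_into_rtranclp dest: pstep_sym)

lemma peq_induct [consumes 1, case_names refl step]:
  assumes "u \<approx> v" "P u" "\<And>v w. u \<approx> v \<Longrightarrow> pstep v w \<Longrightarrow> P v \<Longrightarrow> P w"
  shows "P v"
  using assms unfolding peq_def by (induction rule: rtranclp_induct) auto

lemma peq_step: "u \<approx> v \<Longrightarrow> pstep v w \<Longrightarrow> u \<approx> w"
  by (simp add: peq_def)

lemma peq_context: "u \<approx> v \<Longrightarrow> x @ u @ y \<approx> x @ v @ y"
  by (induction rule: peq_induct) (auto intro: peq_step dest: pstep_context)

lemma peq_append: "u \<approx> v \<Longrightarrow> x \<approx> y \<Longrightarrow> u @ x \<approx> v @ y"
  using peq_context[of u v "[]" x] peq_context[of x y v "[]"] by (auto intro: peq_trans)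

lemma peq_Cons: "u \<approx> v \<Longrightarrow> i # u \<approx> i # v"
  using peq_append[of "[i]" "[i]" u v] by simp

lemma peq_length: "u \<approx> v \<Longrightarrow> length u = length v"
  by (induction rule: peq_induct) (auto elim!: pstep.cases)

lemma pstep_set: "pstep u v \<Longrightarrow> set u = set v"
  by (induction rule: pstep.induct) auto

lemma peq_set: "u \<approx> v \<Longrightarrow> set u = set v"
  by (induction rule: peq_induct) (auto dest: pstep_set)

lemma peq_Nil [simp]: "u \<approx> [] \<longleftrightarrow> u = []" "[] \<approx> u \<longleftrightarrow> u = []"
  by (auto dest: peq_length)

lemma peq_far: "far i j \<Longrightarrow> u \<approx> j # v \<Longrightarrow> i # u \<approx> j # i # v"
  using peq_step[OF peq_Cons[of u "j # v" i], of "j # i # v"] pstep.far[of i j "[]" v] by simp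

lemma peq_near: "near i j \<Longrightarrow> u \<approx> j # i # v \<Longrightarrow> i # u \<approx> j # i # j # v"
  using peq_step[OF peq_Cons[of u "j # i # v" i], of "j # i # j # v"] pstep.near[of i j "[]" v] by simp

lemma peq_map:
  assumes "u \<approx> v" "\<And>i j. i \<in> set u \<Longrightarrow> j \<in> set u \<Longrightarrow> far i j \<Longrightarrow> far (f i) (f j)"
    "\<And>i j. i \<in> set u \<Longrightarrow> j \<in> set u \<Longrightarrow> near i j \<Longrightarrow> near (f i) (f j)"
  shows "map f u \<approx> map f v"
  using assms(1)
proof (induction rule: peq_induct)
  case (step v w)
  from step.hyps(2) show ?case
  proof cases
    case (far i j x y)
    have "far (f i) (f j)" using far peq_set[OF step.hyps(1)] assms(2) by auto
    then show ?thesis using far step.IH pstep.far[of "f i" "f j" "map f x" "map f y"] peq_step by auto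
  next
    case (near i j x y)
    have "near (f i) (f j)" using near peq_set[OF step.hyps(1)] assms(3) by auto
    then show ?thesis using near step.IH pstep.near[of "f i" "f j" "map f x" "map f y"] peq_step by auto
  qed
qed simp

lemma peq_rev: "u \<approx> v \<Longrightarrow> rev u \<approx> rev v"
proof (induction rule: peq_induct)
  case (step v w)
  have "pstep (rev v) (rev w)"
    using step.hyps(2)
  proof cases
    case (far i j x y)
    then show ?thesis using far_sym[OF far(3)] far(1,2) pstep.far[of j i "rev y" "rev x"] by simp
  next
    case (near i j x y)
    then show ?thesis using pstep.near[of i j "rev y" "rev x"] by simp
  qed
  then show ?case using step.IH peq_step by blast
qed simp

subsection \<open>Cancellation and common multiples\<close>

text \<open>The conclusion of Garside's theorem: if \<open>i # a\<close> and \<open>j # b\<close>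
  represent the same braid, then both come from the least common multiple of the two
  generators.\<close>

definition common_multiple :: "nat \<Rightarrow> nat \<Rightarrow> nat list \<Rightarrow> nat list \<Rightarrow> bool" where
  "common_multiple i j a b \<longleftrightarrow>
     i = j \<and> a \<approx> b \<or>
     far i j \<and> (\<exists>c. a \<approx> j # c \<and> b \<approx> i # c) \<or>
     near i j \<and> (\<exists>c. a \<approx> j # i # c \<and> b \<approx> i # j # c)"

lemma common_multiple_sym: "common_multiple i j a b \<Longrightarrow> common_multiple j i b a"
  unfolding common_multiple_def by (blast intro: far_sym near_sym peq_sym)

lemma not_far_near: "far i j \<Longrightarrow> near i j \<Longrightarrow> False" "\<not> far i i" "\<not> near i i"
  by (auto simp: far_def near_def)

lemma common_multiple_same [simp]: "common_multiple i i a b \<longleftrightarrow> a \<approx> b"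
  by (auto simp: common_multiple_def not_far_near)

lemma common_multiple_far: "far i j \<Longrightarrow> common_multiple i j a b \<longleftrightarrow> (\<exists>c. a \<approx> j # c \<and> b \<approx> i # c)"
  using not_far_near by (auto simp: common_multiple_def)

lemma common_multiple_near:
  "near i j \<Longrightarrow> common_multiple i j a b \<longleftrightarrow> (\<exists>c. a \<approx> j # i # c \<and> b \<approx> i # j # c)"
  using not_far_near by (auto simp: common_multiple_def)

lemma common_multiple_step:
  assumes "pstep (i # a) (j # b)"
  shows "common_multiple i j a b"
  using assms
proof cases
  case (far k l u v)
  show ?thesis
  proof (cases u)
    case Nil then show ?thesis using far by (auto simp: common_multiple_def)
  next
    case (Cons x u')
    then show ?thesis using far pstep.far[of k l u' v] by (auto simp: peq_def)
  qed
next
  case (near k l u v)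
  show ?thesis
  proof (cases u)
    case Nil then show ?thesis using near by (auto simp: common_multiple_def)
  next
    case (Cons x u')
    then show ?thesis using near pstep.near[of k l u' v] by (auto simp: peq_def)
  qed
qed

lemma common_multiple_peq_left: "a \<approx> a' \<Longrightarrow> common_multiple i j a' b \<Longrightarrow> common_multiple i j a b"
  unfolding common_multiple_def using peq_trans by blast

lemma common_multiple_peq_right: "b' \<approx> b \<Longrightarrow> common_multiple i j a b' \<Longrightarrow> common_multiple i j a b"
  unfolding common_multiple_def using peq_trans peq_sym by blast

text \<open>The case in which \<open>\<sigma>\<^sub>k\<close> commutes with
  \<open>\<sigma>\<^sub>i\<close> and is a neighbour of \<open>\<sigma>\<^sub>j\<close> is the
  asymmetric one. It occurs for both orders of the two relations, which is why it is stated
  separately.\<close>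

lemma common_multiple_trans_far_near:
  assumes IH: "\<And>i j a b. length a < length d \<Longrightarrow> i # a \<approx> j # b \<Longrightarrow> common_multiple i j a b"
    and fik: "far i k" and nkj: "near k j" and ik: "common_multiple i k a d" and kj: "common_multiple k j d b"
  shows "common_multiple i j a b"
proof -
  obtain e f where a: "a \<approx> k # e" and d: "d \<approx> i # e" and d': "d \<approx> j # k # f" and b: "b \<approx> k # j # f"
    using ik kj fik nkj by (auto simp: common_multiple_far common_multiple_near)
  have ij: "i \<noteq> j" using fik nkj not_far_near near_sym by blast
  have eq: "i # e \<approx> j # k # f" using d d' peq_sym peq_trans by blast
  have len: "length e < length d" "Suc (length f) < length d" using peq_length[OF d] peq_length[OF d'] by auto
  show ?thesis
  proof (cases i j rule: index_cases)
    case 2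
    obtain c where e: "e \<approx> j # c" and f: "k # f \<approx> i # c"
      using IH[OF len(1) eq] 2 by (auto simp: common_multiple_far)
    obtain g where f': "f \<approx> i # g" and c: "c \<approx> k # g"
      using IH[OF _ f] len common_multiple_far[OF far_sym[OF fik]] by auto
    have "a \<approx> k # j # k # g" by (rule peq_trans[OF a peq_Cons[OF peq_trans[OF e peq_Cons[OF c]]]])
    also have "\<dots> \<approx> j # k # j # g" by (rule peq_near) (use nkj in auto)
    finally have 1: "a \<approx> j # k # j # g" .
    have "b \<approx> k # j # i # g" by (rule peq_trans[OF b peq_Cons[OF peq_Cons[OF f']]])
    also have "\<dots> \<approx> k # i # j # g" by (rule peq_Cons, rule peq_far) (use 2 in \<open>auto intro: far_sym\<close>)
    also have "\<dots> \<approx> i # k # j # g" by (rule peq_far) (use fik in \<open>auto intro: far_sym\<close>)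
    finally have b': "b \<approx> i # k # j # g" .
    then show ?thesis using 1 2 by (auto simp: common_multiple_far)
  next
    case 3
    obtain c where e: "e \<approx> j # i # c" and f: "k # f \<approx> i # j # c"
      using IH[OF len(1) eq] 3 by (auto simp: common_multiple_near)
    obtain g where f': "f \<approx> i # g" and c: "j # c \<approx> k # g"
      using IH[OF _ f] len common_multiple_far[OF far_sym[OF fik]] by auto
    have "length c < length d" using peq_length[OF f] len by simp
    from IH[OF this c] obtain h where c': "c \<approx> k # j # h" and g: "g \<approx> j # k # h"
      by (auto simp: common_multiple_near[OF near_sym[OF nkj]])
    have "a \<approx> k # j # i # k # j # h" by (rule peq_trans[OF a peq_Cons[OF peq_trans[OF e peq_Cons[OF peq_Cons[OF c']]]]])
    also have "\<dots> \<approx> k # j # k # i # j # h" by (intro peq_Cons peq_far) (use fik in auto)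
    also have "\<dots> \<approx> j # k # j # i # j # h" by (rule peq_near) (use nkj in auto)
    also have "\<dots> \<approx> j # k # i # j # i # h" by (intro peq_Cons peq_near) (use 3 in \<open>auto intro: near_sym\<close>)
    also have "\<dots> \<approx> j # i # k # j # i # h" by (intro peq_Cons peq_far) (use fik in \<open>auto intro: far_sym\<close>)
    finally have 1: "a \<approx> j # i # k # j # i # h" .
    have "b \<approx> k # j # i # j # k # h" by (rule peq_trans[OF b peq_Cons[OF peq_Cons[OF peq_trans[OF f' peq_Cons[OF g]]]]])
    also have "\<dots> \<approx> k # i # j # i # k # h" by (intro peq_Cons peq_near) (use 3 in \<open>auto intro: near_sym\<close>)
    also have "\<dots> \<approx> i # k # j # i # k # h" by (rule peq_far) (use fik in \<open>auto intro: far_sym\<close>)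
    also have "\<dots> \<approx> i # k # j # k # i # h" by (intro peq_Cons peq_far) (use fik in auto)
    also have "\<dots> \<approx> i # j # k # j # i # h" by (intro peq_Cons peq_near) (use nkj in auto)
    finally show ?thesis using 1 3 by (auto simp: common_multiple_near)
  qed (use ij in auto)
qed

text \<open>The heart of Garside's argument: common multiples of two generators factor through the
  least one, and this property is transitive because the shorter words that arise in comparing
  the two factorizations of \<open>d\<close> are covered by the induction hypothesis.\<close>

lemma common_multiple_trans:
  assumes IH: "\<And>i j a b. length a < length d \<Longrightarrow> i # a \<approx> j # b \<Longrightarrow> common_multiple i j a b"
    and ik: "common_multiple i k a d" and kj: "common_multiple k j d b"
  shows "common_multiple i j a b"
proof -
  show ?thesis
  proof (cases i k rule: index_cases)
    case 1
    then show ?thesis using ik kj common_multiple_peq_left by auto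
  next
    case ik': 2
    show ?thesis
    proof (cases k j rule: index_cases)
      case 1
      then show ?thesis using ik kj common_multiple_peq_right by auto
    next
      case 2
      obtain e f where a: "a \<approx> k # e" and d: "d \<approx> i # e" and d': "d \<approx> j # f" and b: "b \<approx> k # f"
        using ik kj ik' 2 by (auto simp: common_multiple_far)
      have eq: "i # e \<approx> j # f" using d d' peq_sym peq_trans by blast
      have len: "length e < length d" using peq_length[OF d] by auto
      note cm = IH[OF len eq]
      show ?thesis
      proof (cases i j rule: index_cases)
        case 1 then show ?thesis using cm by (auto intro: peq_trans[OF a peq_trans[OF peq_Cons peq_sym[OF b]]])
      next
        case ij: 2
        then obtain c where e: "e \<approx> j # c" and f: "f \<approx> i # c" using cm by (auto simp: common_multiple_far)
        have "a \<approx> j # k # c" using a peq_far[OF 2 e] peq_trans by blast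
        moreover have "b \<approx> i # k # c" using b peq_far[OF far_sym[OF ik'] f] peq_trans by blast
        ultimately show ?thesis using ij by (auto simp: common_multiple_far)
      next
        case ij: 3
        then obtain c where e: "e \<approx> j # i # c" and f: "f \<approx> i # j # c" using cm by (auto simp: common_multiple_near)
        have "a \<approx> j # i # k # c" 
          using a peq_far[OF 2 e] peq_Cons[OF peq_far[OF far_sym[OF ik'], of "i # c" c], of j] peq_trans by blast
        moreover have "b \<approx> i # j # k # c"
          using b peq_far[OF far_sym[OF ik'] f] peq_Cons[OF peq_far[OF 2, of "j # c" c], of i] peq_trans by blast
        ultimately show ?thesis using ij by (auto simp: common_multiple_near)
      qed
    next
      case 3
      show ?thesis by (rule common_multiple_trans_far_near[OF IH ik' 3 ik kj])
    qed
  next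
    case ik': 3
    show ?thesis
    proof (cases k j rule: index_cases)
      case 1
      then show ?thesis using ik kj common_multiple_peq_right by auto
    next
      case 2
      show ?thesis
        by (rule common_multiple_sym, rule common_multiple_trans_far_near[OF IH far_sym[OF 2] near_sym[OF ik']
            common_multiple_sym[OF kj] common_multiple_sym[OF ik]])
    next
      case 3
      obtain e f where a: "a \<approx> k # i # e" and d: "d \<approx> i # k # e" and d': "d \<approx> j # k # f" and b: "b \<approx> k # j # f"
        using ik kj ik' 3 by (auto simp: common_multiple_near)
      have eq: "i # k # e \<approx> j # k # f" using d d' peq_sym peq_trans by blast
      have len: "Suc (length e) < length d" "length f = length e" using peq_length[OF d] peq_length[OF d'] by auto
      have cm: "common_multiple i j (k # e) (k # f)" using IH[OF _ eq] len by auto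
      from near_near[OF near_sym[OF ik'] 3] show ?thesis
      proof
        assume ij: "i = j"
        then have "e \<approx> f" using cm IH[of e k k f] len by auto
        then have "k # i # e \<approx> k # j # f" using ij by (simp add: peq_Cons)
        from peq_trans[OF a peq_trans[OF this peq_sym[OF b]]] have "a \<approx> b" .
        then show ?thesis using ij by simp
      next
        assume ij: "far i j"
        then obtain c where e: "k # e \<approx> j # c" and f: "k # f \<approx> i # c"
          using cm by (auto simp: common_multiple_far)
        obtain g where e': "e \<approx> j # k # g" and c: "c \<approx> k # j # g"
          using IH[OF _ e] len 3 by (auto simp: common_multiple_near)
        obtain h where f': "f \<approx> i # k # h" and c': "c \<approx> k # i # h"
          using IH[OF _ f] len near_sym[OF ik'] by (auto simp: common_multiple_near)
        have "k # j # g \<approx> k # i # h" using c c' peq_sym peq_trans by blast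
        then have "j # g \<approx> i # h" using IH[of "j # g" k k] peq_length[OF e'] len by auto
        then obtain m where g: "g \<approx> i # m" and h: "h \<approx> j # m"
          using IH[of g j i h] peq_length[OF e'] len far_sym[OF ij] by (auto simp: common_multiple_far)
        have "a \<approx> k # i # j # k # i # m" by (rule peq_trans[OF a peq_Cons[OF peq_Cons[OF peq_trans[OF e' peq_Cons[OF peq_Cons[OF g]]]]]])
        also have "\<dots> \<approx> k # j # i # k # i # m" by (intro peq_Cons peq_far) (use ij in auto)
        also have "\<dots> \<approx> k # j # k # i # k # m" by (intro peq_Cons peq_near) (use ik' in auto)
        also have "\<dots> \<approx> j # k # j # i # k # m" by (intro peq_near) (use 3 in auto)
        finally have 1: "a \<approx> j # k # j # i # k # m" .
        have "b \<approx> k # j # i # k # j # m" by (rule peq_trans[OF b peq_Cons[OF peq_Cons[OF peq_trans[OF f' peq_Cons[OF peq_Cons[OF h]]]]]])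
        also have "\<dots> \<approx> k # i # j # k # j # m" by (intro peq_Cons peq_far) (use ij in \<open>auto intro: far_sym\<close>)
        also have "\<dots> \<approx> k # i # k # j # k # m" by (intro peq_Cons peq_near) (use 3 in \<open>auto intro: near_sym\<close>)
        also have "\<dots> \<approx> i # k # i # j # k # m" by (intro peq_near) (use ik' in \<open>auto intro: near_sym\<close>)
        also have "\<dots> \<approx> i # k # j # i # k # m" by (intro peq_Cons peq_far) (use ij in auto)
        finally show ?thesis using 1 ij by (auto simp: common_multiple_far)
      qed
    qed
  qed
qed

lemma common_multiple: "i # a \<approx> j # b \<Longrightarrow> common_multiple i j a b"
proof (induction "length a" arbitrary: i j a b rule: less_induct)
  case less
  have "\<forall>j b. v = j # b \<longrightarrow> common_multiple i j a b" if "i # a \<approx> v" for v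
    using that
  proof (induction rule: peq_induct)
    case (step v w)
    obtain k d where v: "v = k # d" using peq_length[OF step.hyps(1)] by (cases v) auto
    have len: "length d = length a" using peq_length[OF step.hyps(1)] v by simp
    show ?case
    proof (intro allI impI)
      fix j b assume w: "w = j # b"
      show "common_multiple i j a b"
        by (rule common_multiple_trans[of d])
          (use less.hyps len step.IH v w common_multiple_step step.hyps(2) in auto)
    qed
  qed auto
  then show ?case using less.prems by blast
qed

lemma peq_Cons_iff [simp]: "i # a \<approx> i # b \<longleftrightarrow> a \<approx> b"
  using common_multiple[of i a i b] peq_Cons[of a b i] by auto

lemma peq_append_left_iff [simp]: "u @ a \<approx> u @ b \<longleftrightarrow> a \<approx> b"
  by (induction u) auto

lemma peq_rev_iff: "rev a \<approx> rev b \<longleftrightarrow> a \<approx> b"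
  by (metis peq_rev rev_rev_ident)

text \<open>Reversing words turns left cancellation, which is the case \<open>i = j\<close> of
  Garside's theorem, into right cancellation.\<close>

lemma peq_append_right_iff [simp]: "a @ u \<approx> b @ u \<longleftrightarrow> a \<approx> b"
  by (metis peq_append_left_iff peq_rev_iff rev_append)

text \<open>The least common left multiple of two generators.\<close>

definition glcm :: "nat \<Rightarrow> nat \<Rightarrow> nat list" where
  "glcm i j = (if i = j then [i] else if far i j then [j, i] else [i, j, i])"

lemma glcm_sym: "glcm i j \<approx> glcm j i"
proof (cases i j rule: index_cases)
  case 2
  then have "i \<noteq> j" "far j i" by (auto simp: far_def)
  with 2 show ?thesis using peq_far[of j i "[i]" "[]"] by (simp add: glcm_def)
next
  case 3
  then have "i \<noteq> j" "\<not> far i j" "\<not> far j i" by (auto simp: far_def near_def)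
  with 3 show ?thesis using peq_near[of i j "[j,i]" "[]"] by (simp add: glcm_def)
qed simp

lemma glcm_last: "\<exists>c. glcm i j = c @ [i]"
  by (auto simp: glcm_def)

lemma common_left_multiple: "a @ [i] \<approx> b @ [j] \<Longrightarrow> \<exists>c. a @ [i] \<approx> c @ glcm i j"
proof -
  assume "a @ [i] \<approx> b @ [j]"
  then have "common_multiple i j (rev a) (rev b)" using common_multiple[of i "rev a" j "rev b"] peq_rev[of "a @ [i]" "b @ [j]"] by simp
  then consider "i = j" | c where "i \<noteq> j" "far i j" "rev a \<approx> j # c"
    | c where "i \<noteq> j" "\<not> far i j" "rev a \<approx> j # i # c"
    using not_far_near by (auto simp: common_multiple_def)
  then show ?thesis
  proof cases
    case 1 then show ?thesis by (auto simp: glcm_def)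
  next
    case 2
    then have "a \<approx> rev c @ [j]" using peq_rev[of "rev a" "j # c"] by simp
    then have "a @ [i] \<approx> (rev c @ [j]) @ [i]" by (rule peq_append) simp
    then show ?thesis using 2 by (auto simp: glcm_def)
  next
    case 3
    then have "a \<approx> rev c @ [i, j]" using peq_rev[of "rev a" "j # i # c"] by simp
    then have "a @ [i] \<approx> (rev c @ [i, j]) @ [i]" by (rule peq_append) simp
    then show ?thesis using 3 by (auto simp: glcm_def)
  qed
qed

section \<open>Non-repeating words and permutations\<close>

abbreviation pinv :: "(nat \<Rightarrow> nat) \<Rightarrow> nat \<Rightarrow> nat" where
  "pinv \<equiv> inv_into UNIV"

primrec pend :: "nat list \<Rightarrow> nat \<Rightarrow> nat" where
  pend_Nil: "pend [] = id"
| pend_Cons: "pend (j # w) = pend w \<circ> transpose j (Suc j)"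

lemma pend_append: "pend (u @ v) = pend v \<circ> pend u"
  by (induction u) (auto simp: fun_eq_iff)

lemma bij_pend [simp]: "bij (pend w)"
proof (induction w)
  case (Cons j w)
  then show ?case unfolding pend_Cons by (intro bij_comp) auto
qed (simp only: pend_Nil bij_id)

lemma inj_pend [simp]: "pend w a = pend w b \<longleftrightarrow> a = b"
  using bij_pend[of w] by (auto simp: bij_def inj_eq)

lemma inv_pend [simp]: "pinv (pend w) (pend w a) = a" "pend w (pinv (pend w) a) = a"
  using bij_pend[of w] by (auto simp: bij_def surj_f_inv_f)

lemma pend_permutes: "set w \<subseteq> {1..<n} \<Longrightarrow> pend w permutes {1..n}"
proof (induction w)
  case (Cons j w)
  then show ?case unfolding pend_Cons by (intro permutes_compose permutes_swap_id) auto
qed (simp add: permutes_id)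

lemma transpose_Suc:
  "transpose j (Suc j) k = (if k = j then Suc j else if k = Suc j then j else k)"
  by (auto simp: transpose_def)

lemma pend_peq: "u \<approx> v \<Longrightarrow> pend u = pend v"
proof (induction rule: peq_induct)
  case (step v w)
  from step.hyps(2) have "pend v = pend w"
    by (induction rule: pstep.induct) (auto simp: pend_append fun_eq_iff transpose_Suc far_def near_def)
  then show ?case using step.IH by simp
qed simp

text \<open>The first crossing separates the strands at \<open>j\<close> and \<open>Suc j\<close>
  by exchanging them; they must not meet again in the rest of the word, which keeps them in
  order.\<close>

fun nonrep :: "nat list \<Rightarrow> bool" where
  "nonrep [] \<longleftrightarrow> True"
| "nonrep (j # w) \<longleftrightarrow> nonrep w \<and> pend w j < pend w (Suc j)"

lemma nonrep_peq: "u \<approx> v \<Longrightarrow> nonrep u \<longleftrightarrow> nonrep v"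
proof (induction rule: peq_induct)
  case (step v w)
  have "nonrep v = nonrep w" if "pstep v w" for v w
    using that
  proof (induction rule: pstep.induct)
    case (far i j u v)
    have 0: "pend (u @ i # j # v) = pend (u @ j # i # v)" for u
      using pend_peq[of "u @ i # j # v" "u @ j # i # v"] pstep.far[OF far] by (auto simp: peq_def)
    show ?case
    proof (induction u)
      case Nil
      show ?case using far by (auto simp: far_def transpose_Suc)
    next
      case (Cons k u)
      then show ?case using 0[of u] by simp
    qed
  next
    case (near i j u v)
    have 0: "pend (u @ i # j # i # v) = pend (u @ j # i # j # v)" for u
      using pend_peq[of "u @ i # j # i # v" "u @ j # i # j # v"] pstep.near[OF near] by (auto simp: peq_def)
    show ?case
    proof (induction u)
      case Nil
      show ?case using near by (auto simp: near_def transpose_Suc)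
    next
      case (Cons k u)
      then show ?case using 0[of u] by simp
    qed
  qed
  then show ?case using step by simp
qed simp

subsection \<open>Crossings\<close>

primrec crs :: "nat list \<Rightarrow> nat set list" where
  "crs [] = []"
| "crs (j # w) = {j, Suc j} # map (image (transpose j (Suc j))) (crs w)"

lemma distinct_map_image: "inj f \<Longrightarrow> distinct (map (image f) xs) \<longleftrightarrow> distinct xs"
  by (simp add: distinct_map inj_on_def inj_image_eq_iff)

lemma crs_append: "crs (u @ v) = crs u @ map (image (pinv (pend u))) (crs v)"
proof (induction u)
  case (Cons j u)
  have "pinv (pend (j # u)) = transpose j (Suc j) \<circ> pinv (pend u)"
    unfolding pend_Cons by (subst o_inv_distrib) auto
  then show ?case using Cons by (simp add: image_image comp_def del: pend_Cons)
qed (simp add: inv_id)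

lemma crs_pairs: "S \<in> set (crs w) \<Longrightarrow> \<exists>a b. a < b \<and> S = {a, b}"
proof (induction w arbitrary: S)
  case (Cons j w)
  show ?case
  proof (cases "S = {j, Suc j}")
    case True then show ?thesis by (intro exI[of _ j] exI[of _ "Suc j"]) simp
  next
    case False
    then obtain S' where S': "S' \<in> set (crs w)" "S = transpose j (Suc j) ` S'"
      using Cons.prems by (auto simp: crs.simps)
    obtain a b where "a < b" "S' = {a, b}" using Cons.IH S' by blast
    then have "S = {transpose j (Suc j) a, transpose j (Suc j) b}" "transpose j (Suc j) a \<noteq> transpose j (Suc j) b"
      using S' by (auto simp: transpose_eq_iff)
    then show ?thesis by (metis insert_commute linorder_neqE_nat)
  qed
qed simp

lemma image_transpose_pair:
  "{a, b} \<in> image (transpose i j) ` F \<longleftrightarrow> {transpose i j a, transpose i j b} \<in> F"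
proof
  assume "{a, b} \<in> image (transpose i j) ` F"
  then obtain S where S: "S \<in> F" "{a, b} = transpose i j ` S" by auto
  have "{transpose i j a, transpose i j b} = transpose i j ` {a, b}" by simp
  also have "\<dots> = S" unfolding S(2) by (simp add: image_image)
  finally show "{transpose i j a, transpose i j b} \<in> F" using S(1) by simp
next
  assume "{transpose i j a, transpose i j b} \<in> F"
  then have "transpose i j ` {transpose i j a, transpose i j b} \<in> image (transpose i j) ` F" by (rule imageI)
  then show "{a, b} \<in> image (transpose i j) ` F" by simp
qed

lemma crs_set: "nonrep w \<Longrightarrow> a < b \<Longrightarrow> {a, b} \<in> set (crs w) \<longleftrightarrow> pend w b < pend w a"
proof (induction w arbitrary: a b)
  case (Cons j w)
  let ?t = "transpose j (Suc j)"
  have eq: "{a, b} \<in> set (crs (j # w)) \<longleftrightarrow> {a, b} = {j, Suc j} \<or> {?t a, ?t b} \<in> set (crs w)"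
    by (simp add: image_transpose_pair)
  show ?case
  proof (cases "a = j \<and> b = Suc j")
    case True then show ?thesis using Cons.prems eq by simp
  next
    case False
    then have "?t a < ?t b" "{a, b} \<noteq> {j, Suc j}"
      using Cons.prems(2) by (auto simp: transpose_Suc doubleton_eq_iff)
    then show ?thesis using eq Cons by simp
  qed
qed simp

lemma nonrep_iff_distinct: "nonrep w \<longleftrightarrow> distinct (crs w)"
proof (induction w)
  case (Cons j w)
  let ?t = "transpose j (Suc j)"
  have "distinct (map (image ?t) (crs w)) \<longleftrightarrow> distinct (crs w)"
    by (rule distinct_map_image) (simp add: bij_is_inj)
  moreover have "{j, Suc j} \<in> image ?t ` set (crs w) \<longleftrightarrow> {j, Suc j} \<in> set (crs w)"
    by (simp add: image_transpose_pair insert_commute)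
  moreover have "nonrep w \<Longrightarrow> {j, Suc j} \<in> set (crs w) \<longleftrightarrow> \<not> pend w j < pend w (Suc j)"
    using crs_set[of w j "Suc j"] inj_pend[of w j "Suc j"] by (auto simp del: inj_pend)
  ultimately show ?case using Cons.IH by (auto simp: crs.simps)
qed simp

text \<open>An inversion of the first factor must not be undone by the second.\<close>

lemma nonrep_append:
  "nonrep (u @ v) \<longleftrightarrow> nonrep u \<and> nonrep v \<and>
     (\<forall>a b. a < b \<longrightarrow> pend u b < pend u a \<longrightarrow> pend (u @ v) b < pend (u @ v) a)"
proof -
  let ?p = "pinv (pend u)"
  have injp: "inj ?p" using bij_pend[of u] by (simp add: bij_betw_inv_into bij_is_inj)
  have d: "distinct (map (image ?p) (crs v)) \<longleftrightarrow> distinct (crs v)"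
    using injp by (rule distinct_map_image)
  have disj: "set (crs u) \<inter> image ?p ` set (crs v) = {} \<longleftrightarrow>
     (\<forall>a b. a < b \<longrightarrow> pend u b < pend u a \<longrightarrow> pend (u @ v) b < pend (u @ v) a)"
    if u: "nonrep u" and v: "nonrep v"
  proof -
    have *: "{a, b} \<in> image ?p ` set (crs v) \<longleftrightarrow> {pend u a, pend u b} \<in> set (crs v)" for a b
    proof -
      have "{a, b} \<in> image ?p ` F \<longleftrightarrow> {pend u a, pend u b} \<in> F" for F
      proof
        assume "{a, b} \<in> image ?p ` F"
        then obtain S where S: "S \<in> F" "{a, b} = ?p ` S" by auto
        have "{pend u a, pend u b} = pend u ` {a, b}" by simp
        also have "\<dots> = S" unfolding S(2) by (simp add: image_image)
        finally show "{pend u a, pend u b} \<in> F" using S(1) by simp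
      next
        assume "{pend u a, pend u b} \<in> F"
        then have "?p ` {pend u a, pend u b} \<in> image ?p ` F" by (rule imageI)
        then show "{a, b} \<in> image ?p ` F" by simp
      qed
      then show ?thesis .
    qed
    have **: "{a, b} \<in> image ?p ` set (crs v) \<longleftrightarrow> pend (u @ v) a < pend (u @ v) b" if "pend u b < pend u a" for a b
      using crs_set[OF v that] * by (simp add: pend_append insert_commute)
    show ?thesis
    proof
      assume e: "set (crs u) \<inter> image ?p ` set (crs v) = {}"
      show "\<forall>a b. a < b \<longrightarrow> pend u b < pend u a \<longrightarrow> pend (u @ v) b < pend (u @ v) a"
      proof (intro allI impI)
        fix a b :: nat assume ab: "a < b" "pend u b < pend u a"
        then have "{a, b} \<in> set (crs u)" using crs_set[OF u] by simp
        then have "{a, b} \<notin> image ?p ` set (crs v)" using e by (metis IntI emptyE)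
        then have "\<not> pend (u @ v) a < pend (u @ v) b" using **[OF ab(2)] by simp
        then show "pend (u @ v) b < pend (u @ v) a"
          using ab inj_pend[of "u @ v" a b] by (metis linorder_neqE_nat less_irrefl)
      qed
    next
      assume h: "\<forall>a b. a < b \<longrightarrow> pend u b < pend u a \<longrightarrow> pend (u @ v) b < pend (u @ v) a"
      show "set (crs u) \<inter> image ?p ` set (crs v) = {}"
      proof (rule ccontr)
        assume "set (crs u) \<inter> image ?p ` set (crs v) \<noteq> {}"
        then obtain S where S: "S \<in> set (crs u)" "S \<in> image ?p ` set (crs v)" by blast
        obtain a b where ab: "a < b" "S = {a, b}" using crs_pairs S(1) by blast
        then have c: "pend u b < pend u a" using crs_set[OF u ab(1)] S by simp
        then have "pend (u @ v) a < pend (u @ v) b" using **[OF c] S ab by simp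
        then show False using h ab(1) c less_asym by blast
      qed
    qed
  qed
  show ?thesis
    using d disj by (simp only: nonrep_iff_distinct crs_append distinct_append set_map) blast
qed

lemma nonrep_appendD: "nonrep (u @ v) \<Longrightarrow> nonrep u" "nonrep (u @ v) \<Longrightarrow> nonrep v"
  by (auto simp: nonrep_append)

lemma nonrep_snoc: "nonrep (u @ [i]) \<longleftrightarrow> nonrep u \<and> pinv (pend u) i < pinv (pend u) (Suc i)"
proof -
  have "(\<forall>a b. a < b \<longrightarrow> pend u b < pend u a \<longrightarrow> pend (u @ [i]) b < pend (u @ [i]) a)
     \<longleftrightarrow> pinv (pend u) i < pinv (pend u) (Suc i)" (is "?L \<longleftrightarrow> ?R")
  proof
    assume ?L
    show ?R
    proof (rule ccontr)
      assume "\<not> ?R"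
      moreover have "pinv (pend u) i \<noteq> pinv (pend u) (Suc i)" by (metis inv_pend(2) n_not_Suc_n)
      ultimately have "pinv (pend u) (Suc i) < pinv (pend u) i" by linarith
      with \<open>?L\<close> show False by (fastforce simp: pend_append transpose_Suc)
    qed
  next
    assume ?R
    show ?L
    proof (intro allI impI)
      fix a b assume ab: "a < b" "pend u b < pend u a"
      have "\<not> (pend u b = i \<and> pend u a = Suc i)" using \<open>?R\<close> ab by (metis inv_pend(1) less_asym)
      then show "pend (u @ [i]) b < pend (u @ [i]) a"
        using ab by (auto simp: pend_append transpose_Suc)
    qed
  qed
  then show ?thesis by (simp only: nonrep_append) simp
qed

subsection \<open>Words of permutations\<close>

lemma ascending_permutation_id:
  assumes "s permutes {1..n}" "\<And>i. i \<in> {1..<n} \<Longrightarrow> s i < s (Suc i)"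
  shows "s = id"
proof (rule permutes_natset_ge[OF assms(1)])
  have "k \<le> s k" if "1 \<le> k" "k \<le> n" for k
    using that
  proof (induction k rule: dec_induct)
    case base
    then show ?case using permutes_in_image[OF assms(1), of 1] by auto
  next
    case (step k)
    then show ?case using assms(2)[of k] by auto
  qed
  then show "\<forall>i\<in>{1..n}. i \<le> s i" by auto
qed

text \<open>Exchanging the two values at a descent lowers the sum of the numbers \<open>(n - k) *
  s k\<close>, and a permutation without descents is the identity.\<close>

lemma ex_nonrep_word:
  assumes "s permutes {1..n}"
  shows "\<exists>w. set w \<subseteq> {1..<n} \<and> nonrep w \<and> pend w = s"
  using assms
proof (induction "\<Sum>k\<in>{1..n}. (n - k) * s k" arbitrary: s rule: less_induct)
  case less
  show ?case
  proof (cases "s = id")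
    case True then show ?thesis by (intro exI[of _ "[]"]) auto
  next
    case False
    then obtain i where i: "i \<in> {1..<n}" "\<not> s i < s (Suc i)"
      using ascending_permutation_id[OF less.prems] by blast
    moreover have "s i \<noteq> s (Suc i)" using less.prems by (metis n_not_Suc_n permutes_inj injD)
    ultimately have desc: "s (Suc i) < s i" by simp
    define s' where "s' = s \<circ> transpose i (Suc i)"
    have s': "s' permutes {1..n}"
      unfolding s'_def using less.prems i by (intro permutes_compose permutes_swap_id) auto
    have split: "(\<Sum>k\<in>{1..n}. f k) = f i + (f (Suc i) + (\<Sum>k\<in>{1..n} - {i} - {Suc i}. f k))" for f :: "nat \<Rightarrow> nat"
      using i by (subst sum.remove[of _ i], simp, simp, subst sum.remove[of _ "Suc i"]) auto
    have rest: "(\<Sum>k\<in>{1..n} - {i} - {Suc i}. (n - k) * s' k) = (\<Sum>k\<in>{1..n} - {i} - {Suc i}. (n - k) * s k)"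
      by (rule sum.cong) (auto simp: s'_def transpose_Suc)
    obtain d where d: "n - i = Suc d" "n - Suc i = d" using i by (metis Suc_diff_Suc atLeastLessThan_iff)
    have "(n - i) * s (Suc i) + (n - Suc i) * s i < (n - i) * s i + (n - Suc i) * s (Suc i)"
      using d desc by simp
    then have "(\<Sum>k\<in>{1..n}. (n - k) * s' k) < (\<Sum>k\<in>{1..n}. (n - k) * s k)"
      unfolding split rest by (simp add: s'_def transpose_Suc)
    from less.hyps[OF this s'] obtain w where w: "set w \<subseteq> {1..<n}" "nonrep w" "pend w = s'" by blast
    have "pend (i # w) = s" using w by (auto simp: s'_def fun_eq_iff)
    moreover have "nonrep (i # w)" using w desc by (simp add: s'_def transpose_Suc)
    ultimately show ?thesis using w i by (intro exI[of _ "i # w"]) auto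
  qed
qed

text \<open>Two first letters \<open>i\<close> and \<open>j\<close> of non-repeating words for the same permutation are both
  first letters of words that differ by one relation, so the induction hypothesis applies on both
  sides.\<close>

lemma nonrep_unique:
  assumes "nonrep u" "nonrep v" "pend u = pend v" "set u \<subseteq> {1..<n}" "set v \<subseteq> {1..<n}"
  shows "u \<approx> v"
  using assms
proof (induction "length u" arbitrary: u v rule: less_induct)
  case less
  have no: "pend (j # x) \<noteq> id" if "nonrep (j # x)" for j x
  proof
    assume "pend (j # x) = id"
    then have "pend (j # x) j = j" "pend (j # x) (Suc j) = Suc j" by (auto simp del: pend_Cons)
    then show False using that by simp
  qed
  show ?case
  proof (cases u)
    case Nil
    then have "pend v = id" using less.prems(3) by (metis pend_Nil)
    then have "v = []" using no less.prems(2) by (metis list.exhaust)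
    then show ?thesis using Nil by simp
  next
    case (Cons i u')
    then have "pend v \<noteq> id" using no[of i u'] less.prems(1,3) by metis
    then obtain j v' where v: "v = j # v'" using pend_Nil by (cases v) blast+
    note u = Cons
    define s where "s = pend u"
    let ?t = "\<lambda>i. transpose i (Suc i)"
    have s: "s permutes {1..n}" unfolding s_def by (rule pend_permutes[OF less.prems(4)])
    have ij: "i \<in> {1..<n}" "j \<in> {1..<n}" using less.prems(4,5) u v by simp_all
    have s': "s = pend u' \<circ> ?t i" "s = pend v' \<circ> ?t j"
      using less.prems(3) unfolding s_def u v by (simp_all only: pend_Cons)
    have desc: "s (Suc i) < s i" using less.prems(1) u unfolding s'(1) by simp
    have desc': "s (Suc j) < s j" using less.prems(2) v unfolding s'(2) by simp
    have fin: "u \<approx> v"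
      if xy: "nonrep (i # x)" "nonrep (j # y)" "pend (i # x) = s" "pend (j # y) = s" "i # x \<approx> j # y"
        "set x \<subseteq> {1..<n}" "set y \<subseteq> {1..<n}" for x y
    proof -
      have "pend u' = pend x" using xy(3) s'(1) unfolding pend_Cons by (metis comp_assoc comp_id transpose_comp_involutory)
      then have 1: "u' \<approx> x" using less.hyps[of u' x] less.prems u xy by auto
      have "length y = length u'" using peq_length[OF 1] peq_length[OF xy(5)] by auto
      moreover have "pend y = pend v'" using xy(4) s'(2) unfolding pend_Cons by (metis comp_assoc comp_id transpose_comp_involutory)
      ultimately have 2: "y \<approx> v'" using less.hyps[of y v'] less.prems u v xy by auto
      show ?thesis unfolding u v using 1 2 xy(5) peq_Cons peq_trans by meson
    qed
    show ?thesis
    proof (cases i j rule: index_cases)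
      case 1
      then have "pend u' = pend v'" using s' by (metis comp_assoc comp_id transpose_comp_involutory)
      then show ?thesis using less.hyps[of u' v'] less.prems u v 1 by auto
    next
      case 2
      have "(s \<circ> ?t i \<circ> ?t j) permutes {1..n}" using s ij by (intro permutes_compose permutes_swap_id) auto
      then obtain w where w: "set w \<subseteq> {1..<n}" "nonrep w" "pend w = s \<circ> ?t i \<circ> ?t j" using ex_nonrep_word by blast
      have "nonrep (i # j # w)" "nonrep (j # i # w)" "pend (i # j # w) = s" "pend (j # i # w) = s"
        using w(2,3) desc desc' 2 by (auto simp: transpose_Suc far_def fun_eq_iff)
      moreover have "i # j # w \<approx> j # i # w" using peq_far[OF 2] by auto
      ultimately show ?thesis using fin[of "j # w" "i # w"] w(1) ij by simp
    next
      case 3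
      have "(s \<circ> ?t i \<circ> ?t j \<circ> ?t i) permutes {1..n}" using s ij by (intro permutes_compose permutes_swap_id) auto
      then obtain w where w: "set w \<subseteq> {1..<n}" "nonrep w" "pend w = s \<circ> ?t i \<circ> ?t j \<circ> ?t i" using ex_nonrep_word by blast
      have "nonrep (i # j # i # w)" "nonrep (j # i # j # w)" "pend (i # j # i # w) = s" "pend (j # i # j # w) = s"
        using w(2,3) desc desc' 3 by (auto simp: transpose_Suc near_def fun_eq_iff)
      moreover have "i # j # i # w \<approx> j # i # j # w" using peq_near[OF 3] by auto
      ultimately show ?thesis using fin[of "j # i # w" "i # j # w"] w(1) ij by simp
    qed
  qed
qed

section \<open>The maximal non-repeating right divisor\<close>

definition rdiv :: "nat list \<Rightarrow> nat list \<Rightarrow> bool" where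
  "rdiv d x \<longleftrightarrow> (\<exists>c. x \<approx> c @ d)"

lemma rdiv_refl [simp]: "rdiv d d"
  unfolding rdiv_def by (intro exI[of _ "[]"]) simp

lemma rdiv_Nil [simp]: "rdiv [] x"
  unfolding rdiv_def by (intro exI[of _ x]) simp

lemma rdiv_append [simp]: "rdiv d (c @ d)"
  unfolding rdiv_def by blast

lemma rdiv_trans: "rdiv d e \<Longrightarrow> rdiv e x \<Longrightarrow> rdiv d x"
  unfolding rdiv_def using peq_trans[OF _ peq_append[OF peq_refl]] by (metis append_assoc)

lemma rdiv_peq: "x \<approx> y \<Longrightarrow> rdiv d x \<Longrightarrow> rdiv d y"
  unfolding rdiv_def using peq_sym peq_trans by blast

lemma rdiv_peq_left: "d \<approx> e \<Longrightarrow> rdiv d x \<Longrightarrow> rdiv e x"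
  unfolding rdiv_def using peq_append peq_refl peq_trans by metis

lemma rdiv_length: "rdiv d x \<Longrightarrow> length d \<le> length x"
  unfolding rdiv_def using peq_length by force

lemma rdiv_antisym: "rdiv d e \<Longrightarrow> length e \<le> length d \<Longrightarrow> e \<approx> d"
  unfolding rdiv_def using peq_length by force

lemma rdiv_append_right [simp]: "rdiv (d @ x) (y @ x) \<longleftrightarrow> rdiv d y"
proof -
  have "y @ x \<approx> c @ d @ x \<longleftrightarrow> y \<approx> c @ d" for c
    using peq_append_right_iff[of y x "c @ d"] by simp
  then show ?thesis by (simp add: rdiv_def)
qed

lemma rdiv_glcm: "rdiv (i # d) x \<Longrightarrow> rdiv (j # d) x \<Longrightarrow> rdiv (glcm i j @ d) x"
proof -
  assume "rdiv (i # d) x" "rdiv (j # d) x"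
  then obtain a b where a: "x \<approx> a @ i # d" and b: "x \<approx> b @ j # d" by (auto simp: rdiv_def)
  have "(a @ [i]) @ d \<approx> (b @ [j]) @ d" using peq_trans[OF peq_sym[OF a] b] by simp
  then have "a @ [i] \<approx> b @ [j]" by (simp only: peq_append_right_iff)
  then obtain c where "a @ [i] \<approx> c @ glcm i j" using common_left_multiple by blast
  then have "(a @ [i]) @ d \<approx> (c @ glcm i j) @ d" by (simp only: peq_append_right_iff)
  then have "x \<approx> (c @ glcm i j) @ d" using peq_trans[OF a] by simp
  then show ?thesis by (auto simp: rdiv_def)
qed

lemma nonrep_glcm: "nonrep (i # d) \<Longrightarrow> nonrep (j # d) \<Longrightarrow> nonrep (glcm i j @ d)"
  by (cases i j rule: index_cases) (auto simp: glcm_def far_def near_def transpose_Suc)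

definition maxdiv :: "nat list \<Rightarrow> nat list \<Rightarrow> bool" where
  "maxdiv x d \<longleftrightarrow> nonrep d \<and> rdiv d x \<and> (\<forall>c. nonrep c \<longrightarrow> rdiv c x \<longrightarrow> rdiv c d)"

text \<open>A divisor that cannot be enlarged by a letter is unique up to equivalence, by
  confluence, and therefore a multiple of all others: it satisfies \<open>maxdiv\<close>.\<close>

definition topdiv :: "nat list \<Rightarrow> nat list \<Rightarrow> bool" where
  "topdiv x d \<longleftrightarrow> nonrep d \<and> rdiv d x \<and> (\<forall>i. nonrep (i # d) \<longrightarrow> \<not> rdiv (i # d) x)"

lemma ex_topdiv_above: "nonrep e \<Longrightarrow> rdiv e x \<Longrightarrow> \<exists>m. topdiv x m \<and> rdiv e m"
proof (induction "length x - length e" arbitrary: e rule: less_induct)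
  case less
  show ?case
  proof (cases "topdiv x e")
    case True then show ?thesis by auto
  next
    case False
    then obtain i where i: "nonrep (i # e)" "rdiv (i # e) x" using less.prems by (auto simp: topdiv_def)
    have "length x - length (i # e) < length x - length e" using rdiv_length[OF i(2)] by simp
    from less.hyps[OF this i] obtain m where "topdiv x m" "rdiv (i # e) m" by blast
    then show ?thesis using rdiv_trans[of e "i # e" m] rdiv_append[of e "[i]"] by auto
  qed
qed

lemma rdiv_step:
  assumes "rdiv e m" "nonrep m" "\<not> m \<approx> e"
  obtains i where "nonrep (i # e)" "rdiv (i # e) m"
proof -
  obtain c where c: "m \<approx> c @ e" using assms(1) by (auto simp: rdiv_def)
  then obtain i c' where c': "c = c' @ [i]" using assms(3) by (cases c rule: rev_cases) auto
  have "nonrep (c' @ i # e)" using nonrep_peq[OF c] assms(2) c' by simp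
  then have "nonrep (i # e)" by (rule nonrep_appendD)
  moreover have "rdiv (i # e) m" using c c' by (auto simp: rdiv_def)
  ultimately show ?thesis using that by blast
qed

text \<open>This is Newman's lemma: by \<open>rdiv_glcm\<close>, adding letters in front of a divisor is locally
  confluent.\<close>

lemma topdiv_unique:
  "nonrep e \<Longrightarrow> rdiv e x \<Longrightarrow> topdiv x m \<Longrightarrow> topdiv x m' \<Longrightarrow> rdiv e m \<Longrightarrow> rdiv e m' \<Longrightarrow> m \<approx> m'"
proof (induction "length x - length e" arbitrary: e m m' rule: less_induct)
  case less
  have top: "k \<approx> e" if "topdiv x e" "topdiv x k" "rdiv e k" for k
  proof (rule ccontr)
    have ek: "rdiv e k" using that by simp
    assume "\<not> k \<approx> e"
    moreover have "nonrep k" using that by (simp add: topdiv_def)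
    ultimately obtain i where "nonrep (i # e)" "rdiv (i # e) k" using rdiv_step[OF ek] by blast
    then show False using that rdiv_trans by (auto simp: topdiv_def)
  qed
  have top': "topdiv x e" if "topdiv x k" "k \<approx> e" for k
    using that less.prems rdiv_peq_left[of "_ # e" "_ # k"] nonrep_peq[of "_ # k" "_ # e"] peq_sym
    unfolding topdiv_def by (metis peq_Cons_iff)
  show ?case
  proof (cases "topdiv x e")
    case True
    then have "m \<approx> e" "m' \<approx> e" using top less.prems by auto
    then show ?thesis using peq_sym peq_trans by blast
  next
    case False
    have ne: "\<not> m \<approx> e" "\<not> m' \<approx> e" using top' False less.prems by blast+
    obtain i where i: "nonrep (i # e)" "rdiv (i # e) m"
      using rdiv_step[OF less.prems(5) _ ne(1)] less.prems by (auto simp: topdiv_def)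
    obtain j where j: "nonrep (j # e)" "rdiv (j # e) m'"
      using rdiv_step[OF less.prems(6) _ ne(2)] less.prems by (auto simp: topdiv_def)
    have ix: "rdiv (i # e) x" and jx: "rdiv (j # e) x"
      using i j less.prems rdiv_trans by (auto simp: topdiv_def)
    obtain k where k: "topdiv x k" "rdiv (glcm i j @ e) k"
      using ex_topdiv_above[OF nonrep_glcm[OF i(1) j(1)] rdiv_glcm[OF ix jx]] by blast
    have "rdiv (i # e) (glcm i j @ e)" using glcm_last[of i j] by auto
    then have ik: "rdiv (i # e) k" using k rdiv_trans by blast
    have "rdiv (j # e) (glcm j i @ e)" using glcm_last[of j i] by auto
    then have "rdiv (j # e) (glcm i j @ e)" using rdiv_peq peq_append[OF glcm_sym peq_refl] by blast
    then have jk: "rdiv (j # e) k" using k rdiv_trans by blast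
    have "length x - length (i # e) < length x - length e" using rdiv_length[OF ix] by simp
    from less.hyps[OF this i(1) ix less.prems(3) k(1) i(2) ik] have "m \<approx> k" .
    moreover have "length x - length (j # e) < length x - length e" using rdiv_length[OF jx] by simp
    from less.hyps[OF this j(1) jx less.prems(4) k(1) j(2) jk] have "m' \<approx> k" .
    ultimately show ?thesis using peq_sym peq_trans by blast
  qed
qed

lemma maxdiv_if_topdiv: "topdiv x d \<Longrightarrow> maxdiv x d"
  unfolding maxdiv_def
proof (intro conjI allI impI)
  fix c assume d: "topdiv x d" and c: "nonrep c" "rdiv c x"
  obtain m where m: "topdiv x m" "rdiv c m" using ex_topdiv_above[OF c] by blast
  have "m \<approx> d" using topdiv_unique[of "[]" x m d] m d by simp
  then show "rdiv c d" using m rdiv_peq by blast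
qed (auto simp: topdiv_def)

lemma ex_maxdiv: "\<exists>d. maxdiv x d"
  using ex_topdiv_above[of "[]" x] maxdiv_if_topdiv by auto

lemma maxdiv_unique: "maxdiv x d \<Longrightarrow> maxdiv x e \<Longrightarrow> d \<approx> e"
  unfolding maxdiv_def using rdiv_antisym rdiv_length by blast

lemma maxdiv_peq: "x \<approx> y \<Longrightarrow> maxdiv x d \<Longrightarrow> maxdiv y d"
  unfolding maxdiv_def using rdiv_peq peq_sym by blast

lemma maxdiv_peq_right: "d \<approx> e \<Longrightarrow> maxdiv x d \<Longrightarrow> maxdiv x e"
  unfolding maxdiv_def using rdiv_peq rdiv_peq_left nonrep_peq by blast

text \<open>A divisor of the product that properly extends \<open>t\<close> by a letter
  \<open>i\<close> would make \<open>i\<close> a divisor of the maximal divisor \<open>s\<close>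
  of the first factor, so that the last two letters alone decide maximality.\<close>

lemma maxdiv_append:
  assumes "maxdiv y s" "nonrep t" "\<And>i. rdiv [i] s \<Longrightarrow> \<not> nonrep (i # t)"
  shows "maxdiv (y @ t) t"
proof (rule maxdiv_if_topdiv)
  show "topdiv (y @ t) t"
    unfolding topdiv_def
  proof (intro conjI allI impI notI)
    fix i assume i: "nonrep (i # t)" "rdiv (i # t) (y @ t)"
    then have "rdiv [i] y" using rdiv_append_right[of "[i]" t y] by simp
    then have "rdiv [i] s" using assms(1) by (auto simp: maxdiv_def)
    then show False using assms(3) i by blast
  qed (use assms in auto)
qed

lemma maxdiv_append_conv:
  assumes "maxdiv (y @ t) t" "rdiv [i] s" "rdiv s y"
  shows "\<not> nonrep (i # t)"
proof
  assume "nonrep (i # t)"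
  moreover have "rdiv (i # t) (y @ t)" using assms(2,3) rdiv_trans rdiv_append_right[of "[i]" t y] by simp
  ultimately have "rdiv (i # t) t" using assms(1) by (auto simp: maxdiv_def)
  then show False using rdiv_length by fastforce
qed

text \<open>This makes normalization a matter of neighbouring letters: for the last letter of a
  product, the first factor only matters through its maximal divisor.\<close>

lemma maxdiv_replace:
  assumes x: "maxdiv x s" and m: "maxdiv (s @ t) m" and t: "nonrep t"
  shows "maxdiv (x @ t) m"
proof (rule maxdiv_if_topdiv)
  obtain m1 where m1: "m \<approx> m1 @ t" using m t by (auto simp: maxdiv_def rdiv_def)
  have sx: "rdiv (s @ t) (x @ t)" using x by (simp add: maxdiv_def)
  show "topdiv (x @ t) m"
    unfolding topdiv_def
  proof (intro conjI allI impI notI)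
    show "nonrep m" "rdiv m (x @ t)" using m sx rdiv_trans by (auto simp: maxdiv_def)
    fix i assume i: "nonrep (i # m)" "rdiv (i # m) (x @ t)"
    have e: "i # m \<approx> (i # m1) @ t" using m1 peq_Cons by simp
    have "rdiv ((i # m1) @ t) (x @ t)" using rdiv_peq_left[OF e i(2)] .
    then have 1: "rdiv (i # m1) x" by (simp only: rdiv_append_right)
    have "nonrep ((i # m1) @ t)" using i nonrep_peq[OF e] by simp
    then have "nonrep (i # m1)" by (rule nonrep_appendD)
    then have "rdiv (i # m1) s" using x 1 by (auto simp: maxdiv_def)
    then have "rdiv ((i # m1) @ t) (s @ t)" by (simp only: rdiv_append_right)
    then have "rdiv (i # m) (s @ t)" using rdiv_peq_left[OF peq_sym[OF e]] by blast
    then have "rdiv (i # m) m" using m i by (auto simp: maxdiv_def)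
    then show False using rdiv_length by fastforce
  qed
qed

section \<open>The half twist\<close>

definition pw :: "nat \<Rightarrow> (nat \<Rightarrow> nat) \<Rightarrow> nat list" where
  "pw n s = (SOME w. set w \<subseteq> {1..<n} \<and> nonrep w \<and> pend w = s)"

lemma pw:
  assumes "s permutes {1..n}"
  shows "set (pw n s) \<subseteq> {1..<n}" "nonrep (pw n s)" "pend (pw n s) = s"
  using someI_ex[OF ex_nonrep_word[OF assms]] unfolding pw_def by blast+

lemma pw_peq:
  assumes "set w \<subseteq> {1..<n}" "nonrep w" "pend w = s"
  shows "pw n s \<approx> w"
proof -
  have "s permutes {1..n}" using assms pend_permutes by blast
  note p = pw[OF this]
  show ?thesis using nonrep_unique[OF p(2) assms(2) _ p(1) assms(1)] p(3) assms(3) by simp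
qed

lemma half_twist_involution [simp]: "half_twist n (half_twist n i) = i"
  by (auto simp: half_twist_def)

lemma half_twist_comp [simp]: "half_twist n \<circ> half_twist n = id"
  by (simp add: fun_eq_iff)

lemma half_twist_permutes: "half_twist n permutes {1..n}"
proof (rule bij_imp_permutes)
  show "bij_betw (half_twist n) {1..n} {1..n}"
    by (rule bij_betw_byWitness[where f' = "half_twist n"]) (auto simp: half_twist_def)
qed (auto simp: half_twist_def)

lemma inversion_range:
  fixes s :: "nat \<Rightarrow> nat"
  assumes "s permutes {1..n}" "a < b" "s b < s a"
  shows "a \<in> {1..n} \<and> b \<in> {1..n}"
proof -
  have *: "x \<in> {1..n} \<and> s x \<in> {1..n} \<or> x \<notin> {1..n} \<and> s x = x" for x
    using permutes_in_image[OF assms(1), of x] permutes_not_in[OF assms(1), of x] by blast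
  show ?thesis using *[of a] *[of b] assms(2,3) unfolding atLeastAtMost_iff by (elim disjE) auto
qed

definition dl :: "nat \<Rightarrow> nat list" where
  "dl n = pw n (half_twist n)"

lemmas dl = pw[OF half_twist_permutes, folded dl_def]

text \<open>Any factorization of the permutation of \<open>\<Delta>\<close> into two factors lifts
  to braids, as every pair of strands crosses exactly once in \<open>\<Delta>\<close>.\<close>

lemma dl_peq:
  assumes "set u \<subseteq> {1..<n}" "set v \<subseteq> {1..<n}" "nonrep u" "nonrep v" "pend v \<circ> pend u = half_twist n"
  shows "dl n \<approx> u @ v"
  unfolding dl_def
proof (rule pw_peq)
  show "nonrep (u @ v)"
    unfolding nonrep_append
  proof (intro conjI allI impI)
    fix a b assume "a < b" "pend u b < pend u a"
    then have "a \<in> {1..n}" "b \<in> {1..n}" using inversion_range[OF pend_permutes[OF assms(1)]] by blast+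
    then show "pend (u @ v) b < pend (u @ v) a"
      using \<open>a < b\<close> unfolding pend_append assms(5) by (auto simp: half_twist_def)
  qed (use assms(3,4) in auto)
  show "set (u @ v) \<subseteq> {1..<n}" using assms(1,2) by simp
  show "pend (u @ v) = half_twist n" unfolding pend_append by (rule assms(5))
qed

text \<open>The braid \<open>\<sigma>\<^sub>i\<^sup>-\<^sup>1 \<Delta>\<close>.\<close>

definition twist_rest :: "nat \<Rightarrow> nat \<Rightarrow> nat list" where
  "twist_rest n i = pw n (half_twist n \<circ> transpose i (Suc i))"

lemma twist_rest:
  assumes "i \<in> {1..<n}"
  shows "set (twist_rest n i) \<subseteq> {1..<n}" "dl n \<approx> i # twist_rest n i" "dl n \<approx> twist_rest n i @ [n - i]"
proof -
  have "(half_twist n \<circ> transpose i (Suc i)) permutes {1..n}"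
    using assms by (intro permutes_compose[OF permutes_swap_id half_twist_permutes]) auto
  note p = pw[OF this, folded twist_rest_def]
  show "set (twist_rest n i) \<subseteq> {1..<n}" by (rule p)
  show "dl n \<approx> i # twist_rest n i"
    using dl_peq[of "[i]" n "twist_rest n i"] assms p by (simp add: fun_eq_iff)
  have "transpose (n - i) (Suc (n - i)) (half_twist n (transpose i (Suc i) k)) = half_twist n k" for k
    using assms by (auto simp: half_twist_def transpose_def)
  then show "dl n \<approx> twist_rest n i @ [n - i]"
    using dl_peq[of "twist_rest n i" n "[n - i]"] assms p by (auto simp: fun_eq_iff)
qed

definition flip :: "nat \<Rightarrow> nat list \<Rightarrow> nat list" where
  "flip n w = map (\<lambda>k. n - k) w"

lemma flip_append [simp]: "flip n (u @ v) = flip n u @ flip n v" "flip n [] = []"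
  "flip n (i # v) = (n - i) # flip n v"
  by (simp_all add: flip_def)

lemma set_flip: "set w \<subseteq> {1..<n} \<Longrightarrow> set (flip n w) \<subseteq> {1..<n}"
proof
  fix x assume "set w \<subseteq> {1..<n}" "x \<in> set (flip n w)"
  then obtain k where "k \<in> {1..<n}" "x = n - k" unfolding flip_def by auto
  then show "x \<in> {1..<n}" by auto
qed

lemma flip_peq: "u \<approx> v \<Longrightarrow> set u \<subseteq> {1..<n} \<Longrightarrow> flip n u \<approx> flip n v"
  unfolding flip_def
proof (rule peq_map)
  fix i j assume "set u \<subseteq> {1..<n}" "i \<in> set u" "j \<in> set u"
  then have ij: "i < n" "j < n" by auto
  show "far i j \<Longrightarrow> far (n - i) (n - j)" using ij unfolding far_def by arith
  show "near i j \<Longrightarrow> near (n - i) (n - j)" using ij unfolding near_def by arith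
qed

text \<open>Conjugation by \<open>\<Delta>\<close> is the automorphism \<open>\<sigma>\<^sub>i
  \<mapsto> \<sigma>\<^sub>n\<^sub>-\<^sub>i\<close>. Both ways of completing
  \<open>\<sigma>\<^sub>i\<close> to \<open>\<Delta>\<close>, on the left and on the right, are
  compared.\<close>

lemma dl_flip: "set w \<subseteq> {1..<n} \<Longrightarrow> w @ dl n \<approx> dl n @ flip n w"
proof (induction w)
  case (Cons i w)
  then have i: "i \<in> {1..<n}" by auto
  have "i # dl n \<approx> i # twist_rest n i @ [n - i]" using twist_rest(3)[OF i] by simp
  also have "\<dots> \<approx> dl n @ [n - i]"
    using peq_append[OF peq_sym[OF twist_rest(2)[OF i]], of "[n - i]" "[n - i]"] by simp
  finally have 1: "(i # dl n) @ flip n w \<approx> (dl n @ [n - i]) @ flip n w" by (rule peq_append) simp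
  have "i # w @ dl n \<approx> i # dl n @ flip n w" using Cons by simp
  from peq_trans[OF this, of "dl n @ (n - i) # flip n w"] 1 show ?case by simp
qed simp

lemma flip_dl: "flip n (dl n) \<approx> dl n"
  using dl_flip[OF dl(1)] peq_sym by simp

definition dlp :: "nat \<Rightarrow> nat \<Rightarrow> nat list" where
  "dlp n m = concat (replicate m (dl n))"

lemma dlp_simps [simp]: "dlp n 0 = []" "dlp n (Suc m) = dl n @ dlp n m"
  by (simp_all add: dlp_def)

lemma dlp_add: "dlp n (a + b) = dlp n a @ dlp n b"
  by (simp add: dlp_def replicate_add)

lemma dlp_Suc': "dlp n (Suc m) = dlp n m @ dl n"
  using dlp_add[of n m 1] by simp

lemma set_dlp: "set (dlp n m) \<subseteq> {1..<n}"
  using dl(1)[of n] by (induction m) auto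

lemma flip_dlp: "flip n (dlp n m) \<approx> dlp n m"
  by (induction m) (auto intro: peq_append flip_dl)

section \<open>Braid words and positive words\<close>

lemma artin_words_simps [simp]:
  "[] \<in> artin_words n" "(e, i) # w \<in> artin_words n \<longleftrightarrow> 1 \<le> i \<and> i < n \<and> w \<in> artin_words n"
  "u @ v \<in> artin_words n \<longleftrightarrow> u \<in> artin_words n \<and> v \<in> artin_words n"
  by (auto simp: artin_words_def)

lemma braid_equiv_words: "braid_equiv n v w \<Longrightarrow> v \<in> artin_words n \<and> w \<in> artin_words n"
  by (induction rule: braid_equiv.induct) auto

lemma braid_equiv_context:
  assumes "braid_equiv n v w" "x \<in> artin_words n" "y \<in> artin_words n"
  shows "braid_equiv n (x @ v @ y) (x @ w @ y)"
  using assms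
proof (induction rule: braid_equiv.induct)
  case (cancel u v i e)
  then show ?case using braid_equiv.cancel[of "x @ u" n "v @ y" i e] by simp
next
  case (far u v i j)
  then show ?case using braid_equiv.far[of "x @ u" n "v @ y" i j] by simp
next
  case (near u v i)
  then show ?case using braid_equiv.near[of "x @ u" n "v @ y" i] by simp
qed (auto intro: braid_equiv.refl braid_equiv.sym braid_equiv.trans)

lemma braid_equiv_append:
  assumes "braid_equiv n v v'" "braid_equiv n w w'"
  shows "braid_equiv n (v @ w) (v' @ w')"
proof -
  have "braid_equiv n (v @ w) (v' @ w)"
    using braid_equiv_context[OF assms(1), of "[]" w] braid_equiv_words[OF assms(2)] by simp
  moreover have "braid_equiv n (v' @ w) (v' @ w')"
    using braid_equiv_context[OF assms(2), of v' "[]"] braid_equiv_words[OF assms(1)] by simp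
  ultimately show ?thesis by (rule braid_equiv.trans)
qed

abbreviation pos :: "nat list \<Rightarrow> artin_word" where
  "pos w \<equiv> map (Pair True) w"

lemma pos_words: "pos w \<in> artin_words n \<longleftrightarrow> set w \<subseteq> {1..<n}"
  by (auto simp: artin_words_def)

lemma positive_words_eq: "positive_words n = pos ` {w. set w \<subseteq> {1..<n}}"
proof -
  have 1: "\<exists>u. w = pos u" if "w \<in> positive_words n" for w
  proof
    show "w = pos (map snd w)" using that by (auto simp: positive_words_def intro!: map_idI[symmetric])
  qed
  have 2: "pos w \<in> positive_words n \<longleftrightarrow> set w \<subseteq> {1..<n}" for w
    using pos_words[of w n] by (auto simp: positive_words_def)
  show ?thesis
  proof (rule subset_antisym; rule subsetI)
    fix w assume w: "w \<in> positive_words n"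
    then obtain u where "w = pos u" using 1 by blast
    then show "w \<in> pos ` {w. set w \<subseteq> {1..<n}}" using w 2[of u] by blast
  next
    fix w assume "w \<in> pos ` {w. set w \<subseteq> {1..<n}}"
    then show "w \<in> positive_words n" using 2 by blast
  qed
qed

lemma strand_end_pos: "strand_end (pos w) = pend w"
proof
  fix i show "strand_end (pos w) i = pend w i" by (induction w arbitrary: i) auto
qed

lemma crossings_pos: "crossings p (pos w) = map (image p) (crs w)"
  by (induction w arbitrary: p) (auto simp: image_comp comp_def)

lemma nonrepeating_words_eq: "nonrepeating_words n = pos ` {w. set w \<subseteq> {1..<n} \<and> nonrep w}"
  by (auto simp: nonrepeating_words_def positive_words_eq crossings_pos nonrep_iff_distinct)

lemma pos_equiv: "u \<approx> v \<Longrightarrow> set u \<subseteq> {1..<n} \<Longrightarrow> braid_equiv n (pos u) (pos v)"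
proof (induction rule: peq_induct)
  case refl then show ?case by (intro braid_equiv.refl) (simp add: pos_words)
next
  case (step v w)
  have v: "set v \<subseteq> {1..<n}" using peq_set[OF step.hyps(1)] step.prems by simp
  from step.hyps(2) v have "braid_equiv n (pos v) (pos w)"
  proof (induction rule: pstep.induct)
    case (far i j u v)
    have uv: "pos u \<in> artin_words n" "pos v \<in> artin_words n" using far by (auto simp: pos_words)
    consider "i + 2 \<le> j" | "j + 2 \<le> i" using far by (auto simp: far_def)
    then show ?case
    proof cases
      case 1 then show ?thesis using braid_equiv.far[OF uv, of i j] far by simp
    next
      case 2 then show ?thesis using braid_equiv.sym[OF braid_equiv.far[OF uv, of j i]] far by simp
    qed
  next
    case (near i j u v)
    have uv: "pos u \<in> artin_words n" "pos v \<in> artin_words n" using near by (auto simp: pos_words)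
    consider "j = i + 1" | "i = j + 1" using near by (auto simp: near_def)
    then show ?case
    proof cases
      case 1 then show ?thesis using braid_equiv.near[OF uv, of i] near by simp
    next
      case 2 then show ?thesis using braid_equiv.sym[OF braid_equiv.near[OF uv, of j]] near by simp
    qed
  qed
  then show ?case using step braid_equiv.trans by blast
qed

subsection \<open>The positive monoid embeds into the braid group\<close>

text \<open>The braid of \<open>w\<close> is \<open>posp n w\<close> times the inverse of the \<open>negc w\<close>-th power of \<open>\<Delta>\<close>: replace
  \<open>\<sigma>\<^sub>i\<^sup>-\<^sup>1\<close> by \<open>twist_rest n i\<close> times \<open>\<Delta>\<^sup>-\<^sup>1\<close>, and move \<open>\<Delta>\<^sup>-\<^sup>1\<close> to the end of the word.\<close>

fun posp :: "nat \<Rightarrow> artin_word \<Rightarrow> nat list" where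
  "posp n [] = []"
| "posp n ((e, i) # w) = (if e then i # posp n w else twist_rest n i @ flip n (posp n w))"

fun negc :: "artin_word \<Rightarrow> nat" where
  "negc [] = 0"
| "negc ((e, i) # w) = (if e then negc w else Suc (negc w))"

lemma negc_append [simp]: "negc (u @ v) = negc u + negc v"
  by (induction u rule: negc.induct) auto

lemma posp_words: "w \<in> artin_words n \<Longrightarrow> set (posp n w) \<subseteq> {1..<n}"
proof (induction n w rule: posp.induct)
  case (2 n e i w)
  then show ?case using twist_rest(1)[of i n] set_flip[of "posp n w" n] by auto
qed simp

text \<open>Equality of the fractions \<open>posp n w\<close> over \<open>\<Delta>\<close> to the
  power \<open>negc w\<close>, with denominators cleared.\<close>

definition same_positive :: "nat \<Rightarrow> artin_word \<Rightarrow> artin_word \<Rightarrow> bool" where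
  "same_positive n v w \<longleftrightarrow> (\<exists>a b. negc v + a = negc w + b \<and> posp n v @ dlp n a \<approx> posp n w @ dlp n b)"

lemma same_positive_trans:
  assumes "same_positive n u v" "same_positive n v w"
  shows "same_positive n u w"
proof -
  obtain a b where 1: "negc u + a = negc v + b" "posp n u @ dlp n a \<approx> posp n v @ dlp n b"
    using assms(1) by (auto simp: same_positive_def)
  obtain c d where 2: "negc v + c = negc w + d" "posp n v @ dlp n c \<approx> posp n w @ dlp n d"
    using assms(2) by (auto simp: same_positive_def)
  have "posp n u @ dlp n (a + c) \<approx> posp n v @ dlp n (b + c)"
    using peq_append[OF 1(2) peq_refl, of "dlp n c"] by (simp add: dlp_add)
  also have "\<dots> = posp n v @ dlp n (c + b)" by (simp add: add.commute)
  also have "\<dots> \<approx> posp n w @ dlp n (d + b)"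
    using peq_append[OF 2(2) peq_refl, of "dlp n b"] by (simp add: dlp_add)
  finally show ?thesis unfolding same_positive_def
    by (intro exI[of _ "a + c"] exI[of _ "d + b"]) (use 1 2 in auto)
qed

lemma same_positive_context:
  assumes "same_positive n v w" "u \<in> artin_words n" "v \<in> artin_words n" "w \<in> artin_words n"
  shows "same_positive n (u @ v) (u @ w)"
  using assms(2)
proof (induction u)
  case (Cons x u)
  obtain e i where x: "x = (e, i)" by (cases x)
  have i: "i \<in> {1..<n}" and u: "u \<in> artin_words n" using Cons.prems x by auto
  then obtain a b where ab: "negc (u @ v) + a = negc (u @ w) + b"
    "posp n (u @ v) @ dlp n a \<approx> posp n (u @ w) @ dlp n b"
    using Cons.IH by (auto simp: same_positive_def)
  have "posp n (x # u @ v) @ dlp n a \<approx> posp n (x # u @ w) @ dlp n b"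
  proof (cases e)
    case True then show ?thesis using x ab by simp
  next
    case False
    have "set (posp n (u @ v) @ dlp n a) \<subseteq> {1..<n}"
      using set_dlp[of n a] posp_words[of "u @ v" n] u assms by auto
    from flip_peq[OF ab(2) this]
    have *: "flip n (posp n (u @ v)) @ flip n (dlp n a) \<approx> flip n (posp n (u @ w)) @ flip n (dlp n b)" by simp
    have "flip n (posp n (u @ v)) @ dlp n a \<approx> flip n (posp n (u @ v)) @ flip n (dlp n a)"
      using peq_sym[OF flip_dlp] by simp
    also note *
    also have "flip n (posp n (u @ w)) @ flip n (dlp n b) \<approx> flip n (posp n (u @ w)) @ dlp n b"
      using flip_dlp by simp
    finally show ?thesis using False x by simp
  qed
  moreover have "negc (x # u @ v) + a = negc (x # u @ w) + b" using ab(1) x by auto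
  ultimately show ?case unfolding same_positive_def by auto
qed (use assms in simp)

lemma same_positive_cancel:
  assumes "v \<in> artin_words n" "i \<in> {1..<n}"
  shows "same_positive n ((e, i) # (\<not> e, i) # v) v"
proof -
  have sv: "set (posp n v) \<subseteq> {1..<n}" using posp_words assms by blast
  have "posp n ((e, i) # (\<not> e, i) # v) \<approx> dl n @ flip n (posp n v)"
  proof (cases e)
    case True
    then show ?thesis
      using peq_append[OF peq_sym[OF twist_rest(2)[OF assms(2)]], of "flip n (posp n v)"] by simp
  next
    case False
    then show ?thesis
      using peq_append[OF peq_sym[OF twist_rest(3)[OF assms(2)]], of "flip n (posp n v)"] by simp
  qed
  also have "\<dots> \<approx> posp n v @ dl n" using peq_sym[OF dl_flip[OF sv]] .
  finally show ?thesis unfolding same_positive_def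
    by (intro exI[of _ 0] exI[of _ 1]) (cases e; simp)
qed

lemma same_positive_braid_equiv: "braid_equiv n v w \<Longrightarrow> same_positive n v w"
proof (induction rule: braid_equiv.induct)
  case (refl w)
  then show ?case unfolding same_positive_def by auto
next
  case (sym v w)
  then show ?case unfolding same_positive_def using peq_sym by metis
next
  case (trans u v w)
  then show ?case using same_positive_trans by blast
next
  case (cancel u v i e)
  then show ?case using same_positive_context[OF same_positive_cancel[of v n i e]] by simp
next
  case (far u v i j)
  have "same_positive n ((True, i) # (True, j) # v) ((True, j) # (True, i) # v)"
    unfolding same_positive_def using peq_far[of i j] far by (intro exI[of _ 0]) (auto simp: far_def)
  then show ?case using same_positive_context[of n _ _ u] far by simp
next
  case (near u v i)
  have "same_positive n ((True, i) # (True, i + 1) # (True, i) # v) ((True, i + 1) # (True, i) # (True, i + 1) # v)"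
    unfolding same_positive_def using peq_near[of i "i + 1"] near by (intro exI[of _ 0]) (auto simp: near_def)
  then show ?case using same_positive_context[of n _ _ u] near by simp
qed

text \<open>A positive word is its own numerator, with trivial denominator. So equivalent positive
  words become equal after multiplication with a power of \<open>\<Delta>\<close>, which can be
  cancelled.\<close>

lemma braid_equiv_pos_iff:
  assumes "set u \<subseteq> {1..<n}" "set v \<subseteq> {1..<n}"
  shows "braid_equiv n (pos u) (pos v) \<longleftrightarrow> u \<approx> v"
proof
  assume "braid_equiv n (pos u) (pos v)"
  then obtain a b where "negc (pos u) + a = negc (pos v) + b" "posp n (pos u) @ dlp n a \<approx> posp n (pos v) @ dlp n b"
    using same_positive_braid_equiv unfolding same_positive_def by blast
  moreover have "negc (pos w) = 0" "posp n (pos w) = w" for w by (induction w) auto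
  ultimately show "u \<approx> v" by simp
qed (use pos_equiv assms in blast)

section \<open>The braid group\<close>

lemma mem_braid_of: "v \<in> braid_of n w \<longleftrightarrow> braid_equiv n w v"
  by (simp add: braid_of_def)

lemma braid_of_eq_iff: "w \<in> artin_words n \<Longrightarrow> braid_of n w = braid_of n v \<longleftrightarrow> braid_equiv n w v"
  unfolding braid_of_def using braid_equiv.refl braid_equiv.sym braid_equiv.trans by blast

lemma braid_of_eqI: "braid_equiv n w v \<Longrightarrow> braid_of n w = braid_of n v"
  using braid_of_eq_iff braid_equiv_words by blast

lemma braid_mult [simp]:
  assumes "v \<in> artin_words n" "w \<in> artin_words n"
  shows "braid_of n v \<otimes>\<^bsub>braid_group n\<^esub> braid_of n w = braid_of n (v @ w)"
proof -
  have *: "braid_of n (a @ b) = braid_of n (v @ w)" if ab: "a \<in> braid_of n v" "b \<in> braid_of n w" for a b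
    by (rule braid_of_eqI[OF braid_equiv_append[OF ab[unfolded mem_braid_of]], symmetric])
  have mem: "v \<in> braid_of n v" "w \<in> braid_of n w" using assms by (auto simp: mem_braid_of intro: braid_equiv.refl)
  have "(\<Union>a\<in>braid_of n v. \<Union>b\<in>braid_of n w. braid_of n (a @ b)) = braid_of n (v @ w)"
  proof (intro subset_antisym subsetI)
    fix x assume "x \<in> (\<Union>a\<in>braid_of n v. \<Union>b\<in>braid_of n w. braid_of n (a @ b))"
    then obtain a b where "a \<in> braid_of n v" "b \<in> braid_of n w" "x \<in> braid_of n (a @ b)" by blast
    then show "x \<in> braid_of n (v @ w)" using * by simp
  qed (intro UN_I[OF mem(1)] UN_I[OF mem(2)])
  then show ?thesis unfolding braid_group_def by simp
qed

lemma braid_one: "\<one>\<^bsub>braid_group n\<^esub> = braid_of n []"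
  by (simp add: braid_group_def)

lemma braid_carrier: "b \<in> carrier (braid_group n) \<longleftrightarrow> (\<exists>w \<in> artin_words n. b = braid_of n w)"
  by (auto simp: braid_group_def)

lemma braid_of_carrier [simp]: "w \<in> artin_words n \<Longrightarrow> braid_of n w \<in> carrier (braid_group n)"
  by (auto simp: braid_carrier)

definition winv :: "artin_word \<Rightarrow> artin_word" where
  "winv w = rev (map (\<lambda>(e, i). (\<not> e, i)) w)"

lemma winv_simps [simp]: "winv [] = []" "winv ((e, i) # w) = winv w @ [(\<not> e, i)]"
  "winv (u @ v) = winv v @ winv u"
  by (simp_all add: winv_def)

lemma winv_words [simp]: "winv w \<in> artin_words n \<longleftrightarrow> w \<in> artin_words n"
  by (auto simp: winv_def artin_words_def)

lemma winv_winv [simp]: "winv (winv w) = w"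
  by (induction w) (auto simp: winv_def)

lemma winv_cancel: "w \<in> artin_words n \<Longrightarrow> braid_equiv n (w @ winv w) []"
proof (induction w)
  case (Cons x w)
  obtain e i where x: "x = (e, i)" by (cases x)
  have "braid_equiv n ([x] @ (w @ winv w) @ [(\<not> e, i)]) ([x] @ [] @ [(\<not> e, i)])"
    by (rule braid_equiv_context) (use Cons x in auto)
  moreover have "braid_equiv n ([] @ [(e, i), (\<not> e, i)] @ []) ([] @ [])"
    by (rule braid_equiv.cancel) (use Cons x in auto)
  ultimately show ?case using x braid_equiv.trans[of n "[x] @ (w @ winv w) @ [(\<not> e, i)]" "[(e, i), (\<not> e, i)]" "[]"] by simp
qed (auto intro: braid_equiv.refl)

lemma group_braid_group: "group (braid_group n)"
proof (rule groupI)
  fix x y z assume "x \<in> carrier (braid_group n)" "y \<in> carrier (braid_group n)" "z \<in> carrier (braid_group n)"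
  then show "x \<otimes>\<^bsub>braid_group n\<^esub> y \<otimes>\<^bsub>braid_group n\<^esub> z = x \<otimes>\<^bsub>braid_group n\<^esub> (y \<otimes>\<^bsub>braid_group n\<^esub> z)"
    by (auto simp: braid_carrier)
next
  fix x assume "x \<in> carrier (braid_group n)"
  then obtain w where w: "w \<in> artin_words n" "x = braid_of n w" by (auto simp: braid_carrier)
  have "braid_of n (winv w) \<otimes>\<^bsub>braid_group n\<^esub> x = \<one>\<^bsub>braid_group n\<^esub>"
    using w winv_cancel[of "winv w" n] by (simp add: braid_one braid_of_eqI)
  then show "\<exists>y\<in>carrier (braid_group n). y \<otimes>\<^bsub>braid_group n\<^esub> x = \<one>\<^bsub>braid_group n\<^esub>"
    using w by (intro bexI[of _ "braid_of n (winv w)"]) auto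
qed (auto simp: braid_carrier braid_one)

lemma braid_inv [simp]:
  assumes "w \<in> artin_words n"
  shows "inv\<^bsub>braid_group n\<^esub> (braid_of n w) = braid_of n (winv w)"
proof -
  interpret group "braid_group n" by (rule group_braid_group)
  have "braid_equiv n (winv w @ w) []" using winv_cancel[of "winv w" n] assms by simp
  then have "braid_of n (winv w) \<otimes>\<^bsub>braid_group n\<^esub> braid_of n w = \<one>\<^bsub>braid_group n\<^esub>"
    using assms by (simp add: braid_one braid_of_eqI)
  then show ?thesis using inv_equality assms by simp
qed

definition pb :: "nat \<Rightarrow> nat list \<Rightarrow> braid" where
  "pb n w = braid_of n (pos w)"

lemma pb_carrier [simp]: "set w \<subseteq> {1..<n} \<Longrightarrow> pb n w \<in> carrier (braid_group n)"
  by (simp add: pb_def pos_words)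

lemma pb_Nil [simp]: "pb n [] = \<one>\<^bsub>braid_group n\<^esub>"
  by (simp add: pb_def braid_one)

lemma pb_append: "set u \<subseteq> {1..<n} \<Longrightarrow> set v \<subseteq> {1..<n} \<Longrightarrow> pb n (u @ v) = pb n u \<otimes>\<^bsub>braid_group n\<^esub> pb n v"
  by (simp add: pb_def pos_words)

lemma pb_eq_iff: "set u \<subseteq> {1..<n} \<Longrightarrow> set v \<subseteq> {1..<n} \<Longrightarrow> pb n u = pb n v \<longleftrightarrow> u \<approx> v"
  by (simp add: pb_def braid_of_eq_iff pos_words braid_equiv_pos_iff)

lemma pb_eqI: "u \<approx> v \<Longrightarrow> set u \<subseteq> {1..<n} \<Longrightarrow> pb n u = pb n v"
  using pb_eq_iff[of u n v] peq_set[of u v] by simp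

lemma positive_braids_eq: "positive_braids n = pb n ` {w. set w \<subseteq> {1..<n}}"
  unfolding positive_braids_def positive_words_eq pb_def image_image ..

lemma nonrepeating_braids_eq: "nonrepeating_braids n = pb n ` {w. set w \<subseteq> {1..<n} \<and> nonrep w}"
  unfolding nonrepeating_braids_def nonrepeating_words_eq pb_def image_image ..

text \<open>The definite description is justified by \<open>nonrep_unique\<close>: all
  non-repeating words with the same permutation represent the same braid.\<close>

lemma perm_braid_eq:
  assumes "s permutes {1..n}"
  shows "perm_braid n s = pb n (pw n s)"
  unfolding perm_braid_def
proof (rule the_equality)
  have "pos (pw n s) \<in> nonrepeating_words n" unfolding nonrepeating_words_eq using pw[OF assms] by blast
  moreover have "strand_end (pos (pw n s)) = s" unfolding strand_end_pos by (rule pw(3)[OF assms])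
  ultimately show "\<exists>w\<in>nonrepeating_words n. strand_end w = s \<and> pb n (pw n s) = braid_of n w"
    unfolding pb_def by blast
next
  fix b assume "\<exists>w\<in>nonrepeating_words n. strand_end w = s \<and> b = braid_of n w"
  then obtain x where x: "x \<in> nonrepeating_words n" "strand_end x = s" "b = braid_of n x" by blast
  then obtain w where w: "x = pos w" "set w \<subseteq> {1..<n}" "nonrep w" unfolding nonrepeating_words_eq by blast
  then have "pend w = s" using x(2) strand_end_pos by simp
  from pb_eqI[OF pw_peq[OF w(2,3) this] pw(1)[OF assms]] show "b = pb n (pw n s)"
    using x(3) w(1) by (simp add: pb_def)
qed

lemma perm_braid_pend:
  assumes "set w \<subseteq> {1..<n}" "nonrep w"
  shows "perm_braid n (pend w) = pb n w"
  using perm_braid_eq[OF pend_permutes[OF assms(1)]]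
    pb_eqI[OF pw_peq[OF assms HOL.refl] pw(1)[OF pend_permutes[OF assms(1)]]] by (rule HOL.trans)

lemma right_divides_pb:
  assumes "set u \<subseteq> {1..<n}" "set v \<subseteq> {1..<n}"
  shows "right_divides n (pb n u) (pb n v) \<longleftrightarrow> rdiv u v"
proof
  assume "right_divides n (pb n u) (pb n v)"
  then obtain c where c: "set c \<subseteq> {1..<n}" "pb n v = pb n c \<otimes>\<^bsub>braid_group n\<^esub> pb n u"
    unfolding right_divides_def positive_braids_eq by blast
  then have "pb n v = pb n (c @ u)" using assms by (simp add: pb_append)
  then have "v \<approx> c @ u" using pb_eq_iff[OF assms(2), of "c @ u"] assms c by simp
  then show "rdiv u v" unfolding rdiv_def by blast
next
  assume "rdiv u v"
  then obtain c where c: "v \<approx> c @ u" unfolding rdiv_def by blast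
  then have sc: "set c \<subseteq> {1..<n}" using peq_set[OF c] assms by simp
  have "pb n v = pb n c \<otimes>\<^bsub>braid_group n\<^esub> pb n u"
    using pb_eqI[OF c assms(2)] pb_append[OF sc assms(1)] by simp
  then show "right_divides n (pb n u) (pb n v)"
    unfolding right_divides_def positive_braids_eq using sc by blast
qed

lemma max_nonrepeating_right_divisor_pb:
  assumes "set u \<subseteq> {1..<n}" "set v \<subseteq> {1..<n}" "maxdiv v u"
  shows "max_nonrepeating_right_divisor n (pb n u) (pb n v)"
  unfolding max_nonrepeating_right_divisor_def
proof (intro conjI ballI impI)
  show "pb n u \<in> nonrepeating_braids n"
    unfolding nonrepeating_braids_eq using assms by (auto simp: maxdiv_def)
  show "right_divides n (pb n u) (pb n v)"
    unfolding right_divides_pb[OF assms(1,2)] using assms(3) by (simp add: maxdiv_def)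
  fix c assume "c \<in> nonrepeating_braids n" and cv: "right_divides n c (pb n v)"
  then obtain w where w: "c = pb n w" "set w \<subseteq> {1..<n}" "nonrep w" unfolding nonrepeating_braids_eq by blast
  then have "rdiv w u" using cv assms(3) right_divides_pb[OF w(2) assms(2)] by (simp add: maxdiv_def)
  then show "right_divides n c (pb n u)" using w right_divides_pb[OF w(2) assms(1)] by simp
qed

section \<open>Greedy words\<close>

text \<open>The number 1 occurs in the numbering of leaves and in programs and has to stay a numeral.\<close>

declare One_nat_def [simp del]

lemma pw_inj: "s permutes {1..n} \<Longrightarrow> t permutes {1..n} \<Longrightarrow> pw n s \<approx> pw n t \<Longrightarrow> s = t"
  using pend_peq pw(3) by metis

lemma pw_id [simp]: "pw n id = []"
  using pw_peq[of "[]" n id] by simp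

lemma pw_id' [simp]: "pw n (\<lambda>a. a) = []"
  using pw_id[of n] unfolding id_def .

declare half_twist_permutes [simp]

lemma pw_half_twist [simp]: "pw n (half_twist n) = dl n"
  by (simp add: dl_def)

lemma permutes_pinv: "s permutes {1..n} \<Longrightarrow> pinv s permutes {1..n}"
  by (rule permutes_inv)

lemma pinv_swap:
  assumes "s permutes {1..n}"
  shows "pinv (transpose i j \<circ> s) = pinv s \<circ> transpose i j"
  by (subst o_inv_distrib) (use permutes_bij[OF assms] in auto)

text \<open>A letter at the end of the word crosses the two strands that arrive there, so that
  their starting points must be inverted.\<close>

lemma rdiv_letter:
  assumes s: "s permutes {1..n}" and i: "i \<in> {1..<n}"
  shows "rdiv [i] (pw n s) \<longleftrightarrow> pinv s (Suc i) < pinv s i"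
proof
  assume "rdiv [i] (pw n s)"
  then obtain c where c: "pw n s \<approx> c @ [i]" unfolding rdiv_def by blast
  have "nonrep (c @ [i])" using nonrep_peq[OF c] pw(2)[OF s] by simp
  then have 1: "pinv (pend c) i < pinv (pend c) (Suc i)" by (simp add: nonrep_snoc)
  have "s = transpose i (Suc i) \<circ> pend c"
    using pend_peq[OF c] pw(3)[OF s] by (simp add: pend_append comp_def)
  then have "pinv s = pinv (pend c) \<circ> transpose i (Suc i)"
    by (simp only:) (subst o_inv_distrib, auto)
  then show "pinv s (Suc i) < pinv s i" using 1 by simp
next
  assume d: "pinv s (Suc i) < pinv s i"
  have p: "(transpose i (Suc i) \<circ> s) permutes {1..n}"
    using i by (intro permutes_compose[OF s] permutes_swap_id) auto
  let ?c = "pw n (transpose i (Suc i) \<circ> s)"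
  have "nonrep (?c @ [i])"
    unfolding nonrep_snoc pw(3)[OF p] pinv_swap[OF s] using pw(2)[OF p] d by simp
  moreover have "pend (?c @ [i]) = s" unfolding pend_append pw(3)[OF p] by (simp add: fun_eq_iff)
  moreover have "set (?c @ [i]) \<subseteq> {1..<n}" using pw(1)[OF p] i by simp
  ultimately have "pw n s \<approx> ?c @ [i]" by (intro pw_peq)
  then show "rdiv [i] (pw n s)" unfolding rdiv_def by blast
qed

text \<open>No crossing can be moved from \<open>s\<close> to \<open>t\<close>: each letter with
  which \<open>s\<close> can end would repeat a crossing of \<open>t\<close>. In terms of
  permutations, the descents of the inverse of \<open>s\<close> are descents of
  \<open>t\<close>.\<close>

definition gpair :: "nat \<Rightarrow> (nat \<Rightarrow> nat) \<Rightarrow> (nat \<Rightarrow> nat) \<Rightarrow> bool" where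
  "gpair n s t \<longleftrightarrow> (\<forall>k \<in> {1..<n}. pinv s (Suc k) < pinv s k \<longrightarrow> t (Suc k) < t k)"

lemma gpair_iff:
  assumes s: "s permutes {1..n}" and t: "t permutes {1..n}"
  shows "gpair n s t \<longleftrightarrow> (\<forall>i. rdiv [i] (pw n s) \<longrightarrow> \<not> nonrep (i # pw n t))"
proof -
  have "i \<in> {1..<n}" if r: "rdiv [i] (pw n s)" for i
  proof -
    obtain c where c: "pw n s \<approx> c @ [i]" using r unfolding rdiv_def by blast
    show ?thesis using peq_set[OF c] pw(1)[OF s] by auto
  qed
  moreover have "\<not> nonrep (i # pw n t) \<longleftrightarrow> t (Suc i) < t i" for i
  proof -
    have "t i \<noteq> t (Suc i)" using permutes_inj[OF t] by (metis injD n_not_Suc_n)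
    then show ?thesis using pw(2,3)[OF t] by auto
  qed
  ultimately show ?thesis unfolding gpair_def using rdiv_letter[OF s] by blast
qed

definition words :: "nat \<Rightarrow> (nat \<Rightarrow> nat) list \<Rightarrow> nat list" where
  "words n ss = concat (map (pw n) ss)"

lemma words_simps [simp]: "words n [] = []" "words n (s # ss) = pw n s @ words n ss"
  "words n (ss @ ts) = words n ss @ words n ts"
  by (simp_all add: words_def)

definition perms :: "nat \<Rightarrow> (nat \<Rightarrow> nat) list \<Rightarrow> bool" where
  "perms n ss \<longleftrightarrow> (\<forall>s \<in> set ss. s permutes {1..n})"

lemma perms_simps [simp]: "perms n []" "perms n (s # ss) \<longleftrightarrow> s permutes {1..n} \<and> perms n ss"
  "perms n (ss @ ts) \<longleftrightarrow> perms n ss \<and> perms n ts" "perms n (rev ss) \<longleftrightarrow> perms n ss"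
  by (auto simp: perms_def)

lemma set_words: "perms n ss \<Longrightarrow> set (words n ss) \<subseteq> {1..<n}"
proof (induction ss)
  case (Cons s ss)
  then show ?case using pw(1)[of s n] by simp
qed simp

text \<open>In contrast to the normal form, trivial letters at the beginning and half twists at
  the end are allowed. Thus greedy words of the same braid can be padded to the same length and
  compared letter by letter.\<close>

definition greedy :: "nat \<Rightarrow> (nat \<Rightarrow> nat) list \<Rightarrow> bool" where
  "greedy n ss \<longleftrightarrow> perms n ss \<and> successively (gpair n) ss"

lemma greedy_perms: "greedy n ss \<Longrightarrow> perms n ss"
  by (simp add: greedy_def)

lemma greedy_append:
  "greedy n (ss @ ts) \<longleftrightarrow> greedy n ss \<and> greedy n ts \<and> (ss \<noteq> [] \<longrightarrow> ts \<noteq> [] \<longrightarrow> gpair n (last ss) (hd ts))"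
  by (auto simp: greedy_def successively_append_iff)

lemma greedy_single [simp]: "greedy n []" "greedy n [s] \<longleftrightarrow> s permutes {1..n}"
  by (auto simp: greedy_def)

lemma greedy_Cons: "greedy n (s # ss) \<longleftrightarrow> s permutes {1..n} \<and> greedy n ss \<and> (ss \<noteq> [] \<longrightarrow> gpair n s (hd ss))"
  using greedy_append[of n "[s]" ss] by auto

text \<open>By \<open>maxdiv_append\<close>, the local condition on neighbours propagates to all
  prefixes.\<close>

lemma greedy_maxdiv: "greedy n (ss @ [s]) \<Longrightarrow> maxdiv (words n (ss @ [s])) (pw n s)"
proof (induction ss arbitrary: s rule: rev_induct)
  case Nil
  then show ?case using pw(2)[of s n] by (simp add: maxdiv_def)
next
  case (snoc r ss)
  have rs: "r permutes {1..n}" "s permutes {1..n}" "gpair n r s" "greedy n (ss @ [r])"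
    using snoc.prems by (auto simp: greedy_append greedy_Cons)
  have "maxdiv (words n (ss @ [r]) @ pw n s) (pw n s)"
    by (rule maxdiv_append[OF snoc.IH[OF rs(4)] pw(2)[OF rs(2)]]) (use rs(3) gpair_iff[OF rs(1,2)] in blast)
  then show ?case by simp
qed

lemma greedy_snocI:
  assumes "greedy n ss" "s permutes {1..n}" "maxdiv (words n (ss @ [s])) (pw n s)"
  shows "greedy n (ss @ [s])"
proof (cases ss rule: rev_cases)
  case Nil
  then show ?thesis using assms by simp
next
  case (snoc ss' r)
  have r: "r permutes {1..n}" using assms(1) snoc by (simp add: greedy_def)
  have "\<not> nonrep (i # pw n s)" if "rdiv [i] (pw n r)" for i
    by (rule maxdiv_append_conv[of "words n ss", OF _ that]) (use assms(3) snoc in simp_all)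
  then have "gpair n r s" using gpair_iff[OF r assms(2)] by blast
  then show ?thesis using assms snoc by (simp add: greedy_append greedy_Cons)
qed

text \<open>The last letters are the maximal divisors of equal braids and can be
  cancelled.\<close>

lemma greedy_unique:
  assumes "greedy n ss" "greedy n ts" "length ss = length ts" "words n ss \<approx> words n ts"
  shows "ss = ts"
  using assms
proof (induction ss arbitrary: ts rule: rev_induct)
  case (snoc s ss)
  obtain t ts' where ts: "ts = ts' @ [t]" using snoc.prems(3) by (cases ts rule: rev_cases) auto
  have p: "s permutes {1..n}" "t permutes {1..n}" "greedy n ss" "greedy n ts'"
    using snoc.prems ts by (auto simp: greedy_append)
  have "maxdiv (words n (ss @ [s])) (pw n s)" "maxdiv (words n (ts' @ [t])) (pw n t)"
    using greedy_maxdiv snoc.prems(1,2) ts by blast+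
  then have "pw n s \<approx> pw n t" using maxdiv_unique maxdiv_peq snoc.prems(4) ts by blast
  then have st: "s = t" by (rule pw_inj[OF p(1,2)])
  then have "words n ss \<approx> words n ts'" using snoc.prems(4) ts by simp
  then show ?case using snoc.IH[OF p(3,4)] snoc.prems(3) ts st by simp
qed simp

lemma gpair_id_left [simp]: "gpair n id s"
  by (simp add: gpair_def)

lemma gpair_id_right:
  assumes "gpair n s id" "s permutes {1..n}"
  shows "s = id"
proof -
  have "pinv s = id"
  proof (rule ascending_permutation_id[OF permutes_pinv[OF assms(2)]])
    fix i assume "i \<in> {1..<n}"
    then have "\<not> pinv s (Suc i) < pinv s i" using assms(1) by (auto simp: gpair_def)
    moreover have "pinv s (Suc i) \<noteq> pinv s i" using permutes_inj[OF permutes_pinv[OF assms(2)]] by (metis injD n_not_Suc_n)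
    ultimately show "pinv s i < pinv s (Suc i)" by simp
  qed
  then show ?thesis using permutes_inv_inv[OF assms(2)] by simp
qed

lemma descending_half_twist:
  assumes s: "s permutes {1..n}" and d: "\<And>k. k \<in> {1..<n} \<Longrightarrow> s (Suc k) < s k"
  shows "s = half_twist n"
proof -
  have "half_twist n \<circ> s = id"
  proof (rule ascending_permutation_id[OF permutes_compose[OF s half_twist_permutes]])
    fix i assume i: "i \<in> {1..<n}"
    have "s i \<in> {1..n}" "s (Suc i) \<in> {1..n}" using permutes_in_image[OF s] i by simp_all
    then show "(half_twist n \<circ> s) i < (half_twist n \<circ> s) (Suc i)"
      using d[OF i] by (auto simp: half_twist_def)
  qed
  then have "half_twist n (half_twist n (s x)) = half_twist n x" for x by (metis comp_apply id_apply)
  then show ?thesis by (simp add: fun_eq_iff)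
qed

lemma gpair_half_twist_left:
  assumes "gpair n (half_twist n) s" "s permutes {1..n}"
  shows "s = half_twist n"
proof (rule descending_half_twist[OF assms(2)])
  fix k assume k: "k \<in> {1..<n}"
  have "pinv (half_twist n) = half_twist n" by (rule inv_unique_comp) simp_all
  then show "s (Suc k) < s k" using assms(1) k by (auto simp: gpair_def half_twist_def)
qed

lemma gpair_half_twist_right [simp]: "gpair n s (half_twist n)"
  by (auto simp: gpair_def half_twist_def)

lemma greedy_half_twists: "greedy n ss \<Longrightarrow> greedy n (ss @ replicate d (half_twist n))"
proof (induction d)
  case (Suc d)
  then have "greedy n ((ss @ replicate d (half_twist n)) @ [half_twist n])"
    by (subst greedy_append) (simp add: half_twist_permutes)
  then show ?case by (simp add: replicate_append_same[symmetric])
qed simp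

lemma greedy_ids: "greedy n ss \<Longrightarrow> greedy n (replicate d id @ ss)"
  by (induction d) (auto simp: greedy_Cons permutes_id)

lemma words_half_twists: "words n (replicate d (half_twist n)) = dlp n d"
  by (induction d) auto

lemma words_ids: "words n (replicate d id) = []"
  by (induction d) auto

subsection \<open>Sliding crossings to the right\<close>

definition slid :: "nat \<Rightarrow> (nat \<Rightarrow> nat) \<Rightarrow> (nat \<Rightarrow> nat) \<Rightarrow> (nat \<Rightarrow> nat) \<times> (nat \<Rightarrow> nat) \<Rightarrow> bool" where
  "slid n r t p \<longleftrightarrow> fst p permutes {1..n} \<and> snd p permutes {1..n} \<and>
     pw n (fst p) @ pw n (snd p) \<approx> pw n r @ pw n t \<and> gpair n (fst p) (snd p)"

lemma slid_unique:
  assumes "slid n r t p" "slid n r t q"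
  shows "p = q"
proof -
  have "[fst p, snd p] = [fst q, snd q]"
  proof (rule greedy_unique)
    have 1: "pw n (fst p) @ pw n (snd p) \<approx> pw n r @ pw n t" using assms(1) by (simp add: slid_def)
    have 2: "pw n (fst q) @ pw n (snd q) \<approx> pw n r @ pw n t" using assms(2) by (simp add: slid_def)
    show "words n [fst p, snd p] \<approx> words n [fst q, snd q]" using peq_trans[OF 1 peq_sym[OF 2]] by simp
  qed (use assms in \<open>auto simp: slid_def greedy_Cons\<close>)
  then show ?thesis by (simp add: prod_eq_iff)
qed

text \<open>The second letter of the greedy pair is the maximal non-repeating right divisor of the
  product. The remaining left factor is non-repeating because it is a divisor of \<open>r\<close>,
  as the maximal divisor contains \<open>t\<close>.\<close>

lemma ex_slid:
  assumes r: "r permutes {1..n}" and t: "t permutes {1..n}"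
  shows "\<exists>p. slid n r t p"
proof -
  have sub: "set (pw n r @ pw n t) \<subseteq> {1..<n}" using pw(1)[OF r] pw(1)[OF t] by simp
  obtain d where d: "maxdiv (pw n r @ pw n t) d" using ex_maxdiv by blast
  have "rdiv (pw n t) d" using d pw(2)[OF t] by (simp add: maxdiv_def)
  then obtain m where m: "d \<approx> m @ pw n t" unfolding rdiv_def by blast
  obtain c where c: "pw n r @ pw n t \<approx> c @ d" using d unfolding maxdiv_def rdiv_def by blast
  have cd: "set c \<subseteq> {1..<n}" "set d \<subseteq> {1..<n}" using peq_set[OF c] sub by auto
  have "c @ d \<approx> (c @ m) @ pw n t" using m by simp
  then have "pw n r @ pw n t \<approx> (c @ m) @ pw n t" by (rule peq_trans[OF c])
  then have "pw n r \<approx> c @ m" by (simp only: peq_append_right_iff)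
  then have "nonrep (c @ m)" using nonrep_peq pw(2)[OF r] by blast
  then have nc: "nonrep c" by (rule nonrep_appendD)
  have nd: "nonrep d" using d by (simp add: maxdiv_def)
  let ?p = "(pend c, pend d)"
  have pc: "pw n (pend c) \<approx> c" using pw_peq cd(1) nc by blast
  have pd: "pw n (pend d) \<approx> d" using pw_peq cd(2) nd by blast
  have perm: "pend c permutes {1..n}" "pend d permutes {1..n}" using cd pend_permutes by blast+
  have eq: "pw n (pend c) @ pw n (pend d) \<approx> pw n r @ pw n t"
    using peq_trans[OF peq_append[OF pc pd] peq_sym[OF c]] .
  have "maxdiv (words n ([pend c] @ [pend d])) (pw n (pend d))"
    using maxdiv_peq[OF peq_sym[OF eq] maxdiv_peq_right[OF peq_sym[OF pd] d]] by simp
  then have "greedy n ([pend c] @ [pend d])" using greedy_snocI[of n "[pend c]"] perm by simp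
  then have "gpair n (pend c) (pend d)" by (simp add: greedy_Cons)
  then have "slid n r t ?p" using perm eq by (simp add: slid_def)
  then show ?thesis by blast
qed

definition slide :: "nat \<Rightarrow> (nat \<Rightarrow> nat) \<Rightarrow> (nat \<Rightarrow> nat) \<Rightarrow> (nat \<Rightarrow> nat) \<times> (nat \<Rightarrow> nat)" where
  "slide n r t = (SOME p. slid n r t p)"

lemma slide: "r permutes {1..n} \<Longrightarrow> t permutes {1..n} \<Longrightarrow> slid n r t (slide n r t)"
  unfolding slide_def using someI_ex[OF ex_slid] .

lemma slide_eqI: "r permutes {1..n} \<Longrightarrow> t permutes {1..n} \<Longrightarrow> slid n r t p \<Longrightarrow> slide n r t = p"
  using slide slid_unique by blast

text \<open>The list is stored from the last letter to the first. The number of letters grows by one in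
  each insertion, so that trivial letters may arise; in a greedy word they are at the beginning.\<close>

fun insert_letter :: "nat \<Rightarrow> (nat \<Rightarrow> nat) \<Rightarrow> (nat \<Rightarrow> nat) list \<Rightarrow> (nat \<Rightarrow> nat) list" where
  "insert_letter n t [] = [t]"
| "insert_letter n t (r # rs) =
     snd (slide n r t) # insert_letter n (fst (slide n r t)) rs"

lemma length_insert_letter [simp]: "length (insert_letter n t rs) = Suc (length rs)"
  by (induction rs arbitrary: t) auto

text \<open>The new left letter is inserted into the shorter word. By
  \<open>maxdiv_replace\<close>, the new last letter is maximal for the whole word.\<close>

lemma insert_letter:
  assumes "greedy n (rev rs)" "t permutes {1..n}"
  shows "greedy n (rev (insert_letter n t rs)) \<and>
    words n (rev (insert_letter n t rs)) \<approx> words n (rev rs) @ pw n t"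
  using assms
proof (induction rs arbitrary: t)
  case (Cons r rs)
  define r' t' where rt: "r' = fst (slide n r t)" "t' = snd (slide n r t)"
  have r: "r permutes {1..n}" "greedy n (rev rs)" using Cons.prems by (auto simp: greedy_append)
  have s: "r' permutes {1..n}" "t' permutes {1..n}" "pw n r' @ pw n t' \<approx> pw n r @ pw n t" "gpair n r' t'"
    using slide[OF r(1) Cons.prems(2)] unfolding slid_def rt by auto
  have IH: "greedy n (rev (insert_letter n r' rs))"
    "words n (rev (insert_letter n r' rs)) \<approx> words n (rev rs) @ pw n r'"
    using Cons.IH[OF r(2) s(1)] by auto
  have "maxdiv (words n ([r'] @ [t'])) (pw n t')" by (rule greedy_maxdiv) (use s in \<open>simp add: greedy_Cons\<close>)
  then have m: "maxdiv (pw n r @ pw n t) (pw n t')" using maxdiv_peq[OF s(3)] by simp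
  have mr: "maxdiv (words n (rev (r # rs))) (pw n r)" using greedy_maxdiv[of n "rev rs" r] Cons.prems by simp
  have "words n (rev (insert_letter n r' rs)) @ pw n t' \<approx> (words n (rev rs) @ pw n r') @ pw n t'"
    using IH(2) by (simp only: peq_append_right_iff)
  also have "\<dots> \<approx> words n (rev (r # rs)) @ pw n t" using s(3) by simp
  finally have eq: "words n (rev (insert_letter n r' rs)) @ pw n t' \<approx> words n (rev (r # rs)) @ pw n t" .
  have "maxdiv (words n (rev (r # rs)) @ pw n t) (pw n t')"
    by (rule maxdiv_replace[OF mr m pw(2)[OF Cons.prems(2)]])
  then have "maxdiv (words n (rev (insert_letter n r' rs) @ [t'])) (pw n t')"
    using maxdiv_peq[OF peq_sym[OF eq]] by simp
  then have "greedy n (rev (insert_letter n r' rs) @ [t'])" by (rule greedy_snocI[OF IH(1) s(2)])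
  then show ?case using eq by (simp add: rt)
qed simp

subsection \<open>Conjugation by the half twist, complements\<close>

definition flipp :: "nat \<Rightarrow> (nat \<Rightarrow> nat) \<Rightarrow> nat \<Rightarrow> nat" where
  "flipp n s = half_twist n \<circ> s \<circ> half_twist n"

lemma flipp_permutes: "s permutes {1..n} \<Longrightarrow> flipp n s permutes {1..n}"
  unfolding flipp_def by (intro permutes_compose half_twist_permutes)

lemma pend_flip:
  assumes "set w \<subseteq> {1..<n}"
  shows "pend (flip n w) = flipp n (pend w)"
proof
  fix x
  have "pend (flip n w) (half_twist n (half_twist n x)) = half_twist n (pend w (half_twist n x))"
    using fun_cong[OF pend_peq[OF dl_flip[OF assms]], of "half_twist n x"] by (simp add: pend_append dl(3))
  then show "pend (flip n w) x = flipp n (pend w) x" by (simp add: flipp_def)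
qed

lemma nonrep_flip: "set w \<subseteq> {1..<n} \<Longrightarrow> nonrep w \<Longrightarrow> nonrep (flip n w)"
proof (induction w)
  case (Cons j w)
  have j: "j \<in> {1..<n}" and w: "set w \<subseteq> {1..<n}" "nonrep w" "pend w j < pend w (Suc j)" using Cons.prems by auto
  have "pend w j \<in> {1..n}" "pend w (Suc j) \<in> {1..n}"
    using permutes_in_image[OF pend_permutes[OF w(1)]] j by simp_all
  moreover have "half_twist n (n - j) = Suc j" "half_twist n (Suc (n - j)) = j"
    using j by (auto simp: half_twist_def)
  ultimately have "flipp n (pend w) (n - j) < flipp n (pend w) (Suc (n - j))"
    using diff_less_mono2[OF w(3), of "n + 1"]
    by (simp add: flipp_def half_twist_def[of n "pend w j"] half_twist_def[of n "pend w (Suc j)"])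
  then show ?case using Cons.IH[OF w(1,2)] pend_flip[OF w(1)] by simp
qed simp

lemma pw_flipp:
  assumes s: "s permutes {1..n}"
  shows "pw n (flipp n s) \<approx> flip n (pw n s)"
  by (rule pw_peq) (use set_flip[OF pw(1)[OF s]] nonrep_flip[OF pw(1,2)[OF s]] pend_flip[OF pw(1)[OF s]] pw(3)[OF s] in simp_all)

lemma flipp_dlp:
  assumes "s permutes {1..n}"
  shows "pw n s @ dlp n m \<approx> dlp n m @ pw n ((flipp n ^^ m) s) \<and> (flipp n ^^ m) s permutes {1..n}"
proof (induction m)
  case (Suc m)
  let ?s = "(flipp n ^^ m) s"
  have s: "?s permutes {1..n}" and IH: "pw n s @ dlp n m \<approx> dlp n m @ pw n ?s" using Suc by auto
  have "pw n s @ dlp n (Suc m) = (pw n s @ dlp n m) @ dl n" by (simp only: dlp_Suc' append_assoc)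
  also have "\<dots> \<approx> (dlp n m @ pw n ?s) @ dl n" using IH by (simp only: peq_append_right_iff)
  also have "\<dots> \<approx> dlp n m @ dl n @ flip n (pw n ?s)" using dl_flip[OF pw(1)[OF s]] by simp
  also have "\<dots> \<approx> dlp n m @ dl n @ pw n (flipp n ?s)" using peq_sym[OF pw_flipp[OF s]] by simp
  also have "\<dots> = dlp n (Suc m) @ pw n (flipp n ?s)" by (simp only: dlp_Suc' append_assoc)
  finally show ?case using flipp_permutes[OF s] by simp
qed (use assms in simp)

text \<open>The letter \<open>s\<^sup>-\<^sup>1 \<Delta>\<close>.\<close>

definition rcompl :: "nat \<Rightarrow> (nat \<Rightarrow> nat) \<Rightarrow> nat \<Rightarrow> nat" where
  "rcompl n s = half_twist n \<circ> pinv s"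

lemma rcompl_permutes: "s permutes {1..n} \<Longrightarrow> rcompl n s permutes {1..n}"
  unfolding rcompl_def by (intro permutes_compose half_twist_permutes permutes_pinv)

lemma pw_rcompl:
  assumes s: "s permutes {1..n}"
  shows "pw n s @ pw n (rcompl n s) \<approx> dl n"
proof (rule peq_sym, rule dl_peq)
  show "pend (pw n (rcompl n s)) \<circ> pend (pw n s) = half_twist n"
    unfolding pw(3)[OF s] pw(3)[OF rcompl_permutes[OF s]]
    using permutes_inverses(2)[OF s] by (simp add: fun_eq_iff rcompl_def)
qed (use pw[OF s] pw[OF rcompl_permutes[OF s]] in auto)

section \<open>Greedy words with a negative power of the half twist\<close>

text \<open>The braid \<open>x \<Delta>\<^sup>-\<^sup>m\<close>.\<close>

definition gval :: "nat \<Rightarrow> nat list \<Rightarrow> nat \<Rightarrow> braid" where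
  "gval n x m = pb n x \<otimes>\<^bsub>braid_group n\<^esub> inv\<^bsub>braid_group n\<^esub> (pb n (dlp n m))"

lemma gval_carrier [simp]: "set x \<subseteq> {1..<n} \<Longrightarrow> gval n x m \<in> carrier (braid_group n)"
proof -
  interpret group "braid_group n" by (rule group_braid_group)
  show "set x \<subseteq> {1..<n} \<Longrightarrow> gval n x m \<in> carrier (braid_group n)"
    unfolding gval_def by (intro m_closed inv_closed pb_carrier set_dlp)
qed

lemma gval_peq: "x \<approx> y \<Longrightarrow> set x \<subseteq> {1..<n} \<Longrightarrow> gval n x m = gval n y m"
  unfolding gval_def using pb_eqI by simp

lemma gval_0 [simp]: "set x \<subseteq> {1..<n} \<Longrightarrow> gval n x 0 = pb n x"
proof -
  interpret group "braid_group n" by (rule group_braid_group)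
  show "set x \<subseteq> {1..<n} \<Longrightarrow> gval n x 0 = pb n x" unfolding gval_def by simp
qed

lemma braid_cancel:
  assumes "a \<in> carrier (braid_group n)" "b \<in> carrier (braid_group n)"
  shows "a \<otimes>\<^bsub>braid_group n\<^esub> (inv\<^bsub>braid_group n\<^esub> a \<otimes>\<^bsub>braid_group n\<^esub> b) = b"
    "inv\<^bsub>braid_group n\<^esub> a \<otimes>\<^bsub>braid_group n\<^esub> (a \<otimes>\<^bsub>braid_group n\<^esub> b) = b"
proof -
  interpret group "braid_group n" by (rule group_braid_group)
  show "a \<otimes>\<^bsub>braid_group n\<^esub> (inv\<^bsub>braid_group n\<^esub> a \<otimes>\<^bsub>braid_group n\<^esub> b) = b"
    "inv\<^bsub>braid_group n\<^esub> a \<otimes>\<^bsub>braid_group n\<^esub> (a \<otimes>\<^bsub>braid_group n\<^esub> b) = b"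
    using assms by (simp_all flip: m_assoc)
qed

lemma gval_add:
  assumes x: "set x \<subseteq> {1..<n}"
  shows "gval n (x @ dlp n k) (m + k) = gval n x m"
proof -
  interpret group "braid_group n" by (rule group_braid_group)
  note c = pb_carrier[OF x] pb_carrier[OF set_dlp]
  have "pb n (dlp n (m + k)) = pb n (dlp n m) \<otimes>\<^bsub>braid_group n\<^esub> pb n (dlp n k)"
    unfolding dlp_add by (rule pb_append[OF set_dlp set_dlp])
  then show ?thesis
    unfolding gval_def pb_append[OF x set_dlp] using c by (simp add: inv_mult_group m_assoc braid_cancel)
qed

text \<open>Multiplication with \<open>\<Delta>\<close> to the power \<open>a + b\<close> makes
  both sides positive.\<close>

lemma gval_eqD:
  assumes x: "set x \<subseteq> {1..<n}" and y: "set y \<subseteq> {1..<n}" and eq: "gval n x a = gval n y b"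
  shows "x @ dlp n b \<approx> y @ dlp n a"
proof -
  interpret group "braid_group n" by (rule group_braid_group)
  have xs: "set (x @ dlp n b) \<subseteq> {1..<n}" "set (y @ dlp n a) \<subseteq> {1..<n}" using x y set_dlp by auto
  have "gval n (x @ dlp n b) (a + b) = gval n (y @ dlp n a) (a + b)"
    using gval_add[OF x, of b a] gval_add[OF y, of a b] eq by (simp add: add.commute)
  then have "pb n (x @ dlp n b) = pb n (y @ dlp n a)"
    unfolding gval_def using pb_carrier[OF xs(1)] pb_carrier[OF xs(2)] pb_carrier[OF set_dlp] by simp
  then show ?thesis using pb_eq_iff xs by blast
qed

lemma gval_letter:
  assumes x: "set x \<subseteq> {1..<n}" and s: "s permutes {1..n}"
  shows "gval n x m \<otimes>\<^bsub>braid_group n\<^esub> pb n (pw n s) = gval n (x @ pw n ((flipp n ^^ m) s)) m"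
proof -
  interpret group "braid_group n" by (rule group_braid_group)
  let ?u = "pw n ((flipp n ^^ m) s)"
  have p: "(flipp n ^^ m) s permutes {1..n}" using flipp_dlp[OF s] by blast
  note c = pb_carrier[OF x] pb_carrier[OF set_dlp[of n m]] pb_carrier[OF pw(1)[OF s]] pb_carrier[OF pw(1)[OF p]]
  have "pb n (pw n s @ dlp n m) = pb n (dlp n m @ ?u)"
    using flipp_dlp[OF s, of m] pw(1)[OF s] set_dlp[of n m] by (intro pb_eqI) auto
  then have e: "pb n (pw n s) \<otimes>\<^bsub>braid_group n\<^esub> pb n (dlp n m) = pb n (dlp n m) \<otimes>\<^bsub>braid_group n\<^esub> pb n ?u"
    using pw(1)[OF s] pw(1)[OF p] set_dlp by (simp add: pb_append)
  have "inv\<^bsub>braid_group n\<^esub> (pb n (dlp n m)) \<otimes>\<^bsub>braid_group n\<^esub> pb n (pw n s)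
      = pb n ?u \<otimes>\<^bsub>braid_group n\<^esub> inv\<^bsub>braid_group n\<^esub> (pb n (dlp n m))"
    using e c by (metis inv_closed inv_solve_left inv_solve_right m_assoc m_closed)
  then show ?thesis unfolding gval_def pb_append[OF x pw(1)[OF p]] using c by (simp add: m_assoc)
qed

lemma inverse_letter:
  assumes s: "s permutes {1..n}"
  shows "inv\<^bsub>braid_group n\<^esub> (pb n (pw n s)) = gval n (pw n (rcompl n s)) (Suc 0)"
proof -
  interpret group "braid_group n" by (rule group_braid_group)
  note p = rcompl_permutes[OF s]
  note c = pb_carrier[OF pw(1)[OF s]] pb_carrier[OF pw(1)[OF p]] pb_carrier[OF dl(1)]
  have "pb n (pw n s @ pw n (rcompl n s)) = pb n (dl n)"
    by (rule pb_eqI[OF pw_rcompl[OF s]]) (use pw(1)[OF s] pw(1)[OF p] in auto)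
  then have "pb n (dl n) = pb n (pw n s) \<otimes>\<^bsub>braid_group n\<^esub> pb n (pw n (rcompl n s))"
    by (simp add: pb_append pw(1)[OF s] pw(1)[OF p])
  then have "inv\<^bsub>braid_group n\<^esub> (pb n (pw n s)) \<otimes>\<^bsub>braid_group n\<^esub> pb n (dl n) = pb n (pw n (rcompl n s))"
    using c by (simp add: braid_cancel)
  then have "pb n (pw n (rcompl n s)) \<otimes>\<^bsub>braid_group n\<^esub> inv\<^bsub>braid_group n\<^esub> (pb n (dl n)) = inv\<^bsub>braid_group n\<^esub> (pb n (pw n s))"
    using c by (metis inv_closed m_assoc r_inv r_one)
  then show ?thesis unfolding gval_def by simp
qed

lemma gval_inverse_letter:
  assumes x: "set x \<subseteq> {1..<n}" and s: "s permutes {1..n}"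
  shows "gval n x m \<otimes>\<^bsub>braid_group n\<^esub> inv\<^bsub>braid_group n\<^esub> (pb n (pw n s))
    = gval n (x @ pw n ((flipp n ^^ m) (rcompl n s))) (Suc m)"
proof -
  interpret group "braid_group n" by (rule group_braid_group)
  note p = rcompl_permutes[OF s]
  let ?u = "pw n ((flipp n ^^ m) (rcompl n s))"
  have p': "(flipp n ^^ m) (rcompl n s) permutes {1..n}" using flipp_dlp[OF p] by blast
  note c = pb_carrier[OF dl(1)[of n]] pb_carrier[OF set_dlp[of n m]] pb_carrier[OF pw(1)[OF p]]
    pb_carrier[OF pw(1)[OF p']] gval_carrier[OF x]
  have "gval n x m \<otimes>\<^bsub>braid_group n\<^esub> inv\<^bsub>braid_group n\<^esub> (pb n (pw n s))
    = (gval n x m \<otimes>\<^bsub>braid_group n\<^esub> pb n (pw n (rcompl n s))) \<otimes>\<^bsub>braid_group n\<^esub> inv\<^bsub>braid_group n\<^esub> (pb n (dl n))"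
    unfolding inverse_letter[OF s] gval_def[of n "pw n (rcompl n s)"] using c by (simp add: m_assoc)
  also have "\<dots> = gval n (x @ ?u) m \<otimes>\<^bsub>braid_group n\<^esub> inv\<^bsub>braid_group n\<^esub> (pb n (dl n))"
    by (simp add: gval_letter[OF x p])
  also have "\<dots> = gval n (x @ ?u) (Suc m)"
    unfolding gval_def dlp_simps pb_append[OF dl(1) set_dlp]
    using c pb_carrier[of "x @ ?u" n] x pw(1)[OF p'] by (simp add: m_assoc inv_mult_group)
  finally show ?thesis .
qed

definition letters :: "nat \<Rightarrow> perm_word \<Rightarrow> bool" where
  "letters n w \<longleftrightarrow> perms n (map snd w)"

lemma letters_simps [simp]: "letters n []" "letters n ((e, s) # w) \<longleftrightarrow> s permutes {1..n} \<and> letters n w"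
  "letters n (v @ w) \<longleftrightarrow> letters n v \<and> letters n w"
  by (auto simp: letters_def)

lemma letter_braid_carrier [simp]: "s permutes {1..n} \<Longrightarrow> letter_braid n (e, s) \<in> carrier (braid_group n)"
proof -
  interpret group "braid_group n" by (rule group_braid_group)
  show "s permutes {1..n} \<Longrightarrow> letter_braid n (e, s) \<in> carrier (braid_group n)"
    by (simp add: perm_braid_eq pw(1))
qed

lemma word_braid_Nil: "word_braid n [] = \<one>\<^bsub>braid_group n\<^esub>"
  and word_braid_Cons: "word_braid n (x # w) = letter_braid n x \<otimes>\<^bsub>braid_group n\<^esub> word_braid n w"
  by (simp_all add: word_braid_def)

lemma word_braid_carrier [simp]: "letters n w \<Longrightarrow> word_braid n w \<in> carrier (braid_group n)"
proof (induction w)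
  case Nil
  then show ?case using group.is_monoid[OF group_braid_group] by (simp add: word_braid_Nil monoid.one_closed)
next
  case (Cons x w)
  interpret group "braid_group n" by (rule group_braid_group)
  obtain e s where "x = (e, s)" by (cases x)
  then show ?case using Cons letter_braid_carrier[of s n e] by (simp add: word_braid_Cons del: letter_braid.simps)
qed

lemma word_braid_append:
  assumes "letters n v" "letters n w"
  shows "word_braid n (v @ w) = word_braid n v \<otimes>\<^bsub>braid_group n\<^esub> word_braid n w"
  using assms(1)
proof (induction v)
  interpret group "braid_group n" by (rule group_braid_group)
  case Nil
  then show ?case using assms by (simp add: word_braid_Nil)
next
  interpret group "braid_group n" by (rule group_braid_group)
  case (Cons x v)
  obtain e s where x: "x = (e, s)" by (cases x)
  then have c: "letter_braid n x \<in> carrier (braid_group n)" using Cons.prems letter_braid_carrier by simp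
  show ?case using Cons x c assms by (simp add: word_braid_Cons m_assoc del: letter_braid.simps)
qed

lemma word_braid_positive: "perms n ss \<Longrightarrow> word_braid n (map (Pair True) ss) = pb n (words n ss)"
  by (induction ss) (simp_all add: word_braid_Nil word_braid_Cons perm_braid_eq pb_append set_words pw)

text \<open>The list is the greedy word read so far, last letter first, and \<open>m\<close>
  counts the factors \<open>\<Delta>\<^sup>-\<^sup>1\<close> after it. A new letter has to pass
  them, which conjugates it \<open>m\<close> times.\<close>

fun push_letters :: "nat \<Rightarrow> perm_word \<Rightarrow> (nat \<Rightarrow> nat) list \<Rightarrow> nat \<Rightarrow> (nat \<Rightarrow> nat) list \<times> nat" where
  "push_letters n [] rs m = (rs, m)"
| "push_letters n ((e, s) # w) rs m =
     (if e then push_letters n w (insert_letter n ((flipp n ^^ m) s) rs) m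
      else push_letters n w (insert_letter n ((flipp n ^^ m) (rcompl n s)) rs) (Suc m))"

lemma push_letters:
  assumes "letters n w" "greedy n (rev rs)" "push_letters n w rs m = (rs', m')"
  shows "greedy n (rev rs') \<and> length rs' = length rs + length w \<and> m' \<le> m + length w \<and>
    gval n (words n (rev rs')) m' = gval n (words n (rev rs)) m \<otimes>\<^bsub>braid_group n\<^esub> word_braid n w"
  using assms
proof (induction w arbitrary: rs m)
  case Nil
  interpret group "braid_group n" by (rule group_braid_group)
  show ?case using Nil set_words[OF greedy_perms[OF Nil(2)]] by (simp add: word_braid_Nil)
next
  case (Cons x w)
  interpret group "braid_group n" by (rule group_braid_group)
  obtain e s where x: "x = (e, s)" by (cases x)
  define t where "t = (flipp n ^^ m) (if e then s else rcompl n s)"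
  define m1 where "m1 = (if e then m else Suc m)"
  have s: "s permutes {1..n}" and w: "letters n w" using Cons.prems(1) x by auto
  have t: "t permutes {1..n}"
    unfolding t_def using flipp_dlp[OF s] flipp_dlp[OF rcompl_permutes[OF s]] by simp
  note ins = insert_letter[OF Cons.prems(2) t]
  have g: "greedy n (rev (insert_letter n t rs))" using ins by blast
  have n: "push_letters n w (insert_letter n t rs) m1 = (rs', m')"
    using Cons.prems(3) x by (simp add: t_def m1_def split: if_splits)
  note IH = Cons.IH[OF w g n]
  have sw: "set (words n (rev rs)) \<subseteq> {1..<n}" using set_words[OF greedy_perms[OF Cons.prems(2)]] .
  have "gval n (words n (rev (insert_letter n t rs))) m1 = gval n (words n (rev rs) @ pw n t) m1"
    using ins set_words[OF greedy_perms[OF g]] by (intro gval_peq) auto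
  also have "\<dots> = gval n (words n (rev rs)) m \<otimes>\<^bsub>braid_group n\<^esub> letter_braid n x"
    using gval_letter[OF sw s, of m] gval_inverse_letter[OF sw s, of m]
    by (auto simp: t_def m1_def x perm_braid_eq[OF s])
  finally have "gval n (words n (rev rs')) m'
      = gval n (words n (rev rs)) m \<otimes>\<^bsub>braid_group n\<^esub> letter_braid n x \<otimes>\<^bsub>braid_group n\<^esub> word_braid n w"
    using IH by simp
  also have "\<dots> = gval n (words n (rev rs)) m \<otimes>\<^bsub>braid_group n\<^esub> word_braid n (x # w)"
    unfolding word_braid_Cons using gval_carrier[OF sw] word_braid_carrier[OF w] letter_braid_carrier[OF s, of e] x
    by (simp add: m_assoc del: letter_braid.simps)
  finally show ?case using IH by (simp add: m1_def split: if_splits)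
qed

text \<open>Every braid is a product of generators and their inverses, and these are letters of
  \<open>push_letters\<close>.\<close>

lemma ex_greedy:
  assumes "b \<in> carrier (braid_group n)"
  shows "\<exists>ss m. greedy n ss \<and> b = gval n (words n ss) m"
proof -
  interpret group "braid_group n" by (rule group_braid_group)
  obtain w where w: "w \<in> artin_words n" "b = braid_of n w" using assms braid_carrier by blast
  define v where "v = map (\<lambda>(e, i). (e, transpose i (Suc i))) w"
  have "letters n v \<and> word_braid n v = braid_of n w"
    using w(1) unfolding v_def
  proof (induction w)
    case Nil
    then show ?case by (simp add: word_braid_Nil braid_one)
  next
    case (Cons x w)
    obtain e i where x: "x = (e, i)" by (cases x)
    have i: "i \<in> {1..<n}" and w: "w \<in> artin_words n" using Cons.prems x by auto
    have p: "transpose i (Suc i) permutes {1..n}" using i by (intro permutes_swap_id) auto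
    have "pend [i] = transpose i (Suc i)" by (simp add: fun_eq_iff)
    then have "perm_braid n (transpose i (Suc i)) = pb n [i]" using perm_braid_pend[of "[i]" n] i by simp
    then have "letter_braid n (e, transpose i (Suc i)) = braid_of n [(e, i)]"
      using i by (cases e) (simp_all add: pb_def)
    then show ?case using Cons.IH[OF w] x p i w by (simp add: word_braid_Cons del: letter_braid.simps)
  qed
  moreover obtain rs m where "push_letters n v [] 0 = (rs, m)" by fastforce
  ultimately have "greedy n (rev rs)" "gval n (words n (rev rs)) m = b"
    using push_letters[of n v "[]" 0 rs m] w by auto
  then show ?thesis by metis
qed

subsection \<open>The normal form of a braid\<close>

definition nontrivial :: "(nat \<Rightarrow> nat) \<Rightarrow> bool" where
  "nontrivial s \<longleftrightarrow> s \<noteq> id"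

text \<open>The half twists of a greedy word are its last letters, the first ones of
  \<open>rs\<close>. They are set against the \<open>m\<close> factors
  \<open>\<Delta>\<^sup>-\<^sup>1\<close>.\<close>

definition strip :: "nat \<Rightarrow> (nat \<Rightarrow> nat) list \<Rightarrow> nat \<Rightarrow> perm_word" where
  "strip n rs m =
     (let d = length (takeWhile (\<lambda>s. s = half_twist n) rs);
          ss = filter nontrivial (rev (dropWhile (\<lambda>s. s = half_twist n) rs))
      in map (Pair True) ss @
         (if d < m then replicate (m - d) (False, half_twist n) else replicate (d - m) (True, half_twist n)))"

lemma greedy_filter_id: "greedy n ss \<Longrightarrow> greedy n (filter nontrivial ss)"
proof (induction ss)
  case (Cons s ss)
  have IH: "greedy n (filter nontrivial ss)" using Cons by (simp add: greedy_Cons)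
  show ?case
  proof (cases "\<not> nontrivial s \<or> ss = []")
    case True then show ?thesis using IH Cons.prems by (auto simp: greedy_Cons)
  next
    case False
    then obtain t ts where ss: "ss = t # ts" by (cases ss) auto
    have "s permutes {1..n}" "gpair n s t" using Cons.prems ss by (auto simp: greedy_Cons)
    then have "nontrivial t" using False gpair_id_right unfolding nontrivial_def by blast
    then show ?thesis using IH Cons.prems False ss by (simp add: greedy_Cons)
  qed
qed simp

lemma greedy_no_half_twist:
  "greedy n ss \<Longrightarrow> ss = [] \<or> last ss \<noteq> half_twist n \<Longrightarrow> half_twist n \<notin> set ss"
proof (induction ss)
  case (Cons s ss)
  show ?case
  proof (cases ss)
    case Nil then show ?thesis using Cons.prems by auto
  next
    case t: (Cons t ts)
    have IH: "half_twist n \<notin> set ss" using Cons t by (auto simp: greedy_Cons)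
    have "t permutes {1..n}" "gpair n s t" using Cons.prems t by (auto simp: greedy_Cons)
    then have "s \<noteq> half_twist n" using IH t gpair_half_twist_left by auto
    then show ?thesis using IH by auto
  qed
qed simp

lemma words_filter_id: "words n (filter nontrivial ss) = words n ss"
  by (induction ss) (auto simp: nontrivial_def)

lemma half_twist_power:
  "word_braid n (replicate k (True, half_twist n)) = pb n (dlp n k)" (is ?pos)
  "word_braid n (replicate k (False, half_twist n)) = inv\<^bsub>braid_group n\<^esub> (pb n (dlp n k))" (is ?neg)
proof -
  interpret group "braid_group n" by (rule group_braid_group)
  have l: "letters n (replicate k (e, half_twist n))" for k e by (induction k) (auto simp: half_twist_permutes)
  have e: "letter_braid n (True, half_twist n) = pb n (dl n)" "letter_braid n (False, half_twist n) = inv\<^bsub>braid_group n\<^esub> (pb n (dl n))"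
    by (simp_all add: perm_braid_eq half_twist_permutes)
  show ?pos
    by (induction k) (simp_all add: word_braid_Nil word_braid_Cons e pb_append dl(1) set_dlp del: letter_braid.simps)
  show ?neg
  proof (induction k)
    case (Suc k)
    have "pb n (dlp n (Suc k)) = pb n (dlp n k) \<otimes>\<^bsub>braid_group n\<^esub> pb n (dl n)"
      unfolding dlp_Suc' by (rule pb_append[OF set_dlp dl(1)])
    then show ?case using Suc pb_carrier[OF set_dlp[of n k]] pb_carrier[OF dl(1)[of n]]
      by (simp add: word_braid_Cons e inv_mult_group del: letter_braid.simps dlp_simps)
  qed (simp add: word_braid_Nil)
qed

lemma strip:
  assumes g: "greedy n (rev rs)" and n: "2 \<le> n"
  shows "right_greedy n (strip n rs m)" "letters n (strip n rs m)"
    "word_braid n (strip n rs m) = gval n (words n (rev rs)) m"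
proof -
  interpret group "braid_group n" by (rule group_braid_group)
  let ?P = "\<lambda>s. s = half_twist n"
  define d where "d = length (takeWhile ?P rs)"
  define ss where "ss = filter nontrivial (rev (dropWhile ?P rs))"
  define p :: int where "p = int d - int m"
  define tail where "tail = replicate (nat \<bar>p\<bar>) (p \<ge> 0, half_twist n)"
  have st: "strip n rs m = map (Pair True) ss @ tail"
    unfolding strip_def tail_def p_def Let_def d_def[symmetric] ss_def[symmetric]
    by (cases "d < m") (auto simp: nat_diff_distrib)
  have tw: "takeWhile ?P rs = replicate d (half_twist n)"
    unfolding d_def by (intro replicate_eqI[symmetric, THEN HOL.sym]) (auto dest: set_takeWhileD)
  have rs: "rev rs = rev (dropWhile ?P rs) @ replicate d (half_twist n)"
    using takeWhile_dropWhile_id[of ?P rs] tw by (metis rev_append rev_replicate)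
  have gd: "greedy n (rev (dropWhile ?P rs))" using g rs by (simp add: greedy_append)
  have gs: "greedy n ss" unfolding ss_def by (rule greedy_filter_id[OF gd])
  have "rev (dropWhile ?P rs) = [] \<or> last (rev (dropWhile ?P rs)) \<noteq> half_twist n"
    using hd_dropWhile[of ?P rs] by (auto simp: last_rev)
  then have no: "half_twist n \<notin> set ss" using greedy_no_half_twist[OF gd] unfolding ss_def by auto
  have ps: "perms n ss" using gs by (rule greedy_perms)
  have lt: "letters n tail" unfolding tail_def by (simp add: letters_def perms_def half_twist_permutes)
  have ls: "letters n (map (Pair True) ss)" using ps by (simp add: letters_def comp_def)
  show "letters n (strip n rs m)" unfolding st using lt ls by simp
  show "right_greedy n (strip n rs m)"
    unfolding right_greedy_def
  proof (intro exI[of _ ss] exI[of _ p] conjI allI impI ballI)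
    show "strip n rs m = map (Pair True) ss @ replicate (nat \<bar>p\<bar>) (p \<ge> 0, half_twist n)"
      using st by (simp add: tail_def)
    fix s assume s: "s \<in> set ss"
    show "s permutes {1..n}" using s ps by (auto simp: perms_def)
    show "s \<noteq> id" using s unfolding ss_def by (auto simp: nontrivial_def)
    show "s \<noteq> half_twist n" using s no by auto
  next
    fix i assume i: "i < length ss"
    have t: "take (Suc i) ss = take i ss @ [ss ! i]" using i by (simp add: take_Suc_conv_app_nth)
    have "greedy n (take (Suc i) ss)"
      using gs greedy_append[of n "take (Suc i) ss" "drop (Suc i) ss"] unfolding append_take_drop_id by blast
    then have gt: "greedy n (take i ss @ [ss ! i])" by (simp only: t)
    have pt: "perms n (take (Suc i) ss)" using greedy_perms[OF gt] t by simp
    have pi: "ss ! i permutes {1..n}" using greedy_perms[OF gt] by simp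
    show "max_nonrepeating_right_divisor n (perm_braid n (ss ! i)) (word_braid n (map (Pair True) (take (Suc i) ss)))"
      unfolding word_braid_positive[OF pt] perm_braid_eq[OF pi]
      by (rule max_nonrepeating_right_divisor_pb[OF pw(1)[OF pi] set_words[OF pt]]) (use greedy_maxdiv[OF gt] t in simp)
  qed (use n in simp)
  have ws: "words n (rev rs) = words n ss @ dlp n d"
    using rs words_filter_id[of n "rev (dropWhile ?P rs)"] by (simp add: words_half_twists ss_def)
  have sset: "set (words n ss) \<subseteq> {1..<n}" by (rule set_words[OF ps])
  have "word_braid n (strip n rs m) = pb n (words n ss) \<otimes>\<^bsub>braid_group n\<^esub> word_braid n tail"
    unfolding st word_braid_append[OF ls lt] word_braid_positive[OF ps] ..
  also have "\<dots> = gval n (words n ss @ dlp n d) m"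
  proof (cases "d < m")
    case True
    then have "tail = replicate (m - d) (False, half_twist n)" by (auto simp: tail_def p_def nat_diff_distrib)
    then have "pb n (words n ss) \<otimes>\<^bsub>braid_group n\<^esub> word_braid n tail = gval n (words n ss) (m - d)"
      by (simp add: half_twist_power gval_def)
    then show ?thesis using gval_add[OF sset, of d "m - d"] True by simp
  next
    case False
    then have "tail = replicate (d - m) (True, half_twist n)" by (auto simp: tail_def p_def nat_diff_distrib)
    then have "pb n (words n ss) \<otimes>\<^bsub>braid_group n\<^esub> word_braid n tail = gval n (words n ss @ dlp n (d - m)) 0"
      using sset set_dlp[of n "d - m"] by (simp add: half_twist_power pb_append)
    also have "\<dots> = gval n ((words n ss @ dlp n (d - m)) @ dlp n m) (0 + m)"
      by (rule gval_add[symmetric]) (use sset set_dlp in auto)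
    also have "\<dots> = gval n (words n ss @ dlp n d) m" using False dlp_add[of n "d - m" m] by simp
    finally show ?thesis .
  qed
  finally show "word_braid n (strip n rs m) = gval n (words n (rev rs)) m" unfolding ws .
qed

section \<open>Doubling a strand\<close>

text \<open>Positions before and after doubling the strand at \<open>j\<close>: the copies are at
  \<open>j\<close> and \<open>Suc j\<close>, and \<open>up j\<close> sends \<open>j\<close> to the
  first copy. The map \<open>coll\<close> below is the collapse in the other direction.\<close>

definition up :: "nat \<Rightarrow> nat \<Rightarrow> nat" where
  "up j v = (if v \<le> j then v else Suc v)"

definition coll :: "nat \<Rightarrow> nat \<Rightarrow> nat" where
  "coll i k = (if k \<le> i then k else k - 1)"

definition dbl :: "nat \<Rightarrow> (nat \<Rightarrow> nat) \<Rightarrow> nat \<Rightarrow> nat" where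
  "dbl i s k = (if k = Suc i then Suc (s i) else up (s i) (s (coll i k)))"

lemma coll_up [simp]: "coll j (up j v) = v"
  by (auto simp: coll_def up_def)

lemma up_neq [simp]: "up j v \<noteq> Suc j" "Suc j \<noteq> up j v"
  by (auto simp: up_def)

lemma up_coll: "k \<noteq> Suc i \<Longrightarrow> up i (coll i k) = k"
  by (auto simp: coll_def up_def)

lemma up_less_iff [simp]: "up j v < up j w \<longleftrightarrow> v < w" "up j v = up j w \<longleftrightarrow> v = w"
  by (auto simp: up_def)

lemma dbl_same [simp]: "dbl i s i = s i" "dbl i s (Suc i) = Suc (s i)"
  by (auto simp: dbl_def coll_def up_def)

lemma dbl_up: "dbl i s (up i j) = up (s i) (s j)"
  by (simp add: dbl_def)

lemma dbl_comp: "dbl i (s \<circ> t) = dbl (t i) s \<circ> dbl i t"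
  by (simp add: fun_eq_iff dbl_def)

lemma dbl_id: "dbl i id = id"
  by (auto simp: fun_eq_iff dbl_def up_coll)

lemma dbl_less:
  assumes "inj s"
  shows "dbl i s k < dbl i s l \<longleftrightarrow> (if coll i k = coll i l then k < l else s (coll i k) < s (coll i l))"
proof -
  have ne: "s x = s y \<longleftrightarrow> x = y" for x y using assms by (simp add: inj_eq)
  have c: "coll i k = i \<longleftrightarrow> k = i \<or> k = Suc i" for k by (auto simp: coll_def)
  have e: "coll i k = coll i l \<Longrightarrow> k = l \<or> k \<in> {i, Suc i} \<and> l \<in> {i, Suc i}" by (auto simp: coll_def split: if_splits)
  have d: "dbl i s k = (if k = Suc i then Suc (s i) else if k = i then s i else up (s i) (s (coll i k)))" for k
    by (auto simp: dbl_def coll_def up_def)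
  show ?thesis
  proof (cases "coll i k = coll i l")
    case True
    from e[OF True] show ?thesis using True by auto
  next
    case False
    then have "s (coll i k) \<noteq> s (coll i l)" using ne by simp
    moreover have "k \<in> {i, Suc i} \<Longrightarrow> coll i k = i" "l \<in> {i, Suc i} \<Longrightarrow> coll i l = i" using c by auto
    ultimately show ?thesis using False c[of k] c[of l] by (auto simp: d up_def)
  qed
qed

lemma inj_dbl:
  assumes "inj s"
  shows "inj (dbl i s)"
proof (rule injI)
  fix k l assume eq: "dbl i s k = dbl i s l"
  show "k = l"
  proof (rule ccontr)
    assume "k \<noteq> l"
    then have "dbl i s k < dbl i s l \<or> dbl i s l < dbl i s k"
      unfolding dbl_less[OF assms] using inj_eq[OF assms, of "coll i k" "coll i l"]
      by (cases "coll i k = coll i l") (simp_all add: nat_neq_iff)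
    then show False using eq by simp
  qed
qed

definition blk :: "nat \<Rightarrow> nat \<Rightarrow> nat list" where
  "blk i j = (if i < j then [Suc j] else if i = j then [Suc j, j] else if i = Suc j then [j, Suc j] else [j])"

fun pdbl :: "nat \<Rightarrow> nat list \<Rightarrow> nat list" where
  "pdbl i [] = []"
| "pdbl i (j # w) = blk i j @ pdbl (transpose j (Suc j) i) w"

lemma pdbl_append: "pdbl i (u @ v) = pdbl i u @ pdbl (pend u i) v"
  by (induction u arbitrary: i) auto

lemma double_strand_pos: "double_strand i (pos w) = pos (pdbl i w)"
  by (induction w arbitrary: i) (auto simp: blk_def)

lemma double_strand_snd: "map snd (double_strand i w) = pdbl i (map snd w)"
proof (induction w arbitrary: i)
  case (Cons x w)
  then show ?case by (cases x) (auto simp: blk_def)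
qed simp

lemma strand_end_pend: "strand_end w = pend (map snd w)"
proof
  fix i show "strand_end w i = pend (map snd w) i"
  proof (induction w arbitrary: i)
    case (Cons x w)
    then show ?case by (cases x) simp
  qed simp
qed

lemma pend_blk: "pend (blk i j) = dbl i (transpose j (Suc j))"
proof
  fix k
  consider "i < j" | "i = j" | "i = Suc j" | "Suc j < i" by linarith
  then show "pend (blk i j) k = dbl i (transpose j (Suc j)) k"
  proof cases
    case 1
    then have "blk i j = [Suc j]" "transpose j (Suc j) i = i" by (simp_all add: blk_def transpose_Suc)
    then show ?thesis using 1 by (simp add: dbl_def up_def coll_def transpose_Suc) arith
  next
    case 2
    then have "blk i j = [Suc j, j]" by (simp add: blk_def)
    then show ?thesis using 2 by (simp add: dbl_def up_def coll_def transpose_Suc) arith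
  next
    case 3
    then have "blk i j = [j, Suc j]" by (simp add: blk_def)
    then show ?thesis using 3 by (simp add: dbl_def up_def coll_def transpose_Suc) arith
  next
    case 4
    then have "blk i j = [j]" "transpose j (Suc j) i = i" by (simp_all add: blk_def transpose_Suc)
    then show ?thesis using 4 by (simp add: dbl_def up_def coll_def transpose_Suc) arith
  qed
qed

lemma pend_pdbl: "pend (pdbl i w) = dbl i (pend w)"
proof (induction w arbitrary: i)
  case Nil
  then show ?case by (simp only: pdbl.simps pend_Nil dbl_id)
next
  case (Cons j w)
  then show ?case by (simp only: pdbl.simps pend_append pend_blk pend_Cons dbl_comp)
qed

lemma set_pdbl: "set w \<subseteq> {1..<n} \<Longrightarrow> set (pdbl i w) \<subseteq> {1..<Suc n}"
proof (induction w arbitrary: i)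
  case (Cons j w)
  have "set (blk i j) \<subseteq> {1..<Suc n}" using Cons.prems by (auto simp: blk_def)
  then show ?case using Cons by simp
qed simp

lemma inj_pend': "inj (pend w)"
  by (rule bij_is_inj[OF bij_pend])

text \<open>The copies of the doubled strand are parallel and do not cross, and each of them meets
  any other strand as often as the original does.\<close>

lemma nonrep_pdbl: "nonrep w \<Longrightarrow> nonrep (pdbl i w)"
proof (induction w arbitrary: i)
  case (Cons j w)
  let ?i = "transpose j (Suc j) i"
  have 1: "nonrep (pdbl ?i w)" using Cons by simp
  have 2: "pend w j < pend w (Suc j)" using Cons.prems by simp
  have 3: "pend (pdbl ?i w) k < pend (pdbl ?i w) l \<longleftrightarrow>
    (if coll ?i k = coll ?i l then k < l else pend w (coll ?i k) < pend w (coll ?i l))" for k l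
    unfolding pend_pdbl by (rule dbl_less[OF inj_pend'])
  consider "i < j" | "i = j" | "i = Suc j" | "Suc j < i" by linarith
  then show ?case
    by cases (use 1 2 3 in \<open>auto simp: blk_def transpose_Suc coll_def\<close>)
qed simp

lemma dbl_permutes:
  assumes "s permutes {1..n}"
  shows "dbl i s permutes {1..Suc n}"
  using pend_permutes[OF set_pdbl[OF pw(1)[OF assms]], of i] by (simp only: pend_pdbl pw(3)[OF assms])

lemma pw_dbl:
  assumes "s permutes {1..n}"
  shows "pw (Suc n) (dbl i s) \<approx> pdbl i (pw n s)"
  by (rule pw_peq) (use set_pdbl[OF pw(1)[OF assms]] nonrep_pdbl[OF pw(2)[OF assms]] pw(3)[OF assms] in \<open>auto simp: pend_pdbl\<close>)

subsection \<open>Doubling of braids\<close>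

lemma strand_end_append: "strand_end (u @ v) = strand_end v \<circ> strand_end u"
  by (simp add: strand_end_pend pend_append)

lemma double_strand_append: "double_strand i (u @ v) = double_strand i u @ double_strand (strand_end u i) v"
proof (induction u arbitrary: i)
  case (Cons x u)
  then show ?case by (cases x) simp
qed simp

lemma double_strand_words: "w \<in> artin_words n \<Longrightarrow> double_strand i w \<in> artin_words (Suc n)"
proof (induction w arbitrary: i)
  case (Cons x w)
  obtain e j where x: "x = (e, j)" by (cases x)
  have "double_strand (transpose j (Suc j) i) w \<in> artin_words (Suc n)" "1 \<le> j" "j < n" using Cons x by auto
  then show ?case unfolding x double_strand.simps artin_words_simps(3) by auto
qed simp

lemma strand_end_equiv: "braid_equiv n v w \<Longrightarrow> strand_end v = strand_end w"
proof (induction rule: braid_equiv.induct)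
  case (cancel u v i e)
  then show ?case by (simp add: strand_end_append fun_eq_iff)
next
  case (far u v i j)
  have "[i, j] \<approx> [j, i]" using peq_far[of i j "[j]" "[]"] far by (simp add: far_def)
  from pend_peq[OF this] have *: "pend v (pend [i, j] x) = pend v (pend [j, i] x)" for v x by (simp only:)
  show ?case using * by (simp add: strand_end_pend pend_append fun_eq_iff)
next
  case (near u v i)
  have "[i, Suc i, i] \<approx> [Suc i, i, Suc i]" using peq_near[of i "Suc i" "[Suc i, i]" "[]"] by (simp add: near_def)
  from pend_peq[OF this] have *: "pend v (pend [i, Suc i, i] x) = pend v (pend [Suc i, i, Suc i] x)" for v x by (simp only:)
  show ?case using * by (simp add: strand_end_pend pend_append fun_eq_iff flip: Suc_eq_plus1)
qed auto

lemma double_strand_local: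
  assumes "braid_equiv (Suc n) (double_strand (strand_end u i) x) (double_strand (strand_end u i) y)"
    "strand_end x = strand_end y" "u \<in> artin_words n" "v \<in> artin_words n"
  shows "braid_equiv (Suc n) (double_strand i (u @ x @ v)) (double_strand i (u @ y @ v))"
  unfolding double_strand_append strand_end_append assms(2)
  by (rule braid_equiv_context[OF assms(1)]) (use assms double_strand_words in auto)

lemma double_strand_nonrep_equiv:
  assumes "nonrep u" "nonrep v" "u \<approx> v" "set u \<subseteq> {1..<n}"
  shows "braid_equiv (Suc n) (double_strand i (pos u)) (double_strand i (pos v))"
proof -
  have v: "set v \<subseteq> {1..<n}" using peq_set[OF assms(3)] assms(4) by simp
  have "pdbl i u \<approx> pdbl i v"
    by (rule nonrep_unique[OF nonrep_pdbl[OF assms(1)] nonrep_pdbl[OF assms(2)] _ set_pdbl[OF assms(4)] set_pdbl[OF v]])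
      (simp add: pend_pdbl pend_peq[OF assms(3)])
  then show ?thesis unfolding double_strand_pos by (rule pos_equiv[OF _ set_pdbl[OF assms(4)]])
qed

text \<open>The sides of a braid relation are non-repeating. Hence so are their doublings, and two
  non-repeating words with the same permutation are equivalent.\<close>

lemma double_strand_equiv: "braid_equiv n v w \<Longrightarrow> braid_equiv (Suc n) (double_strand i v) (double_strand i w)"
proof (induction rule: braid_equiv.induct)
  case (refl w)
  then show ?case by (intro braid_equiv.refl double_strand_words)
next
  case (sym v w)
  show ?case by (rule braid_equiv.sym[OF sym.IH])
next
  case (trans u v w)
  then show ?case using braid_equiv.trans by blast
next
  case (cancel u v j e)
  let ?i = "strand_end u i"
  have c: "braid_equiv (Suc n) [(e, k), (\<not> e, k)] []" if "k \<in> {1..<Suc n}" for k e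
    using braid_equiv.cancel[of "[]" "Suc n" "[]" k e] that by simp
  have c2: "braid_equiv (Suc n) [(e, k), (e, l), (\<not> e, l), (\<not> e, k)] []" if kl: "k \<in> {1..<Suc n}" "l \<in> {1..<Suc n}" for k l e
  proof -
    have "braid_equiv (Suc n) ([(e, k)] @ [(e, l), (\<not> e, l)] @ [(\<not> e, k)]) ([(e, k)] @ [] @ [(\<not> e, k)])"
      by (rule braid_equiv_context[OF c[OF kl(2)]]) (use kl in simp_all)
    then have "braid_equiv (Suc n) [(e, k), (e, l), (\<not> e, l), (\<not> e, k)] [(e, k), (\<not> e, k)]" by simp
    from braid_equiv.trans[OF this c[OF kl(1)]] show ?thesis .
  qed
  have j: "j \<in> {1..<Suc n}" "Suc j \<in> {1..<Suc n}" using cancel by auto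
  consider "?i < j" | "?i = j" | "?i = Suc j" | "Suc j < ?i" by linarith
  then have "braid_equiv (Suc n) (double_strand ?i [(e, j), (\<not> e, j)]) (double_strand ?i [])"
  proof cases
    case 1 then show ?thesis using c[OF j(2), of e] by (simp add: transpose_Suc)
  next
    case 2 then show ?thesis using c2[OF j(2,1), of e] by (simp add: transpose_Suc)
  next
    case 3 then show ?thesis using c2[OF j(1,2), of e] by (simp add: transpose_Suc)
  next
    case 4 then show ?thesis using c[OF j(1), of e] by (simp add: transpose_Suc)
  qed
  then have "braid_equiv (Suc n) (double_strand i (u @ [(e, j), (\<not> e, j)] @ v)) (double_strand i (u @ [] @ v))"
    by (rule double_strand_local[OF _ _ cancel(1,2)]) (simp add: fun_eq_iff)
  then show ?case by simp
next
  case (far u v j k)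
  have e: "[j, k] \<approx> [k, j]" using peq_far[of j k "[k]" "[]"] far by (simp add: far_def)
  have nr: "nonrep [j, k]" "nonrep [k, j]" using far by (auto simp: transpose_Suc)
  have "braid_equiv (Suc n) (double_strand (strand_end u i) (pos [j, k])) (double_strand (strand_end u i) (pos [k, j]))"
    by (rule double_strand_nonrep_equiv[OF nr e]) (use far in auto)
  then have "braid_equiv (Suc n) (double_strand i (u @ pos [j, k] @ v)) (double_strand i (u @ pos [k, j] @ v))"
    by (rule double_strand_local[OF _ _ far(1,2)]) (simp only: strand_end_pos pend_peq[OF e])
  then show ?case by simp
next
  case (near u v j)
  have e: "[j, Suc j, j] \<approx> [Suc j, j, Suc j]" using peq_near[of j "Suc j" "[Suc j, j]" "[]"] by (simp add: near_def)
  have nr: "nonrep [j, Suc j, j]" "nonrep [Suc j, j, Suc j]" by (auto simp: transpose_Suc)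
  have "braid_equiv (Suc n) (double_strand (strand_end u i) (pos [j, Suc j, j])) (double_strand (strand_end u i) (pos [Suc j, j, Suc j]))"
    by (rule double_strand_nonrep_equiv[OF nr e]) (use near in auto)
  then have "braid_equiv (Suc n) (double_strand i (u @ pos [j, Suc j, j] @ v)) (double_strand i (u @ pos [Suc j, j, Suc j] @ v))"
    by (rule double_strand_local[OF _ _ near(1,2)]) (simp only: strand_end_pos pend_peq[OF e])
  then show ?case by (simp flip: Suc_eq_plus1)
qed

text \<open>The permutation of a braid; the choice of a word is harmless by
  \<open>strand_end_equiv\<close>.\<close>

definition bend :: "braid \<Rightarrow> nat \<Rightarrow> nat" where
  "bend b = strand_end (SOME w. w \<in> b)"

text \<open>The map \<open>\<iota>\<^sub>i\<close> on braids; the choice of a word is harmless by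
  \<open>double_strand_equiv\<close>.\<close>

definition dbr :: "nat \<Rightarrow> nat \<Rightarrow> braid \<Rightarrow> braid" where
  "dbr n i b = braid_of (Suc n) (double_strand i (SOME w. w \<in> b))"

lemma some_braid_of: "w \<in> artin_words n \<Longrightarrow> braid_equiv n w (SOME v. v \<in> braid_of n w)"
  unfolding mem_braid_of by (rule someI, rule braid_equiv.refl)

lemma bend [simp]: "w \<in> artin_words n \<Longrightarrow> bend (braid_of n w) = strand_end w"
  unfolding bend_def using strand_end_equiv[OF some_braid_of] by simp

lemma dbr [simp]: "w \<in> artin_words n \<Longrightarrow> dbr n i (braid_of n w) = braid_of (Suc n) (double_strand i w)"
  unfolding dbr_def using braid_of_eqI[OF double_strand_equiv[OF some_braid_of]] by simp

lemma strand_end_permutes: "w \<in> artin_words n \<Longrightarrow> strand_end w permutes {1..n}"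
  unfolding strand_end_pend by (rule pend_permutes) (auto simp: artin_words_def)

lemma bend_permutes: "b \<in> carrier (braid_group n) \<Longrightarrow> bend b permutes {1..n}"
  using strand_end_permutes by (auto simp: braid_carrier)

lemma dbr_carrier [simp]: "b \<in> carrier (braid_group n) \<Longrightarrow> dbr n i b \<in> carrier (braid_group (Suc n))"
  using double_strand_words by (auto simp: braid_carrier)

lemma bend_mult:
  assumes "b \<in> carrier (braid_group n)" "c \<in> carrier (braid_group n)"
  shows "bend (b \<otimes>\<^bsub>braid_group n\<^esub> c) = bend c \<circ> bend b"
  using assms by (auto simp: braid_carrier strand_end_append)

lemma dbr_mult:
  assumes "b \<in> carrier (braid_group n)" "c \<in> carrier (braid_group n)"
  shows "dbr n i (b \<otimes>\<^bsub>braid_group n\<^esub> c) = dbr n i b \<otimes>\<^bsub>braid_group (Suc n)\<^esub> dbr n (bend b i) c"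
  using assms by (auto simp: braid_carrier double_strand_append double_strand_words)

lemma double_strand_winv: "double_strand (strand_end w i) (winv w) = winv (double_strand i w)"
proof (induction w arbitrary: i)
  case (Cons x w)
  obtain e j where x: "x = (e, j)" by (cases x)
  have "strand_end (winv w) (strand_end w k) = k" for k
  proof (induction w arbitrary: k)
    case (Cons x w)
    then show ?case by (cases x) (simp add: strand_end_append)
  qed simp
  then show ?case using Cons[of "transpose j (Suc j) i"] x
    by (auto simp: double_strand_append strand_end_append transpose_Suc)
qed simp

lemma strand_end_winv: "strand_end (winv w) = pinv (strand_end w)"
proof -
  have 1: "strand_end (winv w) (strand_end w k) = k" for w k
  proof (induction w arbitrary: k)
    case (Cons x w)
    then show ?case by (cases x) (simp add: strand_end_append)
  qed simp
  show ?thesis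
    by (rule inv_equality[symmetric]) (use 1 1[of "winv w"] in simp_all)
qed

lemma bend_inv: "b \<in> carrier (braid_group n) \<Longrightarrow> bend (inv\<^bsub>braid_group n\<^esub> b) = pinv (bend b)"
  by (auto simp: braid_carrier strand_end_winv)

text \<open>In the inverse braid, the doubled strand starts where it ends in the braid.\<close>

lemma dbr_inv:
  assumes "b \<in> carrier (braid_group n)"
  shows "dbr n (bend b i) (inv\<^bsub>braid_group n\<^esub> b) = inv\<^bsub>braid_group (Suc n)\<^esub> (dbr n i b)"
  using assms by (auto simp: braid_carrier double_strand_winv double_strand_words)

lemma bend_pb: "set u \<subseteq> {1..<n} \<Longrightarrow> bend (pb n u) = pend u"
  by (simp add: pb_def pos_words strand_end_pos)

lemma dbr_pb: "set u \<subseteq> {1..<n} \<Longrightarrow> dbr n i (pb n u) = pb (Suc n) (pdbl i u)"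
  by (simp add: pb_def pos_words double_strand_pos)

subsection \<open>Doubling two strands\<close>

lemma braid_equiv_winv: "braid_equiv n v w \<Longrightarrow> braid_equiv n (winv v) (winv w)"
  using braid_inv[of v n] braid_inv[of w n] braid_of_eqI[of n v w] braid_of_eq_iff[of "winv v" n "winv w"]
    braid_equiv_words[of n v w] by simp

lemma far_equiv:
  assumes "i + 2 \<le> j" "1 \<le> i" "j < n"
  shows "braid_equiv n [(e, i), (e, j)] [(e, j), (e, i)]"
proof -
  have "braid_equiv n [(True, i), (True, j)] [(True, j), (True, i)]"
    using braid_equiv.far[of "[]" n "[]" i j] assms by simp
  from this braid_equiv_winv[OF braid_equiv.sym[OF this]] show ?thesis by (cases e) simp_all
qed

lemma double_letter_commute:
  assumes "i \<noteq> j" "1 \<le> k" "k < n"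
  shows "braid_equiv (Suc (Suc n)) (double_strand (up i j) (double_strand i [(e, k)])) (double_strand (up j i) (double_strand j [(e, k)]))"
proof -
  have two: "braid_equiv (Suc (Suc n)) [(e, Suc k), (e, Suc (Suc k)), (e, k), (e, Suc k)] [(e, Suc k), (e, k), (e, Suc (Suc k)), (e, Suc k)]"
    using braid_equiv_context[OF braid_equiv.sym[OF far_equiv[of k "Suc (Suc k)" "Suc (Suc n)" e]], of "[(e, Suc k)]" "[(e, Suc k)]"] assms by simp
  consider "i = k" "j = Suc k" | "i = Suc k" "j = k" | "\<not> (i = k \<and> j = Suc k)" "\<not> (i = Suc k \<and> j = k)" by blast
  then show ?thesis
  proof cases
    case 1
    then show ?thesis using two by (simp add: up_def transpose_Suc)
  next
    case 2
    then show ?thesis using braid_equiv.sym[OF two] by (simp add: up_def transpose_Suc)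
  next
    case 3
    have "double_strand (up i j) (double_strand i [(e, k)]) = double_strand (up j i) (double_strand j [(e, k)])"
      using 3 assms(1) by (auto simp: up_def transpose_Suc)
    moreover have "double_strand (up j i) (double_strand j [(e, k)]) \<in> artin_words (Suc (Suc n))"
      by (intro double_strand_words) (use assms in simp)
    ultimately show ?thesis using braid_equiv.refl by simp
  qed
qed

lemma double_strand_commute:
  assumes "i \<noteq> j" "w \<in> artin_words n"
  shows "braid_equiv (Suc (Suc n)) (double_strand (up i j) (double_strand i w)) (double_strand (up j i) (double_strand j w))"
  using assms
proof (induction w arbitrary: i j)
  case (Cons x w)
  obtain e k where x: "x = (e, k)" by (cases x)
  have k: "1 \<le> k" "k < n" and w: "w \<in> artin_words n" using Cons.prems x by auto
  let ?t = "transpose k (Suc k)"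
  have se: "strand_end (double_strand i [(e, k)]) (up i j) = up (?t i) (?t j)" for i j
    by (simp only: strand_end_pend double_strand_snd list.map snd_conv pdbl.simps append_Nil2 pend_blk dbl_up)
  have split: "double_strand (up i j) (double_strand i ((e, k) # w))
     = double_strand (up i j) (double_strand i [(e, k)]) @ double_strand (up (?t i) (?t j)) (double_strand (?t i) w)" for i j
    using double_strand_append[of i "[(e, k)]" w]
      double_strand_append[of "up i j" "double_strand i [(e, k)]" "double_strand (?t i) w"]
    unfolding se by simp
  have "?t i \<noteq> ?t j" using Cons.prems(1) by (metis transpose_involutory)
  from braid_equiv_append[OF double_letter_commute[OF Cons.prems(1) k] Cons.IH[OF this w]]
  show ?case unfolding x split .
qed (auto intro: braid_equiv.refl)

lemma dbr_commute:
  assumes "i \<noteq> j" "b \<in> carrier (braid_group n)"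
  shows "dbr (Suc n) (up i j) (dbr n i b) = dbr (Suc n) (up j i) (dbr n j b)"
proof -
  obtain w where w: "w \<in> artin_words n" "b = braid_of n w" using assms(2) braid_carrier by blast
  then show ?thesis
    using braid_of_eqI[OF double_strand_commute[OF assms(1) w(1)]] by (simp add: double_strand_words)
qed

lemma bend_dbr:
  assumes "b \<in> carrier (braid_group n)"
  shows "bend (dbr n i b) = dbl i (bend b)"
proof -
  obtain w where w: "w \<in> artin_words n" "b = braid_of n w" using assms braid_carrier by blast
  then show ?thesis by (simp add: double_strand_words strand_end_pend double_strand_snd pend_pdbl)
qed

subsection \<open>Doubling a strand of a word in non-repeating braids\<close>

definition lend :: "bool \<times> (nat \<Rightarrow> nat) \<Rightarrow> nat \<Rightarrow> nat" where
  "lend x i = (if fst x then snd x i else pinv (snd x) i)"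

fun dblw :: "nat \<Rightarrow> perm_word \<Rightarrow> perm_word" where
  "dblw i [] = []"
| "dblw i ((e, s) # w) = (e, if e then dbl i s else dbl (pinv s i) s) # dblw (lend (e, s) i) w"

fun wend :: "perm_word \<Rightarrow> nat \<Rightarrow> nat" where
  "wend [] i = i"
| "wend (x # w) i = wend w (lend x i)"

lemma length_dblw [simp]: "length (dblw i w) = length w"
  by (induction i w rule: dblw.induct) auto

lemma perm_braid_carrier: "s permutes {1..n} \<Longrightarrow> perm_braid n s \<in> carrier (braid_group n)"
  using pw(1) by (simp add: perm_braid_eq)

lemma bend_perm_braid: "s permutes {1..n} \<Longrightarrow> bend (perm_braid n s) = s"
  using pw by (simp add: perm_braid_eq bend_pb)

lemma dbr_perm_braid:
  assumes "s permutes {1..n}"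
  shows "dbr n i (perm_braid n s) = perm_braid (Suc n) (dbl i s)"
  unfolding perm_braid_eq[OF assms] dbr_pb[OF pw(1)[OF assms]]
  using perm_braid_pend[OF set_pdbl[OF pw(1)[OF assms]] nonrep_pdbl[OF pw(2)[OF assms]], of i]
  unfolding pend_pdbl pw(3)[OF assms] by (rule HOL.sym)

lemma bend_letter: "s permutes {1..n} \<Longrightarrow> bend (letter_braid n (e, s)) i = lend (e, s) i"
  by (cases e) (simp_all add: lend_def bend_perm_braid bend_inv perm_braid_carrier)

lemma dbr_letter:
  assumes "s permutes {1..n}"
  shows "dbr n i (letter_braid n (e, s)) = letter_braid (Suc n) (e, if e then dbl i s else dbl (pinv s i) s)"
proof (cases e)
  case False
  have "i = bend (perm_braid n s) (pinv s i)"
    using permutes_inverses(1)[OF assms] by (simp add: bend_perm_braid[OF assms])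
  then have "dbr n i (inv\<^bsub>braid_group n\<^esub> (perm_braid n s)) = inv\<^bsub>braid_group (Suc n)\<^esub> (dbr n (pinv s i) (perm_braid n s))"
    using dbr_inv[OF perm_braid_carrier[OF assms], of "pinv s i"] by simp
  then show ?thesis using False by (simp add: dbr_perm_braid[OF assms])
qed (simp add: dbr_perm_braid[OF assms])

lemma dblw:
  assumes "letters n w"
  shows "letters (Suc n) (dblw i w) \<and> word_braid (Suc n) (dblw i w) = dbr n i (word_braid n w) \<and>
    bend (word_braid n w) i = wend w i"
  using assms
proof (induction w arbitrary: i)
  case Nil
  then show ?case by (simp add: word_braid_Nil braid_one)
next
  case (Cons x w)
  obtain e s where x: "x = (e, s)" by (cases x)
  have s: "s permutes {1..n}" and w: "letters n w" using Cons.prems x by auto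
  note c = letter_braid_carrier[OF s, of e] word_braid_carrier[OF w]
  show ?case
    using Cons.IH[OF w, of "lend (e, s) i"] dbl_permutes[OF s]
    by (simp add: x word_braid_Cons dbr_mult[OF c] dbr_letter[OF s] bend_letter[OF s] bend_mult[OF c] del: letter_braid.simps)
qed

lemma wend_range:
  assumes "letters n w" "i \<in> {1..n}"
  shows "wend w i \<in> {1..n}"
  using permutes_in_image[OF bend_permutes[OF word_braid_carrier[OF assms(1)]], of i] dblw[OF assms(1)] assms(2) by metis

definition winvw :: "perm_word \<Rightarrow> perm_word" where
  "winvw w = rev (map (\<lambda>(e, s). (\<not> e, s)) w)"

lemma letters_winvw [simp]: "letters n (winvw w) \<longleftrightarrow> letters n w"
  by (induction w) (auto simp: winvw_def)

lemma word_braid_winvw: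
  assumes "letters n w"
  shows "word_braid n (winvw w) = inv\<^bsub>braid_group n\<^esub> (word_braid n w)"
  using assms
proof (induction w)
  interpret group "braid_group n" by (rule group_braid_group)
  case Nil
  then show ?case by (simp add: winvw_def word_braid_Nil)
next
  interpret group "braid_group n" by (rule group_braid_group)
  case (Cons x w)
  obtain e s where x: "x = (e, s)" by (cases x)
  have s: "s permutes {1..n}" and w: "letters n w" using Cons.prems x by auto
  note c = letter_braid_carrier[OF s, of e] word_braid_carrier[OF w]
  have l: "letter_braid n (\<not> e, s) = inv\<^bsub>braid_group n\<^esub> (letter_braid n (e, s))"
    using perm_braid_carrier[OF s] by (cases e) simp_all
  have "winvw (x # w) = winvw w @ [(\<not> e, s)]" by (simp add: winvw_def x)
  then have "word_braid n (winvw (x # w)) = word_braid n (winvw w) \<otimes>\<^bsub>braid_group n\<^esub> word_braid n [(\<not> e, s)]"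
    using w s by (simp add: word_braid_append del: letter_braid.simps)
  also have "word_braid n [(\<not> e, s)] = inv\<^bsub>braid_group n\<^esub> (letter_braid n (e, s))"
    using c by (simp add: word_braid_Cons word_braid_Nil l del: letter_braid.simps)
  finally show ?case using Cons.IH[OF w] c by (simp add: word_braid_Cons x inv_mult_group del: letter_braid.simps)
qed

section \<open>Ribbons\<close>

text \<open>The strand at \<open>a\<close> is replaced by a ribbon of two neighbouring strands,
  and the flag \<open>c\<close> tells whether these two strands cross within the letter.\<close>

definition rib :: "bool \<Rightarrow> nat \<Rightarrow> (nat \<Rightarrow> nat) \<Rightarrow> nat \<Rightarrow> nat" where
  "rib c a s = (if c then dbl a s \<circ> transpose a (Suc a) else dbl a s)"

lemma rib_same: "rib c a s a = (if c then Suc (s a) else s a)" "rib c a s (Suc a) = (if c then s a else Suc (s a))"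
  by (simp_all add: rib_def)

lemma rib_up: "rib c a s (up a k) = (if c \<and> k = a then Suc (s a) else up (s a) (s k))"
proof (cases "k = a")
  case True
  then have "up a k = a" by (simp add: up_def)
  then show ?thesis using True by (simp add: rib_same) (simp add: up_def)
next
  case False
  then have "up a k \<noteq> a" "up a k \<noteq> Suc a" by (auto simp: up_def)
  then show ?thesis using False dbl_up[of a s k] by (simp add: rib_def transpose_Suc)
qed

lemma rib_permutes:
  assumes "s permutes {1..n}" "a \<in> {1..n}"
  shows "rib c a s permutes {1..Suc n}"
proof -
  have "transpose a (Suc a) permutes {1..Suc n}" using assms(2) by (intro permutes_swap_id) auto
  then show ?thesis unfolding rib_def using dbl_permutes[OF assms(1)] permutes_compose by (cases c) auto
qed

lemma pw_rib:
  assumes s: "s permutes {1..n}" and a: "a \<in> {1..n}"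
  shows "pw (Suc n) (rib c a s) \<approx> (if c then [a] else []) @ pdbl a (pw n s)"
proof (cases c)
  case True
  have "pw (Suc n) (rib c a s) \<approx> a # pdbl a (pw n s)"
  proof (rule pw_peq)
    show "set (a # pdbl a (pw n s)) \<subseteq> {1..<Suc n}" using set_pdbl[OF pw(1)[OF s], of a] a by auto
    show "nonrep (a # pdbl a (pw n s))" using nonrep_pdbl[OF pw(2)[OF s], of a] by (simp add: pend_pdbl)
    show "pend (a # pdbl a (pw n s)) = rib c a s" using True unfolding pend_Cons pend_pdbl pw(3)[OF s] rib_def by simp
  qed
  then show ?thesis using True by simp
next
  case False
  then show ?thesis using pw_dbl[OF s, of a] by (simp add: rib_def)
qed

lemma blk_push: "a # blk a j \<approx> blk a j @ [transpose j (Suc j) a]"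
proof -
  consider "a < j" | "a = j" | "a = Suc j" | "Suc j < a" by linarith
  then show ?thesis
  proof cases
    case 1
    then show ?thesis using peq_far[of a "Suc j" "[Suc j]" "[]"] by (simp add: blk_def transpose_Suc far_def)
  next
    case 2
    then show ?thesis using peq_near[of a "Suc a" "[Suc a, a]" "[]"] by (simp add: blk_def transpose_Suc near_def)
  next
    case 3
    then show ?thesis using peq_near[of "Suc j" j "[j, Suc j]" "[]"] by (simp add: blk_def transpose_Suc near_def)
  next
    case 4
    then show ?thesis using peq_far[of a j "[j]" "[]"] by (simp add: blk_def transpose_Suc far_def)
  qed
qed

lemma pdbl_push: "a # pdbl a x \<approx> pdbl a x @ [pend x a]"
proof (induction x arbitrary: a)
  case (Cons j x)
  let ?a = "transpose j (Suc j) a"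
  have "(a # blk a j) @ pdbl ?a x \<approx> (blk a j @ [?a]) @ pdbl ?a x"
    by (rule peq_append[OF blk_push peq_refl])
  also have "\<dots> \<approx> blk a j @ (pdbl ?a x @ [pend x ?a])" using Cons[of ?a] by simp
  finally show ?case by simp
qed simp

fun ribs :: "nat \<Rightarrow> (bool \<times> (nat \<Rightarrow> nat)) list \<Rightarrow> (nat \<Rightarrow> nat) list" where
  "ribs a [] = []"
| "ribs a ((c, s) # l) = rib c a s # ribs (s a) l"

fun rend :: "nat \<Rightarrow> (nat \<Rightarrow> nat) list \<Rightarrow> nat" where
  "rend a [] = a"
| "rend a (s # ss) = rend (s a) ss"

definition ncross :: "(bool \<times> (nat \<Rightarrow> nat)) list \<Rightarrow> nat" where
  "ncross l = length (filter fst l)"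

lemma ncross_simps [simp]: "ncross [] = 0" "ncross ((c, s) # l) = (if c then Suc (ncross l) else ncross l)"
  "ncross (k @ l) = ncross k + ncross l"
  by (simp_all add: ncross_def)

lemma length_ribs [simp]: "length (ribs a l) = length l"
  by (induction a l rule: ribs.induct) auto

lemma rend_words: "perms n ss \<Longrightarrow> pend (words n ss) a = rend a ss"
  by (induction ss arbitrary: a) (simp_all add: pend_append pw(3))

lemma perm_range: "s permutes {1..n} \<Longrightarrow> a \<in> {1..n} \<Longrightarrow> s a \<in> {1..n}"
  by (simp only: permutes_in_image)

lemma rend_range: "perms n ss \<Longrightarrow> a \<in> {1..n} \<Longrightarrow> rend a ss \<in> {1..n}"
  by (induction ss arbitrary: a) (simp_all del: atLeastAtMost_iff add: perm_range)

text \<open>A crossing inside the ribbon slides along the ribbon to its lower end, by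
  \<open>pdbl_push\<close>.\<close>

lemma words_ribs:
  assumes "perms n (map snd l)" "a \<in> {1..n}"
  shows "words (Suc n) (ribs a l) \<approx> pdbl a (words n (map snd l)) @ replicate (ncross l) (rend a (map snd l))"
  using assms
proof (induction a l rule: ribs.induct)
  case (2 a c s l)
  have s: "s permutes {1..n}" and l: "perms n (map snd l)" using 2 by auto
  let ?e = "rend (s a) (map snd l)" let ?x = "pw n s @ words n (map snd l)"
  let ?c = "if c then [a] else []" let ?c' = "if c then [?e] else []"
  have e: "pend ?x a = ?e" using rend_words[OF l] pw(3)[OF s] by (simp add: pend_append)
  have x: "pdbl a ?x = pdbl a (pw n s) @ pdbl (s a) (words n (map snd l))"
    using pw(3)[OF s] by (simp add: pdbl_append)
  have "words (Suc n) (ribs a ((c, s) # l)) \<approx>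
      (?c @ pdbl a (pw n s)) @ (pdbl (s a) (words n (map snd l)) @ replicate (ncross l) ?e)"
    using peq_append[OF pw_rib[OF s 2(3)] 2(1)[OF l perm_range[OF s 2(3)]], of c] by simp
  also have "\<dots> = (?c @ pdbl a ?x) @ replicate (ncross l) ?e" unfolding x by simp
  also have "\<dots> \<approx> (pdbl a ?x @ ?c') @ replicate (ncross l) ?e"
    by (rule peq_append[OF _ peq_refl]) (use pdbl_push[of a ?x] e in auto)
  finally show ?case by (cases c) simp_all
qed simp

lemma rib_half_twist:
  assumes "b \<in> {1..n}"
  shows "rib True b (half_twist n) = half_twist (Suc n)"
proof
  fix k
  have hb: "half_twist n b = n + 1 - b" using assms by (simp add: half_twist_def)
  show "rib True b (half_twist n) k = half_twist (Suc n) k"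
  proof (cases "k = b \<or> k = Suc b")
    case True
    then show ?thesis using assms hb by (auto simp: rib_same) (auto simp: half_twist_def)
  next
    case False
    then have "rib True b (half_twist n) k = up (n + 1 - b) (half_twist n (coll b k))"
      by (simp add: rib_def transpose_Suc dbl_def hb)
    also have "\<dots> = half_twist (Suc n) k"
      using False assms by (simp add: half_twist_def up_def coll_def) arith
    finally show ?thesis .
  qed
qed

lemma ribs_half_twists:
  "b \<in> {1..n} \<Longrightarrow> ribs b (replicate m (True, half_twist n)) = replicate m (half_twist (Suc n))"
proof (induction m arbitrary: b)
  case (Suc m)
  then show ?case using Suc.IH[OF perm_range[OF half_twist_permutes Suc.prems]] by (simp add: rib_half_twist)
qed simp

lemma pend_dlp: "pend (dlp n m) = half_twist n ^^ m"
  by (induction m) (simp_all add: pend_append dl(3) funpow_Suc_right del: funpow.simps(2))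

lemma half_twist_pow_involution: "(half_twist n ^^ m) ((half_twist n ^^ m) a) = a"
proof (induction m arbitrary: a)
  case (Suc m)
  have "(half_twist n ^^ Suc m) ((half_twist n ^^ Suc m) a) =
      half_twist n ((half_twist n ^^ m) ((half_twist n ^^ m) (half_twist n a)))"
    by (simp add: funpow_swap1)
  then show ?case using Suc by simp
qed simp

lemma pinv_dlp: "pinv (pend (dlp n m)) = half_twist n ^^ m"
  by (rule inv_equality) (simp_all add: pend_dlp half_twist_pow_involution)

lemma half_twist_pow_range: "a \<in> {1..n} \<Longrightarrow> (half_twist n ^^ m) a \<in> {1..n}"
  using perm_range[OF pend_permutes[OF set_dlp]] pend_dlp by metis

lemma bend_gval:
  assumes "set x \<subseteq> {1..<n}"
  shows "bend (gval n x m) i = (half_twist n ^^ m) (pend x i)"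
proof -
  interpret group "braid_group n" by (rule group_braid_group)
  show ?thesis
    using assms unfolding gval_def
    by (simp add: bend_mult bend_inv set_dlp bend_pb pinv_dlp)
qed

text \<open>Both strands of a ribbon cross in each half twist, so that a ribbon with \<open>m\<close> crossings
  becomes a pair of parallel strands after multiplication with \<open>\<Delta>\<^sup>-\<^sup>m\<close>.\<close>

lemma dbr_gval_ribs:
  assumes l: "perms n (map snd l)" and i: "i \<in> {1..n}"
  shows "dbr n i (gval n (words n (map snd l)) (ncross l)) = gval (Suc n) (words (Suc n) (ribs i l)) (ncross l)"
proof -
  interpret G: group "braid_group (Suc n)" by (rule group_braid_group)
  interpret g: group "braid_group n" by (rule group_braid_group)
  let ?x = "words n (map snd l)" let ?m = "ncross l"
  define b where "b = rend i (map snd l)"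
  define b' where "b' = (half_twist n ^^ ?m) b"
  have x: "set ?x \<subseteq> {1..<n}" by (rule set_words[OF l])
  have b: "b \<in> {1..n}" unfolding b_def by (rule rend_range[OF l i])
  have b': "b' \<in> {1..n}" unfolding b'_def by (rule half_twist_pow_range[OF b])
  have e: "pend ?x i = b" unfolding b_def by (rule rend_words[OF l])
  have e': "pend (dlp n ?m) b' = b" unfolding b'_def pend_dlp by (rule half_twist_pow_involution)
  let ?A = "pb (Suc n) (pdbl b' (dlp n ?m))" let ?R = "pb (Suc n) (replicate ?m b)" let ?D = "pb (Suc n) (dlp (Suc n) ?m)"
  have sr: "set (replicate ?m b) \<subseteq> {1..<Suc n}" using b by auto
  note cA = pb_carrier[OF set_pdbl[OF set_dlp[of n ?m]], of b'] and cR = pb_carrier[OF sr]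
    and cD = pb_carrier[OF set_dlp[of "Suc n" ?m]] and cX = pb_carrier[OF set_pdbl[OF x], of i]
  have pr: "perms n (map snd (replicate ?m (True, half_twist n)))" by (simp add: perms_def)
  have nc: "ncross (replicate k (True, half_twist n)) = k" for k by (simp add: ncross_def)
  have "rend b' (replicate ?m (half_twist n)) = b"
    using rend_words[OF pr, of b'] e' by (simp add: words_half_twists)
  then have "dlp (Suc n) ?m \<approx> pdbl b' (dlp n ?m) @ replicate ?m b"
    using words_ribs[OF pr b'] by (simp add: ribs_half_twists[OF b'] words_half_twists nc)
  from pb_eqI[OF this set_dlp] have D: "?D = ?A \<otimes>\<^bsub>braid_group (Suc n)\<^esub> ?R"
    using pb_append[OF set_pdbl[OF set_dlp] sr] by simp
  have invA: "inv\<^bsub>braid_group (Suc n)\<^esub> ?A = ?R \<otimes>\<^bsub>braid_group (Suc n)\<^esub> inv\<^bsub>braid_group (Suc n)\<^esub> ?D"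
    unfolding D using cA cR by (simp add: G.inv_mult_group braid_cancel)
  have "dbr n b (inv\<^bsub>braid_group n\<^esub> (pb n (dlp n ?m))) = inv\<^bsub>braid_group (Suc n)\<^esub> ?A"
    using dbr_inv[OF pb_carrier[OF set_dlp[of n ?m]], of b'] by (simp add: bend_pb set_dlp e' dbr_pb)
  then have "dbr n i (gval n ?x ?m) = pb (Suc n) (pdbl i ?x) \<otimes>\<^bsub>braid_group (Suc n)\<^esub> inv\<^bsub>braid_group (Suc n)\<^esub> ?A"
    unfolding gval_def using dbr_mult[of "pb n ?x" n "inv\<^bsub>braid_group n\<^esub> (pb n (dlp n ?m))" i] x
    by (simp add: set_dlp bend_pb dbr_pb e)
  also have "\<dots> = (pb (Suc n) (pdbl i ?x) \<otimes>\<^bsub>braid_group (Suc n)\<^esub> ?R) \<otimes>\<^bsub>braid_group (Suc n)\<^esub> inv\<^bsub>braid_group (Suc n)\<^esub> ?D"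
    unfolding invA using cX cR cD by (simp add: G.m_assoc)
  also have "\<dots> = gval (Suc n) (pdbl i ?x @ replicate ?m b) ?m"
    unfolding gval_def pb_append[OF set_pdbl[OF x] sr] ..
  also have "\<dots> = gval (Suc n) (words (Suc n) (ribs i l)) ?m"
    by (rule gval_peq[OF peq_sym[OF words_ribs[OF l i], folded b_def]]) (use set_pdbl[OF x] sr in auto)
  finally show ?thesis .
qed

subsection \<open>Ribbons in greedy words\<close>

lemma transpose_dbl:
  assumes "inj s"
  shows "transpose (s a) (Suc (s a)) \<circ> dbl a s = dbl a s \<circ> transpose a (Suc a)"
proof
  fix k
  consider "k = a" | "k = Suc a" | "k \<noteq> a" "k \<noteq> Suc a" by blast
  then show "(transpose (s a) (Suc (s a)) \<circ> dbl a s) k = (dbl a s \<circ> transpose a (Suc a)) k"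
  proof cases
    case 3
    then have "dbl a s k \<noteq> dbl a s a" "dbl a s k \<noteq> dbl a s (Suc a)" using inj_dbl[OF assms] by (auto simp: inj_eq simp del: dbl_same)
    then show ?thesis using 3 by (simp add: transpose_Suc)
  qed simp_all
qed

lemma pinv_rib:
  assumes s: "s permutes {1..n}"
  shows "pinv (rib c a s) = rib c (s a) (pinv s)"
proof -
  have *: "rib c (t a) u (rib c a t k) = k" if tu: "\<And>x. u (t x) = x" and t: "inj t" for t u :: "nat \<Rightarrow> nat" and a k
  proof -
    have 1: "dbl (t a) u (dbl a t x) = x" for x
      using fun_cong[OF dbl_comp[of a u t], of x] tu dbl_id[of a] by (simp add: comp_def id_def)
    show ?thesis
    proof (cases c)
      case True
      have "transpose (t a) (Suc (t a)) (dbl a t (transpose a (Suc a) k)) = dbl a t k"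
        using fun_cong[OF transpose_dbl[OF t, of a], of "transpose a (Suc a) k"] by simp
      then show ?thesis using True 1 by (simp add: rib_def)
    qed (simp add: rib_def 1)
  qed
  show ?thesis
  proof (rule inv_equality)
    show "rib c (s a) (pinv s) (rib c a s k) = k" for k
      by (rule *) (use permutes_inverses[OF s] permutes_inj[OF s] in simp_all)
    show "rib c a s (rib c (s a) (pinv s) k) = k" for k
      using *[of s "pinv s" "s a" k] permutes_inverses[OF s] permutes_inj[OF permutes_pinv[OF s]] by simp
  qed
qed

lemma rib_descent:
  assumes r: "inj r"
  shows "rib c b r (Suc k) < rib c b r k \<longleftrightarrow>
    k = b \<and> c \<or> k < b \<and> r (Suc k) < r k \<or> b < k \<and> r k < r (k - 1)"
proof -
  have e: "rib c b r x = dbl b r (if c then transpose b (Suc b) x else x)" for x by (simp add: rib_def)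
  consider "k = b" | "k < b" | "k = Suc b" | "Suc b < k" by linarith
  then show ?thesis
  proof cases
    case 1
    then show ?thesis by (simp add: rib_same)
  next
    case 2
    then show ?thesis unfolding e dbl_less[OF r] by (auto simp: transpose_Suc coll_def)
  next
    case 3
    then show ?thesis unfolding e dbl_less[OF r] by (auto simp: transpose_Suc coll_def)
  next
    case 4
    then show ?thesis unfolding e dbl_less[OF r] by (auto simp: transpose_Suc coll_def)
  qed
qed

text \<open>The descents of a ribbon letter are those of the original letter, except for the
  position between the two strands of the ribbon. There the greedy condition says that a ribbon
  that crosses in one letter also crosses in the next one.\<close>

lemma gpair_rib:
  assumes s: "s permutes {1..n}" and t: "t permutes {1..n}" and a: "a \<in> {1..n}"
  shows "gpair (Suc n) (rib c a s) (rib d (s a) t) \<longleftrightarrow> gpair n s t \<and> (c \<longrightarrow> d)"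
proof -
  let ?b = "s a" let ?r = "pinv s"
  have b: "?b \<in> {1..n}" by (rule perm_range[OF s a])
  note dr = rib_descent[OF permutes_inj[OF permutes_pinv[OF s]], of c ?b] and dt = rib_descent[OF permutes_inj[OF t], of d ?b]
  have g: "gpair (Suc n) (rib c a s) (rib d ?b t) \<longleftrightarrow>
    (\<forall>k \<in> {1..<Suc n}. (k = ?b \<and> c \<or> k < ?b \<and> ?r (Suc k) < ?r k \<or> ?b < k \<and> ?r k < ?r (k - 1)) \<longrightarrow>
       (k = ?b \<and> d \<or> k < ?b \<and> t (Suc k) < t k \<or> ?b < k \<and> t k < t (k - 1)))"
    unfolding gpair_def pinv_rib[OF s] dr dt ..
  show ?thesis
  proof
    assume "gpair (Suc n) (rib c a s) (rib d ?b t)"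
    then have h: "(k = ?b \<and> c \<or> k < ?b \<and> ?r (Suc k) < ?r k \<or> ?b < k \<and> ?r k < ?r (k - 1)) \<Longrightarrow>
       (k = ?b \<and> d \<or> k < ?b \<and> t (Suc k) < t k \<or> ?b < k \<and> t k < t (k - 1))" if "k \<in> {1..<Suc n}" for k
      unfolding g using that by blast
    have "c \<longrightarrow> d" using h[of ?b] b by auto
    moreover have "gpair n s t"
      unfolding gpair_def
    proof (intro ballI impI)
      fix k assume k: "k \<in> {1..<n}" "?r (Suc k) < ?r k"
      show "t (Suc k) < t k"
        using h[of k] h[of "Suc k"] k by (cases "k < ?b") auto
    qed
    ultimately show "gpair n s t \<and> (c \<longrightarrow> d)" by blast
  next
    assume h: "gpair n s t \<and> (c \<longrightarrow> d)"
    have *: "?r (Suc k) < ?r k \<Longrightarrow> t (Suc k) < t k" if "k \<in> {1..<n}" for k using h that unfolding gpair_def by blast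
    show "gpair (Suc n) (rib c a s) (rib d ?b t)"
      unfolding g
    proof (intro ballI impI)
      fix k assume k: "k \<in> {1..<Suc n}"
        and "k = ?b \<and> c \<or> k < ?b \<and> ?r (Suc k) < ?r k \<or> ?b < k \<and> ?r k < ?r (k - 1)"
      then consider "k = ?b" c | "k < ?b" "?r (Suc k) < ?r k" | "?b < k" "?r k < ?r (k - 1)" by blast
      then show "k = ?b \<and> d \<or> k < ?b \<and> t (Suc k) < t k \<or> ?b < k \<and> t k < t (k - 1)"
      proof cases
        case 1 then show ?thesis using h by blast
      next
        case 2 then show ?thesis using *[of k] k b by simp
      next
        case 3
        then obtain k' where k': "k = Suc k'" by (cases k) auto
        show ?thesis using 3 *[of k'] k b k' by simp
      qed
    qed
  qed
qed

lemma greedy_ribs: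
  assumes "perms n (map snd l)" "a \<in> {1..n}"
  shows "greedy (Suc n) (ribs a l) \<longleftrightarrow> greedy n (map snd l) \<and> successively (\<longrightarrow>) (map fst l)"
  using assms
proof (induction a l rule: ribs.induct)
  case (2 a c s l)
  have s: "s permutes {1..n}" and l: "perms n (map snd l)" using 2 by auto
  note IH = 2(1)[OF l perm_range[OF s 2(3)]]
  show ?case
  proof (cases l)
    case Nil
    then show ?thesis using s rib_permutes[OF s 2(3)] by simp
  next
    case (Cons x l')
    obtain d t where x: "x = (d, t)" by (cases x)
    have t: "t permutes {1..n}" using l Cons x by simp
    have hd: "hd (ribs (s a) l) = rib d (s a) t" "hd (map snd l) = t" using Cons x by auto
    have "greedy (Suc n) (ribs a ((c, s) # l)) \<longleftrightarrow> greedy (Suc n) (ribs (s a) l) \<and> gpair (Suc n) (rib c a s) (rib d (s a) t)"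
      using rib_permutes[OF s 2(3), of c] hd(1) Cons x by (simp add: greedy_Cons)
    also have "\<dots> \<longleftrightarrow> greedy n (map snd l) \<and> successively (\<longrightarrow>) (map fst l) \<and> gpair n s t \<and> (c \<longrightarrow> d)"
      unfolding IH gpair_rib[OF s t 2(3)] by blast
    also have "\<dots> \<longleftrightarrow> greedy n (map snd ((c, s) # l)) \<and> successively (\<longrightarrow>) (map fst ((c, s) # l))"
      using s Cons x by (auto simp: greedy_Cons)
    finally show ?thesis .
  qed
qed simp

subsection \<open>Removing a strand of a ribbon\<close>

text \<open>The inverse operation to \<open>rib\<close>: both copies are merged at the smaller one
  of the two lower positions.\<close>

definition del :: "nat \<Rightarrow> (nat \<Rightarrow> nat) \<Rightarrow> nat \<Rightarrow> nat" where
  "del a s k = coll (min (s a) (s (Suc a))) (s (up a k))"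

lemma del_rib [simp]: "del a (rib c a s) = s"
proof
  fix k
  have m: "min (rib c a s a) (rib c a s (Suc a)) = s a" by (simp add: rib_same)
  show "del a (rib c a s) k = s k"
  proof (cases "c \<and> k = a")
    case True
    then show ?thesis unfolding del_def m rib_up by (simp add: coll_def)
  next
    case False
    show ?thesis unfolding del_def m rib_up if_not_P[OF False] by (rule coll_up)
  qed
qed

lemma rib_del_aux:
  assumes S: "S permutes {1..Suc n}" and a: "a \<in> {1..n}" and adj: "S (Suc a) = Suc (S a)"
  shows "dbl a (del a S) = S" "del a S permutes {1..n}"
proof -
  let ?s = "del a S"
  have sa: "?s a = S a" using adj by (simp add: del_def up_def coll_def)
  have inj: "inj S" by (rule permutes_inj[OF S])
  show eq: "dbl a ?s = S"
  proof
    fix k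
    show "dbl a ?s k = S k"
    proof (cases "k = Suc a")
      case False
      then have "S k \<noteq> Suc (S a)" using inj adj by (metis injD)
      then have "up (S a) (coll (S a) (S k)) = S k" by (rule up_coll)
      moreover have "up a (coll a k) = k" using False by (rule up_coll)
      ultimately show ?thesis using False adj by (simp add: dbl_def sa) (simp add: del_def)
    qed (simp add: sa adj)
  qed
  have up: "up (S a) (?s j) = S (up a j)" for j
    using dbl_up[of a ?s j] unfolding eq sa by (rule HOL.sym)
  have Sr: "S x \<in> {1..Suc n} \<longleftrightarrow> x \<in> {1..Suc n}" for x by (rule permutes_in_image[OF S])
  have Sa: "S a \<in> {1..n}" using Sr[of a] Sr[of "Suc a"] a adj by auto
  show "?s permutes {1..n}"
  proof (rule inj_imp_permutes)
    show "inj_on ?s {1..n}"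
    proof (rule inj_onI)
      fix x y assume "?s x = ?s y"
      then have "S (up a x) = S (up a y)" unfolding up[symmetric] by simp
      then have "up a x = up a y" using inj by (metis injD)
      then show "x = y" by simp
    qed
    show "?s j \<in> {1..n}" if "j \<in> {1..n}" for j
    proof -
      have "up a j \<in> {1..Suc n}" using that by (auto simp: up_def)
      then have "up (S a) (?s j) \<in> {1..Suc n}" unfolding up Sr .
      then show ?thesis using Sa by (auto simp: up_def split: if_splits)
    qed
    show "?s j = j" if "j \<notin> {1..n}" for j
    proof -
      have "up a j \<notin> {1..Suc n}" using that a by (auto simp: up_def)
      then have "up (S a) (?s j) = up a j" unfolding up by (rule permutes_not_in[OF S])
      then show ?thesis using Sa a that by (auto simp: up_def split: if_splits)
    qed
  qed simp
qed

lemma rib_del: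
  assumes S: "S permutes {1..Suc n}" and a: "a \<in> {1..n}"
    and adj: "S (Suc a) = Suc (S a) \<or> S a = Suc (S (Suc a))"
  shows "rib (S (Suc a) < S a) a (del a S) = S" "del a S permutes {1..n}"
proof -
  have "rib (S (Suc a) < S a) a (del a S) = S \<and> del a S permutes {1..n}"
  proof (cases "S (Suc a) < S a")
    case False
    then have "S (Suc a) = Suc (S a)" using adj by auto
    from rib_del_aux[OF S a this] show ?thesis using False by (simp add: rib_def)
  next
    case True
    let ?t = "transpose a (Suc a)"
    have p: "(S \<circ> ?t) permutes {1..Suc n}"
      using a by (intro permutes_compose[OF permutes_swap_id S]) auto
    have adj': "(S \<circ> ?t) (Suc a) = Suc ((S \<circ> ?t) a)" using True adj by auto
    have "S (?t (up a k)) = (if k = a then S (Suc a) else S (up a k))" for k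
      by (auto simp: transpose_Suc up_def)
    then have d: "del a (S \<circ> ?t) = del a S"
      using True adj by (intro ext) (auto simp: del_def coll_def up_def)
    have "dbl a (del a S) = S \<circ> ?t" "del a S permutes {1..n}" using rib_del_aux[OF p a adj'] unfolding d by blast+
    moreover have "S \<circ> ?t \<circ> ?t = S" by (simp add: fun_eq_iff)
    ultimately show ?thesis using True by (simp add: rib_def)
  qed
  then show "rib (S (Suc a) < S a) a (del a S) = S" "del a S permutes {1..n}" by auto
qed

text \<open>Follows the strands from \<open>a\<close> and \<open>Suc a\<close> and removes the
  second one. The result contains the lower end of the ribbon; it is \<open>None\<close> if the
  strands separate or if the number of their crossings is not \<open>m\<close>.\<close>

fun unribbon :: "nat \<Rightarrow> (nat \<Rightarrow> nat) list \<Rightarrow> nat \<Rightarrow> (nat \<times> (nat \<Rightarrow> nat) list) option" where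
  "unribbon a [] m = (if m = 0 then Some (a, []) else None)"
| "unribbon a (s # ss) m =
     (if s (Suc a) = Suc (s a) then map_option (\<lambda>(b, ts). (b, del a s # ts)) (unribbon (s a) ss m)
      else if s a = Suc (s (Suc a)) \<and> m \<noteq> 0 then map_option (\<lambda>(b, ts). (b, del a s # ts)) (unribbon (s (Suc a)) ss (m - 1))
      else None)"

lemma unribbon_sound:
  assumes "perms (Suc n) Ss" "a \<in> {1..n}" "unribbon a Ss m = Some (b, ss)"
  shows "\<exists>l. Ss = ribs a l \<and> map snd l = ss \<and> ncross l = m \<and> b = rend a ss \<and> perms n ss"
  using assms
proof (induction a Ss m arbitrary: ss rule: unribbon.induct)
  case (1 a m)
  then show ?case by (intro exI[of _ "[]"]) (auto split: if_splits)
next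
  case (2 a S Ss m)
  have S: "S permutes {1..Suc n}" and Ss: "perms (Suc n) Ss" using "2.prems" by auto
  have Sr: "S a \<in> {1..Suc n}" "S (Suc a) \<in> {1..Suc n}" using perm_range[OF S] "2.prems"(2) by simp_all
  show ?case
  proof (cases "S (Suc a) = Suc (S a)")
    case True
    then obtain ts where ts: "unribbon (S a) Ss m = Some (b, ts)" "ss = del a S # ts" using "2.prems"(3) by auto
    have sa: "del a S a = S a" using True by (simp add: del_def up_def coll_def)
    have "S a \<in> {1..n}" using Sr True by auto
    from "2.IH"(1)[OF True Ss this ts(1)] obtain l where
      l: "Ss = ribs (S a) l" "map snd l = ts" "ncross l = m" "b = rend (S a) ts" "perms n ts" by blast
    note r = rib_del[OF S "2.prems"(2) disjI1[OF True]]
    show ?thesis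
      by (rule exI[of _ "(False, del a S) # l"]) (use l ts(2) sa True r in simp)
  next
    case False
    then have adj: "S a = Suc (S (Suc a))" and m: "m \<noteq> 0" using "2.prems"(3) by (auto split: if_splits)
    then obtain ts where ts: "unribbon (S (Suc a)) Ss (m - 1) = Some (b, ts)" "ss = del a S # ts"
      using "2.prems"(3) False by auto
    have sa: "del a S a = S (Suc a)" using adj by (simp add: del_def up_def coll_def)
    have "S (Suc a) \<in> {1..n}" using Sr adj by auto
    from "2.IH"(2)[OF False _ Ss this ts(1)] adj m obtain l where
      l: "Ss = ribs (S (Suc a)) l" "map snd l = ts" "ncross l = m - 1" "b = rend (S (Suc a)) ts" "perms n ts" by blast
    note r = rib_del[OF S "2.prems"(2) disjI2[OF adj]]
    show ?thesis
      by (rule exI[of _ "(True, del a S) # l"]) (use l ts(2) sa adj r m in simp)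
  qed
qed

lemma unribbon_ribs: "unribbon a (ribs a l) (ncross l) = Some (rend a (map snd l), map snd l)"
proof (induction a l rule: ribs.induct)
  case (2 a c s l)
  then show ?case by (cases c) (simp_all add: rib_same)
qed simp

lemma unribbon_ids: "unribbon a (replicate k id @ ss) m \<noteq> None \<longleftrightarrow> unribbon a ss m \<noteq> None"
  by (induction k) simp_all

text \<open>In a half twist any ribbon crosses, so that half twists at the end only use up
  crossings.\<close>

lemma unribbon_half_twists:
  assumes "unribbon a (ss @ replicate k (half_twist (Suc n))) m \<noteq> None" "perms (Suc n) ss" "a \<in> {1..n}"
  shows "k \<le> m \<and> unribbon a ss (m - k) \<noteq> None"
  using assms
proof (induction a ss m rule: unribbon.induct)
  case (1 a m)
  then show ?case
  proof (induction k arbitrary: a m)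
    case (Suc k)
    let ?h = "half_twist (Suc n)"
    have h: "?h a = n + 2 - a" "?h (Suc a) = n + 1 - a" using Suc.prems(3) by (auto simp: half_twist_def)
    then have "?h (Suc a) \<noteq> Suc (?h a)" "?h a = Suc (?h (Suc a))" "?h (Suc a) \<in> {1..n}" using Suc.prems(3) by auto
    then have "m \<noteq> 0" "k \<le> m - 1 \<and> unribbon (?h (Suc a)) [] (m - 1 - k) \<noteq> None"
      using Suc.prems(1,2) Suc.IH[of "?h (Suc a)" "m - 1"] by (auto split: if_splits)
    then show ?case by (auto split: if_splits)
  qed simp
next
  case (2 a S Ss m)
  have S: "S permutes {1..Suc n}" and Ss: "perms (Suc n) Ss" using "2.prems" by auto
  have Sr: "S a \<in> {1..Suc n}" "S (Suc a) \<in> {1..Suc n}" using perm_range[OF S] "2.prems"(3) by simp_all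
  show ?case
  proof (cases "S (Suc a) = Suc (S a)")
    case True
    then have "S a \<in> {1..n}" using Sr by auto
    then show ?thesis using "2.IH"(1)[OF True _ Ss] "2.prems"(1) True by auto
  next
    case False
    then have adj: "S a = Suc (S (Suc a))" "m \<noteq> 0" using "2.prems"(1) by (auto split: if_splits)
    then have "S (Suc a) \<in> {1..n}" using Sr by auto
    then have "k \<le> m - 1 \<and> unribbon (S (Suc a)) Ss (m - 1 - k) \<noteq> None"
      using "2.IH"(2)[OF False conjI[OF adj] _ Ss] "2.prems"(1) False adj by auto
    moreover have "m - k - 1 = m - 1 - k" by simp
    ultimately show ?thesis using False adj by auto
  qed
qed

lemma unribbon_dbr:
  assumes g: "greedy (Suc n) Ss" and i: "i \<in> {1..n}" and u: "unribbon i Ss m = Some (b, ss)"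
  shows "greedy n ss" "gval (Suc n) (words (Suc n) Ss) m = dbr n i (gval n (words n ss) m)"
    "bend (gval n (words n ss) m) i = (half_twist n ^^ m) b" "length ss = length Ss" "b \<in> {1..n}"
proof -
  obtain l where l: "Ss = ribs i l" "map snd l = ss" "ncross l = m" "b = rend i ss" "perms n ss"
    using unribbon_sound[OF greedy_perms[OF g] i u] by blast
  then have p: "perms n (map snd l)" by simp
  show "greedy n ss" using greedy_ribs[OF p i] g l by simp
  show "gval (Suc n) (words (Suc n) Ss) m = dbr n i (gval n (words n ss) m)" using dbr_gval_ribs[OF p i] l by simp
  show "bend (gval n (words n ss) m) i = (half_twist n ^^ m) b"
    using bend_gval[OF set_words[OF l(5)], of m i] rend_words[OF l(5)] l(4) by simp
  show "length ss = length Ss" using l by auto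
  show "b \<in> {1..n}" using rend_range[OF l(5) i] l(4) by simp
qed

text \<open>The doubled braid has a greedy word in which the crossings of the ribbon lie in the last
  letters. As greedy words are unique up to trivial letters, the given word is a ribbon letter by
  letter as well.\<close>

lemma unribbon_complete:
  assumes g: "greedy (Suc n) Ss" and i: "i \<in> {1..n}" and \<beta>: "\<beta> \<in> carrier (braid_group n)"
    and eq: "gval (Suc n) (words (Suc n) Ss) m = dbr n i \<beta>"
  shows "unribbon i Ss m \<noteq> None"
proof -
  let ?h = "half_twist n" and ?H = "half_twist (Suc n)"
  obtain ts q0 where ts: "greedy n ts" "\<beta> = gval n (words n ts) q0" using ex_greedy[OF \<beta>] by blast
  define q where "q = q0 + m"
  \<comment> \<open>The \<open>q\<close> trivial letters at the front leave room for the flags: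
    the last \<open>q\<close> letters, as many as there are factors
    \<open>\<Delta>\<^sup>-\<^sup>1\<close>, are those in which the ribbon crosses.\<close>
  define us where "us = replicate q id @ ts @ replicate m ?h"
  define fl where "fl = replicate (length us - q) False @ replicate q True"
  define l where "l = zip fl us"
  have gu: "greedy n us" unfolding us_def by (intro greedy_ids greedy_half_twists ts)
  have len: "length fl = length us" unfolding fl_def us_def by simp
  have l: "map snd l = us" "map fst l = fl" unfolding l_def using len by simp_all
  have "ncross l = length (filter id (map fst l))" unfolding ncross_def by (simp add: filter_map comp_def)
  also have "\<dots> = q" unfolding l by (simp add: fl_def)
  finally have nc: "ncross l = q" .
  have pl: "perms n (map snd l)" using greedy_perms[OF gu] l by simp
  have "successively (\<longrightarrow>) fl"
  proof -
    have "successively (\<longrightarrow>) (replicate k True)" for k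
    proof (induction k)
      case (Suc k)
      then show ?case by (cases k) auto
    qed simp
    moreover have "successively (\<longrightarrow>) (replicate k False)" for k by (induction k) (auto simp: successively_Cons)
    ultimately show ?thesis unfolding fl_def by (auto simp: successively_append_iff)
  qed
  then have gr: "greedy (Suc n) (ribs i l)" using greedy_ribs[OF pl i] gu l by simp
  have "words n us = words n ts @ dlp n m" by (simp add: us_def words_ids words_half_twists)
  then have "gval n (words n us) q = \<beta>"
    using gval_add[OF set_words[OF greedy_perms[OF ts(1)]], of m q0] ts(2) by (simp add: q_def)
  then have "gval (Suc n) (words (Suc n) Ss) m = gval (Suc n) (words (Suc n) (ribs i l)) q"
    using dbr_gval_ribs[OF pl i] eq by (simp add: nc l)
  from gval_eqD[OF set_words[OF greedy_perms[OF g]] set_words[OF greedy_perms[OF gr]] this]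
  have "(words (Suc n) Ss @ dlp (Suc n) q0) @ dlp (Suc n) m \<approx> words (Suc n) (ribs i l) @ dlp (Suc n) m"
    by (simp add: q_def dlp_add)
  then have "words (Suc n) Ss @ dlp (Suc n) q0 \<approx> words (Suc n) (ribs i l)" by (simp only: peq_append_right_iff)
  then have "words (Suc n) (Ss @ replicate q0 ?H) \<approx> words (Suc n) (ribs i l)" by (simp add: words_half_twists)
  \<comment> \<open>Padding with trivial letters makes both words equally long.\<close>
  moreover define X where "X = replicate (length (ribs i l)) id @ (Ss @ replicate q0 ?H)"
  moreover define Y where "Y = replicate (length (Ss @ replicate q0 ?H)) id @ ribs i l"
  ultimately have "words (Suc n) X \<approx> words (Suc n) Y" by (simp add: words_ids)
  moreover have "greedy (Suc n) X" unfolding X_def by (intro greedy_ids greedy_half_twists g)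
  moreover have "greedy (Suc n) Y" unfolding Y_def by (intro greedy_ids gr)
  moreover have "length X = length Y" unfolding X_def Y_def by simp
  ultimately have XY: "X = Y" using greedy_unique by blast
  have "unribbon i (ribs i l) q \<noteq> None" using unribbon_ribs[of i l] by (simp add: nc)
  then have "unribbon i Y q \<noteq> None" unfolding Y_def unribbon_ids .
  then have "unribbon i (Ss @ replicate q0 ?H) q \<noteq> None" unfolding XY[symmetric] X_def unribbon_ids .
  from unribbon_half_twists[OF this greedy_perms[OF g] i] show ?thesis by (simp add: q_def)
qed

section \<open>Carets of trees\<close>

lemma size1_pos [simp]: "0 < size1 (T :: btree)" "1 \<le> size1 (T :: btree)"
  using size1_ge0[of T] by linarith+

lemma size1_add_caret [simp]: "i \<in> {1..size1 T} \<Longrightarrow> size1 (add_caret T i) = Suc (size1 T)"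
proof (induction T arbitrary: i)
  case (Node l u r)
  show ?case
  proof (cases "i \<le> size1 l")
    case False
    then have "i - size1 l \<in> {1..size1 r}" using Node.prems by auto
    then show ?thesis using Node.IH(2) False by simp
  qed (use Node in simp)
qed simp

lemma add_caret_commute:
  assumes "i \<noteq> j" "i \<in> {1..size1 T}" "j \<in> {1..size1 T}"
  shows "add_caret (add_caret T i) (up i j) = add_caret (add_caret T j) (up j i)"
  using assms
proof (induction T arbitrary: i j)
  case (Node l u r)
  consider "i \<le> size1 l" "j \<le> size1 l" | "i \<le> size1 l" "size1 l < j" | "size1 l < i" "j \<le> size1 l"
    | "size1 l < i" "size1 l < j" by linarith
  then show ?case
  proof cases
    case 1
    then show ?thesis using Node.IH(1)[of i j] Node.prems by (auto simp: up_def)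
  next
    case 2
    then show ?thesis using Node.prems by (auto simp: up_def)
  next
    case 3
    then show ?thesis using Node.prems by (auto simp: up_def)
  next
    case 4
    have "up (i - size1 l) (j - size1 l) = up i j - size1 l" "up (j - size1 l) (i - size1 l) = up j i - size1 l"
      using 4 by (auto simp: up_def)
    moreover have "\<not> up i j \<le> size1 l" "\<not> up j i \<le> size1 l" using 4 by (auto simp: up_def)
    moreover have "i - size1 l \<in> {1..size1 r}" "j - size1 l \<in> {1..size1 r}" "i - size1 l \<noteq> j - size1 l"
      using 4 Node.prems by auto
    ultimately show ?thesis using 4 Node.IH(2)[of "i - size1 l" "j - size1 l"] by simp
  qed
qed simp

lemma has_caret_pos: "has_caret T i \<Longrightarrow> 1 \<le> i \<and> i < size1 T"
proof (induction T arbitrary: i)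
  case (Node l u r)
  then show ?case using Node.IH(1)[of i] Node.IH(2)[of "i - size1 l"] by fastforce
qed simp

lemma add_caret_not_Leaf: "1 \<le> i \<Longrightarrow> i \<le> size1 T \<Longrightarrow> add_caret T i \<noteq> Leaf"
  by (cases T) auto

lemma remove_add_caret: "i \<in> {1..size1 T} \<Longrightarrow> has_caret (add_caret T i) i \<and> remove_caret (add_caret T i) i = T"
proof (induction T arbitrary: i)
  case (Node l u r)
  show ?case
  proof (cases "i \<le> size1 l")
    case True
    then have "add_caret l i \<noteq> Leaf" using Node.prems by (intro add_caret_not_Leaf) auto
    then show ?thesis using True Node.IH(1)[of i] Node.prems by auto
  next
    case False
    then have "add_caret r (i - size1 l) \<noteq> Leaf" using Node.prems by (intro add_caret_not_Leaf) auto
    moreover have "i - size1 l \<in> {1..size1 r}" using False Node.prems by auto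
    ultimately show ?thesis using False Node.IH(2)[of "i - size1 l"] by auto
  qed
qed simp

lemma add_remove_caret:
  "has_caret T i \<Longrightarrow> add_caret (remove_caret T i) i = T \<and> Suc (size1 (remove_caret T i)) = size1 T"
proof (induction T arbitrary: i)
  case (Node l u r)
  consider "l = Leaf" "r = Leaf" "i = 1" | "i < size1 l" "has_caret l i" | "size1 l < i" "has_caret r (i - size1 l)"
    using Node.prems by auto
  then show ?case
  proof cases
    case 1
    then show ?thesis by simp
  next
    case 2
    then have "l \<noteq> Leaf" "i \<le> size1 (remove_caret l i)" using Node.IH(1)[of i] by auto
    then show ?thesis using 2 Node.IH(1)[of i] by auto
  next
    case 3
    then have "r \<noteq> Leaf" by auto
    then show ?thesis using 3 Node.IH(2)[of "i - size1 l"] by auto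
  qed
qed simp

fun subtree :: "btree \<Rightarrow> btree \<Rightarrow> bool" where
  "subtree Leaf Z \<longleftrightarrow> True"
| "subtree (Node l u r) Leaf \<longleftrightarrow> False"
| "subtree (Node l u r) (Node l' u' r') \<longleftrightarrow> subtree l l' \<and> subtree r r'"

text \<open>The union of two trees with a common root, the smallest tree that contains
  both.\<close>

fun tjoin :: "btree \<Rightarrow> btree \<Rightarrow> btree" where
  "tjoin Leaf Z = Z"
| "tjoin (Node l u r) Leaf = Node l u r"
| "tjoin (Node l u r) (Node l' u' r') = Node (tjoin l l') u (tjoin r r')"

lemma subtree_refl [simp]: "subtree T T"
  by (induction T) auto

lemma subtree_trans: "subtree S T \<Longrightarrow> subtree T Z \<Longrightarrow> subtree S Z"
proof (induction S T arbitrary: Z rule: subtree.induct)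
  case (3 l u r l' u' r')
  then show ?case by (cases Z) auto
qed auto

lemma subtree_add_caret: "subtree T (add_caret T i)"
  by (induction T arbitrary: i) auto

lemma subtree_tjoin: "subtree T (tjoin T Z)"
  by (induction T Z rule: tjoin.induct) auto

lemma subtree_imp_tjoin: "subtree T Z \<Longrightarrow> tjoin T Z = Z"
  by (induction T Z rule: tjoin.induct) auto

lemma subtree_two_carets:
  assumes "subtree (add_caret T i) Z" "subtree (add_caret T j) Z" "i \<noteq> j" "i \<in> {1..size1 T}" "j \<in> {1..size1 T}"
  shows "subtree (add_caret (add_caret T i) (up i j)) Z"
  using assms
proof (induction T arbitrary: i j Z)
  case (Node l u r)
  then obtain l' u' r' where Z: "Z = Node l' u' r'" by (cases Z) (auto split: if_splits)
  consider "i \<le> size1 l" "j \<le> size1 l" | "i \<le> size1 l" "size1 l < j" | "size1 l < i" "j \<le> size1 l"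
    | "size1 l < i" "size1 l < j" by linarith
  then show ?case
  proof cases
    case 1
    then show ?thesis using Node.IH(1)[of i l' j] Node.prems Z by (auto simp: up_def)
  next
    case 2
    then show ?thesis using Node.prems Z by (auto simp: up_def)
  next
    case 3
    then show ?thesis using Node.prems Z by (auto simp: up_def)
  next
    case 4
    have "up (i - size1 l) (j - size1 l) = up i j - size1 l" using 4 by (auto simp: up_def)
    moreover have "\<not> up i j \<le> size1 l" using 4 by (auto simp: up_def)
    moreover have "i - size1 l \<in> {1..size1 r}" "j - size1 l \<in> {1..size1 r}" "i - size1 l \<noteq> j - size1 l"
      using 4 Node.prems by auto
    ultimately show ?thesis using 4 Node.IH(2)[of "i - size1 l" r' "j - size1 l"] Node.prems(1,2) Z by simp
  qed
qed simp

lemma open_leaf: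
  "open_leaf T Z \<noteq> 0 \<Longrightarrow> open_leaf T Z \<in> {1..size1 T} \<and> tjoin (add_caret T (open_leaf T Z)) Z = tjoin T Z"
proof (induction T Z rule: open_leaf.induct)
  case (2 l u r)
  then show ?case by (cases l; cases r) auto
next
  case (4 l u r l' u' r')
  show ?case
  proof (cases "open_leaf l l' = 0")
    case False
    then show ?thesis using "4.IH"(1)[OF False] by auto
  next
    case True
    then have r: "open_leaf r r' \<noteq> 0" using "4.prems" by (auto split: if_splits)
    then show ?thesis using "4.IH" True by auto
  qed
qed auto

lemma open_leaf_0: "open_leaf T Z = 0 \<Longrightarrow> tjoin T Z = T"
  by (induction T Z rule: open_leaf.induct) (auto split: if_splits)

text \<open>The bound is strict because at least the root is shared; it keeps the number of
  strands within \<open>n\<^sub>1 + n\<^sub>2\<close>.\<close>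

lemma size1_tjoin: "size1 (tjoin T Z) < size1 T + size1 Z" "size1 T \<le> size1 (tjoin T Z)"
proof (induction T Z rule: tjoin.induct)
  case (3 l u r l' u' r')
  { case 1 then show ?case using "3.IH" by simp }
  { case 2 then show ?case using "3.IH" by simp }
qed auto

lemma ex_caret_towards:
  assumes "subtree T Z" "T \<noteq> Z"
  shows "\<exists>i \<in> {1..size1 T}. subtree (add_caret T i) Z"
proof -
  have j: "tjoin T Z = Z" by (rule subtree_imp_tjoin[OF assms(1)])
  then have "open_leaf T Z \<noteq> 0" using open_leaf_0 assms(2) by metis
  from open_leaf[OF this] j subtree_tjoin[of "add_caret T (open_leaf T Z)" Z] show ?thesis by auto
qed

section \<open>Eye insertions\<close>

text \<open>Eye insertion as a function, with the braid operations in place of a choice of a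
  word.\<close>

fun ins :: "nat \<Rightarrow> triple \<Rightarrow> triple" where
  "ins i (T, b, U) = (add_caret T i, dbr (size1 T) i b, add_caret U (bend b i))"

abbreviation ttop :: "triple \<Rightarrow> btree" where "ttop t \<equiv> fst t"
abbreviation tbot :: "triple \<Rightarrow> btree" where "tbot t \<equiv> snd (snd t)"

lemma triplesD: "(T, b, U) \<in> triples \<Longrightarrow> size1 U = size1 T \<and> b \<in> carrier (braid_group (size1 T))"
  by (auto simp: triples_def)

lemma bend_range: "b \<in> carrier (braid_group n) \<Longrightarrow> i \<in> {1..n} \<Longrightarrow> bend b i \<in> {1..n}"
  by (rule perm_range[OF bend_permutes])

lemma eye_insertion_iff:
  "eye_insertion t t' \<longleftrightarrow> t \<in> triples \<and> (\<exists>i \<in> {1..size1 (ttop t)}. t' = ins i t)"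
proof
  assume "eye_insertion t t'"
  then show "t \<in> triples \<and> (\<exists>i \<in> {1..size1 (ttop t)}. t' = ins i t)"
    by cases (auto simp: triples_def)
next
  assume h: "t \<in> triples \<and> (\<exists>i \<in> {1..size1 (ttop t)}. t' = ins i t)"
  obtain T b U where t: "t = (T, b, U)" by (cases t)
  then obtain i where i: "i \<in> {1..size1 T}" "t' = ins i t" using h by auto
  obtain w where w: "w \<in> artin_words (size1 T)" "b = braid_of (size1 T) w" using h t triplesD braid_carrier by blast
  have "eye_insertion (T, braid_of (size1 T) w, U)
    (add_caret T i, braid_of (Suc (size1 T)) (double_strand i w), add_caret U (strand_end w i))"
    by (rule eye_insertion.intros) (use h t w i in \<open>auto simp: triples_def\<close>)
  then show "eye_insertion t t'" using t i w by simp
qed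

lemma ins_triples:
  assumes "t \<in> triples" "i \<in> {1..size1 (ttop t)}"
  shows "ins i t \<in> triples"
proof -
  obtain T b U where t: "t = (T, b, U)" by (cases t)
  have b: "size1 U = size1 T" "b \<in> carrier (braid_group (size1 T))" using assms t triplesD by blast+
  have i: "i \<in> {1..size1 T}" using assms(2) t by simp
  have "bend b i \<in> {1..size1 U}" using bend_range[OF b(2) i] b(1) by simp
  then show ?thesis using i b dbr_carrier[OF b(2)] by (simp add: t triples_def del: atLeastAtMost_iff)
qed

lemma up_range: "i \<noteq> j \<Longrightarrow> i \<in> {1..n} \<Longrightarrow> j \<in> {1..n} \<Longrightarrow> up i j \<in> {1..Suc n}"
  by (auto simp: up_def)

lemma ins_commute:
  assumes t: "t \<in> triples" and ij: "i \<noteq> j" "i \<in> {1..size1 (ttop t)}" "j \<in> {1..size1 (ttop t)}"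
  shows "ins (up i j) (ins i t) = ins (up j i) (ins j t)"
proof -
  obtain T b U where e: "t = (T, b, U)" by (cases t)
  let ?n = "size1 T"
  have b: "size1 U = ?n" "b \<in> carrier (braid_group ?n)" using t e triplesD by blast+
  have i: "i \<in> {1..?n}" "j \<in> {1..?n}" using ij e by simp_all
  have bi: "bend b i \<noteq> bend b j" using ij(1) permutes_inj[OF bend_permutes[OF b(2)]] by (metis injD)
  have 1: "add_caret (add_caret T i) (up i j) = add_caret (add_caret T j) (up j i)"
    by (rule add_caret_commute[OF ij(1) i])
  have 2: "add_caret (add_caret U (bend b i)) (up (bend b i) (bend b j)) = add_caret (add_caret U (bend b j)) (up (bend b j) (bend b i))"
    by (rule add_caret_commute[OF bi]) (use bend_range[OF b(2)] i b(1) in simp_all)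
  have 3: "bend (dbr ?n i b) (up i j) = up (bend b i) (bend b j)" for i j
    by (simp add: bend_dbr[OF b(2)] dbl_up)
  show ?thesis using 1 2 dbr_commute[OF ij(1) b(2)] i by (simp add: e 3 del: atLeastAtMost_iff)
qed

text \<open>Insertions at different positions commute by \<open>ins_commute\<close>, and those at
  the same position agree.\<close>

lemma strong_confluentp_eye_insertion: "strong_confluentp eye_insertion"
proof (rule strong_confluentpI)
  fix x y z assume "eye_insertion x y" "eye_insertion x z"
  then obtain i j where x: "x \<in> triples" and ij: "i \<in> {1..size1 (ttop x)}" "j \<in> {1..size1 (ttop x)}"
    and yz: "y = ins i x" "z = ins j x" by (auto simp: eye_insertion_iff)
  show "\<exists>u. eye_insertion\<^sup>*\<^sup>* y u \<and> eye_insertion\<^sup>=\<^sup>= z u"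
  proof (cases "i = j")
    case True then show ?thesis using yz by blast
  next
    case False
    have s: "size1 (ttop (ins i x)) = Suc (size1 (ttop x))" if "i \<in> {1..size1 (ttop x)}" for i
      using that by (cases x) simp
    have 1: "eye_insertion y (ins (up i j) y)"
      unfolding eye_insertion_iff yz using ins_triples[OF x ij(1)] up_range[OF False ij] s[OF ij(1)] by (auto simp del: atLeastAtMost_iff)
    have 2: "eye_insertion z (ins (up j i) z)"
      unfolding eye_insertion_iff yz using ins_triples[OF x ij(2)] up_range[OF False[symmetric] ij(2,1)] s[OF ij(2)] by (auto simp del: atLeastAtMost_iff)
    have "ins (up i j) y = ins (up j i) z" using ins_commute[OF x False ij] yz by simp
    then have "eye_insertion\<^sup>=\<^sup>= z (ins (up i j) y)" using 2 by simp
    then show ?thesis using r_into_rtranclp[of eye_insertion, OF 1] by blast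
  qed
qed

lemma eye_equiv_join: "equivclp eye_insertion x y \<Longrightarrow> \<exists>z. eye_insertion\<^sup>*\<^sup>* x z \<and> eye_insertion\<^sup>*\<^sup>* y z"
  using semiconfluentp_equivclp[OF strong_confluentp_into_semiconfluentp[OF strong_confluentp_eye_insertion]]
  by (auto simp: rtranclp_conversep OO_def)

lemma eye_insertion_star:
  assumes "eye_insertion\<^sup>*\<^sup>* x y"
  shows "x \<in> triples \<Longrightarrow> y \<in> triples" "size1 (ttop x) \<le> size1 (ttop y)" "subtree (ttop x) (ttop y)"
    "size1 (ttop y) \<le> size1 (ttop x) \<Longrightarrow> y = x"
proof -
  have "(x \<in> triples \<longrightarrow> y \<in> triples) \<and> subtree (ttop x) (ttop y) \<and> (y = x \<or> size1 (ttop x) < size1 (ttop y))"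
    using assms
  proof (induction rule: rtranclp_induct)
    case (step y z)
    obtain i where i: "y \<in> triples" "i \<in> {1..size1 (ttop y)}" "z = ins i y" using step.hyps(2) by (auto simp: eye_insertion_iff)
    have st: "size1 (ttop z) = Suc (size1 (ttop y))" "subtree (ttop y) (ttop z)"
      using i(2) subtree_add_caret unfolding i(3) by (cases y; simp)+
    have A: "z \<in> triples" using ins_triples[OF i(1,2)] i(3) by simp
    have B: "subtree (ttop x) (ttop z)" using step.IH st(2) subtree_trans by blast
    have C: "size1 (ttop x) < size1 (ttop z)" using step.IH st(1) by force
    show ?case using A B C by blast
  qed simp
  note r = this
  show "x \<in> triples \<Longrightarrow> y \<in> triples" "subtree (ttop x) (ttop y)" using r by blast+
  show "size1 (ttop x) \<le> size1 (ttop y)" using r by force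
  show "size1 (ttop y) \<le> size1 (ttop x) \<Longrightarrow> y = x" using r by force
qed

lemma ex_expansion:
  assumes "x \<in> triples" "subtree (ttop x) Z"
  shows "\<exists>y. eye_insertion\<^sup>*\<^sup>* x y \<and> ttop y = Z"
  using assms
proof (induction "size1 Z - size1 (ttop x)" arbitrary: x rule: less_induct)
  case less
  show ?case
  proof (cases "ttop x = Z")
    case False
    then obtain i where i: "i \<in> {1..size1 (ttop x)}" "subtree (add_caret (ttop x) i) Z" using ex_caret_towards less.prems by blast
    let ?y = "ins i x"
    have y: "ttop ?y = add_caret (ttop x) i" by (cases x) simp
    have s: "size1 (ttop ?y) = Suc (size1 (ttop x))" using i(1) y by simp
    have "size1 (ttop ?y) \<le> size1 Z"
      using subtree_imp_tjoin[OF i(2)] size1_tjoin(2)[of "add_caret (ttop x) i" Z] y by simp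
    then have "size1 Z - size1 (ttop ?y) < size1 Z - size1 (ttop x)" using s by simp
    from less.hyps[OF this ins_triples[OF less.prems(1) i(1)]] i(2) y
    obtain z where z: "eye_insertion\<^sup>*\<^sup>* ?y z" "ttop z = Z" by auto
    have "eye_insertion x ?y" using less.prems(1) i(1) by (auto simp: eye_insertion_iff)
    from converse_rtranclp_into_rtranclp[of eye_insertion, OF this z(1)] z(2) show ?thesis by blast
  qed blast
qed

text \<open>Two first insertions at \<open>i \<noteq> j\<close> towards the same tree are completed to a square by
  \<open>ins_commute\<close>, and the fourth corner can still be expanded to that tree.\<close>

lemma expansion_unique:
  assumes "x \<in> triples" "eye_insertion\<^sup>*\<^sup>* x y" "eye_insertion\<^sup>*\<^sup>* x z" "ttop y = ttop z"
  shows "y = z"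
  using assms
proof (induction "size1 (ttop y) - size1 (ttop x)" arbitrary: x y z rule: less_induct)
  case less
  show ?case
  proof (cases "x = y \<or> x = z")
    case True
    then show ?thesis using eye_insertion_star(4)[OF less.prems(2)] eye_insertion_star(4)[OF less.prems(3)] less.prems(4) by auto
  next
    case False
    obtain y1 where y1: "eye_insertion x y1" "eye_insertion\<^sup>*\<^sup>* y1 y" using less.prems(2) False by (cases rule: converse_rtranclpE) blast+
    obtain z1 where z1: "eye_insertion x z1" "eye_insertion\<^sup>*\<^sup>* z1 z" using less.prems(3) False by (cases rule: converse_rtranclpE) blast+
    obtain i where i: "i \<in> {1..size1 (ttop x)}" "y1 = ins i x" using y1(1) by (auto simp: eye_insertion_iff)
    obtain j where j: "j \<in> {1..size1 (ttop x)}" "z1 = ins j x" using z1(1) by (auto simp: eye_insertion_iff)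
    have ti: "y1 \<in> triples" "z1 \<in> triples" using ins_triples[OF less.prems(1)] i j by auto
    have tt: "ttop (ins k u) = add_caret (ttop u) k" for k u by (cases u) simp
    have s: "size1 (ttop y1) = Suc (size1 (ttop x))" "size1 (ttop z1) = Suc (size1 (ttop x))" using i j tt by simp_all
    have less': "size1 (ttop y) - size1 (ttop y1) < size1 (ttop y) - size1 (ttop x)"
       "size1 (ttop z) - size1 (ttop z1) < size1 (ttop y) - size1 (ttop x)"
      using eye_insertion_star(2)[OF y1(2)] eye_insertion_star(2)[OF z1(2)] s less.prems(4) by simp_all
    show ?thesis
    proof (cases "i = j")
      case True
      then show ?thesis using less.hyps[OF less'(1) ti(1) y1(2), of z] z1(2) i(2) j(2) less.prems(4) by simp
    next
      case False
      let ?w = "ins (up i j) y1"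
      have w: "?w = ins (up j i) z1" using ins_commute[OF less.prems(1) False i(1) j(1)] i j by simp
      have yw: "eye_insertion y1 ?w"
        unfolding eye_insertion_iff using ti s up_range[OF False i(1) j(1)] by (auto simp del: atLeastAtMost_iff)
      have zw: "eye_insertion z1 ?w"
        unfolding eye_insertion_iff w using ti s up_range[OF False[symmetric] j(1) i(1)] by (auto simp del: atLeastAtMost_iff)
      have "subtree (add_caret (add_caret (ttop x) i) (up i j)) (ttop y)"
        by (rule subtree_two_carets[OF _ _ False i(1) j(1)])
          (use eye_insertion_star(3)[OF y1(2)] eye_insertion_star(3)[OF z1(2)] i j tt less.prems(4) in simp_all)
      then have "subtree (ttop ?w) (ttop y)" using i tt by simp
      then obtain v where v: "eye_insertion\<^sup>*\<^sup>* ?w v" "ttop v = ttop y"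
        using ex_expansion[of ?w "ttop y"] eye_insertion_star(1)[OF r_into_rtranclp[of eye_insertion, OF yw] ti(1)] by blast
      have "eye_insertion\<^sup>*\<^sup>* y1 v" "eye_insertion\<^sup>*\<^sup>* z1 v"
        using converse_rtranclp_into_rtranclp[of eye_insertion, OF yw v(1)] converse_rtranclp_into_rtranclp[of eye_insertion, OF zw v(1)] .
      then show ?thesis
      proof -
        assume v1: "eye_insertion\<^sup>*\<^sup>* y1 v" "eye_insertion\<^sup>*\<^sup>* z1 v"
        have "y = v" by (rule less.hyps[OF less'(1) ti(1) y1(2) v1(1)]) (simp add: v(2))
        moreover have "z = v" by (rule less.hyps[OF less'(2) ti(2) z1(2) v1(2)]) (simp add: v(2) less.prems(4))
        ultimately show ?thesis by simp
      qed
    qed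
  qed
qed

section \<open>The product of \<open>BV\<close>\<close>

fun tmul :: "triple \<Rightarrow> triple \<Rightarrow> triple" where
  "tmul (T, b, U) (U', c, V) = (T, b \<otimes>\<^bsub>braid_group (size1 T)\<^esub> c, V)"

fun tinv :: "triple \<Rightarrow> triple" where
  "tinv (T, b, U) = (U, inv\<^bsub>braid_group (size1 T)\<^esub> b, T)"

lemma tmul_triples:
  assumes "x \<in> triples" "y \<in> triples" "tbot x = ttop y"
  shows "tmul x y \<in> triples"
proof -
  obtain T b U c V where e: "x = (T, b, U)" "y = (U, c, V)" using assms(3) by (cases x; cases y) auto
  interpret group "braid_group (size1 T)" by (rule group_braid_group)
  have "size1 V = size1 T" "b \<in> carrier (braid_group (size1 T))" "c \<in> carrier (braid_group (size1 T))"
    using assms(1,2) e triplesD[of T b U] triplesD[of U c V] by simp_all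
  then show ?thesis unfolding e by (simp add: triples_def)
qed

lemma ins_tmul:
  assumes "x \<in> triples" "y \<in> triples" "tbot x = ttop y" "i \<in> {1..size1 (ttop x)}"
  shows "tmul (ins i x) (ins (bend (fst (snd x)) i) y) = ins i (tmul x y)"
proof -
  obtain T b U c V where e: "x = (T, b, U)" "y = (U, c, V)" using assms(3) by (cases x; cases y) auto
  have s: "size1 U = size1 T" and b: "b \<in> carrier (braid_group (size1 T))" and c: "c \<in> carrier (braid_group (size1 T))"
    using assms(1,2) e by (auto simp: triples_def)
  show ?thesis using assms(4) s by (simp add: e dbr_mult[OF b c] bend_mult[OF b c] del: atLeastAtMost_iff)
qed

lemma eye_insertion_left_factor:
  assumes xy: "x \<in> triples" "y \<in> triples" "tbot x = ttop y" and e: "eye_insertion x x'"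
  shows "\<exists>y'. eye_insertion y y' \<and> tbot x' = ttop y' \<and> eye_insertion (tmul x y) (tmul x' y')"
proof -
  obtain i where i: "i \<in> {1..size1 (ttop x)}" "x' = ins i x" using e by (auto simp: eye_insertion_iff)
  let ?j = "bend (fst (snd x)) i"
  obtain T b U c V where t: "x = (T, b, U)" "y = (U, c, V)" using xy(3) by (cases x; cases y) auto
  have b: "size1 U = size1 T" "b \<in> carrier (braid_group (size1 T))" using xy(1) t(1) triplesD by blast+
  have "bend b i \<in> {1..size1 T}" by (rule bend_range[OF b(2)]) (use i(1) t(1) in simp)
  then have j: "?j \<in> {1..size1 (ttop y)}" by (simp only: t fst_conv snd_conv b(1))
  have tt: "ttop (tmul x y) = ttop x" by (simp add: t)
  have "eye_insertion y (ins ?j y)" using xy j by (auto simp: eye_insertion_iff)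
  moreover have "tbot x' = ttop (ins ?j y)" using i t by simp
  moreover have "eye_insertion (tmul x y) (tmul x' (ins ?j y))"
    unfolding i(2) ins_tmul[OF xy i(1)] eye_insertion_iff tt using tmul_triples[OF xy] i(1) by blast
  ultimately show ?thesis by blast
qed

text \<open>The strand at any bottom position of the left factor starts at some top position,
  where the matching eye is inserted.\<close>

lemma eye_insertion_right_factor:
  assumes xy: "x \<in> triples" "y \<in> triples" "tbot x = ttop y" and e: "eye_insertion y y'"
  shows "\<exists>x'. eye_insertion x x' \<and> tbot x' = ttop y' \<and> eye_insertion (tmul x y) (tmul x' y')"
proof -
  obtain j where j: "j \<in> {1..size1 (ttop y)}" "y' = ins j y" using e by (auto simp: eye_insertion_iff)
  obtain T b U c V where t: "x = (T, b, U)" "y = (U, c, V)" using xy(3) by (cases x; cases y) auto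
  have b: "b \<in> carrier (braid_group (size1 T))" and s: "size1 U = size1 T" using xy t by (auto simp: triples_def)
  define i where "i = pinv (bend b) j"
  have i: "i \<in> {1..size1 T}"
    unfolding i_def by (rule perm_range[OF permutes_pinv[OF bend_permutes[OF b]]]) (use j t s in simp)
  have ij: "bend b i = j" unfolding i_def using permutes_inverses(1)[OF bend_permutes[OF b]] .
  have i': "i \<in> {1..size1 (ttop x)}" using i t by simp
  have "eye_insertion x (ins i x)" using xy i' by (auto simp: eye_insertion_iff)
  moreover have "tbot (ins i x) = ttop y'" using j t ij by simp
  moreover have "eye_insertion (tmul x y) (tmul (ins i x) y')"
  proof -
    have "tmul (ins i x) y' = ins i (tmul x y)" using ins_tmul[OF xy i'] ij by (simp add: j(2) t)
    moreover have "ttop (tmul x y) = ttop x" by (simp add: t)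
    ultimately show ?thesis unfolding eye_insertion_iff using tmul_triples[OF xy] i' by auto
  qed
  ultimately show ?thesis by blast
qed

lemma expansion_left_factor:
  assumes "eye_insertion\<^sup>*\<^sup>* x x'" "x \<in> triples" "y \<in> triples" "tbot x = ttop y"
  shows "\<exists>y'. eye_insertion\<^sup>*\<^sup>* y y' \<and> tbot x' = ttop y' \<and> eye_insertion\<^sup>*\<^sup>* (tmul x y) (tmul x' y')"
  using assms
proof (induction rule: rtranclp_induct)
  case (step u v)
  then obtain y' where y': "eye_insertion\<^sup>*\<^sup>* y y'" "tbot u = ttop y'" "eye_insertion\<^sup>*\<^sup>* (tmul x y) (tmul u y')" by blast
  have "u \<in> triples" "y' \<in> triples" using eye_insertion_star(1) step.hyps(1) y'(1) step.prems by blast+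
  from eye_insertion_left_factor[OF this y'(2) step.hyps(2)] obtain z where
    z: "eye_insertion y' z" "tbot v = ttop z" "eye_insertion (tmul u y') (tmul v z)" by (elim exE conjE)
  show ?case
    by (intro exI[of _ z] conjI z(2) rtranclp.rtrancl_into_rtrancl[OF y'(1) z(1)] rtranclp.rtrancl_into_rtrancl[OF y'(3) z(3)])
next
  case base
  show ?case by (rule exI[of _ y]) (simp add: base(3))
qed

lemma expansion_right_factor:
  assumes "eye_insertion\<^sup>*\<^sup>* y y'" "x \<in> triples" "y \<in> triples" "tbot x = ttop y"
  shows "\<exists>x'. eye_insertion\<^sup>*\<^sup>* x x' \<and> tbot x' = ttop y' \<and> eye_insertion\<^sup>*\<^sup>* (tmul x y) (tmul x' y')"
  using assms
proof (induction rule: rtranclp_induct)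
  case (step u v)
  then obtain x' where x': "eye_insertion\<^sup>*\<^sup>* x x'" "tbot x' = ttop u" "eye_insertion\<^sup>*\<^sup>* (tmul x y) (tmul x' u)" by blast
  have "x' \<in> triples" "u \<in> triples" using eye_insertion_star(1) step.hyps(1) x'(1) step.prems by blast+
  from eye_insertion_right_factor[OF this x'(2) step.hyps(2)] obtain z where
    z: "eye_insertion x' z" "tbot z = ttop v" "eye_insertion (tmul x' u) (tmul z v)" by (elim exE conjE)
  show ?case
    by (intro exI[of _ z] conjI z(2) rtranclp.rtrancl_into_rtrancl[OF x'(1) z(1)] rtranclp.rtrancl_into_rtrancl[OF x'(3) z(3)])
next
  case base
  show ?case by (rule exI[of _ x]) (simp add: base(3))
qed

lemma eye_equiv_star: "eye_insertion\<^sup>*\<^sup>* x y \<Longrightarrow> equivclp eye_insertion x y"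
proof (induction rule: rtranclp_induct)
  case (step y z)
  then show ?case using equivclp_into_equivclp[of eye_insertion x y z] by blast
qed simp

text \<open>The factors are expanded alternately. By confluence, both right factors expand to one
  triple; the left factors that match it are equivalent and again have a common expansion; the two
  right factors that match this one agree because expansions with the same top tree are
  unique.\<close>

lemma tmul_equiv:
  assumes x: "x \<in> triples" "x' \<in> triples" and y: "y \<in> triples" "y' \<in> triples"
    and m: "tbot x = ttop y" "tbot x' = ttop y'"
    and ex: "equivclp eye_insertion x x'" and ey: "equivclp eye_insertion y y'"
  shows "equivclp eye_insertion (tmul x y) (tmul x' y')"
proof -
  obtain z where z: "eye_insertion\<^sup>*\<^sup>* y z" "eye_insertion\<^sup>*\<^sup>* y' z" using eye_equiv_join[OF ey] by blast
  obtain x1 where x1: "eye_insertion\<^sup>*\<^sup>* x x1" "tbot x1 = ttop z" "eye_insertion\<^sup>*\<^sup>* (tmul x y) (tmul x1 z)"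
    using expansion_right_factor[OF z(1) x(1) y(1) m(1)] by (elim exE conjE)
  obtain x1' where x1': "eye_insertion\<^sup>*\<^sup>* x' x1'" "tbot x1' = ttop z" "eye_insertion\<^sup>*\<^sup>* (tmul x' y') (tmul x1' z)"
    using expansion_right_factor[OF z(2) x(2) y(2) m(2)] by (elim exE conjE)
  have tz: "z \<in> triples" "x1 \<in> triples" "x1' \<in> triples" using eye_insertion_star(1) z x1 x1' x y by blast+
  have "equivclp eye_insertion x1 x1'"
    by (rule equivclp_trans[OF equivclp_sym[OF eye_equiv_star[OF x1(1)]] equivclp_trans[OF ex eye_equiv_star[OF x1'(1)]]])
  then obtain x2 where x2: "eye_insertion\<^sup>*\<^sup>* x1 x2" "eye_insertion\<^sup>*\<^sup>* x1' x2" using eye_equiv_join by blast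
  obtain z1 where z1: "eye_insertion\<^sup>*\<^sup>* z z1" "tbot x2 = ttop z1" "eye_insertion\<^sup>*\<^sup>* (tmul x1 z) (tmul x2 z1)"
    using expansion_left_factor[OF x2(1) tz(2,1) x1(2)] by (elim exE conjE)
  obtain z1' where z1': "eye_insertion\<^sup>*\<^sup>* z z1'" "tbot x2 = ttop z1'" "eye_insertion\<^sup>*\<^sup>* (tmul x1' z) (tmul x2 z1')"
    using expansion_left_factor[OF x2(2) tz(3,1) x1'(2)] by (elim exE conjE)
  have "z1 = z1'" using expansion_unique[OF tz(1) z1(1) z1'(1)] z1(2) z1'(2) by simp
  then have "equivclp eye_insertion (tmul x y) (tmul x2 z1)" "equivclp eye_insertion (tmul x' y') (tmul x2 z1)"
    using equivclp_trans[OF eye_equiv_star[OF x1(3)] eye_equiv_star[OF z1(3)]]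
      equivclp_trans[OF eye_equiv_star[OF x1'(3)] eye_equiv_star[OF z1'(3)]] by simp_all
  from equivclp_trans[OF this(1) equivclp_sym[OF this(2)]] show ?thesis .
qed

lemma bv_class_eq: "equivclp eye_insertion x y \<Longrightarrow> bv_class x = bv_class y"
  unfolding bv_class_def using equivclp_trans[of eye_insertion] equivclp_sym[of eye_insertion x y] by blast

lemma bv_class_triples:
  assumes "y \<in> bv_class x" "x \<in> triples"
  shows "y \<in> triples"
proof -
  obtain z where z: "eye_insertion\<^sup>*\<^sup>* x z" "eye_insertion\<^sup>*\<^sup>* y z"
    using eye_equiv_join assms(1) unfolding bv_class_def by blast
  from z(2) show ?thesis
  proof (cases rule: converse_rtranclpE)
    case base
    then show ?thesis using eye_insertion_star(1)[OF z(1) assms(2)] by simp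
  qed (auto simp: eye_insertion_iff)
qed

lemma bv_mult:
  assumes x: "x \<in> triples" and y: "y \<in> triples" and m: "tbot x = ttop y"
  shows "bv_class x \<otimes>\<^bsub>BV\<^esub> bv_class y = bv_class (tmul x y)"
proof -
  let ?S = "{bv_class (T, b \<otimes>\<^bsub>braid_group (size1 T)\<^esub> c, V) |T b U c V. (T, b, U) \<in> bv_class x \<and> (U, c, V) \<in> bv_class y}"
  have "A = bv_class (tmul x y)" if A: "A \<in> ?S" for A
  proof -
    obtain T b U c V where e: "A = bv_class (T, b \<otimes>\<^bsub>braid_group (size1 T)\<^esub> c, V)"
      "(T, b, U) \<in> bv_class x" "(U, c, V) \<in> bv_class y" using A by blast
    have "equivclp eye_insertion (tmul x y) (tmul (T, b, U) (U, c, V))"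
      by (rule tmul_equiv[OF x _ y _ m])
        (use e(2,3) bv_class_triples[OF e(2) x] bv_class_triples[OF e(3) y] in \<open>auto simp: bv_class_def\<close>)
    then show ?thesis using bv_class_eq e(1) by simp
  qed
  moreover have "bv_class (tmul x y) \<in> ?S"
  proof -
    obtain T b U c V where t: "x = (T, b, U)" "y = (U, c, V)" using m by (cases x; cases y) auto
    have "x \<in> bv_class x" "y \<in> bv_class y" by (simp_all add: bv_class_def)
    then show ?thesis using t by fastforce
  qed
  ultimately have "\<Union> ?S = bv_class (tmul x y)" by blast
  then show ?thesis by (simp add: BV_def)
qed

lemma tinv_triples: "t \<in> triples \<Longrightarrow> tinv t \<in> triples"
  using group.inv_closed[OF group_braid_group] by (cases t) (auto simp: triples_def)

lemma tinv_tinv: "t \<in> triples \<Longrightarrow> tinv (tinv t) = t"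
  using group.inv_inv[OF group_braid_group] by (cases t) (auto simp: triples_def)

lemma tinv_ins:
  assumes "t \<in> triples" "i \<in> {1..size1 (ttop t)}"
  shows "\<exists>j \<in> {1..size1 (ttop (tinv t))}. tinv (ins i t) = ins j (tinv t)"
proof -
  obtain T b U where t: "t = (T, b, U)" by (cases t)
  have b: "size1 U = size1 T" "b \<in> carrier (braid_group (size1 T))" using assms t triplesD by blast+
  have i: "i \<in> {1..size1 T}" using assms(2) t by simp
  have "pinv (bend b) (bend b i) = i" by (rule permutes_inverses(2)[OF bend_permutes[OF b(2)]])
  then have "tinv (ins i t) = ins (bend b i) (tinv t)"
    using i b(1) dbr_inv[OF b(2), of i] by (simp add: t bend_inv[OF b(2)] del: atLeastAtMost_iff)
  then show ?thesis using bend_range[OF b(2) i] b(1) t by auto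
qed

lemma tinv_star:
  assumes "eye_insertion\<^sup>*\<^sup>* x y"
  shows "eye_insertion\<^sup>*\<^sup>* (tinv x) (tinv y)"
  using assms
proof (induction rule: rtranclp_induct)
  case (step y z)
  have "eye_insertion (tinv y) (tinv z)"
    using step.hyps(2) tinv_ins tinv_triples unfolding eye_insertion_iff by blast
  then show ?case using step.IH by simp
qed simp

section \<open>Eye removals\<close>

definition eye_at :: "nat \<Rightarrow> triple \<Rightarrow> bool" where
  "eye_at k t \<longleftrightarrow> (\<exists>t' \<in> triples. k \<in> {1..size1 (ttop t')} \<and> t = ins k t')"

lemma reduced_iff: "reduced t \<longleftrightarrow> (\<forall>k. \<not> eye_at k t)"
  unfolding reduced_def eye_at_def eye_insertion_iff by blast

text \<open>Read backwards: removing an eye at \<open>i\<close> creates no eye to the right of \<open>i\<close>, so that a search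
  from right to left never has to turn back.\<close>

lemma eye_at_ins:
  assumes "eye_at k t" "i < k" "1 \<le> i"
  shows "eye_at (Suc k) (ins i t)"
proof -
  obtain t' where t': "t' \<in> triples" "k \<in> {1..size1 (ttop t')}" "t = ins k t'" using assms(1) unfolding eye_at_def by blast
  have i: "i \<in> {1..size1 (ttop t')}" using assms t'(2) by auto
  have u: "up k i = i" "up i k = Suc k" using assms(2) by (auto simp: up_def)
  have "ins i t = ins (Suc k) (ins i t')"
    using ins_commute[OF t'(1) _ t'(2) i] assms(2) unfolding u t'(3) by simp
  moreover have "Suc k \<in> {1..size1 (ttop (ins i t'))}" using t'(2) i by (cases t') simp
  ultimately show ?thesis unfolding eye_at_def using ins_triples[OF t'(1) i] by blast
qed

lemma eye_removal:
  assumes t: "(T, gval (size1 T) (words (size1 T) ss) m, V) \<in> triples" and g: "greedy (size1 T) ss"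
    and T: "has_caret T i" and u: "unribbon i ss m = Some (b, ts)"
    and V: "has_caret V ((half_twist (size1 T - 1) ^^ m) b)"
  defines "T' \<equiv> remove_caret T i" and "V' \<equiv> remove_caret V ((half_twist (size1 T - 1) ^^ m) b)"
  shows "(T', gval (size1 T') (words (size1 T') ts) m, V') \<in> triples"
    "greedy (size1 T') ts" "length ts = length ss" "Suc (size1 T') = size1 T"
    "ins i (T', gval (size1 T') (words (size1 T') ts) m, V') = (T, gval (size1 T) (words (size1 T) ss) m, V)" "i \<in> {1..size1 T'}"
proof -
  have T': "add_caret T' i = T" "Suc (size1 T') = size1 T" using add_remove_caret[OF T] by (simp_all add: T'_def)
  have n: "size1 T - 1 = size1 T'" using T'(2) by simp
  have V': "add_caret V' ((half_twist (size1 T') ^^ m) b) = V" "Suc (size1 V') = size1 V"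
    using add_remove_caret[OF V] unfolding V'_def n by simp_all
  show i: "i \<in> {1..size1 T'}" using has_caret_pos[OF T] T'(2) by auto
  note r = unribbon_dbr[OF g[folded T'(2)] i u]
  show "greedy (size1 T') ts" "length ts = length ss" by (rule r)+
  show "Suc (size1 T') = size1 T" by (rule T')
  have "size1 V = size1 T" using triplesD[OF t] by simp
  then show "(T', gval (size1 T') (words (size1 T') ts) m, V') \<in> triples"
    using V' T' set_words[OF greedy_perms[OF r(1)]] by (simp add: triples_def)
  show "ins i (T', gval (size1 T') (words (size1 T') ts) m, V') = (T, gval (size1 T) (words (size1 T) ss) m, V)"
    using r(2,3) T' V' by simp
qed

text \<open>If there is an eye, then the test is successful by \<open>unribbon_complete\<close>,
  and the end of the removed strand is the end of the doubled strand, where the bottom tree has a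
  caret.\<close>

lemma eye_at_test:
  assumes e: "eye_at i (T, gval (size1 T) (words (size1 T) ss) m, V)" and g: "greedy (size1 T) ss"
  shows "has_caret T i \<and> (\<exists>b ts. unribbon i ss m = Some (b, ts) \<and> has_caret V ((half_twist (size1 T - 1) ^^ m) b))"
proof -
  obtain T' \<beta> V' where t': "(T', \<beta>, V') \<in> triples" "i \<in> {1..size1 T'}"
    "(T, gval (size1 T) (words (size1 T) ss) m, V) = ins i (T', \<beta>, V')" using e unfolding eye_at_def by force
  have e1: "T = add_caret T' i \<and> gval (size1 T) (words (size1 T) ss) m = dbr (size1 T') i \<beta> \<and> V = add_caret V' (bend \<beta> i)"
    using t'(3) unfolding ins.simps prod.inject .
  then have "size1 T = Suc (size1 T')" using size1_add_caret[of i T'] t'(2) by metis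
  with e1 have e: "T = add_caret T' i" "size1 T = Suc (size1 T')" "V = add_caret V' (bend \<beta> i)"
    "gval (size1 T) (words (size1 T) ss) m = dbr (size1 T') i \<beta>" by blast+
  have \<beta>: "size1 V' = size1 T'" "\<beta> \<in> carrier (braid_group (size1 T'))" using triplesD[OF t'(1)] by blast+
  have "unribbon i ss m \<noteq> None"
    by (rule unribbon_complete[OF g[unfolded e(2)] t'(2) \<beta>(2) e(4)[unfolded e(2)]])
  then obtain b ts where u: "unribbon i ss m = Some (b, ts)" by auto
  note r = unribbon_dbr[OF g[unfolded e(2)] t'(2) u]
  have "bend (dbr (size1 T') i \<beta>) i = bend (dbr (size1 T') i (gval (size1 T') (words (size1 T') ts) m)) i"
    using e(4)[unfolded e(2)] r(2) by (simp only:)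
  then have "bend \<beta> i = (half_twist (size1 T') ^^ m) b"
    using r(3) set_words[OF greedy_perms[OF r(1)]] by (simp add: bend_dbr[OF \<beta>(2)] bend_dbr)
  moreover have "has_caret V (bend \<beta> i)"
    using remove_add_caret[of "bend \<beta> i" V'] bend_range[OF \<beta>(2) t'(2)] \<beta>(1) e(3) by simp
  moreover have "has_caret T i" using remove_add_caret[OF t'(2)] e(1) by simp
  ultimately show ?thesis using u e(2) by simp
qed

section \<open>Insertions for word triples\<close>

lemma triple_of_triples: "size1 T = size1 U \<Longrightarrow> letters (size1 T) w \<Longrightarrow> triple_of (T, w, U) \<in> triples"
  by (simp add: triples_def)

lemma triple_of_ins:
  assumes "letters (size1 T) w" "i \<in> {1..size1 T}"
  shows "triple_of (add_caret T i, dblw i w, add_caret U (wend w i)) = ins i (triple_of (T, w, U))"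
  using dblw[OF assms(1), of i] assms(2) by simp

lemma triple_of_tinv:
  "letters (size1 T) w \<Longrightarrow> size1 U = size1 T \<Longrightarrow> triple_of (U, winvw w, T) = tinv (triple_of (T, w, U))"
  using word_braid_winvw by simp

lemma triple_of_tmul:
  assumes "letters (size1 T) v" "letters (size1 T) w" "size1 U = size1 T"
  shows "triple_of (T, v @ w, V) = tmul (triple_of (T, v, U)) (triple_of (U, w, V))"
  using word_braid_append[OF assms(1,2)] assms(3) by simp

lemma right_greedy_letters: "right_greedy n w \<Longrightarrow> letters n w"
  unfolding right_greedy_def by (auto simp: letters_def perms_def)

section \<open>Running programs\<close>

inductive_cases eval_VarE: "eval P env (EVar i) a t"
inductive_cases eval_ConstE: "eval P env (EConst m) a t"
inductive_cases eval_Op1E: "eval P env (EOp1 f e) a t"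
inductive_cases eval_Op2E: "eval P env (EOp2 f e e') a t"
inductive_cases eval_TreeE: "eval P env (ETree f e e') a t"
inductive_cases eval_IfE: "eval P env (EIf c e e') a t"
inductive_cases eval_LetE: "eval P env (ELet e e') a t"
inductive_cases eval_CallE: "eval P env (ECall f e) a t"

lemma eval_deterministic: "eval P env e a t \<Longrightarrow> eval P env e b u \<Longrightarrow> a = b \<and> t = u"
proof (induction arbitrary: b u rule: eval.induct)
  case (1 i env)
  then show ?case by (auto elim: eval_VarE)
next
  case (2 env m)
  then show ?case by (auto elim: eval_ConstE)
next
  case (3 env e a t f)
  from 3(3) show ?case by (rule eval_Op1E) (use 3(2) in blast)
next
  case (4 env e a t e' a' t' f)
  from 4(5) show ?case by (rule eval_Op2E) (use 4(3,4) in blast)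
next
  case (5 env e a t e' a' t' f)
  from 5(5) show ?case by (rule eval_TreeE) (use 5(3,4) in blast)
next
  case (6 env c a t e e' b t')
  from 6(5) show ?case by (rule eval_IfE) (use 6(3,4) in blast)
next
  case (7 env e a t e' b t')
  from 7(5) show ?case by (rule eval_LetE) (use 7(3,4) in blast)
next
  case (8 f env e a t b t')
  from 8(6) show ?case by (rule eval_CallE) (use 8(4,5) in blast)
qed

text \<open>Evaluation is deterministic, so that symbolic execution is rewriting: \<open>wp P env e Q\<close> says that
  \<open>e\<close> evaluates to a value at a cost with the property \<open>Q\<close>.\<close>

definition wp :: "program \<Rightarrow> val list \<Rightarrow> exp \<Rightarrow> (val \<Rightarrow> nat \<Rightarrow> bool) \<Rightarrow> bool" where
  "wp P env e Q \<longleftrightarrow> (\<exists>a t. eval P env e a t \<and> Q a t)"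

definition halts :: "program \<Rightarrow> nat \<Rightarrow> val \<Rightarrow> bool" where
  "halts P f a \<longleftrightarrow> (\<exists>b t. eval P [a] (P ! f) b t)"

definition res :: "program \<Rightarrow> nat \<Rightarrow> val \<Rightarrow> val" where
  "res P f a = (THE b. \<exists>t. eval P [a] (P ! f) b t)"

definition cost :: "program \<Rightarrow> nat \<Rightarrow> val \<Rightarrow> nat" where
  "cost P f a = (THE t. \<exists>b. eval P [a] (P ! f) b t)"

text \<open>The value and an upper bound for the cost of a call of function \<open>f\<close>,
  without the cost of the call itself.\<close>

definition runs :: "program \<Rightarrow> nat \<Rightarrow> val \<Rightarrow> val \<Rightarrow> nat \<Rightarrow> bool" where
  "runs P f a b B \<longleftrightarrow> halts P f a \<and> res P f a = b \<and> cost P f a \<le> B"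

lemma res_cost: "eval P [a] (P ! f) b t \<Longrightarrow> halts P f a \<and> res P f a = b \<and> cost P f a = t"
  unfolding halts_def res_def cost_def using eval_deterministic by (auto intro!: the_equality)

lemma wp_Var: "wp P env (EVar i) Q \<longleftrightarrow> i < length env \<and> Q (env ! i) 1"
  unfolding wp_def by (auto elim: eval_VarE intro: eval.intros)

lemma wp_Const: "wp P env (EConst m) Q \<longleftrightarrow> Q (Num m) 1"
  unfolding wp_def by (auto elim: eval_ConstE intro: eval.intros)

lemma wp_Op1: "wp P env (EOp1 f e) Q \<longleftrightarrow> wp P env e (\<lambda>a t. Q (apply_op1 f a) (t + 1))"
  unfolding wp_def by (blast elim: eval_Op1E intro: eval.intros)

lemma wp_Op2: "wp P env (EOp2 f e e') Q \<longleftrightarrow>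
    wp P env e (\<lambda>a t. wp P env e' (\<lambda>a' t'. Q (apply_op2 f a a') (t + t' + 1)))"
  unfolding wp_def by (blast elim: eval_Op2E intro: eval.intros)

lemma wp_Tree: "wp P env (ETree f e e') Q \<longleftrightarrow>
    wp P env e (\<lambda>a t. wp P env e' (\<lambda>a' t'. Q (apply_tree_op f a a') (t + t')))"
  unfolding wp_def by (blast elim: eval_TreeE intro: eval.intros)

lemma wp_If: "wp P env (EIf c e e') Q \<longleftrightarrow>
    wp P env c (\<lambda>a t. wp P env (if a \<noteq> Num 0 then e else e') (\<lambda>b t'. Q b (t + t' + 1)))"
  unfolding wp_def by (blast elim: eval_IfE intro: eval.intros)

lemma wp_Let: "wp P env (ELet e e') Q \<longleftrightarrow>
    wp P env e (\<lambda>a t. wp P (a # env) e' (\<lambda>b t'. Q b (t + t' + 1)))"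
  unfolding wp_def by (blast elim: eval_LetE intro: eval.intros)

lemma wp_Call: "wp P env (ECall f e) Q \<longleftrightarrow>
    wp P env e (\<lambda>a t. f < length P \<and> halts P f a \<and> Q (res P f a) (t + cost P f a + 1))"
proof
  assume "wp P env (ECall f e) Q"
  then obtain b t where bt: "eval P env (ECall f e) b t" "Q b t" unfolding wp_def by blast
  from bt(1) obtain a t1 t2 where "f < length P" "eval P env e a t1" "eval P [a] (P ! f) b t2" "t = t1 + t2 + 1"
    by (rule eval_CallE)
  then show "wp P env e (\<lambda>a t. f < length P \<and> halts P f a \<and> Q (res P f a) (t + cost P f a + 1))"
    unfolding wp_def using res_cost bt(2) by blast
next
  assume "wp P env e (\<lambda>a t. f < length P \<and> halts P f a \<and> Q (res P f a) (t + cost P f a + 1))"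
  then obtain a t1 where a: "eval P env e a t1" "f < length P" "halts P f a" "Q (res P f a) (t1 + cost P f a + 1)"
    unfolding wp_def by blast
  then obtain b t2 where b: "eval P [a] (P ! f) b t2" unfolding halts_def by blast
  from eval.intros(8)[OF a(2,1) b] show "wp P env (ECall f e) Q"
    unfolding wp_def using a(4) res_cost[OF b] by blast
qed

lemmas wp_simps = wp_Var wp_Const wp_Op1 wp_Op2 wp_Tree wp_If wp_Let wp_Call

lemma runsI: "wp P [a] (P ! f) (\<lambda>b' t. b' = b \<and> t \<le> B) \<Longrightarrow> runs P f a b B"
  unfolding wp_def runs_def using res_cost by blast

lemma runs_mono: "runs P f a b B \<Longrightarrow> B \<le> B' \<Longrightarrow> runs P f a b B'"
  by (simp add: runs_def)

lemma runs_computes: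
  assumes "runs P 0 a b B" "0 < length P"
  shows "\<exists>t \<le> B + 2. computes_in_time P a b t"
proof -
  have "wp P [a] (ECall 0 (EVar 0)) (\<lambda>b' t. b' = b \<and> t \<le> B + 2)"
    using assms by (simp add: wp_simps runs_def)
  then show ?thesis unfolding wp_def computes_in_time_def by blast
qed

section \<open>The program\<close>

abbreviation (input) "V0 \<equiv> EVar 0"
abbreviation (input) "V1 \<equiv> EVar (Suc 0)"
abbreviation (input) "V2 \<equiv> EVar (Suc (Suc 0))"
abbreviation (input) "V3 \<equiv> EVar (Suc (Suc (Suc 0)))"
abbreviation (input) "V4 \<equiv> EVar (Suc (Suc (Suc (Suc 0))))"
abbreviation (input) "V5 \<equiv> EVar (Suc (Suc (Suc (Suc (Suc 0)))))"
abbreviation (input) "V6 \<equiv> EVar (Suc (Suc (Suc (Suc (Suc (Suc 0))))))"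
abbreviation (input) "C0 \<equiv> EConst 0"
abbreviation (input) "C1 \<equiv> EConst 1"
abbreviation (input) "Fst e \<equiv> EOp1 OFst e"
abbreviation (input) "Snd e \<equiv> EOp1 OSnd e"
abbreviation (input) "IsPair e \<equiv> EOp1 OIsPair e"
abbreviation (input) "Succ e \<equiv> EOp1 OSuc e"
abbreviation (input) "Pair2 e e' \<equiv> EOp2 OPair e e'"
abbreviation (input) "Pair3 e e' e'' \<equiv> Pair2 e (Pair2 e' e'')"
abbreviation (input) "Pair4 e e' e'' e3 \<equiv> Pair2 e (Pair3 e' e'' e3)"
abbreviation (input) "Pair5 e e' e'' e3 e4 \<equiv> Pair2 e (Pair4 e' e'' e3 e4)"
abbreviation (input) "Minus e e' \<equiv> EOp2 OSub e e'"
abbreviation (input) "Less e e' \<equiv> EOp2 OLess e e'"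
abbreviation (input) "Eq e e' x y \<equiv> EIf (Less e e') y (EIf (Less e' e) y x)"

abbreviation (input) "f_revflip \<equiv> 1 :: nat"
abbreviation (input) "f_nth \<equiv> 2 :: nat"
abbreviation (input) "f_idx \<equiv> 3 :: nat"
abbreviation (input) "f_dbl \<equiv> 4 :: nat"
abbreviation (input) "f_del \<equiv> 5 :: nat"
abbreviation (input) "f_flip \<equiv> 6 :: nat"
abbreviation (input) "f_flipn \<equiv> 7 :: nat"
abbreviation (input) "f_rcompl \<equiv> 8 :: nat"
abbreviation (input) "f_revapp \<equiv> 9 :: nat"
abbreviation (input) "f_slide \<equiv> 10 :: nat"
abbreviation (input) "f_insert \<equiv> 11 :: nat"
abbreviation (input) "f_push \<equiv> 12 :: nat"
abbreviation (input) "f_dblw \<equiv> 13 :: nat"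
abbreviation (input) "f_expand \<equiv> 14 :: nat"
abbreviation (input) "f_unribbon \<equiv> 15 :: nat"
abbreviation (input) "f_hpow \<equiv> 16 :: nat"
abbreviation (input) "f_eyes \<equiv> 17 :: nat"
abbreviation (input) "f_isid \<equiv> 18 :: nat"
abbreviation (input) "f_strip \<equiv> 19 :: nat"
abbreviation (input) "f_out \<equiv> 20 :: nat"
abbreviation (input) "f_desc \<equiv> 21 :: nat"
abbreviation (input) "f_rep \<equiv> 22 :: nat"

text \<open>Arguments are nested pairs in the order of the parameters, and an accumulator is the
  last one. What each function computes, and at which cost, is stated in the corresponding
  \<open>run\<close> lemma.\<close>

definition b_revflip :: exp where
  "b_revflip = EIf (IsPair (Fst V0))
     (ECall f_revflip (Pair2 (Snd (Fst V0))
        (Pair2 (Pair2 (Minus C1 (Fst (Fst (Fst V0)))) (Snd (Fst (Fst V0)))) (Snd V0))))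
     (Snd V0)"

definition b_nth :: exp where
  "b_nth = EIf (Less C1 (Fst V0)) (ECall f_nth (Pair2 (Minus (Fst V0) C1) (Snd (Snd V0)))) (Fst (Snd V0))"

definition b_idx :: exp where
  "b_idx = Eq (Fst V0) (Fst (Snd V0)) C1 (Succ (ECall f_idx (Pair2 (Fst V0) (Snd (Snd V0)))))"

definition b_dbl :: exp where
  "b_dbl = EIf (IsPair (Snd V0))
     (ELet (ECall f_dbl (Pair2 (Fst V0) (Snd (Snd V0))))
       (EIf (Less (Fst (Snd V1)) (Fst V1)) (Pair2 (Fst (Snd V1)) V0)
         (EIf (Less (Fst V1) (Fst (Snd V1))) (Pair2 (Succ (Fst (Snd V1))) V0)
           (Pair3 (Fst (Snd V1)) (Succ (Fst (Snd V1))) V0)))) C0"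

definition b_del :: exp where
  "b_del = EIf (IsPair (Snd V0))
     (ELet (ECall f_del (Pair2 (Fst V0) (Snd (Snd V0))))
       (EIf (Less (Fst (Snd V1)) (Fst V1)) (Pair2 (Fst (Snd V1)) V0)
         (EIf (Less (Fst V1) (Fst (Snd V1))) (Pair2 (Minus (Fst (Snd V1)) C1) V0) V0))) C0"

text \<open>Reversing a list while subtracting its entries from \<open>n + 1\<close> is
  conjugation by the half twist.\<close>

definition b_flip :: exp where
  "b_flip = EIf (IsPair (Fst V0))
     (ECall f_flip (Pair3 (Snd (Fst V0)) (Fst (Snd V0))
        (Pair2 (Minus (Fst (Snd V0)) (Fst (Fst V0))) (Snd (Snd V0)))))
     (Snd (Snd V0))"

definition b_flipn :: exp where
  "b_flipn = EIf (Fst V0)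
     (ECall f_flipn (Pair3 (Minus (Fst V0) C1) (ECall f_flip (Pair3 (Fst (Snd V0)) (Snd (Snd V0)) C0)) (Snd (Snd V0))))
     (Fst (Snd V0))"

text \<open>There is no random access in a list: the inverse permutation is computed by searching
  for each of the values, which is possible in time \<open>O(n\<^sup>2)\<close>.\<close>

definition b_rcompl :: exp where
  "b_rcompl = EIf (Fst V0)
     (ECall f_rcompl (Pair4 (Minus (Fst V0) C1) (Fst (Snd V0)) (Fst (Snd (Snd V0)))
        (Pair2 (Minus (Fst (Snd (Snd V0))) (ECall f_idx (Pair2 (Fst V0) (Fst (Snd V0))))) (Snd (Snd (Snd V0))))))
     (Snd (Snd (Snd V0)))"

definition b_revapp :: exp where
  "b_revapp = EIf (IsPair (Fst V0)) (ECall f_revapp (Pair2 (Snd (Fst V0)) (Pair2 (Fst (Fst V0)) (Snd V0)))) (Snd V0)"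

text \<open>The two lists that are sorted are those of \<open>rcompl n r\<close> and \<open>t\<close>, for a pair of letters \<open>r\<close>
  and \<open>t\<close>. Both are split at a common cursor: the argument consists of the two parts to the left of
  it, nearest entry first, and the two parts to the right.\<close>

abbreviation (input) "slide_move \<equiv>
  ECall f_slide (Pair2 (Pair2 (Pair2 (Fst (Fst (Snd V0))) (Fst (Fst V0))) (Pair2 (Fst (Snd (Snd V0))) (Snd (Fst V0))))
    (Pair2 (Snd (Fst (Snd V0))) (Snd (Snd (Snd V0)))))"

abbreviation (input) "slide_swap \<equiv>
  ECall f_slide (Pair2 (Pair2 (Snd (Fst (Fst V0))) (Snd (Snd (Fst V0))))
    (Pair2 (Pair3 (Fst (Fst (Snd V0))) (Fst (Fst (Fst V0))) (Snd (Fst (Snd V0))))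
      (Pair3 (Fst (Snd (Snd V0))) (Fst (Snd (Fst V0))) (Snd (Snd (Snd V0))))))"

definition b_slide :: exp where
  "b_slide = EIf (IsPair (Fst (Snd V0)))
     (EIf (IsPair (Fst (Fst V0)))
       (EIf (Less (Fst (Fst (Fst V0))) (Fst (Fst (Snd V0))))
         (EIf (Less (Fst (Snd (Fst V0))) (Fst (Snd (Snd V0)))) slide_swap slide_move) slide_move) slide_move)
     (Fst V0)"

text \<open>The left letter is recovered from its complement by applying the complement once more,
  which gives its conjugate by the half twist, and then conjugating.\<close>

definition b_insert :: exp where
  "b_insert = EIf (IsPair (Fst (Snd V0)))
     (ELet (ECall f_rcompl (Pair4 (Snd (Snd V0)) (Fst (Fst (Snd V0))) (Succ (Snd (Snd V0))) C0))
     (ELet (ECall f_slide (Pair2 (Pair2 C0 C0) (Pair2 V0 (Fst V1))))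
     (ELet (ECall f_rcompl (Pair4 (Snd (Snd V2)) (ECall f_revapp (Pair2 (Fst V0) C0)) (Succ (Snd (Snd V2))) C0))
     (ELet (ECall f_flip (Pair3 V0 (Succ (Snd (Snd V3))) C0))
       (Pair2 (ECall f_revapp (Pair2 (Snd V2) C0))
         (ECall f_insert (Pair3 V0 (Snd (Fst (Snd V4))) (Snd (Snd V4)))))))))
     (Pair2 (Fst V0) C0)"

definition b_push :: exp where
  "b_push = EIf (IsPair (Fst V0))
     (ELet (Snd (Snd (Snd V0)))
       (EIf (Fst (Fst (Fst V1)))
         (ECall f_push (Pair4 (Snd (Fst V1))
            (ECall f_insert (Pair3 (ECall f_flipn (Pair3 (Fst (Snd (Snd V1))) (Snd (Fst (Fst V1))) (Succ V0))) (Fst (Snd V1)) V0))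
            (Fst (Snd (Snd V1))) V0))
         (ECall f_push (Pair4 (Snd (Fst V1))
            (ECall f_insert (Pair3 (ECall f_flipn (Pair3 (Fst (Snd (Snd V1)))
               (ECall f_rcompl (Pair4 V0 (Snd (Fst (Fst V1))) (Succ V0) C0)) (Succ V0))) (Fst (Snd V1)) V0))
            (Succ (Fst (Snd (Snd V1)))) V0))))
     (Pair2 (Fst (Snd V0)) (Fst (Snd (Snd V0))))"

definition b_dblw :: exp where
  "b_dblw = EIf (IsPair (Fst V0))
     (ELet (Fst (Fst V0))
       (EIf (Fst V0)
         (ELet (ECall f_nth (Pair2 (Snd V1) (Snd V0)))
           (ELet (ECall f_dblw (Pair2 (Snd (Fst V2)) V0))
             (Pair2 (Pair2 (Pair2 (Fst V2) (ECall f_dbl (Pair2 V1 (Snd V2)))) (Fst V0)) (Snd V0))))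
         (ELet (ECall f_dblw (Pair2 (Snd (Fst V1)) (ECall f_idx (Pair2 (Snd V1) (Snd V0)))))
           (Pair2 (Pair2 (Pair2 (Fst V1) (ECall f_dbl (Pair2 (Snd V2) (Snd V1)))) (Fst V0)) (Snd V0)))))
     (Pair2 C0 (Snd V0))"

definition b_expand :: exp where
  "b_expand = ELet (ETree TOpenLeaf (Fst V0) (Snd (Snd (Snd V0))))
     (EIf V0
       (ELet (ECall f_dblw (Pair2 (Fst (Snd V1)) V0))
         (ECall f_expand (Pair4 (ETree TAddCaret (Fst V2) V1) (Fst V0)
            (ETree TAddCaret (Fst (Snd (Snd V2))) (Snd V0)) (Snd (Snd (Snd V2))))))
       (Pair3 (Fst V1) (Fst (Snd V1)) (Fst (Snd (Snd V1)))))"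

definition b_unribbon :: exp where
  "b_unribbon = EIf (IsPair (Fst (Snd V0)))
     (ELet (Fst (Fst (Snd V0)))
     (ELet (ECall f_nth (Pair2 (Fst V1) V0))
     (ELet (ECall f_nth (Pair2 (Succ (Fst V2)) V1))
       (EIf (Less V1 V0)
         (EIf (Less (Succ V1) V0) C0
           (ELet (ECall f_unribbon (Pair3 V1 (Snd (Fst (Snd V3))) (Snd (Snd V3))))
             (EIf (IsPair V0) (Pair3 (Fst V0) (ECall f_del (Pair2 V1 V3)) (Snd V0)) C0)))
         (EIf (Less (Succ V0) V1) C0
           (EIf (Snd (Snd V3))
             (ELet (ECall f_unribbon (Pair3 V0 (Snd (Fst (Snd V3))) (Minus (Snd (Snd V3)) C1)))
               (EIf (IsPair V0) (Pair3 (Fst V0) (ECall f_del (Pair2 V2 V3)) (Snd V0)) C0)) C0))))))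
     (EIf (Snd (Snd V0)) C0 (Pair2 (Fst V0) C0))"

definition b_hpow :: exp where
  "b_hpow = EIf (Fst V0)
     (ECall f_hpow (Pair3 (Minus (Fst V0) C1) (Minus (Snd (Snd V0)) (Fst (Snd V0))) (Snd (Snd V0))))
     (Fst (Snd V0))"

definition b_eyes :: exp where
  "b_eyes = EIf (Fst V0)
     (EIf (ETree THasCaret (Fst (Snd V0)) (Fst V0))
       (ELet (ECall f_unribbon (Pair3 (Fst V0) (Fst (Snd (Snd V0))) (Fst (Snd (Snd (Snd V0))))))
         (EIf (IsPair V0)
           (ELet (ECall f_hpow (Pair3 (Fst (Snd (Snd (Snd V1)))) (Fst V0) (ETree TLeaves (Fst (Snd V1)) C0)))
             (EIf (ETree THasCaret (Snd (Snd (Snd (Snd V2)))) V0)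
               (ECall f_eyes (Pair5 (Fst V2) (ETree TRemoveCaret (Fst (Snd V2)) (Fst V2)) (Snd V1)
                  (Fst (Snd (Snd (Snd V2)))) (ETree TRemoveCaret (Snd (Snd (Snd (Snd V2)))) V0)))
               (ECall f_eyes (Pair2 (Minus (Fst V2) C1) (Snd V2)))))
           (ECall f_eyes (Pair2 (Minus (Fst V1) C1) (Snd V1)))))
       (ECall f_eyes (Pair2 (Minus (Fst V0) C1) (Snd V0))))
     (Pair3 (Fst (Snd V0)) (Fst (Snd (Snd V0))) (Snd (Snd (Snd (Snd V0)))))"

definition b_isid :: exp where
  "b_isid = EIf (IsPair (Fst V0))
     (Eq (Fst (Fst V0)) (Snd V0) (ECall f_isid (Pair2 (Snd (Fst V0)) (Succ (Snd V0)))) C0) C1"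

definition b_strip :: exp where
  "b_strip = EIf (IsPair (Fst V0))
     (EIf (ECall f_isid (Pair2 (ECall f_rcompl (Pair4 (Snd (Snd V0)) (Fst (Fst V0)) (Succ (Snd (Snd V0))) C0)) C1))
       (ECall f_strip (Pair3 (Snd (Fst V0)) (Succ (Fst (Snd V0))) (Snd (Snd V0))))
       (Pair2 (Fst V0) (Fst (Snd V0))))
     (Pair2 (Fst V0) (Fst (Snd V0)))"

definition b_out :: exp where
  "b_out = EIf (IsPair (Fst V0))
     (EIf (ECall f_isid (Pair2 (Fst (Fst V0)) C1))
       (ECall f_out (Pair2 (Snd (Fst V0)) (Snd V0)))
       (ECall f_out (Pair2 (Snd (Fst V0)) (Pair2 (Pair2 C1 (Fst (Fst V0))) (Snd V0)))))
     (Snd V0)"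

definition b_desc :: exp where
  "b_desc = EIf V0 (Pair2 V0 (ECall f_desc (Minus V0 C1))) C0"

definition b_rep :: exp where
  "b_rep = EIf (Fst V0)
     (ECall f_rep (Pair3 (Minus (Fst V0) C1) (Fst (Snd V0)) (Pair2 (Fst (Snd V0)) (Snd (Snd V0)))))
     (Snd (Snd V0))"

definition b_main :: exp where
  "b_main =
     (let T1 = Fst (Fst V0); W1 = Fst (Snd (Fst V0)); U1 = Snd (Snd (Fst V0)); T2 = Fst (Snd V0) in
     ELet (ECall f_expand (Pair4 U1 (ECall f_revflip (Pair2 W1 C0)) T1 T2))
     (let T2 = Fst (Snd V1); W2 = Fst (Snd (Snd V1)); U2 = Snd (Snd (Snd V1)) in
     ELet (ECall f_expand (Pair4 T2 W2 U2 (Fst V0)))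
     (ELet (ETree TLeaves (Fst V1) C0)
     (ELet (ECall f_push (Pair4 (ECall f_revflip (Pair2 (Fst (Snd V2)) (Fst (Snd V1)))) C0 C0 V0))
     (ELet (ECall f_eyes (Pair5 V1 (Snd (Snd V3)) (ECall f_revapp (Pair2 (Fst V0) C0)) (Snd V0) (Snd (Snd V2))))
     (ELet (ETree TLeaves (Fst V0) C0)
       (EIf (Less C1 V0)
         (ELet (ECall f_strip (Pair3 (ECall f_revapp (Pair2 (Fst (Snd V1)) C0)) C0 V0))
           (Pair3 (Fst V2)
             (ECall f_out (Pair2 (Fst V0)
                (EIf (Less (Snd V0) (Snd V3))
                   (ECall f_rep (Pair3 (Minus (Snd V3) (Snd V0)) (Pair2 C0 (ECall f_desc V1)) C0))
                   (ECall f_rep (Pair3 (Minus (Snd V0) (Snd V3)) (Pair2 C1 (ECall f_desc V1)) C0)))))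
             (Snd (Snd V2))))
         (Pair3 (Fst V1) C0 (Snd (Snd V1))))))))))"

definition prog :: program where
  "prog = [b_main, b_revflip, b_nth, b_idx, b_dbl, b_del, b_flip, b_flipn, b_rcompl, b_revapp, b_slide,
     b_insert, b_push, b_dblw, b_expand, b_unribbon, b_hpow, b_eyes, b_isid, b_strip, b_out, b_desc, b_rep]"

lemma prog_length [simp]: "length prog = 23"
  by (simp add: prog_def)

lemma prog_nth [simp]:
  "prog ! 0 = b_main" "prog ! 1 = b_revflip" "prog ! 2 = b_nth" "prog ! 3 = b_idx" "prog ! 4 = b_dbl"
  "prog ! 5 = b_del" "prog ! 6 = b_flip" "prog ! 7 = b_flipn" "prog ! 8 = b_rcompl" "prog ! 9 = b_revapp"
  "prog ! 10 = b_slide" "prog ! 11 = b_insert" "prog ! 12 = b_push" "prog ! 13 = b_dblw" "prog ! 14 = b_expand"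
  "prog ! 15 = b_unribbon" "prog ! 16 = b_hpow" "prog ! 17 = b_eyes" "prog ! 18 = b_isid" "prog ! 19 = b_strip"
  "prog ! 20 = b_out" "prog ! 21 = b_desc" "prog ! 22 = b_rep"
  unfolding prog_def by (simp_all add: nth_Cons')

subsection \<open>Lists of numbers\<close>

abbreviation enc_nats :: "nat list \<Rightarrow> val" where
  "enc_nats l \<equiv> enc_list (map Num l)"

text \<open>The entries greater than \<open>v\<close> are raised, and \<open>v\<close> is followed
  by its new copy \<open>v + 1\<close>: the list of a permutation becomes the list of the
  permutation with a doubled strand. The function \<open>delval\<close> undoes this.\<close>

fun insval :: "nat \<Rightarrow> nat list \<Rightarrow> nat list" where
  "insval v [] = []"
| "insval v (u # l) = (if u < v then u # insval v l else if v < u then Suc u # insval v l else u # Suc u # insval v l)"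

fun delval :: "nat \<Rightarrow> nat list \<Rightarrow> nat list" where
  "delval v [] = []"
| "delval v (u # l) = (if u < v then u # delval v l else if v < u then (u - 1) # delval v l else delval v l)"

fun idx :: "nat \<Rightarrow> nat list \<Rightarrow> nat" where
  "idx v [] = 1"
| "idx v (u # l) = (if u = v then 1 else Suc (idx v l))"

lemma run_nth: "1 \<le> k \<Longrightarrow> k \<le> length l \<Longrightarrow> runs prog f_nth (Pr (Num k) (enc_nats l)) (Num (l ! (k - 1))) (20 * length l)"
proof (induction l arbitrary: k)
  case (Cons x l)
  show ?case
  proof (cases "k = 1")
    case True
    then show ?thesis by (intro runsI) (simp add: b_nth_def wp_simps)
  next
    case False
    then obtain k' where k: "k = Suc k'" "1 \<le> k'" using Cons.prems by (cases k) auto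
    then have "runs prog f_nth (Pr (Num k') (enc_nats l)) (Num (l ! (k' - 1))) (20 * length l)" using Cons by simp
    then show ?thesis using k False by (intro runsI) (simp add: b_nth_def wp_simps runs_def nth_Cons')
  qed
qed simp

lemma run_idx: "v \<in> set l \<Longrightarrow> runs prog f_idx (Pr (Num v) (enc_nats l)) (Num (idx v l)) (30 * length l)"
proof (induction l)
  case (Cons x l)
  show ?case
  proof (cases "x = v")
    case True
    then show ?thesis by (intro runsI) (simp add: b_idx_def wp_simps)
  next
    case False
    then have "runs prog f_idx (Pr (Num v) (enc_nats l)) (Num (idx v l)) (30 * length l)" using Cons by simp
    then show ?thesis using False by (intro runsI) (auto simp: b_idx_def wp_simps runs_def)
  qed
qed simp

lemma run_dbl: "runs prog f_dbl (Pr (Num v) (enc_nats l)) (enc_nats (insval v l)) (40 * length l + 10)"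
proof (induction l)
  case Nil
  show ?case by (intro runsI) (simp add: b_dbl_def wp_simps)
next
  case (Cons x l)
  then show ?case by (intro runsI) (simp add: b_dbl_def wp_simps runs_def)
qed

lemma run_del: "runs prog f_del (Pr (Num v) (enc_nats l)) (enc_nats (delval v l)) (40 * length l + 10)"
proof (induction l)
  case Nil
  show ?case by (intro runsI) (simp add: b_del_def wp_simps)
next
  case (Cons x l)
  then show ?case by (intro runsI) (simp add: b_del_def wp_simps runs_def)
qed

lemma run_flip: "runs prog f_flip (Pr (enc_nats l) (Pr (Num c) (enc_nats acc)))
    (enc_nats (rev (map (\<lambda>v. c - v) l) @ acc)) (40 * length l + 10)"
proof (induction l arbitrary: acc)
  case Nil
  show ?case by (intro runsI) (simp add: b_flip_def wp_simps)
next
  case (Cons x l)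
  from Cons[of "(c - x) # acc"] show ?case by (intro runsI) (simp add: b_flip_def wp_simps runs_def)
qed

lemma run_revapp: "runs prog f_revapp (Pr (enc_list l) (enc_list acc)) (enc_list (rev l @ acc)) (40 * length l + 10)"
proof (induction l arbitrary: acc)
  case Nil
  show ?case by (intro runsI) (simp add: b_revapp_def wp_simps)
next
  case (Cons x l)
  from Cons[of "x # acc"] show ?case by (intro runsI) (simp add: b_revapp_def wp_simps runs_def)
qed

lemma run_rcompl: "{1..i} \<subseteq> set l \<Longrightarrow> runs prog f_rcompl (Pr (Num i) (Pr (enc_nats l) (Pr (Num c) (enc_nats acc))))
    (enc_nats (map (\<lambda>j. c - idx j l) [1..<Suc i] @ acc)) (i * (30 * length l + 60) + 20)"
proof (induction i arbitrary: acc)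
  case 0
  show ?case by (intro runsI) (simp add: b_rcompl_def wp_simps)
next
  case (Suc i)
  have "{1..i} \<subseteq> set l" using Suc.prems by auto
  note IH = Suc.IH[OF this, of "(c - idx (Suc i) l) # acc"]
  have "Suc i \<in> set l" using Suc.prems by auto
  from run_idx[OF this] IH show ?case by (intro runsI) (simp add: b_rcompl_def wp_simps runs_def)
qed

lemma run_isid: "runs prog f_isid (Pr (enc_nats l) (Num k)) (Num (if l = [k..<k + length l] then 1 else 0)) (40 * length l + 10)"
proof (induction l arbitrary: k)
  case Nil
  show ?case by (intro runsI) (simp add: b_isid_def wp_simps)
next
  case (Cons x l)
  have "x # l = [k..<k + length (x # l)] \<longleftrightarrow> x = k \<and> l = [Suc k..<Suc k + length l]"
    by (simp add: upt_conv_Cons del: upt_Suc)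
  with Cons[of "Suc k"] show ?case by (intro runsI) (auto simp: b_isid_def wp_simps runs_def)
qed

lemma run_desc: "runs prog f_desc (Num n) (enc_nats (rev [1..<Suc n])) (20 * n + 10)"
proof (induction n)
  case 0
  show ?case by (intro runsI) (simp add: b_desc_def wp_simps)
next
  case (Suc n)
  then show ?case by (intro runsI) (simp add: b_desc_def wp_simps runs_def)
qed

lemma run_rep: "runs prog f_rep (Pr (Num p) (Pr x (enc_list acc))) (enc_list (replicate p x @ acc)) (40 * p + 10)"
proof (induction p arbitrary: acc)
  case 0
  show ?case by (intro runsI) (simp add: b_rep_def wp_simps)
next
  case (Suc p)
  from Suc[of "x # acc"] show ?case
    by (intro runsI) (simp add: b_rep_def wp_simps runs_def replicate_app_Cons_same)
qed

lemma run_hpow: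
  "1 \<le> a \<Longrightarrow> a \<le> n \<Longrightarrow> runs prog f_hpow (Pr (Num m) (Pr (Num a) (Num (Suc n)))) (Num ((half_twist n ^^ m) a)) (40 * m + 10)"
proof (induction m arbitrary: a)
  case 0
  show ?case by (intro runsI) (simp add: b_hpow_def wp_simps)
next
  case (Suc m)
  have "half_twist n a = Suc n - a" using Suc.prems by (simp add: half_twist_def)
  moreover have "1 \<le> Suc n - a" "Suc n - a \<le> n" using Suc.prems by auto
  ultimately show ?case using Suc.IH[of "Suc n - a"]
    by (intro runsI) (simp add: b_hpow_def wp_simps runs_def funpow_swap1)
qed

subsection \<open>Lists of values of permutations\<close>

definition plist :: "nat \<Rightarrow> (nat \<Rightarrow> nat) \<Rightarrow> nat list" where
  "plist n s = map s [1..<Suc n]"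

abbreviation enc_perm :: "nat \<Rightarrow> (nat \<Rightarrow> nat) \<Rightarrow> val" where
  "enc_perm n s \<equiv> enc_nats (plist n s)"

abbreviation enc_perms :: "nat \<Rightarrow> (nat \<Rightarrow> nat) list \<Rightarrow> val" where
  "enc_perms n ss \<equiv> enc_list (map (enc_perm n) ss)"

abbreviation enc_word :: "nat \<Rightarrow> perm_word \<Rightarrow> val" where
  "enc_word n w \<equiv> enc_list (map (enc_letter n) w)"

lemma enc_letter_plist: "enc_letter n (e, s) = Pr (Num (if e then 1 else 0)) (enc_perm n s)"
  by (simp add: plist_def comp_def)

lemma length_plist [simp]: "length (plist n s) = n"
  by (simp add: plist_def)

lemma nth_plist: "1 \<le> k \<Longrightarrow> k \<le> n \<Longrightarrow> plist n s ! (k - 1) = s k"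
  by (simp add: plist_def del: upt_Suc)

lemma nth_plist': "k < n \<Longrightarrow> plist n s ! k = s (Suc k)"
  using nth_plist[of "Suc k" n s] by simp

lemma distinct_plist: "s permutes {1..n} \<Longrightarrow> distinct (plist n s)"
  unfolding plist_def by (simp add: distinct_map permutes_inj_on del: upt_Suc)

lemma set_plist: "s permutes {1..n} \<Longrightarrow> set (plist n s) = {1..n}"
  unfolding plist_def using permutes_image[of s "{1..n}"] by (simp add: atLeastLessThanSuc_atLeastAtMost del: upt_Suc)

lemma idx_nth: "distinct l \<Longrightarrow> k < length l \<Longrightarrow> idx (l ! k) l = Suc k"
proof (induction l arbitrary: k)
  case (Cons x l)
  show ?case
  proof (cases k)
    case (Suc k')
    then show ?thesis using Cons nth_mem[of k' l] by (simp del: nth_mem) (metis nth_mem)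
  qed simp
qed simp

lemma idx_plist:
  assumes s: "s permutes {1..n}" and v: "v \<in> {1..n}"
  shows "idx v (plist n s) = pinv s v"
proof -
  let ?k = "pinv s v"
  have k: "?k \<in> {1..n}" by (rule perm_range[OF permutes_pinv[OF s] v])
  have "v = plist n s ! (?k - 1)" using nth_plist[of ?k n s] k permutes_inverses(1)[OF s] by simp
  then have "idx v (plist n s) = Suc (?k - 1)" using idx_nth[OF distinct_plist[OF s], of "?k - 1"] k by auto
  then show ?thesis using k by simp
qed

lemma plist_split:
  assumes "a \<in> {1..n}"
  shows "plist n s = map s [1..<a] @ s a # map s [Suc a..<Suc n]"
proof -
  have "[1..<Suc n] = [1..<a] @ a # [Suc a..<Suc n]"
    using assms upt_add_eq_append[of 1 a "Suc n - a"] upt_conv_Cons[of a "Suc n"] by (simp del: upt_Suc)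
  then show ?thesis by (simp only: plist_def map_append list.map)
qed

lemma plist_rib:
  assumes a: "a \<in> {1..n}"
  shows "plist (Suc n) (rib c a s) =
    map (up (s a)) (map s [1..<a]) @ (if c then [Suc (s a), s a] else [s a, Suc (s a)]) @ map (up (s a)) (map s [Suc a..<Suc n])"
proof -
  have "plist (Suc n) (rib c a s) = map (rib c a s) [1..<a] @ rib c a s a # map (rib c a s) [Suc a..<Suc (Suc n)]"
    by (rule plist_split) (use a in simp)
  also have "[Suc a..<Suc (Suc n)] = Suc a # map Suc [Suc a..<Suc n]"
    using a by (simp only: map_Suc_upt) (simp add: upt_conv_Cons del: upt_Suc)
  finally have e: "plist (Suc n) (rib c a s) =
    map (rib c a s) [1..<a] @ rib c a s a # rib c a s (Suc a) # map (\<lambda>k. rib c a s (Suc k)) [Suc a..<Suc n]"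
    by (simp add: comp_def del: upt_Suc)
  have 1: "map (rib c a s) [1..<a] = map (up (s a)) (map s [1..<a])"
    unfolding map_map
  proof (rule map_cong[OF HOL.refl])
    fix k assume "k \<in> set [1..<a]"
    then have "up a k = k" "k \<noteq> a" by (auto simp: up_def)
    then show "rib c a s k = (up (s a) \<circ> s) k" using rib_up[of c a s k] by simp
  qed
  have 2: "map (\<lambda>k. rib c a s (Suc k)) [Suc a..<Suc n] = map (up (s a)) (map s [Suc a..<Suc n])"
    unfolding map_map
  proof (rule map_cong[OF HOL.refl])
    fix k assume "k \<in> set [Suc a..<Suc n]"
    then have "up a k = Suc k" "k \<noteq> a" by (auto simp: up_def)
    then show "rib c a s (Suc k) = (up (s a) \<circ> s) k" using rib_up[of c a s k] by simp
  qed
  show ?thesis unfolding e 1 2 by (simp add: rib_same del: upt_Suc)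
qed

lemma insval_append: "insval v (k @ l) = insval v k @ insval v l"
  by (induction k) auto

lemma delval_append: "delval v (k @ l) = delval v k @ delval v l"
  by (induction k) auto

lemma insval_up: "v \<notin> set l \<Longrightarrow> insval v l = map (up v) l"
  by (induction l) (auto simp: up_def)

lemma delval_up: "delval (Suc v) (map (up v) l) = l"
  by (induction l) (auto simp: up_def)

lemma insval_plist:
  assumes s: "s permutes {1..n}" and a: "a \<in> {1..n}"
  shows "insval (s a) (plist n s) = plist (Suc n) (dbl a s)"
proof -
  have "s a \<notin> set (map s [1..<a])" "s a \<notin> set (map s [Suc a..<Suc n])"
    using permutes_inj[OF s] by (auto simp: inj_eq)
  then show ?thesis
    using plist_rib[OF a, of False s] unfolding plist_split[OF a, of s] insval_append
    by (simp add: insval_up rib_def del: upt_Suc)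
qed

lemma delval_plist:
  assumes a: "a \<in> {1..n}"
  shows "delval (Suc (s a)) (plist (Suc n) (rib c a s)) = plist n s"
  unfolding plist_rib[OF a] plist_split[OF a, of s] delval_append delval_up by simp

lemma plist_flipp:
  assumes s: "s permutes {1..n}"
  shows "rev (map (\<lambda>v. Suc n - v) (plist n s)) = plist n (flipp n s)"
proof (rule nth_equalityI)
  fix k assume "k < length (rev (map (\<lambda>v. Suc n - v) (plist n s)))"
  then have k: "k < n" by simp
  then have r: "n - k \<in> {1..n}" by auto
  have "s (n - k) \<in> {1..n}" by (rule perm_range[OF s r])
  moreover have "half_twist n (Suc k) = n - k" using k by (simp add: half_twist_def)
  ultimately have "flipp n s (Suc k) = Suc n - s (n - k)" by (simp add: flipp_def) (simp add: half_twist_def)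
  moreover have "plist n s ! (n - Suc k) = s (n - k)" using nth_plist'[of "n - Suc k" n s] k by (simp add: Suc_diff_Suc)
  ultimately show "rev (map (\<lambda>v. Suc n - v) (plist n s)) ! k = plist n (flipp n s) ! k"
    using k by (simp add: rev_nth nth_plist')
qed simp

lemma plist_rcompl:
  assumes s: "s permutes {1..n}"
  shows "map (\<lambda>j. Suc n - idx j (plist n s)) [1..<Suc n] = plist n (rcompl n s)"
proof -
  have "Suc n - idx j (plist n s) = rcompl n s j" if "j \<in> {1..n}" for j
    using perm_range[OF permutes_pinv[OF s] that] idx_plist[OF s that] by (simp add: rcompl_def half_twist_def)
  then show ?thesis unfolding plist_def[of n "rcompl n s"] by (intro map_cong) auto
qed

lemma plist_id_iff:
  assumes s: "s permutes {1..n}"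
  shows "plist n s = [1..<1 + n] \<longleftrightarrow> s = id"
proof
  assume e: "plist n s = [1..<1 + n]"
  have "s k = k" for k
  proof (cases "k \<in> {1..n}")
    case True
    then have "s k = plist n s ! (k - 1)" by (simp add: nth_plist)
    also have "\<dots> = k" using True unfolding e by (simp del: upt_Suc)
    finally show ?thesis .
  qed (rule permutes_not_in[OF s])
  then show "s = id" by (simp add: fun_eq_iff)
next
  assume "s = id"
  then show "plist n s = [1..<1 + n]" unfolding plist_def by (simp only: list.map_id plus_1_eq_Suc)
qed

lemma run_rcompl_perm:
  assumes s: "s permutes {1..n}"
  shows "runs prog f_rcompl (Pr (Num n) (Pr (enc_perm n s) (Pr (Num (Suc n)) (Num 0)))) (enc_perm n (rcompl n s)) (100 * (n + 1)\<^sup>2)"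
proof -
  have "{1..n} \<subseteq> set (plist n s)" using set_plist[OF s] by simp
  from run_rcompl[OF this, of "Suc n" "[]"] plist_rcompl[OF s]
  have "runs prog f_rcompl (Pr (Num n) (Pr (enc_perm n s) (Pr (Num (Suc n)) (Num 0)))) (enc_perm n (rcompl n s)) (n * (30 * n + 60) + 20)"
    by (simp del: upt_Suc)
  then show ?thesis by (rule runs_mono) (simp add: power2_eq_square algebra_simps)
qed

lemma run_flip_perm:
  assumes "s permutes {1..n}"
  shows "runs prog f_flip (Pr (enc_perm n s) (Pr (Num (Suc n)) (Num 0))) (enc_perm n (flipp n s)) (40 * n + 10)"
  using run_flip[of "plist n s" "Suc n" "[]"] plist_flipp[OF assms] by simp

lemma run_flipn:
  "s permutes {1..n} \<Longrightarrow> runs prog f_flipn (Pr (Num m) (Pr (enc_perm n s) (Num (Suc n)))) (enc_perm n ((flipp n ^^ m) s)) (m * (40 * n + 50) + 10)"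
proof (induction m arbitrary: s)
  case 0
  show ?case by (intro runsI) (simp add: b_flipn_def wp_simps)
next
  case (Suc m)
  from run_flip_perm[OF Suc.prems] Suc.IH[OF flipp_permutes[OF Suc.prems]]
  show ?case by (intro runsI) (simp add: b_flipn_def wp_simps runs_def funpow_swap1)
qed

lemma run_isid_perm:
  assumes "s permutes {1..n}"
  shows "runs prog f_isid (Pr (enc_perm n s) (Num 1)) (Num (if s = id then 1 else 0)) (40 * n + 10)"
  using run_isid[of "plist n s" 1] plist_id_iff[OF assms] by simp

section \<open>Normalization\<close>

text \<open>Each pair of strands crosses at most once.\<close>

lemma nonrep_length:
  assumes "set w \<subseteq> {1..<n}" "nonrep w"
  shows "length w \<le> n * n"
proof -
  have "set (crs w) \<subseteq> (\<lambda>(a, b). {a, b}) ` ({1..n} \<times> {1..n})"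
    using assms(1)
  proof (induction w)
    case (Cons j w)
    let ?t = "transpose j (Suc j)"
    have j: "j \<in> {1..n}" "Suc j \<in> {1..n}" using Cons.prems by auto
    have IH: "set (crs w) \<subseteq> (\<lambda>(a, b). {a, b}) ` ({1..n} \<times> {1..n})" using Cons by simp
    have t: "?t a \<in> {1..n}" if "a \<in> {1..n}" for a using that j by (auto simp: transpose_Suc)
    show ?case
    proof
      fix S assume "S \<in> set (crs (j # w))"
      then consider "S = {j, Suc j}" | S' where "S' \<in> set (crs w)" "S = ?t ` S'" by auto
      then show "S \<in> (\<lambda>(a, b). {a, b}) ` ({1..n} \<times> {1..n})"
      proof cases
        case 1 then show ?thesis using j by (intro image_eqI[of _ _ "(j, Suc j)"]) auto
      next
        case 2
        then obtain a b where "S' = {a, b}" "a \<in> {1..n}" "b \<in> {1..n}" using IH by auto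
        then show ?thesis using 2 t by (intro image_eqI[of _ _ "(?t a, ?t b)"]) auto
      qed
    qed
  qed simp
  then have "card (set (crs w)) \<le> card ((\<lambda>(a, b). {a, b}) ` ({1..n} \<times> {1..n}))" by (rule card_mono[rotated]) simp
  also have "\<dots> \<le> card ({1..n} \<times> {1..n})" by (rule card_image_le) simp
  also have "\<dots> = n * n" by simp
  finally have "card (set (crs w)) \<le> n * n" .
  moreover have "card (set (crs w)) = length (crs w)" using assms(2) by (simp add: nonrep_iff_distinct distinct_card)
  moreover have "length (crs w) = length w" by (induction w) auto
  ultimately show ?thesis by simp
qed

lemma plist_nth_mid:
  assumes "plist n X = u @ x # v"
  shows "x = X (Suc (length u))" "Suc (length u) \<le> n"
proof -
  have l: "n = length u + Suc (length v)" using arg_cong[OF assms, of length] by simp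
  then show "Suc (length u) \<le> n" by simp
  have "plist n X ! length u = x" unfolding assms by simp
  then show "x = X (Suc (length u))" using l by (simp add: nth_plist')
qed

lemma plist_swap:
  assumes "plist n X = u @ x # x' # v"
  shows "plist n (X \<circ> transpose (Suc (length u)) (Suc (Suc (length u)))) = u @ x' # x # v"
proof (rule nth_equalityI)
  have l: "n = length u + Suc (Suc (length v))" using arg_cong[OF assms, of length] by simp
  then show "length (plist n (X \<circ> transpose (Suc (length u)) (Suc (Suc (length u))))) = length (u @ x' # x # v)" by simp
  fix k assume "k < length (plist n (X \<circ> transpose (Suc (length u)) (Suc (Suc (length u)))))"
  then have k: "k < n" by simp
  have e: "X (Suc i) = (u @ x # x' # v) ! i" if "i < n" for i using nth_plist'[OF that, of X] unfolding assms by simp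
  consider "k < length u" | "k = length u" | "k = Suc (length u)" | "Suc (length u) < k" by linarith
  then show "plist n (X \<circ> transpose (Suc (length u)) (Suc (Suc (length u)))) ! k = (u @ x' # x # v) ! k"
  proof cases
    case 1 then show ?thesis using k e[of k] by (simp add: nth_plist' transpose_Suc nth_append)
  next
    case 2 then show ?thesis using k e[of "Suc k"] l by (simp add: nth_plist' transpose_Suc nth_append)
  next
    case 3 then show ?thesis using k e[of "length u"] l by (simp add: nth_plist' transpose_Suc nth_append)
  next
    case 4
    then obtain j where "k = Suc (Suc (length u + j))" using less_imp_Suc_add by (metis add_Suc_right add_Suc_shift less_iff_Suc_add)
    then show ?thesis using 4 k e[of k] l by (simp add: nth_plist' transpose_Suc nth_append)
  qed
qed

lemma rcompl_less:
  assumes r: "r permutes {1..n}" and k: "k \<in> {1..n}" "l \<in> {1..n}"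
  shows "rcompl n r k < rcompl n r l \<longleftrightarrow> pinv r l < pinv r k"
  using perm_range[OF permutes_pinv[OF r] k(1)] perm_range[OF permutes_pinv[OF r] k(2)]
  by (auto simp: rcompl_def half_twist_def)

text \<open>A crossing moves from the end of \<open>r\<close> to the beginning of
  \<open>t\<close>. In the lists of \<open>rcompl n r\<close> and \<open>t\<close>, the entries at
  \<open>k\<close> and \<open>Suc k\<close> are exchanged, and the condition for this is an ascent
  at \<open>k\<close> in both lists. This is the reason for working with \<open>rcompl n r\<close>
  in place of \<open>r\<close>.\<close>

lemma slid_swap:
  assumes r: "r permutes {1..n}" and t: "t permutes {1..n}" and k: "k \<in> {1..<n}"
    and d: "pinv r (Suc k) < pinv r k" "t k < t (Suc k)"
  defines "r' \<equiv> transpose k (Suc k) \<circ> r" and "t' \<equiv> t \<circ> transpose k (Suc k)"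
  shows "r' permutes {1..n}" "t' permutes {1..n}" "pw n r' @ pw n t' \<approx> pw n r @ pw n t"
    "Suc (length (pw n r')) = length (pw n r)" "rcompl n r' = rcompl n r \<circ> transpose k (Suc k)"
proof -
  have tr: "transpose k (Suc k) permutes {1..n}" using k by (intro permutes_swap_id) auto
  show r': "r' permutes {1..n}" unfolding r'_def by (rule permutes_compose[OF r tr])
  show t': "t' permutes {1..n}" unfolding t'_def by (rule permutes_compose[OF tr t])
  have pr: "pinv r' = pinv r \<circ> transpose k (Suc k)" unfolding r'_def by (rule pinv_swap[OF r])
  show "rcompl n r' = rcompl n r \<circ> transpose k (Suc k)" unfolding rcompl_def pr by (simp add: comp_assoc)
  have er: "pw n r \<approx> pw n r' @ [k]"
  proof (rule pw_peq)
    show "set (pw n r' @ [k]) \<subseteq> {1..<n}" using pw(1)[OF r'] k by simp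
    show "nonrep (pw n r' @ [k])" unfolding nonrep_snoc pw(3)[OF r'] pr using pw(2)[OF r'] d(1) by simp
    show "pend (pw n r' @ [k]) = r" unfolding pend_append pw(3)[OF r'] by (simp add: r'_def fun_eq_iff)
  qed
  have et: "pw n t' \<approx> k # pw n t"
  proof (rule pw_peq)
    show "set (k # pw n t) \<subseteq> {1..<n}" using pw(1)[OF t] k by simp
    show "nonrep (k # pw n t)" using pw(2,3)[OF t] d(2) by simp
    show "pend (k # pw n t) = t'" unfolding pend_Cons pw(3)[OF t] t'_def ..
  qed
  have "pw n r' @ pw n t' \<approx> (pw n r' @ [k]) @ pw n t" using et by simp
  also have "\<dots> \<approx> pw n r @ pw n t" using peq_sym[OF er] by (simp only: peq_append_right_iff)
  finally show "pw n r' @ pw n t' \<approx> pw n r @ pw n t" .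
  show "Suc (length (pw n r')) = length (pw n r)" using peq_length[OF er] by simp
qed

text \<open>The pair is greedy to the left of the cursor. The cursor advances if the two entries
  next to it need no exchange. An exchange moves it back by one place, so that each exchange costs
  two additional steps, but it also shortens the word of \<open>r\<close>; this gives the measure
  \<open>length ra + 2 * length (pw n r)\<close>.\<close>

lemma run_slide_aux:
  assumes "r permutes {1..n}" "t permutes {1..n}"
    "rev la @ ra = plist n (rcompl n r)" "rev lb @ rb = plist n t" "length la = length lb"
    "\<And>k. 1 \<le> k \<Longrightarrow> k < length la \<Longrightarrow> \<not> (rcompl n r k < rcompl n r (Suc k) \<and> t k < t (Suc k))"
  shows "\<exists>p. slid n r t p \<and> runs prog f_slide (Pr (Pr (enc_nats la) (enc_nats lb)) (Pr (enc_nats ra) (enc_nats rb)))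
     (Pr (enc_nats (rev (plist n (rcompl n (fst p))))) (enc_nats (rev (plist n (snd p)))))
     (100 * (length ra + 2 * length (pw n r)) + 20)"
  using assms
proof (induction "length ra + 2 * length (pw n r)" arbitrary: r t la lb ra rb rule: less_induct)
  case less
  note r = less.prems(1) and t = less.prems(2)
  have len: "length ra = length rb"
    using arg_cong[OF less.prems(3), of length] arg_cong[OF less.prems(4), of length] less.prems(5) by simp
  show ?case
  proof (cases ra)
    case Nil
    then have rb: "rb = []" using len by simp
    have la: "la = rev (plist n (rcompl n r))" "lb = rev (plist n t)" using less.prems(3,4) Nil rb by (simp_all add: rev_swap)
    have "gpair n r t"
      unfolding gpair_def
    proof (intro ballI impI)
      fix k assume k: "k \<in> {1..<n}" "pinv r (Suc k) < pinv r k"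
      then have "rcompl n r k < rcompl n r (Suc k)" using rcompl_less[OF r, of k "Suc k"] by simp
      then have "\<not> t k < t (Suc k)" using less.prems(6)[of k] k la by simp
      moreover have "t k \<noteq> t (Suc k)" using permutes_inj[OF t] by (metis injD n_not_Suc_n)
      ultimately show "t (Suc k) < t k" by simp
    qed
    then have "slid n r t (r, t)" using r t by (simp add: slid_def)
    moreover have "runs prog f_slide (Pr (Pr (enc_nats la) (enc_nats lb)) (Pr (enc_nats ra) (enc_nats rb)))
       (Pr (enc_nats la) (enc_nats lb)) (100 * (length ra + 2 * length (pw n r)) + 20)"
      unfolding Nil by (intro runsI) (simp add: b_slide_def wp_simps)
    ultimately show ?thesis unfolding la by (intro exI[of _ "(r, t)"]) simp
  next
    case (Cons x' ra')
    then obtain y' rb' where rb: "rb = y' # rb'" using len by (cases rb) auto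
    note ra = Cons
    have move: "\<exists>p. slid n r t p \<and> runs prog f_slide (Pr (Pr (enc_nats (x' # la)) (enc_nats (y' # lb))) (Pr (enc_nats ra') (enc_nats rb')))
       (Pr (enc_nats (rev (plist n (rcompl n (fst p))))) (enc_nats (rev (plist n (snd p)))))
       (100 * (length ra' + 2 * length (pw n r)) + 20)"
      if ok: "la \<noteq> [] \<Longrightarrow> \<not> (rcompl n r (length la) < rcompl n r (Suc (length la)) \<and> t (length la) < t (Suc (length la)))"
    proof (rule less.hyps[OF _ r t])
      show "length ra' + 2 * length (pw n r) < length ra + 2 * length (pw n r)" using ra by simp
      show "rev (x' # la) @ ra' = plist n (rcompl n r)" "rev (y' # lb) @ rb' = plist n t" "length (x' # la) = length (y' # lb)"
        using less.prems(3-5) ra rb by simp_all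
      fix k assume k: "1 \<le> k" "k < length (x' # la)"
      show "\<not> (rcompl n r k < rcompl n r (Suc k) \<and> t k < t (Suc k))"
      proof (cases "k = length la")
        case True then show ?thesis using ok k by (cases la) auto
      next
        case False then show ?thesis using less.prems(6)[of k] k by simp
      qed
    qed
    show ?thesis
    proof (cases la)
      case Nil
      then have "lb = []" using less.prems(5) by simp
      obtain p where p: "slid n r t p" "runs prog f_slide (Pr (Pr (enc_nats (x' # la)) (enc_nats (y' # lb))) (Pr (enc_nats ra') (enc_nats rb')))
       (Pr (enc_nats (rev (plist n (rcompl n (fst p))))) (enc_nats (rev (plist n (snd p)))))
       (100 * (length ra' + 2 * length (pw n r)) + 20)" using move Nil by blast
      show ?thesis
        by (rule exI[of _ p], rule conjI[OF p(1)], rule runsI) (use p(2) Nil \<open>lb = []\<close> ra rb in \<open>simp add: b_slide_def wp_simps runs_def\<close>)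
    next
      case (Cons x la')
      then obtain y lb' where lb: "lb = y # lb'" using less.prems(5) by (cases lb) auto
      note la = Cons
      have px: "plist n (rcompl n r) = rev la' @ x # x' # ra'" and py: "plist n t = rev lb' @ y # y' # rb'"
        using less.prems(3,4) la lb ra rb by simp_all
      let ?k = "length la"
      have ll: "length lb' = length la'" using less.prems(5) la lb by simp
      have x: "x = rcompl n r ?k" "x' = rcompl n r (Suc ?k)" "Suc ?k \<le> n"
        using plist_nth_mid[OF px] plist_nth_mid[of n "rcompl n r" "rev la' @ [x]" x' ra'] px la by simp_all
      have y: "y = t ?k" "y' = t (Suc ?k)"
        using plist_nth_mid(1)[OF py] plist_nth_mid(1)[of n t "rev lb' @ [y]" y' rb'] py la ll by simp_all
      show ?thesis
      proof (cases "x < x' \<and> y < y'")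
        case False
        then obtain p where p: "slid n r t p" "runs prog f_slide (Pr (Pr (enc_nats (x' # la)) (enc_nats (y' # lb))) (Pr (enc_nats ra') (enc_nats rb')))
         (Pr (enc_nats (rev (plist n (rcompl n (fst p))))) (enc_nats (rev (plist n (snd p)))))
         (100 * (length ra' + 2 * length (pw n r)) + 20)" using move x y by blast
        show ?thesis
          by (rule exI[of _ p], rule conjI[OF p(1)], rule runsI) (use p(2) la lb ra rb False in \<open>auto simp: b_slide_def wp_simps runs_def\<close>)
      next
        case True
        have k: "?k \<in> {1..<n}" using x(3) la by simp
        have "pinv r (Suc ?k) < pinv r ?k" using True x rcompl_less[OF r, of ?k "Suc ?k"] k by simp
        moreover have "t ?k < t (Suc ?k)" using True y by simp
        note sw = slid_swap[OF r t k calculation this]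
        define r' where "r' = transpose ?k (Suc ?k) \<circ> r"
        define t' where "t' = t \<circ> transpose ?k (Suc ?k)"
        note sw = sw[folded r'_def t'_def]
        have "plist n (rcompl n r') = rev la' @ x' # x # ra'" unfolding sw(5) using plist_swap[OF px] la by simp
        moreover have "plist n t' = rev lb' @ y' # y # rb'" unfolding t'_def using plist_swap[OF py] la ll by simp
        moreover have "\<not> (rcompl n r' j < rcompl n r' (Suc j) \<and> t' j < t' (Suc j))" if j: "1 \<le> j" "j < length la'" for j
        proof -
          have "transpose ?k (Suc ?k) j = j" "transpose ?k (Suc ?k) (Suc j) = Suc j" using j la by (auto simp: transpose_Suc)
          then show ?thesis using less.prems(6)[of j] j la by (simp add: sw(5) t'_def)
        qed
        ultimately have "\<exists>p. slid n r' t' p \<and> runs prog f_slide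
           (Pr (Pr (enc_nats la') (enc_nats lb')) (Pr (enc_nats (x' # x # ra')) (enc_nats (y' # y # rb'))))
           (Pr (enc_nats (rev (plist n (rcompl n (fst p))))) (enc_nats (rev (plist n (snd p)))))
           (100 * (length (x' # x # ra') + 2 * length (pw n r')) + 20)"
          by (intro less.hyps[OF _ sw(1,2)]) (use ll ra sw(4) in auto)
        then obtain p where p: "slid n r' t' p" "runs prog f_slide
           (Pr (Pr (enc_nats la') (enc_nats lb')) (Pr (enc_nats (x' # x # ra')) (enc_nats (y' # y # rb'))))
           (Pr (enc_nats (rev (plist n (rcompl n (fst p))))) (enc_nats (rev (plist n (snd p)))))
           (100 * (length (x' # x # ra') + 2 * length (pw n r')) + 20)" by blast
        have "slid n r t p" using p(1) peq_trans[OF _ sw(3)] unfolding slid_def by blast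
        moreover have "length (pw n r) = Suc (length (pw n r'))" using sw(4) by simp
        ultimately show ?thesis
          by (intro exI[of _ p] conjI runsI) (use p(2) la lb ra rb True in \<open>simp_all add: b_slide_def wp_simps runs_def\<close>)
      qed
    qed
  qed
qed

lemma run_slide:
  assumes r: "r permutes {1..n}" and t: "t permutes {1..n}"
  shows "runs prog f_slide (Pr (Pr (Num 0) (Num 0)) (Pr (enc_perm n (rcompl n r)) (enc_perm n t)))
     (Pr (enc_nats (rev (plist n (rcompl n (fst (slide n r t)))))) (enc_nats (rev (plist n (snd (slide n r t))))))
     (300 * (n + 1)\<^sup>2)"
proof -
  obtain p where p: "slid n r t p" "runs prog f_slide (Pr (Pr (enc_nats []) (enc_nats [])) (Pr (enc_perm n (rcompl n r)) (enc_perm n t)))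
     (Pr (enc_nats (rev (plist n (rcompl n (fst p))))) (enc_nats (rev (plist n (snd p)))))
     (100 * (length (plist n (rcompl n r)) + 2 * length (pw n r)) + 20)"
    using run_slide_aux[OF r t, of "[]" "plist n (rcompl n r)" "[]" "plist n t"] by auto
  have "100 * (n + 2 * length (pw n r)) + 20 \<le> 300 * (n + 1)\<^sup>2"
    using nonrep_length[OF pw(1,2)[OF r]] by (simp add: power2_eq_square algebra_simps)
  then show ?thesis using p(2) slide_eqI[OF r t p(1)] by (auto intro: runs_mono)
qed

lemma flipp_flipp: "flipp n (flipp n s) = s"
  by (simp add: flipp_def fun_eq_iff)

lemma rcompl_rcompl:
  assumes "s permutes {1..n}"
  shows "rcompl n (rcompl n s) = flipp n s"
proof -
  have "pinv (half_twist n \<circ> pinv s) = s \<circ> half_twist n"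
  proof (rule inv_unique_comp)
    show "(half_twist n \<circ> pinv s) \<circ> (s \<circ> half_twist n) = id" using permutes_inverses(2)[OF assms] by (simp add: fun_eq_iff)
    show "(s \<circ> half_twist n) \<circ> (half_twist n \<circ> pinv s) = id" using permutes_inverses(1)[OF assms] by (simp add: fun_eq_iff)
  qed
  then show ?thesis by (simp add: rcompl_def flipp_def comp_assoc)
qed

lemma slide_permutes:
  assumes "r permutes {1..n}" "t permutes {1..n}"
  shows "fst (slide n r t) permutes {1..n}" "snd (slide n r t) permutes {1..n}"
  using slide[OF assms] by (simp_all add: slid_def)

lemma perms_insert_letter: "perms n rs \<Longrightarrow> t permutes {1..n} \<Longrightarrow> perms n (insert_letter n t rs)"
  by (induction rs arbitrary: t) (simp_all add: slide_permutes)

lemma run_insert: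
  "perms n rs \<Longrightarrow> t permutes {1..n} \<Longrightarrow>
   runs prog f_insert (Pr (enc_perm n t) (Pr (enc_perms n rs) (Num n))) (enc_perms n (insert_letter n t rs))
     (length rs * (900 * (n + 1)\<^sup>2) + 20)"
proof (induction rs arbitrary: t)
  case Nil
  show ?case by (intro runsI) (simp add: b_insert_def wp_simps)
next
  case (Cons r rs)
  have r: "r permutes {1..n}" and t: "t permutes {1..n}" and rs: "perms n rs" using Cons.prems by auto
  define r' t' where rt: "r' = fst (slide n r t)" "t' = snd (slide n r t)"
  have p: "r' permutes {1..n}" "t' permutes {1..n}" unfolding rt using slide_permutes[OF r t] by blast+
  have 1: "runs prog f_revapp (Pr (enc_nats (rev (plist n (rcompl n r')))) (Num 0)) (enc_perm n (rcompl n r')) (40 * n + 10)"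
    using run_revapp[of "map Num (rev (plist n (rcompl n r')))" "[]"] by (simp add: rev_map)
  have 2: "runs prog f_revapp (Pr (enc_nats (rev (plist n t'))) (Num 0)) (enc_perm n t') (40 * n + 10)"
    using run_revapp[of "map Num (rev (plist n t'))" "[]"] by (simp add: rev_map)
  have 3: "runs prog f_rcompl (Pr (Num n) (Pr (enc_perm n (rcompl n r')) (Pr (Num (Suc n)) (Num 0)))) (enc_perm n (flipp n r')) (100 * (n + 1)\<^sup>2)"
    using run_rcompl_perm[OF rcompl_permutes[OF p(1)]] rcompl_rcompl[OF p(1)] by simp
  have 4: "runs prog f_flip (Pr (enc_perm n (flipp n r')) (Pr (Num (Suc n)) (Num 0))) (enc_perm n r') (40 * n + 10)"
    using run_flip_perm[OF flipp_permutes[OF p(1)]] by (simp add: flipp_flipp)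
  have b: "300 + 120 * n \<le> 300 * (n + 1)\<^sup>2" by (simp add: power2_eq_square algebra_simps)
  show ?case
    by (intro runsI)
      (use run_rcompl_perm[OF r] run_slide[OF r t, folded rt] 1 2 3 4 Cons.IH[OF rs p(1)] b in
        \<open>simp add: b_insert_def wp_simps runs_def rt[symmetric]\<close>)
qed

lemma run_push:
  assumes "letters n w" "perms n rs" "length rs + length w \<le> L" "m + length w \<le> L" "push_letters n w rs m = (rs', m')"
  shows "runs prog f_push (Pr (enc_word n w) (Pr (enc_perms n rs) (Pr (Num m) (Num n))))
    (Pr (enc_perms n rs') (Num m')) (length w * (1200 * (L + 1) * (n + 1)\<^sup>2) + 30)"
  using assms
proof (induction w arbitrary: rs m)
  case Nil
  then show ?case by (intro runsI) (simp add: b_push_def wp_simps)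
next
  case (Cons x w)
  obtain e s where x: "x = (e, s)" by (cases x)
  have s: "s permutes {1..n}" and w: "letters n w" using Cons.prems x by auto
  note c = rcompl_permutes[OF s]
  define u where "u = (flipp n ^^ m) (if e then s else rcompl n s)"
  define k where "k = (if e then m else Suc m)"
  have u: "u permutes {1..n}" unfolding u_def using flipp_dlp[OF s] flipp_dlp[OF c] by simp
  have e: "push_letters n w (insert_letter n u rs) k = (rs', m')"
    using Cons.prems(5) x by (simp add: u_def k_def split: if_splits)
  note IH = Cons.IH[OF w perms_insert_letter[OF Cons.prems(2) u] _ _ e]
  have IH': "runs prog f_push (Pr (enc_word n w) (Pr (enc_perms n (insert_letter n u rs)) (Pr (Num k) (Num n))))
    (Pr (enc_perms n rs') (Num m')) (length w * (1200 * (L + 1) * (n + 1)\<^sup>2) + 30)"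
    by (rule IH) (use Cons.prems(3,4) in \<open>simp_all add: k_def\<close>)
  have f: "runs prog f_flipn (Pr (Num m) (Pr (enc_perm n (if e then s else rcompl n s)) (Num (Suc n)))) (enc_perm n u) (m * (40 * n + 50) + 10)"
    unfolding u_def by (rule run_flipn) (use s c in simp)
  note i = run_insert[OF Cons.prems(2) u]
  define X where "X = (n + 1)\<^sup>2"
  have "m * (40 * n + 50) \<le> L * (50 * X)"
    unfolding X_def by (rule mult_le_mono) (use Cons.prems(4) in \<open>simp_all add: power2_eq_square algebra_simps\<close>)
  moreover have "length rs * (900 * X) \<le> L * (900 * X)"
    by (rule mult_le_mono1) (use Cons.prems(3) in simp)
  moreover have "1 \<le> X" by (simp add: X_def)
  moreover have "1200 * (L + 1) * X = 1200 * (L * X) + 1200 * X" "L * (50 * X) = 50 * (L * X)" "L * (900 * X) = 900 * (L * X)"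
    by (simp_all add: algebra_simps)
  ultimately have "m * (40 * n + 50) + length rs * (900 * X) + 100 * X + 200 \<le> 1200 * (L + 1) * X" by linarith
  then have b: "m * (40 * n + 50) + length rs * (900 * (n + 1)\<^sup>2) + 100 * (n + 1)\<^sup>2 + 200 \<le> 1200 * (L + 1) * (n + 1)\<^sup>2"
    by (simp only: X_def)
  show ?case
    by (intro runsI)
      (use run_rcompl_perm[OF s] f i IH' b in \<open>cases e; simp add: b_push_def wp_simps runs_def x enc_letter_plist u_def k_def del: enc_letter.simps\<close>)
qed

section \<open>Expansions\<close>

lemma run_revflip:
  "runs prog f_revflip (Pr (enc_word n w) (enc_list acc)) (enc_list (map (enc_letter n) (winvw w) @ acc)) (40 * length w + 20)"
proof (induction w arbitrary: acc)
  case Nil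
  show ?case by (intro runsI) (simp add: b_revflip_def wp_simps winvw_def)
next
  case (Cons x w)
  obtain e s where x: "x = (e, s)" by (cases x)
  have "winvw (x # w) = winvw w @ [(\<not> e, s)]" by (simp add: winvw_def x)
  with Cons[of "enc_letter n (\<not> e, s) # acc"] show ?case
    by (intro runsI) (cases e; simp add: b_revflip_def wp_simps runs_def x enc_letter_plist del: enc_letter.simps)
qed

lemma run_dblw:
  "letters n w \<Longrightarrow> i \<in> {1..n} \<Longrightarrow>
   runs prog f_dblw (Pr (enc_word n w) (Num i)) (Pr (enc_word (Suc n) (dblw i w)) (Num (wend w i))) (length w * (100 * (n + 1)) + 20)"
proof (induction w arbitrary: i)
  case Nil
  show ?case by (intro runsI) (simp add: b_dblw_def wp_simps)
next
  case (Cons x w)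
  obtain e s where x: "x = (e, s)" by (cases x)
  have s: "s permutes {1..n}" and w: "letters n w" using Cons.prems x by auto
  have i: "1 \<le> i" "i \<le> n" using Cons.prems by auto
  show ?case
  proof (cases e)
    case True
    have "runs prog f_nth (Pr (Num i) (enc_perm n s)) (Num (s i)) (20 * n)"
      using run_nth[of i "plist n s"] i nth_plist[of i n s] by simp
    moreover have "runs prog f_dbl (Pr (Num (s i)) (enc_perm n s)) (enc_perm (Suc n) (dbl i s)) (40 * n + 10)"
      using run_dbl[of "s i" "plist n s"] insval_plist[OF s Cons.prems(2)] by simp
    moreover note Cons.IH[OF w perm_range[OF s Cons.prems(2)]]
    ultimately show ?thesis using True
      by (intro runsI) (simp add: b_dblw_def wp_simps runs_def x enc_letter_plist lend_def del: enc_letter.simps)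
  next
    case False
    let ?j = "pinv s i"
    have j: "?j \<in> {1..n}" by (rule perm_range[OF permutes_pinv[OF s] Cons.prems(2)])
    have "runs prog f_idx (Pr (Num i) (enc_perm n s)) (Num ?j) (30 * n)"
      using run_idx[of i "plist n s"] set_plist[OF s] idx_plist[OF s Cons.prems(2)] Cons.prems(2) by simp
    moreover have "runs prog f_dbl (Pr (Num i) (enc_perm n s)) (enc_perm (Suc n) (dbl ?j s)) (40 * n + 10)"
      using run_dbl[of i "plist n s"] insval_plist[OF s j] permutes_inverses(1)[OF s] by simp
    moreover note Cons.IH[OF w j]
    ultimately show ?thesis using False
      by (intro runsI) (simp add: b_dblw_def wp_simps runs_def x enc_letter_plist lend_def del: enc_letter.simps)
  qed
qed

text \<open>Each round costs the doubling of one strand of the word, and there is one round for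
  each missing leaf.\<close>

lemma run_expand:
  assumes "letters (size1 A) w" "size1 B = size1 A" "J = tjoin A Z"
  shows "\<exists>w' B'. runs prog f_expand (Pr (Tr A) (Pr (enc_word (size1 A) w) (Pr (Tr B) (Tr Z))))
      (Pr (Tr J) (Pr (enc_word (size1 J) w') (Tr B'))) ((size1 J - size1 A + 1) * (length w * (100 * (size1 J + 1)) + 100)) \<and>
    letters (size1 J) w' \<and> size1 B' = size1 J \<and> length w' = length w \<and>
    eye_insertion\<^sup>*\<^sup>* (triple_of (A, w, B)) (triple_of (J, w', B'))"
  using assms
proof (induction "size1 J - size1 A" arbitrary: A w B rule: less_induct)
  case less
  let ?i = "open_leaf A Z" let ?n = "size1 A"
  show ?case
  proof (cases "?i = 0")
    case True
    then have J: "J = A" using open_leaf_0 less.prems(3) by simp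
    show ?thesis
      by (intro exI[of _ w] exI[of _ B] conjI runsI) (use less.prems True J in \<open>simp_all add: b_expand_def wp_simps\<close>)
  next
    case False
    have i: "?i \<in> {1..?n}" and J: "J = tjoin (add_caret A ?i) Z" using open_leaf[OF False] less.prems(3) by auto
    have s: "size1 (add_caret A ?i) = Suc ?n" by (rule size1_add_caret[OF i])
    have nJ: "Suc ?n \<le> size1 J" using size1_tjoin(2)[of "add_caret A ?i" Z] J s by simp
    note d = dblw[OF less.prems(1), of ?i]
    have we: "wend w ?i \<in> {1..size1 B}" using wend_range[OF less.prems(1) i] less.prems(2) by simp
    have "letters (size1 (add_caret A ?i)) (dblw ?i w)" "size1 (add_caret B (wend w ?i)) = size1 (add_caret A ?i)"
      using d s size1_add_caret[OF we] less.prems(2) by simp_all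
    note st = this
    have lt: "size1 J - size1 (add_caret A ?i) < size1 J - size1 A" using nJ s by simp
    obtain w' B' where w':
      "runs prog f_expand (Pr (Tr (add_caret A ?i)) (Pr (enc_word (Suc ?n) (dblw ?i w)) (Pr (Tr (add_caret B (wend w ?i))) (Tr Z))))
        (Pr (Tr J) (Pr (enc_word (size1 J) w') (Tr B'))) ((size1 J - Suc ?n + 1) * (length w * (100 * (size1 J + 1)) + 100))"
      "letters (size1 J) w'" "size1 B' = size1 J" "length w' = length w"
      "eye_insertion\<^sup>*\<^sup>* (triple_of (add_caret A ?i, dblw ?i w, add_caret B (wend w ?i))) (triple_of (J, w', B'))"
      using less.hyps[OF lt st J] unfolding s length_dblw by (elim exE conjE)
    have e: "eye_insertion (triple_of (A, w, B)) (triple_of (add_caret A ?i, dblw ?i w, add_caret B (wend w ?i)))"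
      unfolding triple_of_ins[OF less.prems(1) i] eye_insertion_iff
      using triple_of_triples[OF less.prems(2)[symmetric] less.prems(1)] i by auto
    have "length w * (100 * (?n + 1)) \<le> length w * (100 * (size1 J + 1))" using nJ by simp
    moreover have "size1 J - ?n = Suc (size1 J - Suc ?n)" using nJ by simp
    moreover have "y \<le> x \<Longrightarrow> a = Suc q \<Longrightarrow> (y + 20) + (q + 1) * (x + 100) + 60 \<le> (a + 1) * (x + 100)" for x y a q :: nat
      by simp
    ultimately have b: "(length w * (100 * (?n + 1)) + 20) + (size1 J - Suc ?n + 1) * (length w * (100 * (size1 J + 1)) + 100) + 60
      \<le> (size1 J - ?n + 1) * (length w * (100 * (size1 J + 1)) + 100)" by blast
    show ?thesis
    proof (intro exI[of _ w'] exI[of _ B'] conjI)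
      show "runs prog f_expand (Pr (Tr A) (Pr (enc_word (size1 A) w) (Pr (Tr B) (Tr Z))))
        (Pr (Tr J) (Pr (enc_word (size1 J) w') (Tr B'))) ((size1 J - size1 A + 1) * (length w * (100 * (size1 J + 1)) + 100))"
        by (rule runs_mono[OF _ b], intro runsI) (use run_dblw[OF less.prems(1) i] w'(1) False in \<open>simp add: b_expand_def wp_simps runs_def\<close>)
      show "eye_insertion\<^sup>*\<^sup>* (triple_of (A, w, B)) (triple_of (J, w', B'))"
        by (rule converse_rtranclp_into_rtranclp[of eye_insertion, OF e w'(5)])
    qed (use w' in simp_all)
  qed
qed

section \<open>Removal of eyes\<close>

definition enc_opt :: "nat \<Rightarrow> (nat \<times> (nat \<Rightarrow> nat) list) option \<Rightarrow> val" where
  "enc_opt n r = (case r of None \<Rightarrow> Num 0 | Some (b, ss) \<Rightarrow> Pr (Num b) (enc_perms n ss))"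

lemma enc_opt_simps [simp]: "enc_opt n None = Num 0" "enc_opt n (Some (b, ss)) = Pr (Num b) (enc_perms n ss)"
  by (simp_all add: enc_opt_def)

lemma run_unribbon:
  "perms (Suc n) Ss \<Longrightarrow> a \<in> {1..n} \<Longrightarrow>
   runs prog f_unribbon (Pr (Num a) (Pr (enc_perms (Suc n) Ss) (Num m))) (enc_opt n (unribbon a Ss m)) (length Ss * (200 * (n + 2)) + 30)"
proof (induction a Ss m rule: unribbon.induct)
  case (1 a m)
  show ?case by (intro runsI) (simp add: b_unribbon_def wp_simps)
next
  case (2 a S Ss m)
  have S: "S permutes {1..Suc n}" and Ss: "perms (Suc n) Ss" using "2.prems" by auto
  have Sr: "S a \<in> {1..Suc n}" "S (Suc a) \<in> {1..Suc n}" using perm_range[OF S] "2.prems"(2) by simp_all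
  have ne: "S a \<noteq> S (Suc a)" using permutes_inj[OF S] by (metis injD n_not_Suc_n)
  have n1: "runs prog f_nth (Pr (Num a) (enc_perm (Suc n) S)) (Num (S a)) (20 * Suc n)"
    using run_nth[of a "plist (Suc n) S"] nth_plist[of a "Suc n" S] "2.prems"(2) by simp
  have n2: "runs prog f_nth (Pr (Num (Suc a)) (enc_perm (Suc n) S)) (Num (S (Suc a))) (20 * Suc n)"
    using run_nth[of "Suc a" "plist (Suc n) S"] nth_plist[of "Suc a" "Suc n" S] "2.prems"(2) by simp
  consider "S (Suc a) = Suc (S a)" | "S a = Suc (S (Suc a))" | "S (Suc a) \<noteq> Suc (S a)" "S a \<noteq> Suc (S (Suc a))" by blast
  then show ?case
  proof cases
    case 1
    have sa: "del a S a = S a" using 1 by (simp add: del_def up_def coll_def)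
    have Sa: "S a \<in> {1..n}" using Sr 1 by auto
    have d: "runs prog f_del (Pr (Num (Suc (S a))) (enc_perm (Suc n) S)) (enc_perm n (del a S)) (40 * Suc n + 10)"
      using run_del[of "Suc (S a)" "plist (Suc n) S"] delval_plist[OF "2.prems"(2), of "del a S" "S (Suc a) < S a"]
      unfolding rib_del(1)[OF S "2.prems"(2) disjI1[OF 1]] sa by simp
    note IH = "2.IH"(1)[OF 1 Ss Sa]
    show ?thesis
    proof (cases "unribbon (S a) Ss m")
      case None
      then show ?thesis using n1 n2 IH 1 by (intro runsI) (simp add: b_unribbon_def wp_simps runs_def)
    next
      case (Some p)
      obtain b ss where p: "p = (b, ss)" by (cases p)
      show ?thesis using n1 n2 d IH 1 Some p by (intro runsI) (simp add: b_unribbon_def wp_simps runs_def)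
    qed
  next
    case 2
    then have nc: "S (Suc a) \<noteq> Suc (S a)" by simp
    have sa: "del a S a = S (Suc a)" using 2 by (simp add: del_def up_def coll_def)
    have Sa: "S (Suc a) \<in> {1..n}" using Sr 2 by auto
    have d: "runs prog f_del (Pr (Num (Suc (S (Suc a)))) (enc_perm (Suc n) S)) (enc_perm n (del a S)) (40 * Suc n + 10)"
      using run_del[of "Suc (S (Suc a))" "plist (Suc n) S"] delval_plist[OF "2.prems"(2), of "del a S" "S (Suc a) < S a"]
      unfolding rib_del(1)[OF S "2.prems"(2) disjI2[OF 2]] sa by simp
    show ?thesis
    proof (cases "m = 0")
      case True
      then show ?thesis using n1 n2 2 nc by (intro runsI) (simp add: b_unribbon_def wp_simps runs_def)
    next
      case False
      note IH = "2.IH"(2)[OF nc conjI[OF 2 False] Ss Sa]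
      show ?thesis
      proof (cases "unribbon (S (Suc a)) Ss (m - 1)")
        case None
        then show ?thesis using n1 n2 IH 2 nc False by (intro runsI) (simp add: b_unribbon_def wp_simps runs_def)
      next
        case (Some p)
        obtain b ss where p: "p = (b, ss)" by (cases p)
        show ?thesis using n1 n2 d IH 2 nc False Some p by (intro runsI) (simp add: b_unribbon_def wp_simps runs_def)
      qed
    qed
  next
    case 3
    then have "unribbon a (S # Ss) m = None" by simp
    moreover have "S a < S (Suc a) \<and> Suc (S a) < S (Suc a) \<or> S (Suc a) < S a \<and> Suc (S (Suc a)) < S a" using 3 ne by linarith
    ultimately show ?thesis using n1 n2 3 by (intro runsI) (auto simp: b_unribbon_def wp_simps runs_def)
  qed
qed

text \<open>Each round either removes an eye, which lowers the number of leaves, or moves the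
  cursor \<open>i\<close> to the left. The removal of an eye keeps the cursor in place, as a new
  eye can arise at \<open>i\<close>.\<close>

lemma run_eyes:
  assumes "(T, gval (size1 T) (words (size1 T) ss) m, V) \<in> triples" "greedy (size1 T) ss"
    "\<And>k. i < k \<Longrightarrow> \<not> eye_at k (T, gval (size1 T) (words (size1 T) ss) m, V)"
    "length ss \<le> L" "m \<le> L" "size1 T \<le> N" "400 * ((L + 1) * (N + 1)) \<le> K"
  shows "\<exists>T' ss' V'. runs prog f_eyes (Pr (Num i) (Pr (Tr T) (Pr (enc_perms (size1 T) ss) (Pr (Num m) (Tr V)))))
      (Pr (Tr T') (Pr (enc_perms (size1 T') ss') (Tr V'))) ((i + size1 T) * K + 30) \<and>
    (T', gval (size1 T') (words (size1 T') ss') m, V') \<in> triples \<and> greedy (size1 T') ss' \<and>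
    length ss' = length ss \<and> size1 T' \<le> size1 T \<and> reduced (T', gval (size1 T') (words (size1 T') ss') m, V') \<and>
    equivclp eye_insertion (T, gval (size1 T) (words (size1 T) ss) m, V) (T', gval (size1 T') (words (size1 T') ss') m, V')"
  using assms
proof (induction "i + size1 T" arbitrary: i T ss V rule: less_induct)
  case less
  note t = less.prems(1) and g = less.prems(2)
  let ?t = "(T, gval (size1 T) (words (size1 T) ss) m, V)"
  show ?case
  proof (cases "i = 0")
    case True
    have "\<not> eye_at 0 ?t" by (auto simp: eye_at_def)
    then have "reduced ?t" unfolding reduced_iff using less.prems(3) True by (metis gr0I)
    moreover have "runs prog f_eyes (Pr (Num i) (Pr (Tr T) (Pr (enc_perms (size1 T) ss) (Pr (Num m) (Tr V)))))
      (Pr (Tr T) (Pr (enc_perms (size1 T) ss) (Tr V))) ((i + size1 T) * K + 30)"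
      by (intro runsI) (simp add: b_eyes_def wp_simps True)
    ultimately show ?thesis using t g by (intro exI[of _ T] exI[of _ ss] exI[of _ V]) simp
  next
    case i0: False
    have "1 * 1 \<le> (L + 1) * (N + 1)" by (rule mult_le_mono) simp_all
    then have K1: "400 \<le> K" using less.prems(7) by linarith
    have skip: ?thesis if no: "\<not> eye_at i ?t"
      and run: "\<And>b c. runs prog f_eyes (Pr (Num (i - 1)) (Pr (Tr T) (Pr (enc_perms (size1 T) ss) (Pr (Num m) (Tr V))))) b c \<Longrightarrow>
        runs prog f_eyes (Pr (Num i) (Pr (Tr T) (Pr (enc_perms (size1 T) ss) (Pr (Num m) (Tr V))))) b (c + K)"
    proof -
      have lt: "i - 1 + size1 T < i + size1 T" using i0 by simp
      have no': "\<not> eye_at k ?t" if "i - 1 < k" for k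
        using no less.prems(3)[of k] that by (cases "k = i") auto
      obtain T' ss' V' where r: "runs prog f_eyes (Pr (Num (i - 1)) (Pr (Tr T) (Pr (enc_perms (size1 T) ss) (Pr (Num m) (Tr V)))))
        (Pr (Tr T') (Pr (enc_perms (size1 T') ss') (Tr V'))) ((i - 1 + size1 T) * K + 30)"
        "(T', gval (size1 T') (words (size1 T') ss') m, V') \<in> triples \<and> greedy (size1 T') ss' \<and>
        length ss' = length ss \<and> size1 T' \<le> size1 T \<and> reduced (T', gval (size1 T') (words (size1 T') ss') m, V') \<and>
        equivclp eye_insertion ?t (T', gval (size1 T') (words (size1 T') ss') m, V')"
        using less.hyps[OF lt t g no' less.prems(4-7)] by blast
      have e: "i + size1 T = Suc (i - 1 + size1 T)" using i0 by simp
      have "(i - 1 + size1 T) * K + 30 + K = (i + size1 T) * K + 30" unfolding e by (simp only: mult_Suc add_ac)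
      then have "runs prog f_eyes (Pr (Num i) (Pr (Tr T) (Pr (enc_perms (size1 T) ss) (Pr (Num m) (Tr V)))))
        (Pr (Tr T') (Pr (enc_perms (size1 T') ss') (Tr V'))) ((i + size1 T) * K + 30)"
        using run[OF r(1)] by (simp only:)
      with r(2) show ?thesis by blast
    qed
    show ?thesis
    proof (cases "has_caret T i")
      case False
      show ?thesis
      proof (rule skip)
        show "\<not> eye_at i ?t" using eye_at_test[OF _ g] False by blast
      qed (use False i0 K1 in \<open>intro runsI; simp add: b_eyes_def wp_simps runs_def\<close>)
    next
      case T: True
      define n where "n = size1 T - 1"
      have n: "size1 T = Suc n" using size1_pos[of T] by (simp add: n_def)
      have i: "i \<in> {1..n}" using has_caret_pos[OF T] n by auto
      have ps: "perms (Suc n) ss" using greedy_perms[OF g] n by simp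
      note u = run_unribbon[OF ps i, of m, folded n]
      have "length ss * (200 * (n + 2)) \<le> L * (200 * (N + 1))"
        by (rule mult_le_mono) (use less.prems(4,6) n in simp_all)
      moreover have "L * (200 * (N + 1)) = 200 * (L * N) + 200 * L" "400 * ((L + 1) * (N + 1)) = 400 * (L * N) + 400 * L + 400 * N + 400"
        by (simp_all add: algebra_simps)
      ultimately have cu: "length ss * (200 * (n + 2)) + 30 + (40 * m + 10) + 150 \<le> K"
        using less.prems(5,7) by linarith
      show ?thesis
      proof (cases "unribbon i ss m")
        case None
        show ?thesis
        proof (rule skip)
          show "\<not> eye_at i ?t" using eye_at_test[OF _ g] None by force
        qed (use T i0 cu u None n in \<open>intro runsI; simp add: b_eyes_def wp_simps runs_def\<close>)
      next
        case (Some p)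
        obtain b ts where p: "unribbon i ss m = Some (b, ts)" using Some by (cases p) auto
        have g': "greedy (Suc n) ss" using g n by simp
        have b: "1 \<le> b" "b \<le> n" using unribbon_dbr(5)[OF g' i p] by auto
        let ?j = "(half_twist n ^^ m) b"
        have h: "runs prog f_hpow (Pr (Num m) (Pr (Num b) (Num (size1 T)))) (Num ?j) (40 * m + 10)"
          unfolding n by (rule run_hpow[OF b])
        show ?thesis
        proof (cases "has_caret V ?j")
          case False
          show ?thesis
          proof (rule skip)
            show "\<not> eye_at i ?t" using eye_at_test[OF _ g] p False n by force
          qed (use T i0 cu u p n h False in \<open>intro runsI; simp add: b_eyes_def wp_simps runs_def\<close>)
        next
          case True
          let ?T = "remove_caret T i" let ?V = "remove_caret V ?j"
          let ?t' = "(?T, gval (size1 ?T) (words (size1 ?T) ts) m, ?V)"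
          note rm = eye_removal[OF t g T p True[unfolded n_def], folded n_def]
          have rm': "?t' \<in> triples" "greedy (size1 ?T) ts" "length ts = length ss" "Suc (size1 ?T) = size1 T"
            "ins i ?t' = ?t" "i \<in> {1..size1 ?T}"
            by (rule rm)+
          have sT: "size1 ?T = n" using rm'(4) n by simp
          have lt: "i + size1 ?T < i + size1 T" using sT n by simp
          have no: "\<not> eye_at k ?t'" if "i < k" for k
            using eye_at_ins[of k ?t' i] less.prems(3)[of "Suc k"] rm'(5) i that by auto
          obtain T' ss' V' where r: "runs prog f_eyes (Pr (Num i) (Pr (Tr ?T) (Pr (enc_perms (size1 ?T) ts) (Pr (Num m) (Tr ?V)))))
            (Pr (Tr T') (Pr (enc_perms (size1 T') ss') (Tr V'))) ((i + size1 ?T) * K + 30)"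
            "(T', gval (size1 T') (words (size1 T') ss') m, V') \<in> triples" "greedy (size1 T') ss'"
            "length ss' = length ts" "size1 T' \<le> size1 ?T" "reduced (T', gval (size1 T') (words (size1 T') ss') m, V')"
            "equivclp eye_insertion ?t' (T', gval (size1 T') (words (size1 T') ss') m, V')"
            using less.hyps[OF lt rm'(1,2) no] rm'(3,4) less.prems(4-7) by auto
          have "eye_insertion ?t' ?t" unfolding eye_insertion_iff using rm'(1,5,6) by force
          then have "equivclp eye_insertion ?t ?t'" by (intro equivclp_sym[OF eye_equiv_star] r_into_rtranclp)
          then have eq: "equivclp eye_insertion ?t (T', gval (size1 T') (words (size1 T') ss') m, V')"
            by (rule equivclp_trans[OF _ r(7)])
          have "i + size1 T = Suc (i + size1 ?T)" using sT n by simp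
          then have kk: "(i + size1 ?T) * K + 30 + K = (i + size1 T) * K + 30" by simp
          have "runs prog f_eyes (Pr (Num i) (Pr (Tr T) (Pr (enc_perms (size1 T) ss) (Pr (Num m) (Tr V)))))
            (Pr (Tr T') (Pr (enc_perms (size1 T') ss') (Tr V'))) ((i + size1 ?T) * K + 30 + K)"
            by (intro runsI) (use T i0 cu u p n h True r(1) sT in \<open>simp add: b_eyes_def wp_simps runs_def\<close>)
          then have "runs prog f_eyes (Pr (Num i) (Pr (Tr T) (Pr (enc_perms (size1 T) ss) (Pr (Num m) (Tr V)))))
            (Pr (Tr T') (Pr (enc_perms (size1 T') ss') (Tr V'))) ((i + size1 T) * K + 30)"
            unfolding kk .
          then show ?thesis using r eq rm'(3,4) by (intro exI[of _ T'] exI[of _ ss'] exI[of _ V']) simp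
        qed
      qed
    qed
  qed
qed

section \<open>The output\<close>

lemma rcompl_id_iff:
  assumes s: "s permutes {1..n}"
  shows "rcompl n s = id \<longleftrightarrow> s = half_twist n"
proof
  assume e: "rcompl n s = id"
  have "s x = half_twist n x" for x
    using fun_cong[OF e, of "s x"] permutes_inverses(2)[OF s] by (simp add: rcompl_def)
  then show "s = half_twist n" by (simp add: fun_eq_iff)
next
  assume e: "s = half_twist n"
  have "pinv (half_twist n) = half_twist n" by (rule inv_unique_comp) simp_all
  then show "rcompl n s = id" unfolding e rcompl_def by simp
qed

lemma run_strip:
  "perms n rs \<Longrightarrow> runs prog f_strip (Pr (enc_perms n rs) (Pr (Num d) (Num n)))
     (Pr (enc_perms n (dropWhile (\<lambda>s. s = half_twist n) rs)) (Num (d + length (takeWhile (\<lambda>s. s = half_twist n) rs))))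
     (length rs * (200 * (n + 1)\<^sup>2) + 30)"
proof (induction rs arbitrary: d)
  case Nil
  show ?case by (intro runsI) (simp add: b_strip_def wp_simps)
next
  case (Cons s rs)
  have s: "s permutes {1..n}" and rs: "perms n rs" using Cons.prems by auto
  have i: "runs prog f_isid (Pr (enc_perm n (rcompl n s)) (Num 1)) (Num (if s = half_twist n then 1 else 0)) (40 * n + 10)"
    using run_isid_perm[OF rcompl_permutes[OF s]] rcompl_id_iff[OF s] by simp
  have "40 * (n + 1) \<le> 40 * ((n + 1) * (n + 1))" by (intro mult_le_mono2 le_square)
  then have b: "40 * n + 40 \<le> 40 * (n + 1)\<^sup>2" by (simp add: power2_eq_square)
  have one: "1 \<le> (n + 1)\<^sup>2" by simp
  show ?case
    by (intro runsI) (use run_rcompl_perm[OF s] i Cons.IH[OF rs, of "Suc d"] b one in \<open>auto simp: b_strip_def wp_simps runs_def\<close>)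
qed

lemma run_out:
  "perms n rs \<Longrightarrow> runs prog f_out (Pr (enc_perms n rs) (enc_list acc))
     (enc_list (map (enc_letter n) (map (Pair True) (filter nontrivial (rev rs))) @ acc)) (length rs * (100 * (n + 1)) + 20)"
proof (induction rs arbitrary: acc)
  case Nil
  show ?case by (intro runsI) (simp add: b_out_def wp_simps)
next
  case (Cons s rs)
  have s: "s permutes {1..n}" and rs: "perms n rs" using Cons.prems by auto
  have i: "runs prog f_isid (Pr (enc_perm n s) (Num 1)) (Num (if nontrivial s then 0 else 1)) (40 * n + 10)"
    using run_isid_perm[OF s] by (cases "s = id") (simp_all add: nontrivial_def)
  show ?case
  proof (cases "nontrivial s")
    case True
    show ?thesis using i Cons.IH[OF rs, of "enc_letter n (True, s) # acc"] True
      by (intro runsI) (simp add: b_out_def wp_simps runs_def enc_letter_plist del: enc_letter.simps)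
  next
    case False
    show ?thesis using i Cons.IH[OF rs, of acc] False
      by (intro runsI) (simp add: b_out_def wp_simps runs_def del: enc_letter.simps)
  qed
qed

lemma plist_half_twist: "rev [1..<Suc n] = plist n (half_twist n)"
proof (rule nth_equalityI)
  fix k assume "k < length (rev [1..<Suc n])"
  then have "k < n" by (simp del: upt_Suc)
  then show "rev [1..<Suc n] ! k = plist n (half_twist n) ! k"
    by (simp add: rev_nth nth_plist' half_twist_def del: upt_Suc)
qed simp

lemma run_desc_perm: "runs prog f_desc (Num n) (enc_perm n (half_twist n)) (20 * n + 10)"
  using run_desc[of n] unfolding plist_half_twist .

lemma run_rep_half_twist:
  "runs prog f_rep (Pr (Num p) (Pr (Pr (Num (if e then 1 else 0)) (enc_perm n (half_twist n))) (Num 0)))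
     (enc_word n (replicate p (e, half_twist n))) (40 * p + 10)"
  using run_rep[of p "enc_letter n (e, half_twist n)" "[]"] by (simp add: enc_letter_plist del: enc_letter.simps)

section \<open>The whole computation\<close>

lemma subtree_tjoin_right: "subtree Z (tjoin T Z)"
  by (induction T Z rule: tjoin.induct) auto

text \<open>The first triple is expanded in its inverse, where the middle tree is on top.\<close>

lemma run_product:
  assumes x: "size1 T1 = size1 U1" "letters (size1 T1) w1" and y: "size1 T2 = size1 U2" "letters (size1 T2) w2"
    and J: "J = tjoin U1 T2"
  shows "\<exists>v T w V. runs prog f_expand (Pr (Tr U1) (Pr (enc_word (size1 T1) (winvw w1)) (Pr (Tr T1) (Tr T2))))
      (Pr (Tr J) (Pr (enc_word (size1 J) v) (Tr T))) ((size1 J - size1 U1 + 1) * (length w1 * (100 * (size1 J + 1)) + 100)) \<and>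
    runs prog f_expand (Pr (Tr T2) (Pr (enc_word (size1 T2) w2) (Pr (Tr U2) (Tr J))))
      (Pr (Tr J) (Pr (enc_word (size1 J) w) (Tr V))) ((size1 J - size1 T2 + 1) * (length w2 * (100 * (size1 J + 1)) + 100)) \<and>
    letters (size1 J) v \<and> letters (size1 J) w \<and> length v = length w1 \<and> length w = length w2 \<and>
    size1 T = size1 J \<and> size1 V = size1 J \<and>
    bv_class (triple_of (T1, w1, U1)) \<otimes>\<^bsub>BV\<^esub> bv_class (triple_of (T2, w2, U2)) = bv_class (triple_of (T, winvw v @ w, V))"
proof -
  have "letters (size1 U1) (winvw w1)" using x by simp
  from run_expand[OF this x(1) J] obtain v T where v:
    "runs prog f_expand (Pr (Tr U1) (Pr (enc_word (size1 U1) (winvw w1)) (Pr (Tr T1) (Tr T2))))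
      (Pr (Tr J) (Pr (enc_word (size1 J) v) (Tr T))) ((size1 J - size1 U1 + 1) * (length (winvw w1) * (100 * (size1 J + 1)) + 100))"
    "letters (size1 J) v" "size1 T = size1 J" "length v = length (winvw w1)"
    "eye_insertion\<^sup>*\<^sup>* (triple_of (U1, winvw w1, T1)) (triple_of (J, v, T))" by (elim exE conjE)
  have "J = tjoin T2 J" using subtree_imp_tjoin[OF subtree_tjoin_right[of T2 U1]] J by simp
  from run_expand[OF y(2) y(1)[symmetric] this] obtain w V where w:
    "runs prog f_expand (Pr (Tr T2) (Pr (enc_word (size1 T2) w2) (Pr (Tr U2) (Tr J))))
      (Pr (Tr J) (Pr (enc_word (size1 J) w) (Tr V))) ((size1 J - size1 T2 + 1) * (length w2 * (100 * (size1 J + 1)) + 100))"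
    "letters (size1 J) w" "size1 V = size1 J" "length w = length w2"
    "eye_insertion\<^sup>*\<^sup>* (triple_of (T2, w2, U2)) (triple_of (J, w, V))" by (elim exE conjE)
  have tx: "triple_of (T1, w1, U1) \<in> triples" by (rule triple_of_triples[OF x])
  have "eye_insertion\<^sup>*\<^sup>* (tinv (tinv (triple_of (T1, w1, U1)))) (tinv (triple_of (J, v, T)))"
    using tinv_star[OF v(5)] triple_of_tinv[OF x(2) x(1)[symmetric]] by simp
  then have "eye_insertion\<^sup>*\<^sup>* (triple_of (T1, w1, U1)) (triple_of (T, winvw v, J))"
    unfolding tinv_tinv[OF tx] triple_of_tinv[OF v(2,3)] .
  then have cx: "bv_class (triple_of (T1, w1, U1)) = bv_class (triple_of (T, winvw v, J))"
    by (intro bv_class_eq eye_equiv_star)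
  have cy: "bv_class (triple_of (T2, w2, U2)) = bv_class (triple_of (J, w, V))"
    by (intro bv_class_eq eye_equiv_star w(5))
  have l: "letters (size1 T) (winvw v)" "letters (size1 T) w" using v w by simp_all
  have "triple_of (T, winvw v, J) \<in> triples" "triple_of (J, w, V) \<in> triples"
    using triple_of_triples[OF v(3) l(1)] triple_of_triples[OF w(3)[symmetric] w(2)] by simp_all
  then have "bv_class (triple_of (T, winvw v, J)) \<otimes>\<^bsub>BV\<^esub> bv_class (triple_of (J, w, V))
    = bv_class (triple_of (T, winvw v @ w, V))"
    unfolding triple_of_tmul[OF l v(3)[symmetric]] by (intro bv_mult) simp_all
  then show ?thesis using v(1-4) w(1-4) x(1) unfolding cx cy
    by (intro exI[of _ v] exI[of _ T] exI[of _ w] exI[of _ V] conjI) (simp_all add: winvw_def)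
qed

lemma braid_group_1: "carrier (braid_group 1) = {\<one>\<^bsub>braid_group 1\<^esub>}"
proof -
  have "w = []" if "w \<in> artin_words 1" for w using that by (cases w) (auto simp: artin_words_def)
  then have "artin_words 1 = {[]}" by (auto simp: artin_words_def)
  then show ?thesis by (simp add: braid_group_def)
qed

text \<open>For one strand the braid group is trivial, and the empty word is the normal
  form.\<close>

lemma output_word:
  fixes m :: nat
  assumes g: "greedy n ss" and n: "1 \<le> n"
  defines "w \<equiv> (if 1 < n then strip n (rev ss) m else [])"
  shows "right_greedy n w \<and> word_braid n w = gval n (words n ss) m"
proof (cases "1 < n")
  case True
  then show ?thesis using strip[of n "rev ss" m] g by (simp add: w_def)
next
  case False
  then have n1: "n = 1" using n by simp
  have "gval 1 (words 1 ss) m \<in> carrier (braid_group 1)"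
    using gval_carrier set_words[OF greedy_perms[OF g]] n1 by blast
  then have "word_braid 1 [] = gval 1 (words 1 ss) m" unfolding braid_group_1 word_braid_Nil by simp
  moreover have "right_greedy 1 []" unfolding right_greedy_def by (intro exI[of _ "[]"] exI[of _ 0]) simp
  ultimately show ?thesis using n1 by (simp add: w_def)
qed

lemma run_main:
  assumes x: "size1 T1 = size1 U1" "letters (size1 T1) w1" and y: "size1 T2 = size1 U2" "letters (size1 T2) w2"
  defines "X \<equiv> (length w1 + length w2 + 1)\<^sup>2 * (size1 T1 + size1 T2 + 1)\<^sup>2"
  shows "\<exists>T w V. runs prog 0 (Pr (enc_triple (T1, w1, U1)) (enc_triple (T2, w2, U2))) (enc_triple (T, w, V)) (5000 * X) \<and>
    bv_normal_form (T, w, V) \<and> triple_of (T, w, V) \<in> triples \<and>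
    bv_class (triple_of (T1, w1, U1)) \<otimes>\<^bsub>BV\<^esub> bv_class (triple_of (T2, w2, U2)) = bv_class (triple_of (T, w, V))"
proof -
  define H where "H = length w1 + length w2"
  define N where "N = size1 T1 + size1 T2"
  define J where "J = tjoin U1 T2"
  define n where "n = size1 J"
  have nN: "n \<le> N" using size1_tjoin(1)[of U1 T2] x(1) by (simp add: n_def N_def J_def)
  have X: "X = (H + 1)\<^sup>2 * (N + 1)\<^sup>2" by (simp add: X_def H_def N_def)
  have sq: "q + 1 \<le> (q + 1)\<^sup>2" for q :: nat unfolding power2_eq_square by (rule le_square)
  have H2: "H \<le> (H + 1)\<^sup>2" "1 \<le> (H + 1)\<^sup>2" "H + 1 \<le> (H + 1)\<^sup>2"
    by (rule le_trans[OF _ sq], simp)+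
  have H3: "H * (H + 1) \<le> (H + 1)\<^sup>2" unfolding power2_eq_square by (rule mult_le_mono1) simp
  have N2: "N + 1 \<le> (N + 1)\<^sup>2" "1 \<le> (N + 1)\<^sup>2" by (rule sq, rule le_trans[OF _ sq], simp)
  have bnd: "a * b \<le> X" if "a \<le> (H + 1)\<^sup>2" "b \<le> (N + 1)\<^sup>2" for a b
    unfolding X using that by (rule mult_le_mono)
  have X1: "1 \<le> X" "H \<le> X" "H * (N + 1) \<le> X" "N + 1 \<le> X" "H * (N + 1)\<^sup>2 \<le> X" "(H + 1) * (N + 1)\<^sup>2 \<le> X" "H * (H + 1) * (N + 1)\<^sup>2 \<le> X"
    using bnd[OF H2(2) N2(2)] bnd[OF H2(1) N2(2)] bnd[OF H2(1) N2(1)] bnd[OF H2(2) N2(1)] bnd[OF H2(1) order_refl]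
      bnd[OF H2(3) order_refl] bnd[OF H3 order_refl] by simp_all
  have lin: "p * a + q * b \<le> (p + q) * X" if "a \<le> X" "b \<le> X" for a b p q
    unfolding add_mult_distrib by (intro add_le_mono mult_le_mono2 that)
  obtain v T w V where p:
    "runs prog f_expand (Pr (Tr U1) (Pr (enc_word (size1 T1) (winvw w1)) (Pr (Tr T1) (Tr T2))))
      (Pr (Tr J) (Pr (enc_word (size1 J) v) (Tr T))) ((size1 J - size1 U1 + 1) * (length w1 * (100 * (size1 J + 1)) + 100))"
    "runs prog f_expand (Pr (Tr T2) (Pr (enc_word (size1 T2) w2) (Pr (Tr U2) (Tr J))))
      (Pr (Tr J) (Pr (enc_word (size1 J) w) (Tr V))) ((size1 J - size1 T2 + 1) * (length w2 * (100 * (size1 J + 1)) + 100))"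
    "letters (size1 J) v" "letters (size1 J) w" "length v = length w1" "length w = length w2"
    "size1 T = size1 J" "size1 V = size1 J"
    "bv_class (triple_of (T1, w1, U1)) \<otimes>\<^bsub>BV\<^esub> bv_class (triple_of (T2, w2, U2)) = bv_class (triple_of (T, winvw v @ w, V))"
    using run_product[OF x y J_def] by (elim exE conjE)
  \<comment> \<open>The factor \<open>n - a + 1\<close> is the number of rounds of an expansion
    from \<open>a\<close> to \<open>n\<close> leaves.\<close>
  have eb: "(n - a + 1) * (h * (100 * (n + 1)) + 100) \<le> 200 * X" if "h \<le> H" for a h
  proof -
    have "(n - a + 1) * (h * (100 * (n + 1)) + 100) \<le> (N + 1) * (H * (100 * (N + 1)) + 100)"
      using that nN by (intro mult_le_mono add_le_mono order_refl) simp_all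
    also have "\<dots> = 100 * (H * (N + 1)\<^sup>2) + 100 * (N + 1)" by (simp add: power2_eq_square algebra_simps)
    also have "\<dots> \<le> 200 * X" using lin[OF X1(5,4), of 100 100] by simp
    finally show ?thesis .
  qed
  have r1: "runs prog f_revflip (Pr (enc_word (size1 T1) w1) (Num 0)) (enc_word (size1 T1) (winvw w1)) (60 * X)"
    by (rule runs_mono[OF run_revflip[of "size1 T1" w1 "[]", simplified]]) (use X1 in \<open>simp add: H_def\<close>)
  have r2: "runs prog f_expand (Pr (Tr U1) (Pr (enc_word (size1 T1) (winvw w1)) (Pr (Tr T1) (Tr T2))))
      (Pr (Tr J) (Pr (enc_word n v) (Tr T))) (200 * X)"
    unfolding n_def by (rule runs_mono[OF p(1) eb[unfolded n_def]]) (simp add: H_def)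
  have r3: "runs prog f_expand (Pr (Tr T2) (Pr (enc_word (size1 T2) w2) (Pr (Tr U2) (Tr J))))
      (Pr (Tr J) (Pr (enc_word n w) (Tr V))) (200 * X)"
    unfolding n_def by (rule runs_mono[OF p(2) eb[unfolded n_def]]) (simp add: H_def)
  have r4: "runs prog f_revflip (Pr (enc_word n v) (enc_word n w)) (enc_word n (winvw v @ w)) (60 * X)"
    by (rule runs_mono[OF run_revflip[of n v "map (enc_letter n) w", folded map_append]]) (use X1 p(5) in \<open>simp add: H_def\<close>)
  let ?u = "winvw v @ w"
  obtain rs m where rs: "push_letters n ?u [] 0 = (rs, m)" by (cases "push_letters n ?u [] 0") 
  have "length (winvw v) = length v" by (simp add: winvw_def)
  then have lu: "letters n ?u" "length ?u = H" using p(3-6) by (simp_all add: n_def H_def)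
  have nX: "(n + 1)\<^sup>2 \<le> (N + 1)\<^sup>2" using nN by (intro power_mono) simp_all
  have r5: "runs prog f_push (Pr (enc_word n ?u) (Pr (Num 0) (Pr (Num 0) (Num n)))) (Pr (enc_perms n rs) (Num m)) (1230 * X)"
  proof (rule runs_mono)
    show "runs prog f_push (Pr (enc_word n ?u) (Pr (Num 0) (Pr (Num 0) (Num n)))) (Pr (enc_perms n rs) (Num m))
      (H * (1200 * (H + 1) * (n + 1)\<^sup>2) + 30)"
      using run_push[OF lu(1) _ _ _ rs, of H] lu(2) by simp
    have "H * (1200 * (H + 1) * (n + 1)\<^sup>2) + 30 \<le> H * (1200 * (H + 1) * (N + 1)\<^sup>2) + 30"
      using nX by (intro add_le_mono mult_le_mono order_refl)
    also have "\<dots> = 1200 * (H * (H + 1) * (N + 1)\<^sup>2) + 30" by simp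
    also have "\<dots> \<le> 1230 * X" using lin[OF X1(7,1), of 1200 30] by simp
    finally show "H * (1200 * (H + 1) * (n + 1)\<^sup>2) + 30 \<le> 1230 * X" .
  qed
  have "greedy n (rev [])" by simp
  note pl = push_letters[OF lu(1) this rs]
  have g: "greedy n (rev rs)" and lr: "length rs = H" and m: "m \<le> H" using pl lu(2) by simp_all
  have gv: "gval n (words n (rev rs)) m = word_braid n ?u"
  proof -
    interpret group "braid_group n" by (rule group_braid_group)
    have "gval n [] 0 = \<one>\<^bsub>braid_group n\<^esub>" by (simp add: gval_def)
    then show ?thesis using pl word_braid_carrier[OF lu(1)] by simp
  qed
  have rv: "runs prog f_revapp (Pr (enc_perms q l) (Num 0)) (enc_perms q (rev l)) (50 * X)" if "length l = H" for q l
  proof -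
    have "40 * length (map (enc_perm q) l) + 10 \<le> 50 * X" using X1(1,2) that by simp
    from runs_mono[OF run_revapp[of _ "[]"] this] show ?thesis by (simp add: rev_map)
  qed
  note r6 = rv[OF lr, of n]
  have Tn: "size1 T = n" "size1 V = n" using p(7,8) by (simp_all add: n_def)
  let ?t = "(T, gval (size1 T) (words (size1 T) (rev rs)) m, V)"
  have te: "?t = triple_of (T, ?u, V)" using gv Tn by simp
  have tt: "?t \<in> triples" unfolding te using triple_of_triples[of T V ?u] lu(1) Tn by simp
  have noeye: "\<not> eye_at k ?t" if "n < k" for k
    using eye_at_test[of k T "rev rs" m V] has_caret_pos[of T k] that g Tn by fastforce
  have gT: "greedy (size1 T) (rev rs)" and lr': "length (rev rs) \<le> H" and nT: "size1 T \<le> N"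
    using g lr Tn nN by simp_all
  obtain T' ss V' where e: "runs prog f_eyes (Pr (Num n) (Pr (Tr T) (Pr (enc_perms (size1 T) (rev rs)) (Pr (Num m) (Tr V)))))
      (Pr (Tr T') (Pr (enc_perms (size1 T') ss) (Tr V'))) ((n + size1 T) * (400 * ((H + 1) * (N + 1))) + 30)"
    "(T', gval (size1 T') (words (size1 T') ss) m, V') \<in> triples" "greedy (size1 T') ss"
    "length ss = length (rev rs)" "size1 T' \<le> size1 T" "reduced (T', gval (size1 T') (words (size1 T') ss) m, V')"
    "equivclp eye_insertion ?t (T', gval (size1 T') (words (size1 T') ss) m, V')"
    by (rule exE[OF run_eyes[of T "rev rs" m V n, OF tt gT _ lr' m nT order_refl]], erule noeye, elim exE conjE)
  define k where "k = size1 T'"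
  have kN: "k \<le> N" "1 \<le> k" using e(5) Tn nN by (simp_all add: k_def)
  have r7: "runs prog f_eyes (Pr (Num n) (Pr (Tr T) (Pr (enc_perms n (rev rs)) (Pr (Num m) (Tr V)))))
      (Pr (Tr T') (Pr (enc_perms k ss) (Tr V'))) (830 * X)"
  proof (rule runs_mono[OF e(1)[folded k_def, unfolded Tn]])
    have 800: "(2 * q) * (400 * (h * q)) = 800 * (h * q\<^sup>2)" for h q :: nat by (simp add: power2_eq_square)
    have "(n + n) * (400 * ((H + 1) * (N + 1))) + 30 \<le> (2 * (N + 1)) * (400 * ((H + 1) * (N + 1))) + 30"
      using nN by (intro add_le_mono mult_le_mono order_refl) simp
    also have "\<dots> = 800 * ((H + 1) * (N + 1)\<^sup>2) + 30" unfolding 800 ..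
    also have "\<dots> \<le> 830 * X" using lin[OF X1(6,1), of 800 30] by simp
    finally show "(n + n) * (400 * ((H + 1) * (N + 1))) + 30 \<le> 830 * X" .
  qed
  have ls: "length ss = H" using e(4) lr by simp
  note r8 = rv[OF ls, of k]
  have ps: "perms k (rev ss)" using greedy_perms[OF e(3)] by (simp add: k_def)
  let ?D = "dropWhile (\<lambda>s. s = half_twist k) (rev ss)"
  let ?d = "length (takeWhile (\<lambda>s. s = half_twist k) (rev ss))"
  have r9: "runs prog f_strip (Pr (enc_perms k (rev ss)) (Pr (Num 0) (Num k))) (Pr (enc_perms k ?D) (Num ?d)) (230 * X)"
  proof (rule runs_mono)
    show "runs prog f_strip (Pr (enc_perms k (rev ss)) (Pr (Num 0) (Num k))) (Pr (enc_perms k ?D) (Num ?d)) (H * (200 * (k + 1)\<^sup>2) + 30)"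
      using run_strip[OF ps, of 0] ls by simp
    have "(k + 1)\<^sup>2 \<le> (N + 1)\<^sup>2" using kN by (intro power_mono) simp_all
    then have "H * (200 * (k + 1)\<^sup>2) + 30 \<le> H * (200 * (N + 1)\<^sup>2) + 30"
      by (intro add_le_mono mult_le_mono order_refl)
    also have "\<dots> = 200 * (H * (N + 1)\<^sup>2) + 30" by simp
    also have "\<dots> \<le> 230 * X" using lin[OF X1(5,1), of 200 30] by simp
    finally show "H * (200 * (k + 1)\<^sup>2) + 30 \<le> 230 * X" .
  qed
  have dH: "?d \<le> H" using length_takeWhile_le[of "\<lambda>s. s = half_twist k" "rev ss"] ls by simp
  have r10: "runs prog f_desc (Num k) (enc_perm k (half_twist k)) (30 * X)"
    by (rule runs_mono[OF run_desc_perm]) (use X1(4) kN in linarith)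
  have r11: "runs prog f_rep (Pr (Num q) (Pr (Pr (Num 0) (enc_perm k (half_twist k))) (Num 0)))
      (enc_word k (replicate q (False, half_twist k))) (50 * X)"
    "runs prog f_rep (Pr (Num q) (Pr (Pr (Num 1) (enc_perm k (half_twist k))) (Num 0)))
      (enc_word k (replicate q (True, half_twist k))) (50 * X)" if "q \<le> H" for q
  proof -
    have b: "40 * q + 10 \<le> 50 * X" using X1(1,2) that by linarith
    show "runs prog f_rep (Pr (Num q) (Pr (Pr (Num 0) (enc_perm k (half_twist k))) (Num 0)))
      (enc_word k (replicate q (False, half_twist k))) (50 * X)"
      using runs_mono[OF run_rep_half_twist[of q False k] b] by simp
    show "runs prog f_rep (Pr (Num q) (Pr (Pr (Num 1) (enc_perm k (half_twist k))) (Num 0)))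
      (enc_word k (replicate q (True, half_twist k))) (50 * X)"
      using runs_mono[OF run_rep_half_twist[of q True k] b] by simp
  qed
  have pD: "perms k ?D" using ps by (auto simp: perms_def dest: set_dropWhileD)
  have r12: "runs prog f_out (Pr (enc_perms k ?D) (enc_word k z))
      (enc_word k (map (Pair True) (filter nontrivial (rev ?D)) @ z)) (120 * X)" for z
  proof (rule runs_mono[OF run_out[OF pD, of "map (enc_letter k) z", folded map_append]])
    have "length ?D * (100 * (k + 1)) + 20 \<le> H * (100 * (N + 1)) + 20"
      using length_dropWhile_le[of "\<lambda>s. s = half_twist k" "rev ss"] ls kN by (intro add_le_mono mult_le_mono order_refl) simp_all
    also have "\<dots> = 100 * (H * (N + 1)) + 20" by simp
    also have "\<dots> \<le> 120 * X" using lin[OF X1(3,1), of 100 20] by simp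
    finally show "length ?D * (100 * (k + 1)) + 20 \<le> 120 * X" .
  qed
  define w' where "w' = (if 1 < k then strip k (rev ss) m else [])"
  have w': "right_greedy k w'" "word_braid k w' = gval k (words k ss) m"
    using output_word[OF e(3)[folded k_def] kN(2), of m] by (simp_all add: w'_def)
  have t': "triple_of (T', w', V') = (T', gval (size1 T') (words (size1 T') ss) m, V')"
    using w'(2) by (simp add: k_def)
  have run: "runs prog 0 (Pr (enc_triple (T1, w1, U1)) (enc_triple (T2, w2, U2))) (enc_triple (T', w', V')) (5000 * X)"
  proof (cases "1 < k")
    case False
    then have "w' = []" by (simp add: w'_def)
    then show ?thesis using r1 r2 r3 r4 r5 r6 r7 X1(1) False Tn
      by (intro runsI) (simp add: b_main_def Let_def wp_simps runs_def n_def[symmetric] k_def[symmetric])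
  next
    case True
    show ?thesis
    proof (cases "?d < m")
      case d: True
      have "w' = map (Pair True) (filter nontrivial (rev ?D)) @ replicate (m - ?d) (False, half_twist k)"
        using True d by (simp add: w'_def strip_def)
      moreover have "m - ?d \<le> H" using m by simp
      note r11(1)[OF this]
      ultimately show ?thesis using r1 r2 r3 r4 r5 r6 r7 r8 r9 r10 r12[of "replicate (m - ?d) (False, half_twist k)"] X1(1) True d Tn
        by (intro runsI) (simp add: b_main_def Let_def wp_simps runs_def n_def[symmetric] k_def[symmetric])
    next
      case d: False
      have "w' = map (Pair True) (filter nontrivial (rev ?D)) @ replicate (?d - m) (True, half_twist k)"
        using True d by (simp add: w'_def strip_def)
      moreover have "?d - m \<le> H" using dH by simp
      note r11(2)[OF this]
      ultimately show ?thesis using r1 r2 r3 r4 r5 r6 r7 r8 r9 r10 r12[of "replicate (?d - m) (True, half_twist k)"] X1(1) True d Tn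
        by (intro runsI) (simp add: b_main_def Let_def wp_simps runs_def n_def[symmetric] k_def[symmetric])
    qed
  qed
  have nf: "bv_normal_form (T', w', V')"
    using e(2,6) w'(1) triplesD[OF e(2)] unfolding bv_normal_form.simps t' k_def by simp
  have "bv_class (triple_of (T, ?u, V)) = bv_class (triple_of (T', w', V'))"
    unfolding t' te[symmetric] by (rule bv_class_eq[OF e(7)])
  with p(9) have "bv_class (triple_of (T1, w1, U1)) \<otimes>\<^bsub>BV\<^esub> bv_class (triple_of (T2, w2, U2)) = bv_class (triple_of (T', w', V'))" by simp
  moreover have "triple_of (T', w', V') \<in> triples" unfolding t' by (rule e(2))
  ultimately show ?thesis using run nf by (intro exI[of _ T'] exI[of _ w'] exI[of _ V'] conjI)
qed

text \<open>The numbers \<open>h + 1\<close> and \<open>n1 + n2 + 1\<close> are at most twice the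
  numbers in the bound, which explains the factor 16, and \<open>ln 2\<close> bounds the logarithm
  from below because there are at least two leaves.\<close>

lemma time_bound:
  assumes "1 \<le> n1" "1 \<le> n2" "t \<le> 5000 * ((h + 1)\<^sup>2 * (n1 + n2 + 1)\<^sup>2) + 2"
  shows "real t \<le> 80002 / ln 2 * ((real (max 1 h))\<^sup>2 * (real (n1 + n2))\<^sup>2 * ln (real (n1 + n2)))"
proof -
  define a b where "a = real (max 1 h)" and "b = real (n1 + n2)"
  have a: "1 \<le> a" "real (h + 1) \<le> 2 * a" and b: "2 \<le> b" "real (n1 + n2 + 1) \<le> 2 * b"
    using assms(1,2) by (auto simp: a_def b_def)
  have ab: "1 * 1 \<le> a\<^sup>2 * b\<^sup>2" using a b by (intro mult_mono one_le_power) simp_all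
  have "(real (h + 1))\<^sup>2 * (real (n1 + n2 + 1))\<^sup>2 \<le> (2 * a)\<^sup>2 * (2 * b)\<^sup>2"
    using a b by (intro mult_mono power_mono) simp_all
  moreover have "real t \<le> real (5000 * ((h + 1)\<^sup>2 * (n1 + n2 + 1)\<^sup>2) + 2)"
    using assms(3) by (simp only: of_nat_le_iff)
  ultimately have "real t \<le> 80002 * (a\<^sup>2 * b\<^sup>2)" using ab by (simp add: power_mult_distrib)
  also have "\<dots> \<le> 80002 * (a\<^sup>2 * b\<^sup>2) * 1" using ab by simp
  also have "\<dots> \<le> 80002 * (a\<^sup>2 * b\<^sup>2) * (ln b / ln 2)" using b ab by (intro mult_left_mono) (simp_all add: le_divide_eq)
  finally show ?thesis unfolding a_def b_def by simp
qed

theorem mainTheorem2: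
  "\<exists>P :: program. \<exists>C :: real. \<forall>x\<^sub>1 x\<^sub>2 g\<^sub>1 g\<^sub>2 n\<^sub>1 n\<^sub>2 h\<^sub>1 h\<^sub>2.
     bv_normal_form x\<^sub>1 \<longrightarrow> represents x\<^sub>1 g\<^sub>1 \<longrightarrow> n\<^sub>1 = strands x\<^sub>1 \<longrightarrow> h\<^sub>1 = word_length x\<^sub>1 \<longrightarrow>
     bv_normal_form x\<^sub>2 \<longrightarrow> represents x\<^sub>2 g\<^sub>2 \<longrightarrow> n\<^sub>2 = strands x\<^sub>2 \<longrightarrow> h\<^sub>2 = word_length x\<^sub>2 \<longrightarrow>
     (\<exists>y t. bv_normal_form y \<and> represents y (g\<^sub>1 \<otimes>\<^bsub>BV\<^esub> g\<^sub>2) \<and>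
        computes_in_time P (Pr (enc_triple x\<^sub>1) (enc_triple x\<^sub>2)) (enc_triple y) t \<and>
        real t \<le> C * ((real (max 1 (h\<^sub>1 + h\<^sub>2)))\<^sup>2 * (real (n\<^sub>1 + n\<^sub>2))\<^sup>2 * ln (real (n\<^sub>1 + n\<^sub>2))))"
proof (intro exI[of _ prog] exI[of _ "80002 / ln 2"] allI impI)
  fix x\<^sub>1 x\<^sub>2 g\<^sub>1 g\<^sub>2 n\<^sub>1 n\<^sub>2 h\<^sub>1 h\<^sub>2
  assume x: "bv_normal_form x\<^sub>1" "represents x\<^sub>1 g\<^sub>1" "n\<^sub>1 = strands x\<^sub>1" "h\<^sub>1 = word_length x\<^sub>1"
    and y: "bv_normal_form x\<^sub>2" "represents x\<^sub>2 g\<^sub>2" "n\<^sub>2 = strands x\<^sub>2" "h\<^sub>2 = word_length x\<^sub>2"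
  obtain T1 w1 U1 where x1: "x\<^sub>1 = (T1, w1, U1)" by (cases x\<^sub>1)
  obtain T2 w2 U2 where x2: "x\<^sub>2 = (T2, w2, U2)" by (cases x\<^sub>2)
  have n: "size1 T1 = size1 U1" "letters (size1 T1) w1" "size1 T2 = size1 U2" "letters (size1 T2) w2"
    using x(1) y(1) right_greedy_letters unfolding x1 x2 by auto
  have s: "n\<^sub>1 = size1 T1" "h\<^sub>1 = length w1" "n\<^sub>2 = size1 T2" "h\<^sub>2 = length w2"
    using x(3,4) y(3,4) by (simp_all add: x1 x2)
  obtain T w V where r: "runs prog 0 (Pr (enc_triple x\<^sub>1) (enc_triple x\<^sub>2)) (enc_triple (T, w, V))
      (5000 * ((h\<^sub>1 + h\<^sub>2 + 1)\<^sup>2 * (n\<^sub>1 + n\<^sub>2 + 1)\<^sup>2))"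
    "bv_normal_form (T, w, V)" "triple_of (T, w, V) \<in> triples"
    "bv_class (triple_of x\<^sub>1) \<otimes>\<^bsub>BV\<^esub> bv_class (triple_of x\<^sub>2) = bv_class (triple_of (T, w, V))"
    using run_main[OF n] unfolding x1 x2 s by (elim exE conjE)
  obtain t where t: "t \<le> 5000 * ((h\<^sub>1 + h\<^sub>2 + 1)\<^sup>2 * (n\<^sub>1 + n\<^sub>2 + 1)\<^sup>2) + 2"
    "computes_in_time prog (Pr (enc_triple x\<^sub>1) (enc_triple x\<^sub>2)) (enc_triple (T, w, V)) t"
    using runs_computes[OF r(1)] by auto
  have "represents (T, w, V) (g\<^sub>1 \<otimes>\<^bsub>BV\<^esub> g\<^sub>2)" using x(2) y(2) r(3,4) unfolding represents_def by simp
  moreover have "1 \<le> n\<^sub>1" "1 \<le> n\<^sub>2" unfolding s by simp_all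
  note time_bound[OF this t(1)]
  ultimately show "\<exists>y t. bv_normal_form y \<and> represents y (g\<^sub>1 \<otimes>\<^bsub>BV\<^esub> g\<^sub>2) \<and>
      computes_in_time prog (Pr (enc_triple x\<^sub>1) (enc_triple x\<^sub>2)) (enc_triple y) t \<and>
      real t \<le> 80002 / ln 2 * ((real (max 1 (h\<^sub>1 + h\<^sub>2)))\<^sup>2 * (real (n\<^sub>1 + n\<^sub>2))\<^sup>2 * ln (real (n\<^sub>1 + n\<^sub>2)))"
    using r(2) t(2) by blast
qed

end
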